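(* Let $(X,\mathcal F)$ be a compact minimal equicontinuous Polish foliated space whose holonomy pseudogroup has strongly quasi-analytic closure, and let $x_0\in X$. Let $\{U_i,p_i,h_{ij}\}$ and $\{U'_a,p'_a,h'_{ab}\}$ be two defining cocycles of $\mathcal F$ induced by regular foliated atlases. Let $(\widehat X_0,\widehat{\mathcal F}_0)$, $\hat\pi_0:\widehat X_0\to X$ and $(\widehat X'_0,\widehat{\mathcal F}'_0)$, $\hat\pi'_0:\widehat X'_0\to X$ be the foliated spaces and maps constructed from $\{U_i,p_i,h_{ij}\}$ and $\{U'_a,p'_a,h'_{ab}\}$, respectively (construction in the context). Then there is a foliated homeomorphism $F:(\widehat X_0,\widehat{\mathcal F}_0)\to(\widehat X'_0,\widehat{\mathcal F}'_0)$ such that $\hat\pi'_0F=\hat\pi_0$.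
   Context: **Pseudogroups.** All pseudogroups act on locally compact Polish spaces. For a space $T$, $\mathrm{Loct}(T)$ is the set of homeomorphisms between open subsets of $T$ (local transformations); the composite $h'h$ has domain $h^{-1}(\operatorname{im}h\cap\operatorname{dom}h')$. A pseudogroup on $T$ is a set $\mathcal H\subset\mathrm{Loct}(T)$ containing $\mathrm{id}_T$, closed under composition, inversion and restriction to open subsets of domains, and containing every homeomorphism in $\mathrm{Loct}(T)$ that is a union of elements of $\mathcal H$. A pseudo$*$group is a set $S\subset\mathrm{Loct}(T)$ closed under composition and inversion; it is local if also closed under restriction to open subsets of domains. The pseudogroup generated by a set is the smallest pseudogroup containing it. $\mathcal H|_U=\{h\in\mathcal H\mid \operatorname{dom}h\cup\operatorname{im}h\subset U\}$. Orbits: $\mathcal H(x)=\{h(x)\mid h\in\mathcal H,\ x\in\operatorname{dom}h\}$; $\mathcal H$ is minimal if all orbits are dense. The germ of $h$ at $x$ is $\gamma(h,x)$. $\mathcal H$ is compactly generated if there is a relatively compact open $U\subset T$ meeting all orbits and a finite set $\{h_1,\dots,h_n\}\subset\mathcal H|_U$ generating $\mathcal H|_U$ such that each $h_i$ is the restriction of some $\tilde h_i\in\mathcal H$ with $\overline{\operatorname{dom}h_i}\subset\operatorname{dom}\tilde h_i$. $\mathcal H$ is strongly quasi-analytic if it is generated by a sub-pseudo$*$group $S\subset\mathcal H$ such that any $h\in S$ that is the identity on some non-empty open subset of its domain is the identity on its domain. A cover of $T$ by quasi-locally equal metric spaces is a family $\{T_i,d_i\}$ of metric spaces such that $\{T_i\}$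 covers $T$, each $T_i\cap T_j$ is open in $(T_i,d_i)$ and $(T_j,d_j)$, and for all $\epsilon>0$ there is $\delta(\epsilon)>0$ such that for all $i,j$, $z\in T_i\cap T_j$ there is an open neighborhood $U_{i,j,z}$ of $z$ in $T_i\cap T_j$ with $d_i(x,y)<\delta(\epsilon)\Rightarrow d_j(x,y)<\epsilon$ for all $\epsilon>0$, $x,y\in U_{i,j,z}$; it induces the topology with basis all open balls of the $(T_i,d_i)$. $\mathcal H$ is equicontinuous if there is such a cover inducing the topology of $T$ and a sub-pseudo$*$group $S\subset\mathcal H$ generating $\mathcal H$ such that for every $\epsilon>0$ there is $\delta(\epsilon)>0$ with $d_i(x,y)<\delta(\epsilon)\Rightarrow d_j(h(x),h(y))<\epsilon$ for all $h\in S$, all $i,j$, and $x,y\in T_i\cap h^{-1}(T_j\cap\operatorname{im}h)$. **Closure.** Let $\mathcal H$ be compactly generated, equicontinuous and strongly quasi-analytic, the last two conditions holding with a sub-pseudo$*$group $S$ generating $\mathcal H$. $\overline{\mathcal H}$ is the set of $h\in\mathrm{Loct}(T)$ such that every $x\in\operatorname{dom}h$ has an open neighborhood $O_x\subset\operatorname{dom}h$ with $h|_{O_x}$ in the closure of $\{f\in S\mid\operatorname{dom}f=O_x\}$ in $C(O_x,T)$ with the compact-open topology. It is a pseudogroup containing $\mathcal H$, independent of $S$. Strong quasi-analyticity of $\overline{\mathcal H}$ includes that $\mathcal H$ satisfies these conditions. **Foliated spaces.** Let $X$ and $Z$ be locally compact Polish. A foliated chart of leaf dimension $n$, transversely modeled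 on $Z$, is $(U,\phi)$ with $U\subset X$ open and $\phi:U\to B\times T$ a homeomorphism, $B$ an open ball in $\mathbb R^n$, $T\subset Z$ open; the $\phi^{-1}(B\times\{y\})$ are its plaques, and $p=\mathrm{pr}_2\phi:U\to T$ its distinguished submersion. A foliated atlas is a family of such charts covering $X$ for which plaques of different charts intersect in sets open in both; a maximal one is a foliated structure $\mathcal F$. The plaques form a basis of the leaf topology, whose components are the leaves. A foliated map sends leaves into leaves. A foliated atlas $\{U_i,\phi_i\}$ is regular if each $\overline{U_i}$ is a compact subset of the domain of a foliated chart $(W_i,\psi_i)$ with $\phi_i=\psi_i|_{U_i}$, $\{U_i\}$ is locally finite, and each plaque of $(U_i,\phi_i)$ meets at most one plaque of $(U_j,\phi_j)$. It induces a defining cocycle $\{U_i,p_i,h_{ij}\}$: $p_i:U_i\to T_i$ distinguished submersions, $T_{ij}=p_i(U_i\cap U_j)$, $h_{ij}:T_{ij}\to T_{ji}$ homeomorphisms with $h_{ij}p_i=p_j$ on $U_i\cap U_j$. The pseudogroup $\mathcal H$ on $T=\bigsqcup_iT_i$ generated by the $h_{ij}$ represents the holonomy pseudogroup; it is compactly generated if $X$ is compact. The foliated space is minimal, respectively equicontinuous, if $\mathcal H$ is. **Construction of $\widehat T_0$.** Let $\mathcal H$ be the representative of the holonomy pseudogroup of $(X,\mathcal F)$ on $T=\bigsqcup_iT_i$ generated by the maps $h_{ij}$ of the defining cocycle $\{U_i,p_i,h_{ij}\}$, and $t_0\in T$ a base point. Let $U\subset T$ be a relatively compact open set containing $t_0$,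 meeting all orbits, with which compact generation holds. Let $S\subset\mathcal H$ be a local sub-pseudo$*$group generating $\mathcal H$ with which equicontinuity (with a cover $\{T'_a,d_a\}$) and strong quasi-analyticity hold, and let $\overline S$ be the pseudo$*$group of local transformations of $T$ lying, for some open $O\subset T$, in the closure of $\{f\in S\mid\operatorname{dom}f=O\}$ in $C(O,T)$ with the compact-open topology; it generates $\overline{\mathcal H}$. $S$ and the cover are chosen so that: $\overline U$ is covered by finitely many $T'_{a_1},\dots,T'_{a_r}$ such that the closure of $\{h\in S\mid\operatorname{dom}h=T'_{a_k},\ h(T'_{a_k})\cap\overline U\ne\emptyset\}$ in $C(T'_{a_k},T)$ is contained in $\overline S$; for all $h\in\overline{\mathcal H}$ and $x\in T'_{a_k}\cap U\cap\operatorname{dom}h$ with $h(x)\in U$ there is $\tilde h\in\overline S$ with domain $T'_{a_k}$ and $\gamma(\tilde h,x)=\gamma(h,x)$; and strong quasi-analyticity of $\overline{\mathcal H}$ holds with $\overline S$. Give $\overline S$ the topology with subbasis $\{h\in\overline S\mid K\subset\operatorname{dom}h,\ h(K)\subset O\}$ ($K$ compact, $O$ open in $T$), and the set $\widehat T$ of germs of $\overline{\mathcal H}$ the quotient topology of the germ map $\{(f,x)\in\overline S\times T\mid x\in\operatorname{dom}f\}\to\widehat T$ (this topology does not depend on the choice of $S$). Let $\widehat T_0=\{\gamma(g,x)\in\widehat T\mid g(x)=t_0\}$ and $\hat\pi_0:\widehat T_0\to T$, $\gamma(g,x)\mapsto x$. For $h\in\mathcal H$ let $\hat h:\hat\pi_0^{-1}(\operatorname{dom}h)\to\hat\pi_0^{-1}(\operatorname{im}h)$,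 $\hat h(\gamma(g,x))=\gamma(gh^{-1},h(x))$. **Construction of $\widehat X_0$.** Given $x_0\in X$ and the cocycle $\{U_i,p_i,h_{ij}\}$, choose $i_0$ with $x_0\in U_{i_0}$ and take $t_0=p_{i_0}(x_0)\in T_{i_0}\subset T$. Let $\widehat T_{i,0}=\hat\pi_0^{-1}(T_i)$, $\check X_0=\bigsqcup_iU_i\times\widehat T_{i,0}=\bigcup_iU_i\times\widehat T_{i,0}\times\{i\}$ (topological sum of products), and $\widetilde X_0=\{(x,\gamma,i)\in\check X_0\mid p_i(x)=\hat\pi_0(\gamma)\}$. Put $(x,\gamma,i)\sim(y,\delta,j)$ if $x=y$ and $\gamma=\widehat{h_{ji}}(\delta)$; $\widehat X_0$ is the quotient space, and $[x,\gamma,i]$ the class of $(x,\gamma,i)$. Let $\widehat U_{i,0}=\{[x,\gamma,i]\in\widehat X_0\mid x\in U_i,\ \gamma\in\widehat T_{i,0},\ p_i(x)=\hat\pi_0(\gamma)\}$, and $\hat p_{i,0}:\widehat U_{i,0}\to\widehat T_{i,0}$, $\hat p_{i,0}([x,\gamma,i])=\gamma$. The foliated structure $\widehat{\mathcal F}_0$ on $\widehat X_0$ is the one with defining cocycle $\{\widehat U_{i,0},\hat p_{i,0},\widehat{h_{ij}}\}$. The map $\hat\pi_0:\widehat X_0\to X$ is $\hat\pi_0([x,\gamma,i])=x$. The objects $\widehat X'_0,\widehat{\mathcal F}'_0,\hat\pi'_0:\widehat X'_0\to X$ are defined in the same way from $x_0$ and the cocycle $\{U'_a,p'_a,h'_{ab}\}$.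 *)

theory Defs
  imports "HOL-Analysis.Analysis"
begin

section \<open>Quotient and compact-open topologies\<close>

text \<open>The quotient topology on \<open>Y\<close> determined by a surjection \<open>f\<close> of \<open>X\<close> onto \<open>Y\<close>.\<close>

definition quotient_topology :: "'a topology \<Rightarrow> ('a \<Rightarrow> 'b) \<Rightarrow> 'b set \<Rightarrow> 'b topology" where
  "quotient_topology X f Y =
     topology (\<lambda>W. W \<subseteq> Y \<and> openin X {x \<in> topspace X. f x \<in> W})"

lemma openin_quotient_topology:
  "openin (quotient_topology X f Y) W \<longleftrightarrow> W \<subseteq> Y \<and> openin X {x \<in> topspace X. f x \<in> W}"
proof -
  have Int: "{x \<in> topspace X. f x \<in> V \<inter> W}
      = {x \<in> topspace X. f x \<in> V} \<inter> {x \<in> topspace X. f x \<in> W}" for V W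
    by auto
  have Un: "{x \<in> topspace X. f x \<in> \<Union>\<K>} = (\<Union>V\<in>\<K>. {x \<in> topspace X. f x \<in> V})" for \<K>
    by auto
  have "istopology (\<lambda>W. W \<subseteq> Y \<and> openin X {x \<in> topspace X. f x \<in> W})"
    unfolding istopology_def Int Un by (intro conjI allI impI openin_Int openin_Union) auto
  then show ?thesis
    by (simp add: quotient_topology_def)
qed

lemma quotient_map_quotient_topology:
  assumes "f ` topspace X = Y"
  shows "quotient_map X (quotient_topology X f Y) f"
proof -
  have "openin (quotient_topology X f Y) Y"
  proof -
    have "{x \<in> topspace X. f x \<in> Y} = topspace X"
      using assms by auto
    then show ?thesis by (simp add: openin_quotient_topology)
  qed
  then have "topspace (quotient_topology X f Y) = Y"
    by (meson openin_quotient_topology openin_subset openin_topspace subset_antisym)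
  then show ?thesis
    using assms by (simp add: quotient_map_def openin_quotient_topology)
qed

text \<open>Maps with a prescribed domain \<open>W\<close> are represented as partial maps.  The case \<open>K = {}\<close> of
  the subbasis is the whole set of continuous maps from \<open>W\<close> to \<open>T\<close>.\<close>

definition compact_open_topology :: "'t topology \<Rightarrow> 't set \<Rightarrow> ('t \<rightharpoonup> 't) topology" where
  "compact_open_topology T W = topology_generated_by
     {{f. dom f = W \<and> continuous_map (subtopology T W) T (\<lambda>x. the (f x)) \<and>
          (\<lambda>x. the (f x)) ` K \<subseteq> V}
      | K V. compactin T K \<and> K \<subseteq> W \<and> openin T V}"


section \<open>Pseudogroups\<close>

definition locally_compact_Polish :: "'a topology \<Rightarrow> bool" where
  "locally_compact_Polish X \<longleftrightarrow>
     locally_compact_space X \<and> completely_metrizable_space X \<and> second_countable X"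

text \<open>A local transformation is a partial map, so that composition is \<open>\<circ>\<^sub>m\<close>
  and restriction is \<open>|`\<close>.\<close>

definition loct :: "'t topology \<Rightarrow> ('t \<rightharpoonup> 't) set" where
  "loct T = {h. openin T (dom h) \<and> openin T (ran h) \<and>
     homeomorphic_map (subtopology T (dom h)) (subtopology T (ran h)) (\<lambda>x. the (h x))}"

definition pinv :: "('t \<rightharpoonup> 't) \<Rightarrow> ('t \<rightharpoonup> 't)" where
  "pinv h = (\<lambda>y. if y \<in> ran h then Some (THE x. h x = Some y) else None)"

definition pseudogroup :: "'t topology \<Rightarrow> ('t \<rightharpoonup> 't) set \<Rightarrow> bool" where
  "pseudogroup T H \<longleftrightarrow>
     H \<subseteq> loct T \<and>
     Some |` topspace T \<in> H \<and>
     (\<forall>h\<in>H. \<forall>h'\<in>H. h' \<circ>\<^sub>m h \<in> H) \<and>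
     (\<forall>h\<in>H. pinv h \<in> H) \<and>
     (\<forall>h\<in>H. \<forall>W. openin T W \<and> W \<subseteq> dom h \<longrightarrow> h |` W \<in> H) \<and>
     (\<forall>h\<in>loct T. \<forall>K\<subseteq>H. Map.graph h = (\<Union>k\<in>K. Map.graph k) \<longrightarrow> h \<in> H)"

definition pseudostar_group :: "'t topology \<Rightarrow> ('t \<rightharpoonup> 't) set \<Rightarrow> bool" where
  "pseudostar_group T S \<longleftrightarrow>
     S \<subseteq> loct T \<and> (\<forall>h\<in>S. \<forall>h'\<in>S. h' \<circ>\<^sub>m h \<in> S) \<and> (\<forall>h\<in>S. pinv h \<in> S)"

definition local_pseudostar_group :: "'t topology \<Rightarrow> ('t \<rightharpoonup> 't) set \<Rightarrow> bool" where
  "local_pseudostar_group T S \<longleftrightarrow>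
     pseudostar_group T S \<and> (\<forall>h\<in>S. \<forall>W. openin T W \<and> W \<subseteq> dom h \<longrightarrow> h |` W \<in> S)"

definition generated_pseudogroup :: "'t topology \<Rightarrow> ('t \<rightharpoonup> 't) set \<Rightarrow> ('t \<rightharpoonup> 't) set" where
  "generated_pseudogroup T E = pseudogroup T hull E"

definition restricted_pseudogroup :: "('t \<rightharpoonup> 't) set \<Rightarrow> 't set \<Rightarrow> ('t \<rightharpoonup> 't) set" where
  "restricted_pseudogroup H U = {h \<in> H. dom h \<union> ran h \<subseteq> U}"

definition pg_orbit :: "('t \<rightharpoonup> 't) set \<Rightarrow> 't \<Rightarrow> 't set" where
  "pg_orbit H x = {y. \<exists>h\<in>H. h x = Some y}"

definition minimal_pseudogroup :: "'t topology \<Rightarrow> ('t \<rightharpoonup> 't) set \<Rightarrow> bool" where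
  "minimal_pseudogroup T H \<longleftrightarrow> (\<forall>x\<in>topspace T. T closure_of pg_orbit H x = topspace T)"

definition compactly_generated_with :: "'t topology \<Rightarrow> ('t \<rightharpoonup> 't) set \<Rightarrow> 't set \<Rightarrow> bool" where
  "compactly_generated_with T H U \<longleftrightarrow>
     openin T U \<and> compactin T (T closure_of U) \<and>
     (\<forall>x\<in>topspace T. pg_orbit H x \<inter> U \<noteq> {}) \<and>
     (\<exists>E. finite E \<and> E \<subseteq> restricted_pseudogroup H U \<and>
          generated_pseudogroup (subtopology T U) E = restricted_pseudogroup H U \<and>
          (\<forall>h\<in>E. \<exists>h'\<in>H. T closure_of dom h \<subseteq> dom h' \<and> h = h' |` dom h))"

definition compactly_generated :: "'t topology \<Rightarrow> ('t \<rightharpoonup> 't) set \<Rightarrow> bool" where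
  "compactly_generated T H \<longleftrightarrow> (\<exists>U. compactly_generated_with T H U)"

definition strongly_quasi_analytic_with ::
    "'t topology \<Rightarrow> ('t \<rightharpoonup> 't) set \<Rightarrow> ('t \<rightharpoonup> 't) set \<Rightarrow> bool" where
  "strongly_quasi_analytic_with T H S \<longleftrightarrow>
     pseudostar_group T S \<and> S \<subseteq> H \<and> generated_pseudogroup T S = H \<and>
     (\<forall>h\<in>S. (\<exists>W. openin T W \<and> W \<noteq> {} \<and> W \<subseteq> dom h \<and> (\<forall>x\<in>W. h x = Some x))
        \<longrightarrow> (\<forall>x\<in>dom h. h x = Some x))"

definition strongly_quasi_analytic :: "'t topology \<Rightarrow> ('t \<rightharpoonup> 't) set \<Rightarrow> bool" where
  "strongly_quasi_analytic T H \<longleftrightarrow> (\<exists>S. strongly_quasi_analytic_with T H S)"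

text \<open>A cover of \<open>T\<close> by quasi-locally equal metric spaces which induces the topology of \<open>T\<close>.
  The family is represented by the set of its members (repetitions are immaterial).
  The modulus \<open>\<delta>\<close> is independent of the pair of spaces and of the point, and the neighbourhood
  \<open>V\<close> is independent of \<open>\<epsilon>\<close>.\<close>

definition quasi_locally_equal_cover :: "'t topology \<Rightarrow> 't metric set \<Rightarrow> bool" where
  "quasi_locally_equal_cover T C \<longleftrightarrow>
     (\<Union>m\<in>C. mspace m) = topspace T \<and>
     (\<forall>m\<in>C. \<forall>m'\<in>C. openin (mtopology_of m) (mspace m \<inter> mspace m') \<and>
                    openin (mtopology_of m') (mspace m \<inter> mspace m')) \<and>
     (\<exists>\<delta>::real \<Rightarrow> real. (\<forall>\<epsilon>>0. \<delta> \<epsilon> > 0) \<and>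
        (\<forall>m\<in>C. \<forall>m'\<in>C. \<forall>z \<in> mspace m \<inter> mspace m'.
           \<exists>V. openin (mtopology_of m) V \<and> z \<in> V \<and> V \<subseteq> mspace m \<inter> mspace m' \<and>
               (\<forall>\<epsilon>>0. \<forall>x\<in>V. \<forall>y\<in>V. mdist m x y < \<delta> \<epsilon> \<longrightarrow> mdist m' x y < \<epsilon>))) \<and>
     openin T = arbitrary union_of
       (\<lambda>B. \<exists>m\<in>C. \<exists>x\<in>mspace m. \<exists>r>0. B = mball_of m x r)"

definition equicontinuous_with ::
    "'t topology \<Rightarrow> ('t \<rightharpoonup> 't) set \<Rightarrow> ('t \<rightharpoonup> 't) set \<Rightarrow> 't metric set \<Rightarrow> bool" where
  "equicontinuous_with T H S C \<longleftrightarrow>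
     quasi_locally_equal_cover T C \<and>
     pseudostar_group T S \<and> S \<subseteq> H \<and> generated_pseudogroup T S = H \<and>
     (\<forall>\<epsilon>>0. \<exists>\<delta>>0. \<forall>h\<in>S. \<forall>m\<in>C. \<forall>m'\<in>C. \<forall>x y x' y'.
        x \<in> mspace m \<and> y \<in> mspace m \<and> h x = Some x' \<and> h y = Some y' \<and>
        x' \<in> mspace m' \<and> y' \<in> mspace m' \<and> mdist m x y < \<delta> \<longrightarrow> mdist m' x' y' < \<epsilon>)"

definition equicontinuous_pseudogroup :: "'t topology \<Rightarrow> ('t \<rightharpoonup> 't) set \<Rightarrow> bool" where
  "equicontinuous_pseudogroup T H \<longleftrightarrow> (\<exists>S C. equicontinuous_with T H S C)"


section \<open>The closure of an equicontinuous pseudogroup\<close>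

definition pseudogroup_closure :: "'t topology \<Rightarrow> ('t \<rightharpoonup> 't) set \<Rightarrow> ('t \<rightharpoonup> 't) set" where
  "pseudogroup_closure T S = {h \<in> loct T. \<forall>x\<in>dom h. \<exists>W. openin T W \<and> x \<in> W \<and> W \<subseteq> dom h \<and>
     h |` W \<in> compact_open_topology T W closure_of {f \<in> S. dom f = W}}"

text \<open>The closure is computed from a \<^emph>\<open>local\<close> sub-pseudo*group \<open>S\<close>: without
  closedness under restriction there might be no elements of \<open>S\<close> with the small domains \<open>W\<close>
  used in the previous definition.\<close>

definition strongly_quasi_analytic_closure :: "'t topology \<Rightarrow> ('t \<rightharpoonup> 't) set \<Rightarrow> bool" where
  "strongly_quasi_analytic_closure T H \<longleftrightarrow>
     compactly_generated T H \<and>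
     (\<exists>S C. local_pseudostar_group T S \<and> equicontinuous_with T H S C \<and>
            strongly_quasi_analytic_with T H S \<and>
            strongly_quasi_analytic T (pseudogroup_closure T S))"

definition pseudostar_closure :: "'t topology \<Rightarrow> ('t \<rightharpoonup> 't) set \<Rightarrow> ('t \<rightharpoonup> 't) set" where
  "pseudostar_closure T S = {h \<in> loct T. \<exists>W. openin T W \<and>
     h \<in> compact_open_topology T W closure_of {f \<in> S. dom f = W}}"


section \<open>Foliated spaces\<close>

text \<open>A chart \<open>(U, \<phi>)\<close> is a partial map with domain \<open>U\<close>, taking values in the product of
  \<open>n\<close>-dimensional Euclidean space and the transverse model.\<close>

type_synonym ('x, 'z) fchart = "'x \<rightharpoonup> (nat \<Rightarrow> real) \<times> 'z"

definition open_ball_in_Euclidean :: "nat \<Rightarrow> (nat \<Rightarrow> real) set \<Rightarrow> bool" where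
  "open_ball_in_Euclidean n B \<longleftrightarrow> (\<exists>c\<in>topspace (Euclidean_space n). \<exists>r>0.
     B = {v \<in> topspace (Euclidean_space n). sqrt (\<Sum>i<n. (v i - c i)\<^sup>2) < r})"

definition foliated_chart ::
    "nat \<Rightarrow> 'x topology \<Rightarrow> 'z topology \<Rightarrow> ('x, 'z) fchart \<Rightarrow> bool" where
  "foliated_chart n X Z \<phi> \<longleftrightarrow> openin X (dom \<phi>) \<and>
     (\<exists>B V. open_ball_in_Euclidean n B \<and> openin Z V \<and>
        homeomorphic_map (subtopology X (dom \<phi>))
          (prod_topology (subtopology (Euclidean_space n) B) (subtopology Z V))
          (\<lambda>x. the (\<phi> x)))"

definition dist_submersion :: "('x, 'z) fchart \<Rightarrow> 'x \<Rightarrow> 'z" where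
  "dist_submersion \<phi> x = snd (the (\<phi> x))"

definition plaques :: "('x, 'z) fchart \<Rightarrow> 'x set set" where
  "plaques \<phi> = {{x \<in> dom \<phi>. dist_submersion \<phi> x = y} | y. y \<in> dist_submersion \<phi> ` dom \<phi>}"

definition open_in_both :: "'x topology \<Rightarrow> 'x set \<Rightarrow> 'x set \<Rightarrow> bool" where
  "open_in_both X P Q \<longleftrightarrow>
     openin (subtopology X P) (P \<inter> Q) \<and> openin (subtopology X Q) (P \<inter> Q)"

definition foliated_atlas ::
    "nat \<Rightarrow> 'x topology \<Rightarrow> 'z topology \<Rightarrow> ('x, 'z) fchart set \<Rightarrow> bool" where
  "foliated_atlas n X Z A \<longleftrightarrow>
     (\<forall>\<phi>\<in>A. foliated_chart n X Z \<phi>) \<and> (\<Union>\<phi>\<in>A. dom \<phi>) = topspace X \<and>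
     (\<forall>\<phi>\<in>A. \<forall>\<psi>\<in>A. \<forall>P\<in>plaques \<phi>. \<forall>Q\<in>plaques \<psi>. open_in_both X P Q)"

definition foliated_structure ::
    "nat \<Rightarrow> 'x topology \<Rightarrow> 'z topology \<Rightarrow> ('x, 'z) fchart set \<Rightarrow> bool" where
  "foliated_structure n X Z F \<longleftrightarrow>
     foliated_atlas n X Z F \<and> (\<forall>A. foliated_atlas n X Z A \<and> F \<subseteq> A \<longrightarrow> A = F)"

definition foliated_space ::
    "nat \<Rightarrow> 'x topology \<Rightarrow> 'z topology \<Rightarrow> ('x, 'z) fchart set \<Rightarrow> bool" where
  "foliated_space n X Z F \<longleftrightarrow>
     locally_compact_Polish X \<and> locally_compact_Polish Z \<and> foliated_structure n X Z F"

definition leaf_topology :: "('x, 'z) fchart set \<Rightarrow> 'x topology" where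
  "leaf_topology F = topology_generated_by (\<Union>\<phi>\<in>F. plaques \<phi>)"

definition leaves :: "('x, 'z) fchart set \<Rightarrow> 'x set set" where
  "leaves F = connected_components_of (leaf_topology F)"

definition foliated_map ::
    "('x, 'z) fchart set \<Rightarrow> ('x2, 'z2) fchart set \<Rightarrow> ('x \<Rightarrow> 'x2) \<Rightarrow> bool" where
  "foliated_map F F' f \<longleftrightarrow> (\<forall>L\<in>leaves F. \<exists>L'\<in>leaves F'. f ` L \<subseteq> L')"

definition foliated_homeomorphism ::
    "'x topology \<Rightarrow> ('x, 'z) fchart set \<Rightarrow> 'x2 topology \<Rightarrow> ('x2, 'z2) fchart set
      \<Rightarrow> ('x \<Rightarrow> 'x2) \<Rightarrow> bool" where
  "foliated_homeomorphism X F X' F' f \<longleftrightarrow>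
     (\<exists>g. homeomorphic_maps X X' f g \<and> foliated_map F F' f \<and> foliated_map F' F g)"

definition regular_foliated_atlas ::
    "nat \<Rightarrow> 'x topology \<Rightarrow> 'z topology \<Rightarrow> ('x, 'z) fchart set
      \<Rightarrow> 'i set \<Rightarrow> ('i \<Rightarrow> ('x, 'z) fchart) \<Rightarrow> bool" where
  "regular_foliated_atlas n X Z F I \<phi> \<longleftrightarrow>
     (\<forall>i\<in>I. \<phi> i \<in> F) \<and> (\<Union>i\<in>I. dom (\<phi> i)) = topspace X \<and>
     (\<forall>i\<in>I. compactin X (X closure_of dom (\<phi> i)) \<and>
        (\<exists>\<psi>\<in>F. X closure_of dom (\<phi> i) \<subseteq> dom \<psi> \<and> \<phi> i = \<psi> |` dom (\<phi> i))) \<and>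
     (\<forall>x\<in>topspace X. \<exists>N. openin X N \<and> x \<in> N \<and> finite {i \<in> I. N \<inter> dom (\<phi> i) \<noteq> {}}) \<and>
     (\<forall>i\<in>I. \<forall>j\<in>I. \<forall>P\<in>plaques (\<phi> i). \<forall>Q\<in>plaques (\<phi> j). \<forall>Q'\<in>plaques (\<phi> j).
        P \<inter> Q \<noteq> {} \<and> P \<inter> Q' \<noteq> {} \<longrightarrow> Q = Q')"

text \<open>The disjoint union of the transversals \<open>T\<^sub>i = p\<^sub>i(U\<^sub>i)\<close>; a point of \<open>T\<^sub>i\<close> is
  represented by a pair with first component \<open>i\<close>.\<close>

definition transversal ::
    "'z topology \<Rightarrow> 'i set \<Rightarrow> ('i \<Rightarrow> ('x, 'z) fchart) \<Rightarrow> ('i \<times> 'z) topology" where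
  "transversal Z I \<phi> =
     sum_topology (\<lambda>i. subtopology Z (dist_submersion (\<phi> i) ` dom (\<phi> i))) I"

definition to_transversal :: "('i \<Rightarrow> ('x, 'z) fchart) \<Rightarrow> 'i \<Rightarrow> 'x \<Rightarrow> 'i \<times> 'z" where
  "to_transversal \<phi> i x = (i, dist_submersion (\<phi> i) x)"

text \<open>The map \<open>h\<^sub>i\<^sub>j\<close> from \<open>T\<^sub>i\<^sub>j = p\<^sub>i(U\<^sub>i \<inter> U\<^sub>j)\<close> to \<open>T\<^sub>j\<^sub>i\<close> is determined by
  \<open>h\<^sub>i\<^sub>j p\<^sub>i = p\<^sub>j\<close> on \<open>U\<^sub>i \<inter> U\<^sub>j\<close>.\<close>

definition cocycle_map ::
    "('i \<Rightarrow> ('x, 'z) fchart) \<Rightarrow> 'i \<Rightarrow> 'i \<Rightarrow> ('i \<times> 'z) \<rightharpoonup> ('i \<times> 'z)" where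
  "cocycle_map \<phi> i j = (\<lambda>t.
     if t \<in> to_transversal \<phi> i ` (dom (\<phi> i) \<inter> dom (\<phi> j))
     then Some (THE s. \<exists>x \<in> dom (\<phi> i) \<inter> dom (\<phi> j).
                  to_transversal \<phi> i x = t \<and> to_transversal \<phi> j x = s)
     else None)"

definition holonomy_pseudogroup ::
    "'z topology \<Rightarrow> 'i set \<Rightarrow> ('i \<Rightarrow> ('x, 'z) fchart) \<Rightarrow> (('i \<times> 'z) \<rightharpoonup> ('i \<times> 'z)) set" where
  "holonomy_pseudogroup Z I \<phi> =
     generated_pseudogroup (transversal Z I \<phi>) {cocycle_map \<phi> i j | i j. i \<in> I \<and> j \<in> I}"

text \<open>The following properties do not depend on the representative of the holonomy pseudogroup, so
  it suffices to require them for one regular atlas, which can be taken to be indexed by itself.\<close>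

definition minimal_foliation ::
    "nat \<Rightarrow> 'x topology \<Rightarrow> 'z topology \<Rightarrow> ('x, 'z) fchart set \<Rightarrow> bool" where
  "minimal_foliation n X Z F \<longleftrightarrow> (\<exists>A. regular_foliated_atlas n X Z F A (\<lambda>\<phi>. \<phi>) \<and>
     minimal_pseudogroup (transversal Z A (\<lambda>\<phi>. \<phi>)) (holonomy_pseudogroup Z A (\<lambda>\<phi>. \<phi>)))"

definition equicontinuous_foliation ::
    "nat \<Rightarrow> 'x topology \<Rightarrow> 'z topology \<Rightarrow> ('x, 'z) fchart set \<Rightarrow> bool" where
  "equicontinuous_foliation n X Z F \<longleftrightarrow> (\<exists>A. regular_foliated_atlas n X Z F A (\<lambda>\<phi>. \<phi>) \<and>
     equicontinuous_pseudogroup (transversal Z A (\<lambda>\<phi>. \<phi>)) (holonomy_pseudogroup Z A (\<lambda>\<phi>. \<phi>)))"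

definition strongly_quasi_analytic_holonomy_closure ::
    "nat \<Rightarrow> 'x topology \<Rightarrow> 'z topology \<Rightarrow> ('x, 'z) fchart set \<Rightarrow> bool" where
  "strongly_quasi_analytic_holonomy_closure n X Z F \<longleftrightarrow>
     (\<exists>A. regular_foliated_atlas n X Z F A (\<lambda>\<phi>. \<phi>) \<and>
        strongly_quasi_analytic_closure
          (transversal Z A (\<lambda>\<phi>. \<phi>)) (holonomy_pseudogroup Z A (\<lambda>\<phi>. \<phi>)))"

text \<open>The foliated structure on \<open>X\<close>, transversely modeled on \<open>Z\<close>, with defining cocycle
  \<open>{U\<^sub>i, p\<^sub>i, h\<^sub>i\<^sub>j}\<close>: all charts that are compatible with the fibres of the \<open>p\<^sub>i\<close>.
  The lemma below shows that it is the only foliated structure having the \<open>p\<^sub>i\<close> as distinguished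
  submersions.\<close>

definition cocycle_foliation ::
    "nat \<Rightarrow> 'x topology \<Rightarrow> 'z topology \<Rightarrow> 'i set \<Rightarrow> ('i \<Rightarrow> 'x set) \<Rightarrow> ('i \<Rightarrow> 'x \<Rightarrow> 'z)
      \<Rightarrow> ('x, 'z) fchart set" where
  "cocycle_foliation n X Z I U p = {\<phi>. foliated_chart n X Z \<phi> \<and>
     (\<forall>P\<in>plaques \<phi>. \<forall>i\<in>I. \<forall>y\<in>p i ` U i. open_in_both X P {x \<in> U i. p i x = y})}"

lemma open_in_both_trans:
  assumes P: "P \<subseteq> topspace X" and Q: "Q \<subseteq> topspace X"
    and loc: "\<And>x. x \<in> P \<inter> Q \<Longrightarrow> \<exists>R. x \<in> R \<and> open_in_both X P R \<and> open_in_both X Q R"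
  shows "open_in_both X P Q"
proof -
  have *: "openin (subtopology X P) (P \<inter> Q)"
    if loc: "\<And>x. x \<in> P \<inter> Q \<Longrightarrow> \<exists>R. x \<in> R \<and> open_in_both X P R \<and> open_in_both X Q R" for P Q
  proof (subst openin_subopen, intro ballI)
    fix x assume x: "x \<in> P \<inter> Q"
    then obtain R where R: "x \<in> R" "open_in_both X P R" "open_in_both X Q R"
      using loc by blast
    obtain V where V: "openin X V" "P \<inter> R = V \<inter> P"
      using R(2) by (auto simp: open_in_both_def openin_subtopology)
    obtain V' where V': "openin X V'" "Q \<inter> R = V' \<inter> R"
      using R(3) by (auto simp: open_in_both_def openin_subtopology)
    have "openin (subtopology X P) (V \<inter> V' \<inter> P)"
      unfolding openin_subtopology using V(1) V'(1) openin_Int by blast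
    moreover have "x \<in> V \<inter> V' \<inter> P" "V \<inter> V' \<inter> P \<subseteq> P \<inter> Q"
      using x R(1) V(2) V'(2) by blast+
    ultimately show "\<exists>T. openin (subtopology X P) T \<and> x \<in> T \<and> T \<subseteq> P \<inter> Q"
      by blast
  qed
  have "openin (subtopology X Q) (Q \<inter> P)"
  proof (rule *)
    fix x assume "x \<in> Q \<inter> P"
    then have "x \<in> P \<inter> Q" by simp
    from loc[OF this] show "\<exists>R. x \<in> R \<and> open_in_both X Q R \<and> open_in_both X P R"
      by metis
  qed
  moreover have "openin (subtopology X P) (P \<inter> Q)"
    by (rule *) (rule loc)
  ultimately show ?thesis
    unfolding open_in_both_def by (metis Int_commute)
qed

lemma foliated_structure_eq_cocycle_foliation:
  assumes F: "foliated_structure n X Z F"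
    and cover: "(\<Union>i\<in>I. U i) = topspace X"
    and dist: "\<And>i. i \<in> I \<Longrightarrow> \<exists>\<phi>\<in>F. dom \<phi> = U i \<and> (\<forall>x\<in>U i. dist_submersion \<phi> x = p i x)"
  shows "F = cocycle_foliation n X Z I U p"
proof -
  let ?C = "cocycle_foliation n X Z I U p"
  have atl: "foliated_atlas n X Z F"
    using F by (simp add: foliated_structure_def)
  have fib: "\<exists>\<phi>\<in>F. {x \<in> U i. p i x = y} \<in> plaques \<phi>" if "i \<in> I" "y \<in> p i ` U i" for i y
  proof -
    obtain \<phi> where \<phi>: "\<phi> \<in> F" "dom \<phi> = U i" "\<forall>x\<in>U i. dist_submersion \<phi> x = p i x"
      using dist[OF \<open>i \<in> I\<close>] by blast
    have "{x \<in> U i. p i x = y} = {x \<in> dom \<phi>. dist_submersion \<phi> x = y}"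
      using \<phi> by auto
    moreover have "y \<in> dist_submersion \<phi> ` dom \<phi>"
      using \<phi> that by auto
    ultimately show ?thesis
      using \<phi>(1) by (auto simp: plaques_def)
  qed
  have sub: "F \<subseteq> ?C"
  proof
    fix \<phi> assume \<phi>: "\<phi> \<in> F"
    have "open_in_both X P {x \<in> U i. p i x = y}"
      if P: "P \<in> plaques \<phi>" and i: "i \<in> I" "y \<in> p i ` U i" for P i y
    proof -
      obtain \<psi> where "\<psi> \<in> F" "{x \<in> U i. p i x = y} \<in> plaques \<psi>"
        using fib[OF i] by (elim bexE)
      then show ?thesis
        using atl \<phi> P unfolding foliated_atlas_def by metis
    qed
    moreover have "foliated_chart n X Z \<phi>"
      using atl \<phi> by (simp add: foliated_atlas_def)
    ultimately show "\<phi> \<in> ?C"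
      by (simp add: cocycle_foliation_def)
  qed
  have chart_C: "foliated_chart n X Z \<phi>" if "\<phi> \<in> ?C" for \<phi>
    using that by (simp add: cocycle_foliation_def)
  have dom_C: "dom \<phi> \<subseteq> topspace X" if "\<phi> \<in> ?C" for \<phi>
    using chart_C[OF that] openin_subset unfolding foliated_chart_def by metis
  have plq: "P \<subseteq> dom \<phi>" if "P \<in> plaques \<phi>" for P \<phi>
    using that by (auto simp: plaques_def)
  have compat: "open_in_both X P Q"
    if \<phi>: "\<phi> \<in> ?C" and \<psi>: "\<psi> \<in> ?C" and P: "P \<in> plaques \<phi>" and Q: "Q \<in> plaques \<psi>" for \<phi> \<psi> P Q
  proof (rule open_in_both_trans)
    show "P \<subseteq> topspace X" "Q \<subseteq> topspace X"
      using dom_C[OF \<phi>] dom_C[OF \<psi>] plq[OF P] plq[OF Q] by auto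
    fix x assume "x \<in> P \<inter> Q"
    then obtain i where i: "i \<in> I" "x \<in> U i"
      using \<open>P \<subseteq> topspace X\<close> cover by blast
    let ?R = "{z \<in> U i. p i z = p i x}"
    have "open_in_both X P ?R" "open_in_both X Q ?R"
      using \<phi> \<psi> P Q i unfolding cocycle_foliation_def by simp_all
    moreover have "x \<in> ?R"
      using i by simp
    ultimately show "\<exists>R. x \<in> R \<and> open_in_both X P R \<and> open_in_both X Q R"
      by (intro exI conjI)
  qed
  have "(\<Union>\<phi>\<in>F. dom \<phi>) = topspace X"
    using atl by (simp add: foliated_atlas_def)
  then have "(\<Union>\<phi>\<in>?C. dom \<phi>) = topspace X"
    using UN_mono[OF sub, of dom dom] UN_least[of ?C dom "topspace X", OF dom_C] by auto
  then have "foliated_atlas n X Z ?C"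
    unfolding foliated_atlas_def by (intro conjI ballI chart_C compat)
  then show ?thesis
    using F sub unfolding foliated_structure_def by metis
qed


section \<open>The space \<open>\<hat>T\<^sub>0\<close>\<close>

text \<open>A germ is represented by its base point together with the class of all local transformations
  having that germ there.\<close>

type_synonym 't germ = "'t \<times> ('t \<rightharpoonup> 't) set"

definition germ :: "'t topology \<Rightarrow> ('t \<rightharpoonup> 't) \<Rightarrow> 't \<Rightarrow> 't germ" where
  "germ T h x = (x, {f \<in> loct T. \<exists>W. openin T W \<and> x \<in> W \<and> W \<subseteq> dom h \<inter> dom f \<and>
     (\<forall>y\<in>W. f y = h y)})"

text \<open>The choices entering the construction, for a pseudogroup \<open>H\<close> with base point \<open>t0\<close>:
  \<open>C\<close> is the cover \<open>{T'\<^sub>a, d\<^sub>a}\<close> and \<open>C0\<close> its finite subfamily covering the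
  closure of \<open>U\<close>.\<close>

definition construction_choice ::
    "'t topology \<Rightarrow> ('t \<rightharpoonup> 't) set \<Rightarrow> 't \<Rightarrow> 't set \<Rightarrow> ('t \<rightharpoonup> 't) set
      \<Rightarrow> 't metric set \<Rightarrow> 't metric set \<Rightarrow> bool" where
  "construction_choice T H t0 U S C C0 \<longleftrightarrow>
     t0 \<in> U \<and> compactly_generated_with T H U \<and>
     local_pseudostar_group T S \<and> equicontinuous_with T H S C \<and>
     strongly_quasi_analytic_with T H S \<and>
     C0 \<subseteq> C \<and> finite C0 \<and> T closure_of U \<subseteq> (\<Union>m\<in>C0. mspace m) \<and>
     (\<forall>m\<in>C0. compact_open_topology T (mspace m) closure_of
          {h \<in> S. dom h = mspace m \<and> ran h \<inter> T closure_of U \<noteq> {}} \<subseteq> pseudostar_closure T S) \<and>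
     (\<forall>m\<in>C0. \<forall>h\<in>pseudogroup_closure T S. \<forall>x \<in> mspace m \<inter> U. \<forall>y\<in>U. h x = Some y \<longrightarrow>
        (\<exists>h'\<in>pseudostar_closure T S. dom h' = mspace m \<and> germ T h' x = germ T h x)) \<and>
     strongly_quasi_analytic_with T (pseudogroup_closure T S) (pseudostar_closure T S)"

definition pseudostar_closure_topology :: "'t topology \<Rightarrow> ('t \<rightharpoonup> 't) set \<Rightarrow> ('t \<rightharpoonup> 't) topology" where
  "pseudostar_closure_topology T S = topology_generated_by
     {{h \<in> pseudostar_closure T S. K \<subseteq> dom h \<and> (\<lambda>x. the (h x)) ` K \<subseteq> V}
      | K V. compactin T K \<and> openin T V}"

definition germ_space :: "'t topology \<Rightarrow> ('t \<rightharpoonup> 't) set \<Rightarrow> 't germ topology" where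
  "germ_space T S = quotient_topology
     (subtopology (prod_topology (pseudostar_closure_topology T S) T) {(f, x). x \<in> dom f})
     (\<lambda>(f, x). germ T f x)
     {germ T h x | h x. h \<in> pseudogroup_closure T S \<and> x \<in> dom h}"

definition based_germs :: "'t topology \<Rightarrow> ('t \<rightharpoonup> 't) set \<Rightarrow> 't \<Rightarrow> 't germ set" where
  "based_germs T S t0 = {germ T g x | g x. g \<in> pseudogroup_closure T S \<and> g x = Some t0}"

definition based_germ_space :: "'t topology \<Rightarrow> ('t \<rightharpoonup> 't) set \<Rightarrow> 't \<Rightarrow> 't germ topology" where
  "based_germ_space T S t0 = subtopology (germ_space T S) (based_germs T S t0)"

text \<open>The map \<open>\<hat>\<pi>\<^sub>0\<close> on germs is \<open>fst\<close>.  The next map is \<open>\<hat>h\<close>,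
  which takes \<open>\<gamma>(g,x)\<close> to \<open>\<gamma>(gh\<^sup>-\<^sup>1,h(x))\<close>; here \<open>g\<close> is an
  arbitrary representative of the germ.\<close>

definition germ_lift ::
    "'t topology \<Rightarrow> ('t \<rightharpoonup> 't) set \<Rightarrow> 't \<Rightarrow> ('t \<rightharpoonup> 't) \<Rightarrow> 't germ \<rightharpoonup> 't germ" where
  "germ_lift T S t0 h = (\<lambda>\<gamma>.
     if \<gamma> \<in> based_germs T S t0 \<and> fst \<gamma> \<in> dom h
     then Some (germ T ((SOME g. g \<in> snd \<gamma>) \<circ>\<^sub>m pinv h) (the (h (fst \<gamma>))))
     else None)"


section \<open>The foliated space \<open>\<hat>X\<^sub>0\<close>\<close>

text \<open>The triple \<open>(x, \<gamma>, i)\<close> is represented as \<open>(i, x, \<gamma>)\<close>.\<close>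

type_synonym ('x, 'z, 'i) hat_point = "('i \<times> 'x \<times> ('i \<times> 'z) germ) set"

definition X_check ::
    "'x topology \<Rightarrow> 'z topology \<Rightarrow> 'i set \<Rightarrow> ('i \<Rightarrow> ('x, 'z) fchart)
      \<Rightarrow> (('i \<times> 'z) \<rightharpoonup> ('i \<times> 'z)) set \<Rightarrow> ('i \<times> 'z) \<Rightarrow> ('i \<times> 'x \<times> ('i \<times> 'z) germ) topology" where
  "X_check X Z I \<phi> S t0 = sum_topology (\<lambda>i. prod_topology
     (subtopology X (dom (\<phi> i)))
     (subtopology (based_germ_space (transversal Z I \<phi>) S t0) {\<gamma>. fst (fst \<gamma>) = i})) I"

definition X_tilde ::
    "'x topology \<Rightarrow> 'z topology \<Rightarrow> 'i set \<Rightarrow> ('i \<Rightarrow> ('x, 'z) fchart)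
      \<Rightarrow> (('i \<times> 'z) \<rightharpoonup> ('i \<times> 'z)) set \<Rightarrow> ('i \<times> 'z) \<Rightarrow> ('i \<times> 'x \<times> ('i \<times> 'z) germ) topology" where
  "X_tilde X Z I \<phi> S t0 =
     subtopology (X_check X Z I \<phi> S t0) {(i, x, \<gamma>). to_transversal \<phi> i x = fst \<gamma>}"

definition X_rel ::
    "'x topology \<Rightarrow> 'z topology \<Rightarrow> 'i set \<Rightarrow> ('i \<Rightarrow> ('x, 'z) fchart)
      \<Rightarrow> (('i \<times> 'z) \<rightharpoonup> ('i \<times> 'z)) set \<Rightarrow> ('i \<times> 'z) \<Rightarrow> ('i \<times> 'x \<times> ('i \<times> 'z) germ) rel" where
  "X_rel X Z I \<phi> S t0 = {((i, x, \<gamma>), (j, y, \<delta>)).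
     (i, x, \<gamma>) \<in> topspace (X_tilde X Z I \<phi> S t0) \<and>
     (j, y, \<delta>) \<in> topspace (X_tilde X Z I \<phi> S t0) \<and>
     x = y \<and> germ_lift (transversal Z I \<phi>) S t0 (cocycle_map \<phi> j i) \<delta> = Some \<gamma>}"

definition X_hat ::
    "'x topology \<Rightarrow> 'z topology \<Rightarrow> 'i set \<Rightarrow> ('i \<Rightarrow> ('x, 'z) fchart)
      \<Rightarrow> (('i \<times> 'z) \<rightharpoonup> ('i \<times> 'z)) set \<Rightarrow> ('i \<times> 'z) \<Rightarrow> ('x, 'z, 'i) hat_point topology" where
  "X_hat X Z I \<phi> S t0 = quotient_topology (X_tilde X Z I \<phi> S t0)
     (\<lambda>w. X_rel X Z I \<phi> S t0 `` {w})
     (topspace (X_tilde X Z I \<phi> S t0) // X_rel X Z I \<phi> S t0)"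

definition U_hat ::
    "'x topology \<Rightarrow> 'z topology \<Rightarrow> 'i set \<Rightarrow> ('i \<Rightarrow> ('x, 'z) fchart)
      \<Rightarrow> (('i \<times> 'z) \<rightharpoonup> ('i \<times> 'z)) set \<Rightarrow> ('i \<times> 'z) \<Rightarrow> 'i \<Rightarrow> ('x, 'z, 'i) hat_point set" where
  "U_hat X Z I \<phi> S t0 i = {X_rel X Z I \<phi> S t0 `` {(i, x, \<gamma>)} | x \<gamma>.
     (i, x, \<gamma>) \<in> topspace (X_tilde X Z I \<phi> S t0)}"

definition p_hat ::
    "'x topology \<Rightarrow> 'z topology \<Rightarrow> 'i set \<Rightarrow> ('i \<Rightarrow> ('x, 'z) fchart)
      \<Rightarrow> (('i \<times> 'z) \<rightharpoonup> ('i \<times> 'z)) set \<Rightarrow> ('i \<times> 'z)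
      \<Rightarrow> 'i \<Rightarrow> ('x, 'z, 'i) hat_point \<Rightarrow> ('i \<times> 'z) germ" where
  "p_hat X Z I \<phi> S t0 i c = (THE \<gamma>. \<exists>x. (i, x, \<gamma>) \<in> topspace (X_tilde X Z I \<phi> S t0) \<and>
     c = X_rel X Z I \<phi> S t0 `` {(i, x, \<gamma>)})"

definition F_hat ::
    "nat \<Rightarrow> 'x topology \<Rightarrow> 'z topology \<Rightarrow> 'i set \<Rightarrow> ('i \<Rightarrow> ('x, 'z) fchart)
      \<Rightarrow> (('i \<times> 'z) \<rightharpoonup> ('i \<times> 'z)) set \<Rightarrow> ('i \<times> 'z)
      \<Rightarrow> (('x, 'z, 'i) hat_point, ('i \<times> 'z) germ) fchart set" where
  "F_hat n X Z I \<phi> S t0 = cocycle_foliation n (X_hat X Z I \<phi> S t0)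
     (based_germ_space (transversal Z I \<phi>) S t0) I (U_hat X Z I \<phi> S t0) (p_hat X Z I \<phi> S t0)"

definition pi_hat :: "('x, 'z, 'i) hat_point \<Rightarrow> 'x" where
  "pi_hat c = (THE x. \<exists>i \<gamma>. (i, x, \<gamma>) \<in> c)"

end

theory Submission
  imports Defs
begin

text \<open>For two regular atlases, the transverse components of the changes between their charts form an
  equivalence between the two holonomy pseudogroups, because plaques are connected. Let \<open>\<tau>\<close> be such
  a transition at \<open>x\<close> and \<open>\<tau>\<^sub>0\<close> one at \<open>x\<^sub>0\<close>. The
  homeomorphism sends \<open>[x, \<gamma>(g, p\<^sub>i(x)), i]\<close> to
  \<open>[x, \<gamma>(\<tau>\<^sub>0g\<tau>\<^sup>-\<^sup>1, p'\<^sub>a(x)), a]\<close>; the classes defining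
  \<open>\<hat>X\<^sub>0\<close> are the same correspondence for one atlas, so this is well defined and
  bijective.

  The main point is that \<open>g \<mapsto> \<tau>\<^sub>0g\<tau>\<^sup>-\<^sup>1\<close> is continuous for the topologies
  computed from \<open>S\<close> and \<open>S'\<close>. By equicontinuity and compact generation there are uniform
  neighbourhoods on which elements of \<open>S\<close> read in the other transversal belong to \<open>S'\<close>;
  strong quasi-analyticity makes these extensions unique. Hence compact-open limits of elements of
  \<open>S\<close> are carried to compact-open limits of elements of \<open>S'\<close>. Finally, the homeomorphism
  pulls foliated charts back to foliated charts, up to a local homeomorphism between the spaces of
  germs, so it preserves the leaf topologies.\<close>

section \<open>Local homeomorphisms as partial maps\<close>

text \<open>The obstacle is that nothing relates \<open>S\<close> to \<open>S'\<close> directly: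
  each only generates its own pseudogroup. A conjugate of an element of \<open>S\<close> is
  therefore in \<open>S'\<close> near each point, but on a neighbourhood depending on that element,
  and such neighbourhoods could shrink to nothing along a compact-open limit. So the neighbourhoods
  must be chosen before the map. Compact generation writes germs as words in finitely many letters.
  Cutting the letters into finitely many pieces whose conjugates lie in \<open>S'\<close> yields, by
  compactness, one radius within which consecutive pieces can be composed. Words have unbounded
  length, but every initial subword is again in \<open>S\<close>, so equicontinuity controls all of
  them with a single \<delta>; and \<open>S'\<close>, being closed under composition, contains the
  conjugate of the whole word. Only germs matter in the algebra, so maps are partial maps compared
  by neighbourhood filters. Results are proved in one direction between two atlases and read again
  with the atlases exchanged.\<close>

definition minv :: "('a \<rightharpoonup> 'b) \<Rightarrow> ('b \<rightharpoonup> 'a)" where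
  "minv h = (\<lambda>y. if y \<in> ran h then Some (THE x. h x = Some y) else None)"

lemma pinv_eq_minv: "pinv = minv"
  by (intro ext) (simp add: pinv_def minv_def)

text \<open>Two spaces are allowed because transitions run between different transversals. Open
  images and open preimages replace a homeomorphism of subspaces: the condition is symmetric under
  inversion, and composition and restriction preserve it without any computation of domains.\<close>

definition lhomeo :: "'a topology \<Rightarrow> 'b topology \<Rightarrow> ('a \<rightharpoonup> 'b) set" where
  "lhomeo T T' = {h. (\<forall>x y z. h x = Some z \<longrightarrow> h y = Some z \<longrightarrow> x = y) \<and>
     dom h \<subseteq> topspace T \<and> ran h \<subseteq> topspace T' \<and>
     (\<forall>W. openin T W \<longrightarrow> openin T' {y. \<exists>x\<in>W. h x = Some y}) \<and>
     (\<forall>W. openin T' W \<longrightarrow> openin T {x. \<exists>y\<in>W. h x = Some y})}"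

lemma lhomeo_inj: "h \<in> lhomeo T T' \<Longrightarrow> h x = Some z \<Longrightarrow> h y = Some z \<Longrightarrow> x = y"
  by (simp add: lhomeo_def)

lemma lhomeo_in_topspace:
  "h \<in> lhomeo T T' \<Longrightarrow> h x = Some y \<Longrightarrow> x \<in> topspace T"
  "h \<in> lhomeo T T' \<Longrightarrow> h x = Some y \<Longrightarrow> y \<in> topspace T'"
  by (auto simp: lhomeo_def ran_def)

lemma lhomeo_openin_image: "h \<in> lhomeo T T' \<Longrightarrow> openin T W \<Longrightarrow> openin T' {y. \<exists>x\<in>W. h x = Some y}"
  by (simp add: lhomeo_def)

lemma lhomeo_openin_preimage: "h \<in> lhomeo T T' \<Longrightarrow> openin T' W \<Longrightarrow> openin T {x. \<exists>y\<in>W. h x = Some y}"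
  by (simp add: lhomeo_def)

lemma lhomeo_openin_dom: "h \<in> lhomeo T T' \<Longrightarrow> openin T (dom h)"
  using lhomeo_openin_preimage[of h T T' "topspace T'"] lhomeo_in_topspace
  by (smt (verit, best) Collect_cong dom_def not_None_eq openin_topspace)

lemma lhomeo_openin_ran: "h \<in> lhomeo T T' \<Longrightarrow> openin T' (ran h)"
  using lhomeo_openin_image[of h T T' "topspace T"] lhomeo_in_topspace
  by (smt (verit, best) Collect_cong ran_def openin_topspace)

lemma lhomeo_iff_homeomorphic_map:
  "h \<in> lhomeo T T' \<longleftrightarrow> openin T (dom h) \<and> openin T' (ran h) \<and>
     homeomorphic_map (subtopology T (dom h)) (subtopology T' (ran h)) (\<lambda>x. the (h x))"
  (is "?L \<longleftrightarrow> ?R")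
proof
  assume L: ?L
  let ?f = "\<lambda>x. the (h x)"
  have od: "openin T (dom h)" and orn: "openin T' (ran h)"
    using L lhomeo_openin_dom lhomeo_openin_ran by blast+
  have td: "topspace (subtopology T (dom h)) = dom h" "topspace (subtopology T' (ran h)) = ran h"
    using od orn openin_subset by (auto simp: topspace_subtopology)
  have "homeomorphic_map (subtopology T (dom h)) (subtopology T' (ran h)) ?f"
  proof (rule bijective_open_imp_homeomorphic_map)
    show "continuous_map (subtopology T (dom h)) (subtopology T' (ran h)) ?f"
      unfolding continuous_map_def td
    proof (intro conjI allI impI)
      show "?f \<in> dom h \<rightarrow> ran h" by (auto simp: ran_def)
      fix W assume "openin (subtopology T' (ran h)) W"
      then have W: "openin T' W" using orn openin_open_subtopology by blast
      have "{x \<in> dom h. ?f x \<in> W} = {x. \<exists>y\<in>W. h x = Some y}" by auto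
      then show "openin (subtopology T (dom h)) {x \<in> dom h. ?f x \<in> W}"
        using lhomeo_openin_preimage[OF L W] od by (auto simp: openin_open_subtopology)
    qed
    show "open_map (subtopology T (dom h)) (subtopology T' (ran h)) ?f"
      unfolding open_map_def
    proof (intro allI impI)
      fix W assume "openin (subtopology T (dom h)) W"
      then have W: "openin T W" "W \<subseteq> dom h" using od openin_open_subtopology by blast+
      then have "?f ` W = {y. \<exists>x\<in>W. h x = Some y}"
        by (force simp: image_iff)
      then show "openin (subtopology T' (ran h)) (?f ` W)"
        using lhomeo_openin_image[OF L W(1)] orn by (auto simp: openin_open_subtopology ran_def)
    qed
    show "?f ` topspace (subtopology T (dom h)) = topspace (subtopology T' (ran h))"
      unfolding td by (force simp: ran_def image_iff)
    show "inj_on ?f (topspace (subtopology T (dom h)))"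
      unfolding td using L lhomeo_inj by (force simp: inj_on_def)
  qed
  then show ?R using od orn by blast
next
  assume R: ?R
  let ?f = "\<lambda>x. the (h x)"
  have od: "openin T (dom h)" and orn: "openin T' (ran h)" using R by auto
  have td: "topspace (subtopology T (dom h)) = dom h" "topspace (subtopology T' (ran h)) = ran h"
    using od orn openin_subset by (auto simp: topspace_subtopology)
  have inj: "inj_on ?f (dom h)" and op: "open_map (subtopology T (dom h)) (subtopology T' (ran h)) ?f"
    and co: "continuous_map (subtopology T (dom h)) (subtopology T' (ran h)) ?f"
    using R td by (auto simp: homeomorphic_eq_everything_map)
  show ?L
    unfolding lhomeo_def
  proof (intro CollectI conjI allI impI)
    fix x y z assume "h x = Some z" "h y = Some z"
    then show "x = y" using inj by (metis domI inj_onD)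
  next
    show "dom h \<subseteq> topspace T" "ran h \<subseteq> topspace T'" using od orn openin_subset by auto
  next
    fix W assume W: "openin T W"
    then have "openin (subtopology T (dom h)) (W \<inter> dom h)"
      by (auto simp: openin_subtopology)
    then have "openin (subtopology T' (ran h)) (?f ` (W \<inter> dom h))"
      using op by (auto simp: open_map_def)
    moreover have "?f ` (W \<inter> dom h) = {y. \<exists>x\<in>W. h x = Some y}"
      by (force simp: image_iff)
    ultimately show "openin T' {y. \<exists>x\<in>W. h x = Some y}"
      using orn openin_open_subtopology by metis
  next
    fix W assume W: "openin T' W"
    then have "openin (subtopology T' (ran h)) (W \<inter> ran h)"
      by (auto simp: openin_subtopology)
    then have "openin (subtopology T (dom h)) {x \<in> dom h. ?f x \<in> W \<inter> ran h}"
      using co unfolding continuous_map_def td by blast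
    moreover have "{x \<in> dom h. ?f x \<in> W \<inter> ran h} = {x. \<exists>y\<in>W. h x = Some y}"
      by (auto simp: ran_def)
    ultimately show "openin T {x. \<exists>y\<in>W. h x = Some y}"
      using od openin_open_subtopology by metis
  qed
qed

lemma loct_eq_lhomeo: "loct T = lhomeo T T"
  by (rule set_eqI) (simp add: loct_def lhomeo_iff_homeomorphic_map)

lemma minv_Some_iff:
  assumes "h \<in> lhomeo T T'"
  shows "minv h y = Some x \<longleftrightarrow> h x = Some y"
proof -
  have "(THE x. h x = Some y) = x" if "h x = Some y" for x
    using that lhomeo_inj[OF assms] by blast
  then show ?thesis by (auto simp: minv_def ran_def)
qed

lemma map_eqI: "(\<And>x y. f x = Some y \<longleftrightarrow> g x = Some y) \<Longrightarrow> f = g"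
  by (rule ext) (metis not_None_eq)

lemma lhomeo_minv: "h \<in> lhomeo T T' \<Longrightarrow> minv h \<in> lhomeo T' T"
  using lhomeo_in_topspace[of h T T'] lhomeo_openin_image[of h T T'] lhomeo_openin_preimage[of h T T']
  by (auto simp: lhomeo_def[of T' T] minv_Some_iff dom_def ran_def)

lemma minv_minv: "h \<in> lhomeo T T' \<Longrightarrow> minv (minv h) = h"
  by (rule map_eqI) (simp add: minv_Some_iff[OF lhomeo_minv] minv_Some_iff)

lemma dom_minv: "h \<in> lhomeo T T' \<Longrightarrow> dom (minv h) = ran h"
  by (auto simp: minv_Some_iff dom_def ran_def)

lemma lhomeo_comp:
  assumes "h \<in> lhomeo T T'" "k \<in> lhomeo T' T''"
  shows "k \<circ>\<^sub>m h \<in> lhomeo T T''"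
proof -
  have 1: "{z. \<exists>x\<in>W. (k \<circ>\<^sub>m h) x = Some z} = {z. \<exists>y\<in>{y. \<exists>x\<in>W. h x = Some y}. k y = Some z}" for W
    by (auto simp: map_comp_Some_iff)
  have 2: "{x. \<exists>z\<in>W. (k \<circ>\<^sub>m h) x = Some z} = {x. \<exists>y\<in>{y. \<exists>z\<in>W. k y = Some z}. h x = Some y}" for W
    by (auto simp: map_comp_Some_iff)
  show ?thesis
    unfolding lhomeo_def[of T T'']
  proof (intro CollectI conjI allI impI)
    fix x y z assume "(k \<circ>\<^sub>m h) x = Some z" "(k \<circ>\<^sub>m h) y = Some z"
    then show "x = y"
      unfolding map_comp_Some_iff using lhomeo_inj[OF assms(1)] lhomeo_inj[OF assms(2)] by blast
  next
    show "dom (k \<circ>\<^sub>m h) \<subseteq> topspace T" "ran (k \<circ>\<^sub>m h) \<subseteq> topspace T''"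
      by (auto simp: map_comp_Some_iff ran_def dom_def
          intro: lhomeo_in_topspace(1)[OF assms(1)] lhomeo_in_topspace(2)[OF assms(2)])
  next
    fix W assume "openin T W"
    then show "openin T'' {z. \<exists>x\<in>W. (k \<circ>\<^sub>m h) x = Some z}"
      unfolding 1 by (intro lhomeo_openin_image[OF assms(2)] lhomeo_openin_image[OF assms(1)])
  next
    fix W assume "openin T'' W"
    then show "openin T {x. \<exists>z\<in>W. (k \<circ>\<^sub>m h) x = Some z}"
      unfolding 2 by (intro lhomeo_openin_preimage[OF assms(1)] lhomeo_openin_preimage[OF assms(2)])
  qed
qed

lemma restrict_map_Some_iff: "(h |` W) x = Some y \<longleftrightarrow> x \<in> W \<and> h x = Some y"
  by (simp add: restrict_map_def)

lemma lhomeo_restrict: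
  assumes "h \<in> lhomeo T T'" "openin T W"
  shows "h |` W \<in> lhomeo T T'"
proof -
  have 1: "{y. \<exists>x\<in>V. (h |` W) x = Some y} = {y. \<exists>x\<in>V \<inter> W. h x = Some y}" for V
    by (auto simp: restrict_map_Some_iff)
  have 2: "{x. \<exists>y\<in>V. (h |` W) x = Some y} = {x. \<exists>y\<in>V. h x = Some y} \<inter> W" for V
    by (auto simp: restrict_map_Some_iff)
  show ?thesis
    unfolding lhomeo_def[of T T']
  proof (intro CollectI conjI allI impI)
    fix x y z assume "(h |` W) x = Some z" "(h |` W) y = Some z"
    then show "x = y" unfolding restrict_map_Some_iff using lhomeo_inj[OF assms(1)] by blast
  next
    show "dom (h |` W) \<subseteq> topspace T" "ran (h |` W) \<subseteq> topspace T'"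
      by (auto simp: restrict_map_Some_iff ran_def dom_def intro: lhomeo_in_topspace[OF assms(1)])
  next
    fix V assume "openin T V"
    then show "openin T' {y. \<exists>x\<in>V. (h |` W) x = Some y}"
      unfolding 1 by (intro lhomeo_openin_image[OF assms(1)] openin_Int assms(2))
  next
    fix V assume "openin T' V"
    then show "openin T {x. \<exists>y\<in>V. (h |` W) x = Some y}"
      unfolding 2 by (intro lhomeo_openin_preimage[OF assms(1)] openin_Int assms(2))
  qed
qed

lemma lhomeo_id: "openin T W \<Longrightarrow> Some |` W \<in> lhomeo T T"
proof -
  assume W: "openin T W"
  have "{y. \<exists>x\<in>V. (Some |` W) x = Some y} = V \<inter> W" "{x. \<exists>y\<in>V. (Some |` W) x = Some y} = V \<inter> W" for V
    by (auto simp: restrict_map_Some_iff)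
  then show ?thesis using W openin_subset[OF W]
    by (auto simp: lhomeo_def restrict_map_Some_iff ran_def)
qed

section \<open>Germs of partial maps through neighbourhood filters\<close>

lemma eventually_nhdsin_in: "openin T W \<Longrightarrow> x \<in> W \<Longrightarrow> \<forall>\<^sub>F z in nhdsin T x. z \<in> W"
  by (auto simp: eventually_nhdsin)

text \<open>The filter is trivial at a point outside the space, hence the membership assumption here
  and in \<open>eventually_nhdsin_self\<close>.\<close>

lemma eventually_nhdsinD:
  assumes "eventually P (nhdsin T x)" "x \<in> topspace T"
  obtains W where "openin T W" "x \<in> W" "\<And>z. z \<in> W \<Longrightarrow> P z"
  using assms by (auto simp: eventually_nhdsin)

lemma eventually_nhdsin_self: "eventually P (nhdsin T x) \<Longrightarrow> x \<in> topspace T \<Longrightarrow> P x"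
  by (auto simp: eventually_nhdsin)

lemma eventually_eventually_nhdsin:
  "eventually P (nhdsin T x) \<Longrightarrow> \<forall>\<^sub>F y in nhdsin T x. eventually P (nhdsin T y)"
  by (auto simp: eventually_nhdsin)

text \<open>Openness of images and of preimages says that \<open>h\<close> carries the neighbourhood
  filter of \<open>x\<close> to that of \<open>y\<close>. Demanding a value \<open>w\<close> on the
  right keeps undefined points from satisfying the condition vacuously.\<close>

lemma eventually_nhdsin_lhomeo:
  assumes h: "h \<in> lhomeo T T'" and x: "h x = Some y"
  shows "(\<forall>\<^sub>F w in nhdsin T' y. P w) \<longleftrightarrow> (\<forall>\<^sub>F z in nhdsin T x. \<exists>w. h z = Some w \<and> P w)"
proof
  have xT: "x \<in> topspace T" and yT: "y \<in> topspace T'" using lhomeo_in_topspace[OF h x] by auto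
  {
    assume "\<forall>\<^sub>F w in nhdsin T' y. P w"
    then obtain W where W: "openin T' W" "y \<in> W" "\<forall>w\<in>W. P w"
      using yT by (auto simp: eventually_nhdsin)
    then show "\<forall>\<^sub>F z in nhdsin T x. \<exists>w. h z = Some w \<and> P w"
      unfolding eventually_nhdsin using lhomeo_openin_preimage[OF h W(1)] x
      by (intro disjI2 exI[of _ "{x. \<exists>y\<in>W. h x = Some y}"]) auto
  }
  assume "\<forall>\<^sub>F z in nhdsin T x. \<exists>w. h z = Some w \<and> P w"
  then obtain W where W: "openin T W" "x \<in> W" "\<forall>z\<in>W. \<exists>w. h z = Some w \<and> P w"
    using xT by (auto simp: eventually_nhdsin)
  then show "\<forall>\<^sub>F w in nhdsin T' y. P w"
    unfolding eventually_nhdsin using lhomeo_openin_image[OF h W(1)] x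
    by (intro disjI2 exI[of _ "{y. \<exists>x\<in>W. h x = Some y}"]) force
qed

lemmas eventually_nhdsin_lhomeoD = iffD1[OF eventually_nhdsin_lhomeo]

lemma eventually_minv_comp:
  assumes "h \<in> lhomeo T T'" "h x = Some y"
  shows "\<forall>\<^sub>F z in nhdsin T x. (minv h \<circ>\<^sub>m h) z = Some z"
proof -
  have "\<forall>\<^sub>F z in nhdsin T x. z \<in> dom h"
    using assms by (auto intro!: eventually_nhdsin_in lhomeo_openin_dom)
  then show ?thesis
    by eventually_elim (auto simp: map_comp_Some_iff minv_Some_iff[OF assms(1)])
qed

lemma eventually_map_comp_cong:
  assumes h: "h \<in> lhomeo T T'" "h x = Some y"
    and hh: "\<forall>\<^sub>F z in nhdsin T x. h z = h' z" and kk: "\<forall>\<^sub>F w in nhdsin T' y. k w = k' w"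
  shows "\<forall>\<^sub>F z in nhdsin T x. (k \<circ>\<^sub>m h) z = (k' \<circ>\<^sub>m h') z"
  using eventually_nhdsin_lhomeoD[OF h kk] hh
  by eventually_elim (auto simp: map_comp_def)

lemma eventually_minv_cong:
  assumes h: "h \<in> lhomeo T T'" "h x = Some y" and k: "k \<in> lhomeo T T'"
    and hk: "\<forall>\<^sub>F z in nhdsin T x. h z = k z"
  shows "\<forall>\<^sub>F w in nhdsin T' y. minv h w = minv k w"
proof -
  have "\<forall>\<^sub>F z in nhdsin T x. z \<in> dom h"
    using h by (auto intro!: eventually_nhdsin_in lhomeo_openin_dom)
  with hk have "\<forall>\<^sub>F z in nhdsin T x. \<exists>w. h z = Some w \<and> minv h w = minv k w"
    by eventually_elim (metis domD h(1) k minv_Some_iff)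
  then show ?thesis using eventually_nhdsin_lhomeo[OF h] by blast
qed

section \<open>Pseudogroups and their germs\<close>

text \<open>An induction principle for generated pseudogroups: a property of germs that respects
  identity, composition and inversion cuts out a pseudogroup. Restriction and union change no germ,
  so those two axioms reduce to the invariance \<open>germ\<close>.\<close>

lemma pseudogroup_germ_closed:
  assumes germ: "\<And>x h k. h \<in> lhomeo T T \<Longrightarrow> k \<in> lhomeo T T \<Longrightarrow> x \<in> dom h \<Longrightarrow>
      \<forall>\<^sub>F z in nhdsin T x. h z = k z \<Longrightarrow> R x h \<Longrightarrow> R x k"
    and id: "\<And>x. x \<in> topspace T \<Longrightarrow> R x (Some |` topspace T)"
    and comp: "\<And>x y h k. h \<in> lhomeo T T \<Longrightarrow> k \<in> lhomeo T T \<Longrightarrow> h x = Some y \<Longrightarrow> y \<in> dom k \<Longrightarrow>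
      R x h \<Longrightarrow> R y k \<Longrightarrow> R x (k \<circ>\<^sub>m h)"
    and inv: "\<And>x y h. h \<in> lhomeo T T \<Longrightarrow> h x = Some y \<Longrightarrow> R x h \<Longrightarrow> R y (minv h)"
  shows "pseudogroup T {h \<in> lhomeo T T. \<forall>x\<in>dom h. R x h}" (is "pseudogroup T ?P")
  unfolding pseudogroup_def loct_eq_lhomeo pinv_eq_minv
proof (intro conjI ballI allI impI)
  show "Some |` topspace T \<in> ?P" by (auto intro: lhomeo_id id)
next
  fix h k assume "h \<in> ?P" "k \<in> ?P"
  then show "k \<circ>\<^sub>m h \<in> ?P"
    using lhomeo_comp[of h T T k T] comp[of h k] by (force simp: map_comp_Some_iff)
next
  fix h assume h: "h \<in> ?P"
  then show "minv h \<in> ?P"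
    by (auto intro!: lhomeo_minv inv simp: minv_Some_iff[of h T T])
next
  fix h W assume h: "h \<in> ?P" and W: "openin T W \<and> W \<subseteq> dom h"
  have r: "h |` W \<in> lhomeo T T" using h W by (auto intro: lhomeo_restrict)
  moreover have "R x (h |` W)" if "x \<in> W" for x
  proof (rule germ[of h])
    have "\<forall>\<^sub>F z in nhdsin T x. z \<in> W" using W that by (auto intro: eventually_nhdsin_in)
    then show "\<forall>\<^sub>F z in nhdsin T x. h z = (h |` W) z" by eventually_elim simp
  qed (use h W r that in auto)
  ultimately show "h |` W \<in> ?P" by (auto simp: restrict_map_Some_iff)
next
  fix h K assume h: "h \<in> lhomeo T T" and K: "K \<subseteq> ?P" and g: "Map.graph h = (\<Union>k\<in>K. Map.graph k)"
  have "R x h" if "h x = Some y" for x y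
  proof -
    have "(x, y) \<in> Map.graph h" using that by (simp add: graph_def)
    then obtain k where k: "k \<in> K" "k x = Some y" unfolding g by (auto simp: graph_def)
    \<comment> \<open>The graph of \<open>k\<close> lies in that of \<open>h\<close>, so
      \<open>k\<close> is a restriction of \<open>h\<close> and has the same germ at
      \<open>x\<close>.\<close>
    have kh: "h z = Some w" if "k z = Some w" for z w
    proof -
      have "(z, w) \<in> Map.graph h" unfolding g using k(1) that by (auto simp: graph_def)
      then show ?thesis by (simp add: graph_def)
    qed
    show ?thesis
    proof (rule germ[of k])
      have "\<forall>\<^sub>F z in nhdsin T x. z \<in> dom k"
        using K k by (auto intro!: eventually_nhdsin_in lhomeo_openin_dom)
      then show "\<forall>\<^sub>F z in nhdsin T x. k z = h z"
        by eventually_elim (auto simp: kh)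
    qed (use K k h in auto)
  qed
  with h show "h \<in> ?P" by auto
qed auto

lemma pseudogroup_lhomeo: "pseudogroup T (lhomeo T T)"
proof -
  have "{h \<in> lhomeo T T. \<forall>x\<in>dom h. True} = lhomeo T T" by simp
  then show ?thesis using pseudogroup_germ_closed[of T "\<lambda>_ _. True"] by (metis (no_types, lifting))
qed

lemma pseudogroup_UnionI:
  assumes "pseudogroup T H" "h \<in> loct T" "K \<subseteq> H" "Map.graph h = (\<Union>k\<in>K. Map.graph k)"
  shows "h \<in> H"
proof -
  have "\<forall>h\<in>loct T. \<forall>K\<subseteq>H. Map.graph h = (\<Union>k\<in>K. Map.graph k) \<longrightarrow> h \<in> H"
    using assms(1) unfolding pseudogroup_def by (elim conjE)
  from this[rule_format, OF assms(2-4)] show ?thesis .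
qed

lemma generated_pseudogroup_minimal:
  "E \<subseteq> P \<Longrightarrow> pseudogroup T P \<Longrightarrow> generated_pseudogroup T E \<subseteq> P"
  unfolding generated_pseudogroup_def by (rule hull_minimal)

text \<open>An intersection of pseudogroups is a pseudogroup once some pseudogroup contains
  \<open>E\<close>; \<open>lhomeo T T\<close> is one, which excludes the hull of an empty
  family.\<close>

lemma pseudogroup_generated:
  assumes "E \<subseteq> lhomeo T T"
  shows "pseudogroup T (generated_pseudogroup T E)"
proof -
  have sub: "generated_pseudogroup T E \<subseteq> lhomeo T T"
    unfolding generated_pseudogroup_def using hull_minimal[of E "lhomeo T T" "pseudogroup T"] assms pseudogroup_lhomeo by metis
  have *: "h \<in> generated_pseudogroup T E \<longleftrightarrow> (\<forall>P. pseudogroup T P \<and> E \<subseteq> P \<longrightarrow> h \<in> P)" for h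
    by (auto simp: generated_pseudogroup_def hull_def)
  show ?thesis
    unfolding pseudogroup_def
  proof (intro conjI ballI allI impI)
    show "generated_pseudogroup T E \<subseteq> loct T" using sub by (simp add: loct_eq_lhomeo)
  next
    fix h K assume "h \<in> loct T" "K \<subseteq> generated_pseudogroup T E"
      "Map.graph h = (\<Union>k\<in>K. Map.graph k)"
    note hK = this
    show "h \<in> generated_pseudogroup T E"
      unfolding *
    proof (intro allI impI)
      fix P assume P: "pseudogroup T P \<and> E \<subseteq> P"
      then have "K \<subseteq> P" using hK(2) generated_pseudogroup_minimal[of E P T] by blast
      then show "h \<in> P" using pseudogroup_UnionI[of T P h K] P hK(1,3) by simp
    qed
  qed (simp_all add: * pseudogroup_def)
qed

lemma generated_pseudogroup_superset: "E \<subseteq> generated_pseudogroup T E"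
  by (simp add: generated_pseudogroup_def hull_subset)

section \<open>Closure properties of pseudogroups and of local pseudo*groups\<close>

context
  fixes T :: "'t topology" and H
  assumes pg: "pseudogroup T H"
begin

lemma pg_lhomeo: "h \<in> H \<Longrightarrow> h \<in> lhomeo T T"
  using pg by (auto simp: pseudogroup_def loct_eq_lhomeo)

lemma pg_comp: "h \<in> H \<Longrightarrow> k \<in> H \<Longrightarrow> k \<circ>\<^sub>m h \<in> H"
  using pg by (simp add: pseudogroup_def)

lemma pg_minv: "h \<in> H \<Longrightarrow> minv h \<in> H"
  using pg by (simp add: pseudogroup_def pinv_eq_minv)

lemma pg_id: "Some |` topspace T \<in> H"
  using pg by (simp add: pseudogroup_def)

lemma pg_restrict:
  assumes "h \<in> H" "openin T W" shows "h |` W \<in> H"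
proof -
  have "h |` W = h |` (W \<inter> dom h)" by (auto simp: restrict_map_def fun_eq_iff)
  moreover have "openin T (W \<inter> dom h)"
    using assms pg_lhomeo lhomeo_openin_dom by blast
  moreover have "\<forall>W. openin T W \<and> W \<subseteq> dom h \<longrightarrow> h |` W \<in> H"
    using assms(1) pg by (simp add: pseudogroup_def)
  ultimately show ?thesis by (metis inf_le2)
qed

text \<open>The union axiom in local form: where \<open>h\<close> agrees with an element of
  \<open>H\<close>, a restriction of \<open>h\<close> lies in \<open>H\<close>, and \<open>h\<close>
  is the union of these restrictions.\<close>

lemma pg_localI:
  assumes h: "h \<in> lhomeo T T"
    and loc: "\<And>x. x \<in> dom h \<Longrightarrow> \<exists>k\<in>H. \<forall>\<^sub>F z in nhdsin T x. k z = h z"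
  shows "h \<in> H"
proof -
  let ?K = "{h |` W | W. openin T W \<and> W \<subseteq> dom h \<and> h |` W \<in> H}"
  have "\<exists>W. openin T W \<and> x \<in> W \<and> W \<subseteq> dom h \<and> h |` W \<in> H" if x: "x \<in> dom h" for x
  proof -
    obtain k where k: "k \<in> H" "\<forall>\<^sub>F z in nhdsin T x. k z = h z" using loc[OF x] by blast
    have "x \<in> topspace T" using x lhomeo_in_topspace(1)[OF h] by auto
    then obtain W where W: "openin T W" "x \<in> W" "\<And>z. z \<in> W \<Longrightarrow> k z = h z"
      using k(2) by (elim eventually_nhdsinD) auto
    let ?W = "W \<inter> dom h"
    have "openin T ?W" using W(1) lhomeo_openin_dom[OF h] by blast
    moreover have "h |` ?W = k |` ?W" using W(3) by (auto simp: restrict_map_def fun_eq_iff)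
    ultimately show ?thesis
      using pg_restrict[OF k(1)] W(2) x by (intro exI[of _ ?W]) auto
  qed
  note loc' = this
  have "Map.graph h = (\<Union>k\<in>?K. Map.graph k)"
  proof (intro equalityI subsetI)
    fix p assume p: "p \<in> Map.graph h"
    then obtain x y where xy: "p = (x, y)" "h x = Some y" by (auto simp: graph_def)
    then obtain W where "openin T W" "x \<in> W" "W \<subseteq> dom h" "h |` W \<in> H" using loc'[of x] by auto
    then show "p \<in> (\<Union>k\<in>?K. Map.graph k)"
      using xy by (intro UN_I[of "h |` W"]) (auto simp: graph_def)
  qed (auto simp: graph_def restrict_map_Some_iff)
  then show ?thesis
    by (rule pseudogroup_UnionI[OF pg, rotated 2]) (use h loct_eq_lhomeo in auto)
qed

end

context
  fixes T :: "'t topology" and S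
  assumes lps: "local_pseudostar_group T S"
begin

lemma lps_lhomeo: "h \<in> S \<Longrightarrow> h \<in> lhomeo T T"
  using lps by (auto simp: local_pseudostar_group_def pseudostar_group_def loct_eq_lhomeo)

lemma lps_comp: "h \<in> S \<Longrightarrow> k \<in> S \<Longrightarrow> k \<circ>\<^sub>m h \<in> S"
  using lps by (simp add: local_pseudostar_group_def pseudostar_group_def)

lemma lps_minv: "h \<in> S \<Longrightarrow> minv h \<in> S"
  using lps by (simp add: local_pseudostar_group_def pseudostar_group_def pinv_eq_minv)

lemma lps_restrict:
  assumes "h \<in> S" "openin T W" shows "h |` W \<in> S"
proof -
  have "h |` W = h |` (W \<inter> dom h)" by (auto simp: restrict_map_def fun_eq_iff)
  moreover have "openin T (W \<inter> dom h)"
    using assms lps_lhomeo lhomeo_openin_dom by blast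
  moreover have "\<forall>W. openin T W \<and> W \<subseteq> dom h \<longrightarrow> h |` W \<in> S"
    using assms(1) lps by (simp add: local_pseudostar_group_def)
  ultimately show ?thesis by (metis inf_le2)
qed

text \<open>Maps having at each point the germ of some element of \<open>S\<close> form a
  pseudogroup containing \<open>S\<close>, hence containing \<open>H\<close>; closure of
  \<open>S\<close> under restriction then turns the common germ into a restriction of
  \<open>h\<close>. The covering assumption is used for the identity, whose germ at \<open>x\<close>
  is that of \<open>minv f \<circ>\<^sub>m f\<close>.\<close>

lemma generated_locally_restrict:
  assumes cov: "\<And>x. x \<in> topspace T \<Longrightarrow> \<exists>f\<in>S. x \<in> dom f"
    and gen: "generated_pseudogroup T S = H"
    and h: "h \<in> H" "x \<in> dom h"
  obtains G where "openin T G" "x \<in> G" "G \<subseteq> dom h" "h |` G \<in> S"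
proof -
  let ?R = "\<lambda>x h. \<exists>f\<in>S. \<forall>\<^sub>F z in nhdsin T x. f z = h z"
  let ?P = "{h \<in> lhomeo T T. \<forall>x\<in>dom h. ?R x h}"
  have "pseudogroup T ?P"
  proof (rule pseudogroup_germ_closed)
    fix x :: 't and h k :: "'t \<rightharpoonup> 't"
    assume "\<forall>\<^sub>F z in nhdsin T x. h z = k z" "\<exists>f\<in>S. \<forall>\<^sub>F z in nhdsin T x. f z = h z"
    then obtain f where "f \<in> S" "\<forall>\<^sub>F z in nhdsin T x. f z = h z" "\<forall>\<^sub>F z in nhdsin T x. h z = k z" by blast
    then show "\<exists>f\<in>S. \<forall>\<^sub>F z in nhdsin T x. f z = k z"
      by (intro bexI[of _ f]) (auto elim: eventually_elim2)
  next
    fix x assume "x \<in> topspace T"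
    then obtain f where f: "f \<in> S" "x \<in> dom f" using cov by blast
    have "\<forall>\<^sub>F z in nhdsin T x. (minv f \<circ>\<^sub>m f) z = Some z"
      using f lps_lhomeo by (auto intro: eventually_minv_comp)
    moreover have "\<forall>\<^sub>F z in nhdsin T x. z \<in> topspace T"
      using \<open>x \<in> topspace T\<close> by (auto intro: eventually_nhdsin_in)
    ultimately have "\<forall>\<^sub>F z in nhdsin T x. (minv f \<circ>\<^sub>m f) z = (Some |` topspace T) z"
      by eventually_elim simp
    then show "\<exists>f\<in>S. \<forall>\<^sub>F z in nhdsin T x. f z = (Some |` topspace T) z"
      using lps_comp lps_minv f by blast
  next
    fix x y h k assume *: "h \<in> lhomeo T T" "h x = Some y"
      and "\<exists>f\<in>S. \<forall>\<^sub>F z in nhdsin T x. f z = h z" "\<exists>f\<in>S. \<forall>\<^sub>F z in nhdsin T y. f z = k z"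
    then obtain f g where fg: "f \<in> S" "\<forall>\<^sub>F z in nhdsin T x. f z = h z"
      "g \<in> S" "\<forall>\<^sub>F z in nhdsin T y. g z = k z" by blast
    have "x \<in> topspace T" using * lhomeo_in_topspace by metis
    then have "f x = Some y" using eventually_nhdsin_self[OF fg(2)] * by simp
    then show "\<exists>f\<in>S. \<forall>\<^sub>F z in nhdsin T x. f z = (k \<circ>\<^sub>m h) z"
      using eventually_map_comp_cong[OF lps_lhomeo[OF fg(1)] _ fg(2) fg(4)] lps_comp fg by blast
  next
    fix x y h assume *: "h \<in> lhomeo T T" "h x = Some y"
      and "\<exists>f\<in>S. \<forall>\<^sub>F z in nhdsin T x. f z = h z"
    then obtain f where fg: "f \<in> S" "\<forall>\<^sub>F z in nhdsin T x. f z = h z" by blast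
    have "x \<in> topspace T" using * lhomeo_in_topspace by metis
    then have "f x = Some y" using eventually_nhdsin_self[OF fg(2)] * by simp
    then show "\<exists>f\<in>S. \<forall>\<^sub>F z in nhdsin T y. f z = minv h z"
      using eventually_minv_cong[OF lps_lhomeo[OF fg(1)] _ *(1) fg(2)] lps_minv fg by blast
  qed
  moreover have "S \<subseteq> ?P" using lps_lhomeo by (auto intro!: bexI)
  ultimately have "H \<subseteq> ?P" using gen generated_pseudogroup_minimal by blast
  then have hl: "h \<in> lhomeo T T" and "?R x h" using h by auto
  then obtain f where f: "f \<in> S" "\<forall>\<^sub>F z in nhdsin T x. f z = h z" by blast
  have "x \<in> topspace T" using h(2) hl lhomeo_in_topspace by auto
  then obtain W where W: "openin T W" "x \<in> W" "\<And>z. z \<in> W \<Longrightarrow> f z = h z"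
    using f(2) by (elim eventually_nhdsinD) auto
  show thesis
  proof
    show "openin T (W \<inter> dom h)" using W(1) lhomeo_openin_dom[OF hl] by blast
    have "h |` (W \<inter> dom h) = f |` (W \<inter> dom h)" using W(3) by (auto simp: restrict_map_def fun_eq_iff)
    then show "h |` (W \<inter> dom h) \<in> S" using lps_restrict[OF f(1)] \<open>openin T (W \<inter> dom h)\<close> by simp
  qed (use W h in auto)
qed

end

section \<open>Germ words and compact generation\<close>

text \<open>A letter \<open>(D, h)\<close> may be applied only at points of \<open>D\<close>, while
  the word is the composite of the full maps \<open>h\<close> and is used through its germ at
  \<open>x\<close>. There is no empty word, so the identity has to occur among the letters.\<close>

inductive germ_word :: "('t set \<times> ('t \<rightharpoonup> 't)) set \<Rightarrow> 't \<Rightarrow> ('t \<rightharpoonup> 't) \<Rightarrow> bool" for E x where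
  base: "(D, h) \<in> E \<Longrightarrow> x \<in> D \<Longrightarrow> germ_word E x h"
| step: "germ_word E x k \<Longrightarrow> k x = Some y \<Longrightarrow> (D, h) \<in> E \<Longrightarrow> y \<in> D \<Longrightarrow> germ_word E x (h \<circ>\<^sub>m k)"

lemma map_comp_assoc: "(f \<circ>\<^sub>m g) \<circ>\<^sub>m h = f \<circ>\<^sub>m (g \<circ>\<^sub>m h)"
  by (rule map_eqI) (auto simp: map_comp_Some_iff)

lemma germ_word_trans:
  assumes "germ_word E y k'" "germ_word E x k" "k x = Some y"
  shows "germ_word E x (k' \<circ>\<^sub>m k)"
  using assms(1)
proof induction
  case (base D h)
  then show ?case using assms germ_word.step by metis
next
  case (step k' z D h)
  then show ?case using assms by (auto simp: map_comp_assoc map_comp_Some_iff intro!: germ_word.step)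
qed

lemma germ_word_in_pseudogroup:
  assumes "pseudogroup T H" "snd ` E \<subseteq> H" "germ_word E x k"
  shows "k \<in> H"
  using assms(3) by induction (use assms pg_comp in force)+

text \<open>The word is read backwards with the inverse letters that \<open>sym\<close> provides.
  These agree with the true inverses only near the image points, so the result is an equality of
  germs.\<close>

lemma germ_word_minv:
  assumes pg: "pseudogroup T H" and E: "snd ` E \<subseteq> H" "\<And>D h. (D, h) \<in> E \<Longrightarrow> D \<subseteq> dom h"
    and sym: "\<And>D h x. (D, h) \<in> E \<Longrightarrow> x \<in> D \<Longrightarrow> \<exists>(D', h') \<in> E. the (h x) \<in> D' \<and>
       (\<forall>\<^sub>F z in nhdsin T (the (h x)). h' z = minv h z)"
    and w: "germ_word E x k" "k x = Some y"
  shows "\<exists>k'. germ_word E y k' \<and> (\<forall>\<^sub>F z in nhdsin T y. k' z = minv k z)"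
  using w
proof (induction arbitrary: y)
  case (base D h)
  then show ?case using sym[of D h x] germ_word.base by (fastforce split: prod.splits)
next
  case (step k y D h z)
  obtain k' where k': "germ_word E y k'" "\<forall>\<^sub>F w in nhdsin T y. k' w = minv k w"
    using step.IH step.hyps by blast
  have kl: "k \<in> lhomeo T T" and hl: "h \<in> lhomeo T T"
    using germ_word_in_pseudogroup[OF pg E(1) step.hyps(1)] pg_lhomeo[OF pg] E(1) step.hyps(3) by force+
  have hz: "h y = Some z" using step by (auto simp: map_comp_Some_iff)
  obtain D' h' where h': "(D', h') \<in> E" "z \<in> D'" "\<forall>\<^sub>F w in nhdsin T z. h' w = minv h w"
    using sym[OF step.hyps(3,4)] hz by auto
  have zT: "z \<in> topspace T" using hz hl lhomeo_in_topspace by metis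
  have mh: "minv h \<in> lhomeo T T" "minv h z = Some y"
    using lhomeo_minv[OF hl] minv_Some_iff[OF hl] hz by auto
  have h'z: "h' z = Some y" using eventually_nhdsin_self[OF h'(3) zT] mh by simp
  have h'l: "h' \<in> lhomeo T T" using E(1) h'(1) pg_lhomeo[OF pg] by force
  have "germ_word E z (k' \<circ>\<^sub>m h')"
    using germ_word_trans[OF k'(1) germ_word.base[OF h'(1,2)] h'z] .
  moreover have "\<forall>\<^sub>F w in nhdsin T z. (k' \<circ>\<^sub>m h') w = (minv k \<circ>\<^sub>m minv h) w"
    by (rule eventually_map_comp_cong[OF h'l h'z h'(3) k'(2)])
  moreover have "minv k \<circ>\<^sub>m minv h = minv (h \<circ>\<^sub>m k)"
    by (rule map_eqI) (auto simp: map_comp_Some_iff minv_Some_iff[OF kl] minv_Some_iff[OF hl]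
        minv_Some_iff[OF lhomeo_comp[OF kl hl]])
  ultimately show ?case by metis
qed

lemma nhdsin_open_subtopology:
  assumes "openin T U" "x \<in> U"
  shows "eventually P (nhdsin (subtopology T U) x) \<longleftrightarrow> eventually P (nhdsin T x)"
proof -
  have x: "x \<in> topspace T" "x \<in> topspace (subtopology T U)"
    using assms openin_subset by (auto simp: topspace_subtopology)
  show ?thesis
  proof
    assume "eventually P (nhdsin (subtopology T U) x)"
    then show "eventually P (nhdsin T x)"
      using x assms unfolding eventually_nhdsin by (auto simp: openin_open_subtopology)
  next
    assume "eventually P (nhdsin T x)"
    then obtain W where "openin T W" "x \<in> W" "\<And>z. z \<in> W \<Longrightarrow> P z"
      using x eventually_nhdsinD by metis
    then show "eventually P (nhdsin (subtopology T U) x)"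
      using assms unfolding eventually_nhdsin
      by (intro disjI2 exI[of _ "W \<inter> U"]) (auto simp: openin_open_subtopology)
  qed
qed

lemma lhomeo_open_subtopology:
  assumes "openin T U"
  shows "h \<in> lhomeo (subtopology T U) (subtopology T U) \<longleftrightarrow> h \<in> lhomeo T T \<and> dom h \<union> ran h \<subseteq> U"
    (is "?L \<longleftrightarrow> ?R")
proof
  assume L: ?L
  have sub: "dom h \<subseteq> U" "ran h \<subseteq> U"
    using lhomeo_in_topspace[OF L] by (auto simp: topspace_subtopology ran_def)
  have "h \<in> lhomeo T T"
    unfolding lhomeo_def
  proof (intro CollectI conjI allI impI)
    fix x y z assume "h x = Some z" "h y = Some z" then show "x = y" using lhomeo_inj[OF L] by blast
  next
    show "dom h \<subseteq> topspace T" "ran h \<subseteq> topspace T" using sub openin_subset[OF assms] by auto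
  next
    fix W assume "openin T W"
    then have "openin (subtopology T U) (W \<inter> U)" by (auto simp: openin_subtopology)
    from lhomeo_openin_image[OF L this]
    have "openin T {y. \<exists>x\<in>W \<inter> U. h x = Some y}" using assms by (simp add: openin_open_subtopology)
    moreover have "{y. \<exists>x\<in>W \<inter> U. h x = Some y} = {y. \<exists>x\<in>W. h x = Some y}" using sub by auto
    ultimately show "openin T {y. \<exists>x\<in>W. h x = Some y}" by simp
  next
    fix W assume "openin T W"
    then have "openin (subtopology T U) (W \<inter> U)" by (auto simp: openin_subtopology)
    from lhomeo_openin_preimage[OF L this]
    have "openin T {x. \<exists>y\<in>W \<inter> U. h x = Some y}" using assms by (simp add: openin_open_subtopology)
    moreover have "{x. \<exists>y\<in>W \<inter> U. h x = Some y} = {x. \<exists>y\<in>W. h x = Some y}"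
      using sub by (auto simp: ran_def)
    ultimately show "openin T {x. \<exists>y\<in>W. h x = Some y}" by simp
  qed
  then show ?R using sub by simp
next
  assume R: ?R
  then have h: "h \<in> lhomeo T T" and sub: "dom h \<subseteq> U" "ran h \<subseteq> U" by auto
  show ?L
    unfolding lhomeo_def
  proof (intro CollectI conjI allI impI)
    fix x y z assume "h x = Some z" "h y = Some z" then show "x = y" using lhomeo_inj[OF h] by blast
  next
    show "dom h \<subseteq> topspace (subtopology T U)" "ran h \<subseteq> topspace (subtopology T U)"
      using sub openin_subset[OF assms] by auto
  next
    fix W assume "openin (subtopology T U) W"
    then have "openin T W" using assms by (simp add: openin_open_subtopology)
    from lhomeo_openin_image[OF h this] show "openin (subtopology T U) {y. \<exists>x\<in>W. h x = Some y}"
      using assms sub by (auto simp: openin_open_subtopology ran_def)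
  next
    fix W assume "openin (subtopology T U) W"
    then have "openin T W" using assms by (simp add: openin_open_subtopology)
    from lhomeo_openin_preimage[OF h this] show "openin (subtopology T U) {x. \<exists>y\<in>W. h x = Some y}"
      using assms sub by (auto simp: openin_open_subtopology)
  qed
qed

text \<open>Each letter is used on a compact part \<open>D\<close> of its domain only; this compactness is what
  later makes the domains of extended words uniform.\<close>

lemma compactly_generated_words:
  assumes pg: "pseudogroup T H" and haus: "Hausdorff_space T" and cg: "compactly_generated_with T H U"
  obtains E where "finite E" "\<forall>D h. (D, h) \<in> E \<longrightarrow> compactin T D \<and> D \<subseteq> dom h \<and> h \<in> H"
    "\<forall>h x y. h \<in> H \<longrightarrow> x \<in> U \<longrightarrow> h x = Some y \<longrightarrow> y \<in> U \<longrightarrow>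
       (\<exists>k. germ_word E x k \<and> (\<forall>\<^sub>F z in nhdsin T x. k z = h z))"
proof -
  obtain G where G: "finite G" "G \<subseteq> restricted_pseudogroup H U"
    "generated_pseudogroup (subtopology T U) G = restricted_pseudogroup H U"
    "\<forall>h\<in>G. \<exists>h'\<in>H. T closure_of dom h \<subseteq> dom h' \<and> h = h' |` dom h"
    using cg unfolding compactly_generated_with_def by blast
  have U: "openin T U" "compactin T (T closure_of U)"
    using cg by (auto simp: compactly_generated_with_def)
  have UT: "U \<subseteq> topspace T" using U openin_subset by blast
  obtain e where e: "\<And>h. h \<in> G \<Longrightarrow> e h \<in> H \<and> T closure_of dom h \<subseteq> dom (e h) \<and> h = e h |` dom h"
    using G(4) by metis
  let ?D = "\<lambda>h. T closure_of dom h"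
  let ?i = "Some |` topspace T"
  \<comment> \<open>The letters are the extensions of the generators on the compact closures of the
    domains, their inverses on the images of these closures, and the identity on the closure of
    \<open>U\<close> in place of the empty word.\<close>
  define E where "E = (\<lambda>h. (?D h, e h)) ` G \<union>
     (\<lambda>h. ({y. \<exists>x\<in>?D h. e h x = Some y}, minv (e h))) ` G \<union> {(T closure_of U, ?i)}"
  have lh: "h \<in> H \<Longrightarrow> h \<in> lhomeo T T" for h using pg_lhomeo[OF pg] .
  have cD: "compactin T (?D h)" if "h \<in> G" for h
  proof -
    have "dom h \<subseteq> U" using G(2) that by (auto simp: restricted_pseudogroup_def)
    then show ?thesis using U(2) closure_of_mono closed_compactin closedin_closure_of by metis
  qed
  have cE: "compactin T D \<and> D \<subseteq> dom h \<and> h \<in> H" if Dh: "(D, h) \<in> E" for D h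
  proof -
    consider g where "g \<in> G" "D = ?D g" "h = e g"
      | g where "g \<in> G" "D = {y. \<exists>x\<in>?D g. e g x = Some y}" "h = minv (e g)"
      | "D = T closure_of U" "h = ?i"
      using Dh unfolding E_def by blast
    then show ?thesis
    proof cases
      case 1 then show ?thesis using cD e by auto
    next
      case 2
      have eg: "e g \<in> lhomeo T T" "?D g \<subseteq> dom (e g)" using e[OF 2(1)] lh by auto
      have "compactin (subtopology T (dom (e g))) (?D g)"
        using cD[OF 2(1)] eg by (simp add: compactin_subtopology)
      moreover have "continuous_map (subtopology T (dom (e g))) T (\<lambda>x. the (e g x))"
        using eg(1) unfolding lhomeo_iff_homeomorphic_map
        by (meson continuous_map_in_subtopology homeomorphic_imp_continuous_map)
      ultimately have "compactin T ((\<lambda>x. the (e g x)) ` ?D g)" by (rule image_compactin)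
      moreover have "(\<lambda>x. the (e g x)) ` ?D g = D" using eg 2 by (force simp: image_iff)
      moreover have "D \<subseteq> dom h" using 2 by (auto simp: minv_Some_iff[OF eg(1)] dom_def)
      ultimately show ?thesis using 2 pg_minv[OF pg] e by auto
    next
      case 3 then show ?thesis using U pg_id[OF pg] closure_of_subset_topspace by fastforce
    qed
  qed
  have EH: "snd ` E \<subseteq> H" using cE by force
  have sym: "\<exists>(D', h') \<in> E. the (h x) \<in> D' \<and> (\<forall>\<^sub>F z in nhdsin T (the (h x)). h' z = minv h z)"
    if Dh: "(D, h) \<in> E" and x: "x \<in> D" for D h x
  proof -
    consider g where "g \<in> G" "D = ?D g" "h = e g"
      | g where "g \<in> G" "D = {y. \<exists>x\<in>?D g. e g x = Some y}" "h = minv (e g)"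
      | "D = T closure_of U" "h = ?i"
      using Dh unfolding E_def by blast
    then show ?thesis
    proof cases
      case 1
      have "({y. \<exists>x\<in>?D g. e g x = Some y}, minv (e g)) \<in> E" using 1 E_def by blast
      moreover have "the (h x) \<in> {y. \<exists>x\<in>?D g. e g x = Some y}"
        using cE[OF Dh] x 1 by (auto simp: dom_def intro!: bexI[of _ x])
      ultimately show ?thesis using 1 by (intro bexI[of _ "({y. \<exists>x\<in>?D g. e g x = Some y}, minv (e g))"]) auto
    next
      case 2
      have eg: "e g \<in> lhomeo T T" using e[OF 2(1)] lh by auto
      have "(?D g, e g) \<in> E" using 2 E_def by blast
      moreover have "the (h x) \<in> ?D g"
        using x 2 by (auto simp: minv_Some_iff[OF eg, THEN iffD2])
      moreover have "minv h = e g" using 2 minv_minv[OF eg] by simp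
      ultimately show ?thesis by (intro bexI[of _ "(?D g, e g)"]) auto
    next
      case 3
      have "minv ?i = ?i"
        by (rule map_eqI) (auto simp: minv_Some_iff[OF lhomeo_id[OF openin_topspace]] restrict_map_Some_iff)
      moreover have "the (h x) = x" using 3 x closure_of_subset_topspace by fastforce
      ultimately show ?thesis using 3 x Dh by (intro bexI[of _ "(D, h)"]) auto
    qed
  qed
  let ?TU = "subtopology T U"
  let ?R = "\<lambda>x h. \<exists>k. germ_word E x k \<and> (\<forall>\<^sub>F z in nhdsin T x. k z = h z)"
  have domTU: "x \<in> U" if "h \<in> lhomeo ?TU ?TU" "h x = Some y" for h x y
    using lhomeo_in_topspace[OF that] by simp
  have TUD: "h \<in> lhomeo T T" if "h \<in> lhomeo ?TU ?TU" for h
    using that lhomeo_open_subtopology[OF U(1)] by blast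
  \<comment> \<open>Maps represented by words at all their points form a pseudogroup on
    \<open>U\<close>; it contains the generators, hence the whole restricted pseudogroup.\<close>
  have "pseudogroup ?TU {h \<in> lhomeo ?TU ?TU. \<forall>x\<in>dom h. ?R x h}"
  proof (rule pseudogroup_germ_closed)
    fix x and h k :: "'a \<rightharpoonup> 'a"
    assume h: "h \<in> lhomeo ?TU ?TU" and x: "x \<in> dom h" and hk: "\<forall>\<^sub>F z in nhdsin ?TU x. h z = k z"
      and R: "?R x h"
    have "x \<in> U" using domTU h x by blast
    then have hk': "\<forall>\<^sub>F z in nhdsin T x. h z = k z" using hk nhdsin_open_subtopology[OF U(1)] by blast
    obtain w where w: "germ_word E x w" "\<forall>\<^sub>F z in nhdsin T x. w z = h z" using R by blast
    then show "?R x k" using hk' by (intro exI[of _ w]) (auto elim: eventually_elim2)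
  next
    fix x assume x: "x \<in> topspace ?TU"
    then have xU: "x \<in> U" by simp
    then have "x \<in> T closure_of U" using closure_of_subset[OF UT] by blast
    then have "germ_word E x ?i" by (intro germ_word.base[of "T closure_of U"]) (auto simp: E_def)
    moreover have "\<forall>\<^sub>F z in nhdsin T x. z \<in> U" using xU U by (auto intro: eventually_nhdsin_in)
    then have "\<forall>\<^sub>F z in nhdsin T x. ?i z = (Some |` topspace ?TU) z"
      by eventually_elim (use UT in auto)
    ultimately show "?R x (Some |` topspace ?TU)" by blast
  next
    fix x y h k assume h: "h \<in> lhomeo ?TU ?TU" "k \<in> lhomeo ?TU ?TU" "h x = Some y"
      and R: "?R x h" "?R y k"
    obtain w v where w: "germ_word E x w" "\<forall>\<^sub>F z in nhdsin T x. w z = h z"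
      and v: "germ_word E y v" "\<forall>\<^sub>F z in nhdsin T y. v z = k z" using R by blast
    have wl: "w \<in> lhomeo T T" using lh germ_word_in_pseudogroup[OF pg EH w(1)] by blast
    have "x \<in> topspace T" using h TUD lhomeo_in_topspace by metis
    then have wx: "w x = Some y" using eventually_nhdsin_self[OF w(2)] h by simp
    show "?R x (k \<circ>\<^sub>m h)"
      using germ_word_trans[OF v(1) w(1) wx] eventually_map_comp_cong[OF wl wx w(2) v(2)] by blast
  next
    fix x y h assume h: "h \<in> lhomeo ?TU ?TU" "h x = Some y" and R: "?R x h"
    obtain w where w: "germ_word E x w" "\<forall>\<^sub>F z in nhdsin T x. w z = h z" using R by blast
    have wl: "w \<in> lhomeo T T" using lh germ_word_in_pseudogroup[OF pg EH w(1)] by blast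
    have "x \<in> topspace T" using h TUD lhomeo_in_topspace by metis
    then have wx: "w x = Some y" using eventually_nhdsin_self[OF w(2)] h by simp
    have "\<exists>v. germ_word E y v \<and> (\<forall>\<^sub>F z in nhdsin T y. v z = minv w z)"
      by (rule germ_word_minv[OF pg EH _ _ w(1) wx]) (use cE in blast, erule (1) sym)
    then obtain v where v: "germ_word E y v" "\<forall>\<^sub>F z in nhdsin T y. v z = minv w z" by blast
    moreover have "\<forall>\<^sub>F z in nhdsin T y. minv w z = minv h z"
      by (rule eventually_minv_cong[OF wl wx TUD[OF h(1)] w(2)])
    ultimately show "?R y (minv h)" by (intro exI[of _ v]) (auto elim: eventually_elim2)
  qed
  moreover have "G \<subseteq> {h \<in> lhomeo ?TU ?TU. \<forall>x\<in>dom h. ?R x h}"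
  proof clarify
    fix g assume g: "g \<in> G"
    then have gl: "g \<in> lhomeo T T" "dom g \<union> ran g \<subseteq> U"
      using G(2) lh by (auto simp: restricted_pseudogroup_def)
    have "?R x g" if x: "x \<in> dom g" for x
    proof -
      have "x \<in> ?D g" using x gl UT closure_of_subset[of "dom g" T] by auto
      then have "germ_word E x (e g)" using g by (intro germ_word.base[of "?D g"]) (auto simp: E_def)
      moreover have "\<forall>\<^sub>F z in nhdsin T x. z \<in> dom g"
        using x gl by (auto intro: eventually_nhdsin_in lhomeo_openin_dom)
      then have "\<forall>\<^sub>F z in nhdsin T x. e g z = g z"
        by eventually_elim (metis e g restrict_in)
      ultimately show ?thesis by blast
    qed
    then show "g \<in> lhomeo ?TU ?TU \<and> (\<forall>x\<in>dom g. ?R x g)"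
      using gl lhomeo_open_subtopology[OF U(1)] by blast
  qed
  ultimately have sub: "restricted_pseudogroup H U \<subseteq> {h \<in> lhomeo ?TU ?TU. \<forall>x\<in>dom h. ?R x h}"
    using generated_pseudogroup_minimal[of G _ ?TU] G(3) by blast
  show thesis
  proof (rule that, safe del: subsetI)
    show "finite E" using G(1) by (simp add: E_def)
    show "compactin T D" "D \<subseteq> dom h" "h \<in> H" if "(D, h) \<in> E" for D h using cE[OF that] by auto
    fix h x y assume h: "h \<in> H" and x: "x \<in> U" "h x = Some y" "y \<in> U"
    \<comment> \<open>Cutting \<open>h\<close> down to the points of \<open>U\<close> with image in
      \<open>U\<close> puts it into the restricted pseudogroup and keeps its germ at
      \<open>x\<close>.\<close>
    let ?W = "{x. \<exists>y\<in>U. h x = Some y} \<inter> U"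
    have W: "openin T ?W" using lhomeo_openin_preimage[OF lh[OF h] U(1)] U(1) by blast
    have "h |` ?W \<in> H" using pg_restrict[OF pg h W] .
    then have "h |` ?W \<in> restricted_pseudogroup H U"
      by (auto simp: restricted_pseudogroup_def ran_def restrict_map_Some_iff)
    moreover have xW: "x \<in> ?W" using x by blast
    ultimately have "?R x (h |` ?W)" using sub x(2) by (force simp: restrict_map_Some_iff)
    then obtain k where k: "germ_word E x k" "\<forall>\<^sub>F z in nhdsin T x. k z = (h |` ?W) z" by blast
    have "\<forall>\<^sub>F z in nhdsin T x. z \<in> ?W" using W xW by (rule eventually_nhdsin_in)
    with k(2) have "\<forall>\<^sub>F z in nhdsin T x. k z = h z" by eventually_elim auto
    then show "?R x h" using k(1) by blast
  qed
qed

section \<open>Quasi-locally equal covers\<close>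

lemma openin_mtopology_of:
  "openin (mtopology_of m) G \<longleftrightarrow> G \<subseteq> mspace m \<and> (\<forall>x\<in>G. \<exists>r>0. mball_of m x r \<subseteq> G)"
  using Metric_space.openin_mtopology[OF Metric_space_mspace_mdist[of m]]
  by (auto simp: mtopology_of_def mball_of_def)

lemma mdist_self [simp]: "x \<in> mspace m \<Longrightarrow> mdist m x x = 0"
  by simp

text \<open>The balls of all the metrics together generate the topology of \<open>T\<close>. That a
  single metric already gives the subspace topology is due to the comparison modulus: an
  \<open>m1\<close>-ball containing a point of \<open>mspace m\<close> contains an
  \<open>m\<close>-ball around that point.\<close>

lemma quasi_locally_equal_cover_openin:
  assumes C: "quasi_locally_equal_cover T C" and m: "m \<in> C"
  shows "openin (mtopology_of m) G \<longleftrightarrow> openin T G \<and> G \<subseteq> mspace m"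
proof -
  have opT: "openin T G \<longleftrightarrow> (\<forall>x\<in>G. \<exists>m\<in>C. \<exists>y\<in>mspace m. \<exists>r>0. x \<in> mball_of m y r \<and> mball_of m y r \<subseteq> G)" for G
  proof -
    have "openin T G \<longleftrightarrow> (arbitrary union_of
       (\<lambda>B. \<exists>m\<in>C. \<exists>x\<in>mspace m. \<exists>r>0. B = mball_of m x r)) G"
      using C unfolding quasi_locally_equal_cover_def by (metis (no_types, lifting))
    then show ?thesis unfolding arbitrary_union_of_alt by blast
  qed
  show ?thesis
  proof
    assume G: "openin (mtopology_of m) G"
    then have sub: "G \<subseteq> mspace m" by (simp add: openin_mtopology_of)
    have "openin T G"
      unfolding opT
    proof
      fix x assume x: "x \<in> G"
      then obtain r where "r > 0" "mball_of m x r \<subseteq> G" using G unfolding openin_mtopology_of by blast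
      then show "\<exists>m\<in>C. \<exists>y\<in>mspace m. \<exists>r>0. x \<in> mball_of m y r \<and> mball_of m y r \<subseteq> G"
        using m x sub by (intro bexI[of _ m] bexI[of _ x] exI[of _ r] conjI) (auto intro: subsetD)
    qed
    with sub show "openin T G \<and> G \<subseteq> mspace m" by simp
  next
    assume G: "openin T G \<and> G \<subseteq> mspace m"
    have "\<exists>\<delta>::real \<Rightarrow> real. (\<forall>\<epsilon>>0. \<delta> \<epsilon> > 0) \<and>
        (\<forall>m\<in>C. \<forall>m'\<in>C. \<forall>z \<in> mspace m \<inter> mspace m'.
           \<exists>V. openin (mtopology_of m) V \<and> z \<in> V \<and> V \<subseteq> mspace m \<inter> mspace m' \<and>
               (\<forall>\<epsilon>>0. \<forall>x\<in>V. \<forall>y\<in>V. mdist m x y < \<delta> \<epsilon> \<longrightarrow> mdist m' x y < \<epsilon>))"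
      by (rule C[unfolded quasi_locally_equal_cover_def, THEN conjunct2, THEN conjunct2, THEN conjunct1])
    then obtain \<delta> :: "real \<Rightarrow> real" where d: "(\<forall>\<epsilon>>0. \<delta> \<epsilon> > 0) \<and>
        (\<forall>m\<in>C. \<forall>m'\<in>C. \<forall>z \<in> mspace m \<inter> mspace m'.
           \<exists>V. openin (mtopology_of m) V \<and> z \<in> V \<and> V \<subseteq> mspace m \<inter> mspace m' \<and>
               (\<forall>\<epsilon>>0. \<forall>x\<in>V. \<forall>y\<in>V. mdist m x y < \<delta> \<epsilon> \<longrightarrow> mdist m' x y < \<epsilon>))"
      by (rule exE)
    note \<delta> = conjunct1[OF d] and qle = conjunct2[OF d]
    show "openin (mtopology_of m) G"
      unfolding openin_mtopology_of
    proof (intro conjI ballI)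
      fix x assume x: "x \<in> G"
      then obtain m1 a r where m1: "m1 \<in> C" "a \<in> mspace m1" "r > 0" "x \<in> mball_of m1 a r" "mball_of m1 a r \<subseteq> G"
        using bspec[OF opT[THEN iffD1, OF conjunct1[OF G]] x] by (elim bexE exE conjE)
      have xm: "x \<in> mspace m \<inter> mspace m1" using m1 x G by auto
      obtain V where V: "openin (mtopology_of m) V" "x \<in> V" "V \<subseteq> mspace m \<inter> mspace m1"
        and Vd: "\<forall>\<epsilon>>0. \<forall>x\<in>V. \<forall>y\<in>V. mdist m x y < \<delta> \<epsilon> \<longrightarrow> mdist m1 x y < \<epsilon>"
        using qle[rule_format, OF m m1(1) xm] by (elim exE conjE)
      obtain s where s: "s > 0" "mball_of m x s \<subseteq> V" using V unfolding openin_mtopology_of by blast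
      \<comment> \<open>The room left around \<open>x\<close> inside the \<open>m1\<close>-ball. The
        modulus at this value and the radius \<open>s\<close> of a ball inside \<open>V\<close> give
        the required \<open>m\<close>-ball.\<close>
      define e where "e = r - mdist m1 a x"
      have e: "e > 0" using m1 by (simp add: e_def)
      have "mball_of m x (min s (\<delta> e)) \<subseteq> mball_of m1 a r"
      proof
        fix y assume y: "y \<in> mball_of m x (min s (\<delta> e))"
        then have yV: "y \<in> V" using s by auto
        then have "mdist m1 x y < e" using Vd e V(2) y by auto
        moreover have "mdist m1 a y \<le> mdist m1 a x + mdist m1 x y"
          using m1 xm yV V(3) by (auto intro: mdist_triangle)
        ultimately show "y \<in> mball_of m1 a r" using m1 yV V(3) by (auto simp: e_def)
      qed
      then show "\<exists>r>0. mball_of m x r \<subseteq> G"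
        using s(1) \<delta>[rule_format, OF e] m1(5) by (intro exI[of _ "min s (\<delta> e)"]) auto
    qed (use G in auto)
  qed
qed

lemma finite_common_radius:
  assumes "finite P" "\<And>p. p \<in> P \<Longrightarrow> \<exists>r>0. Q p r"
    "\<And>p r r'. p \<in> P \<Longrightarrow> Q p r \<Longrightarrow> r' \<le> r \<Longrightarrow> Q p r'"
  shows "\<exists>r>0::real. \<forall>p\<in>P. Q p r"
  using assms
proof (induction P)
  case empty
  show ?case by (intro exI[of _ 1]) simp
next
  case (insert p P)
  then obtain r where r: "r > 0" "\<forall>p\<in>P. Q p r" by blast
  obtain r' where r': "r' > 0" "Q p r'" using insert.prems by blast
  have "\<forall>q\<in>insert p P. Q q (min r r')"
    using r(2) insert.prems(2)[of _ r "min r r'"] insert.prems(2)[OF insertI1 r'(2), of "min r r'"]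
    by auto
  then show ?case using r r' by (intro exI[of _ "min r r'"]) simp
qed

lemma finite_common_nbhd:
  assumes "finite P" "x \<in> topspace T" "\<And>p. p \<in> P \<Longrightarrow> \<exists>V. openin T V \<and> x \<in> V \<and> Q p V"
    "\<And>p V W. p \<in> P \<Longrightarrow> Q p V \<Longrightarrow> openin T W \<Longrightarrow> W \<subseteq> V \<Longrightarrow> Q p W"
  shows "\<exists>V. openin T V \<and> x \<in> V \<and> (\<forall>p\<in>P. Q p V)"
  using assms
proof (induction P)
  case empty
  then show ?case by (intro exI[of _ "topspace T"]) simp
next
  case (insert p P)
  then obtain V where V: "openin T V" "x \<in> V" "\<forall>p\<in>P. Q p V" by blast
  obtain W where W: "openin T W" "x \<in> W" "Q p W" using insert.prems(2)[of p] by auto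
  have "openin T (V \<inter> W)" using V W by blast
  then have "\<forall>q\<in>insert p P. Q q (V \<inter> W)"
    using V(3) W(3) insert.prems(3)[of _ V "V \<inter> W"] insert.prems(3)[of p W "V \<inter> W"] by auto
  then show ?case using V W by (intro exI[of _ "V \<inter> W"]) auto
qed

section \<open>Uniform domains of holonomy maps\<close>

text \<open>The map \<open>f\<close> read in the chart \<phi> at its source and \<psi> at its
  target. With a restriction of the identity for \<open>f\<close> it is a change of chart; with
  \<tau> and \<tau>0 for the charts it is the conjugation defining the homeomorphism.\<close>

definition transport :: "('a \<rightharpoonup> 'b) \<Rightarrow> ('a \<rightharpoonup> 'a) \<Rightarrow> ('a \<rightharpoonup> 'b) \<Rightarrow> ('b \<rightharpoonup> 'b)" where
  "transport \<psi> f \<phi> = \<psi> \<circ>\<^sub>m (f \<circ>\<^sub>m minv \<phi>)"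

lemma transport_Some_iff:
  assumes "\<phi> \<in> lhomeo T T'"
  shows "transport \<psi> f \<phi> a = Some b \<longleftrightarrow> (\<exists>x y. \<phi> x = Some a \<and> f x = Some y \<and> \<psi> y = Some b)"
  using minv_Some_iff[OF assms] by (auto simp: transport_def map_comp_Some_iff)

text \<open>In the composite the chart \<psi> is applied and then undone; as it is defined on the
  whole range of \<open>f\<close>, this cuts off nothing.\<close>

lemma transport_comp:
  assumes "\<phi> \<in> lhomeo T T'" "\<psi> \<in> lhomeo T T'" "ran f \<subseteq> dom \<psi>"
  shows "transport \<theta> g \<psi> \<circ>\<^sub>m transport \<psi> f \<phi> = transport \<theta> (g \<circ>\<^sub>m f) \<phi>"
proof (rule map_eqI)
  fix a b
  have "(transport \<theta> g \<psi> \<circ>\<^sub>m transport \<psi> f \<phi>) a = Some b \<longleftrightarrow>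
    (\<exists>c x y y' z. \<phi> x = Some a \<and> f x = Some y \<and> \<psi> y = Some c \<and> \<psi> y' = Some c \<and> g y' = Some z \<and> \<theta> z = Some b)"
    unfolding map_comp_Some_iff transport_Some_iff[OF assms(1)] transport_Some_iff[OF assms(2)] by blast
  also have "\<dots> \<longleftrightarrow> (\<exists>x y z. \<phi> x = Some a \<and> f x = Some y \<and> g y = Some z \<and> \<theta> z = Some b)"
  proof
    assume "\<exists>x y z. \<phi> x = Some a \<and> f x = Some y \<and> g y = Some z \<and> \<theta> z = Some b"
    then obtain x y z where *: "\<phi> x = Some a" "f x = Some y" "g y = Some z" "\<theta> z = Some b" by blast
    moreover obtain c where "\<psi> y = Some c" using assms(3) * by (auto simp: ran_def)
    ultimately show "\<exists>c x y y' z. \<phi> x = Some a \<and> f x = Some y \<and> \<psi> y = Some c \<and> \<psi> y' = Some c \<and> g y' = Some z \<and> \<theta> z = Some b"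
      by blast
  next
    assume "\<exists>c x y y' z. \<phi> x = Some a \<and> f x = Some y \<and> \<psi> y = Some c \<and> \<psi> y' = Some c \<and> g y' = Some z \<and> \<theta> z = Some b"
    then obtain c x y y' z where *: "\<phi> x = Some a" "f x = Some y" "\<psi> y = Some c" "\<psi> y' = Some c"
      "g y' = Some z" "\<theta> z = Some b" by blast
    moreover have "y = y'" using lhomeo_inj[OF assms(2)] *(3,4) .
    ultimately show "\<exists>x y z. \<phi> x = Some a \<and> f x = Some y \<and> g y = Some z \<and> \<theta> z = Some b" by blast
  qed
  also have "\<dots> \<longleftrightarrow> transport \<theta> (g \<circ>\<^sub>m f) \<phi> a = Some b"
    by (auto simp: map_comp_Some_iff transport_Some_iff[OF assms(1)])
  finally show "(transport \<theta> g \<psi> \<circ>\<^sub>m transport \<psi> f \<phi>) a = Some b \<longleftrightarrow> transport \<theta> (g \<circ>\<^sub>m f) \<phi> a = Some b" .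
qed

lemma transport_restrict:
  assumes "\<phi> \<in> lhomeo T T'"
  shows "transport \<psi> (f |` V) \<phi> = transport \<psi> f \<phi> |` {b. \<exists>x\<in>V. \<phi> x = Some b}"
  by (rule map_eqI) (use lhomeo_inj[OF assms] in
      \<open>auto simp: restrict_map_Some_iff transport_Some_iff[OF assms]\<close>)

section \<open>Equicontinuous strongly quasi-analytic pseudogroups\<close>

locale eqc_pseudogroup =
  fixes T :: "'t topology" and H S :: "('t \<rightharpoonup> 't) set" and U :: "'t set" and C :: "'t metric set"
  assumes haus: "Hausdorff_space T"
    and loc_compact: "locally_compact_space T"
    and comp_gen: "compactly_generated_with T H U"
    and lps: "local_pseudostar_group T S"
    and eqc: "equicontinuous_with T H S C"
    and sqa: "strongly_quasi_analytic_with T H S"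
    and cov: "x \<in> topspace T \<Longrightarrow> \<exists>f\<in>S. x \<in> dom f"
begin

lemma pg: "pseudogroup T H"
proof -
  have "S \<subseteq> lhomeo T T" using lps_lhomeo[OF lps] by blast
  then have "pseudogroup T (generated_pseudogroup T S)" by (rule pseudogroup_generated)
  then show ?thesis using sqa by (simp add: strongly_quasi_analytic_with_def)
qed

lemmas H_lhomeo = pg_lhomeo[OF pg] and H_comp = pg_comp[OF pg] and H_minv = pg_minv[OF pg]
  and H_id = pg_id[OF pg] and H_restrict = pg_restrict[OF pg] and H_localI = pg_localI[OF pg]
  and S_lhomeo = lps_lhomeo[OF lps] and S_comp = lps_comp[OF lps] and S_minv = lps_minv[OF lps]
  and S_restrict = lps_restrict[OF lps]

lemma S_gen: "generated_pseudogroup T S = H"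
  using sqa by (simp add: strongly_quasi_analytic_with_def)

lemma S_sub_H: "S \<subseteq> H"
  using sqa by (simp add: strongly_quasi_analytic_with_def)

text \<open>This is where the covering assumption \<open>cov\<close> enters: a generated pseudogroup
  contains the identity even at points outside all domains of \<open>S\<close>.\<close>

lemma H_locally_S:
  assumes "h \<in> H" "x \<in> dom h"
  obtains G where "openin T G" "x \<in> G" "G \<subseteq> dom h" "h |` G \<in> S"
  using generated_locally_restrict[OF lps cov S_gen assms] by blast

lemma restrict_subset_S: "h |` G \<in> S \<Longrightarrow> openin T V \<Longrightarrow> V \<subseteq> G \<Longrightarrow> h |` V \<in> S"
  using S_restrict[of "h |` G" V] by (simp add: Int_absorb1)

lemma S_identity:
  assumes "h \<in> S" "h x = Some x" "\<forall>\<^sub>F z in nhdsin T x. h z = Some z" "h z = Some w"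
  shows "w = z"
proof -
  have xT: "x \<in> topspace T" using lhomeo_in_topspace(1)[OF S_lhomeo[OF assms(1)] assms(2)] .
  obtain W where "openin T W" "x \<in> W" "\<And>z. z \<in> W \<Longrightarrow> h z = Some z"
    using eventually_nhdsinD[OF assms(3) xT] by blast
  then have "\<exists>W. openin T W \<and> W \<noteq> {} \<and> W \<subseteq> dom h \<and> (\<forall>x\<in>W. h x = Some x)" by blast
  then have "\<forall>x\<in>dom h. h x = Some x"
    using sqa assms(1) unfolding strongly_quasi_analytic_with_def by blast
  then show ?thesis using assms(4) by (metis domI option.inject)
qed

lemma cover: "quasi_locally_equal_cover T C"
  using eqc by (simp add: equicontinuous_with_def)

lemma cover_mspace:
  assumes "m \<in> C" shows "openin T (mspace m)"
  using quasi_locally_equal_cover_openin[OF cover assms, of "mspace m"]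
  by (metis openin_topspace topspace_mtopology_of)

lemma cover_obtains:
  assumes "x \<in> topspace T" obtains m where "m \<in> C" "x \<in> mspace m"
  using cover assms unfolding quasi_locally_equal_cover_def by blast

lemma equicontinuity:
  assumes "\<epsilon> > 0"
  obtains \<delta> where "\<delta> > 0" "\<And>h m m' x y x' y'. h \<in> S \<Longrightarrow> m \<in> C \<Longrightarrow> m' \<in> C \<Longrightarrow> x \<in> mspace m \<Longrightarrow>
     y \<in> mspace m \<Longrightarrow> h x = Some x' \<Longrightarrow> h y = Some y' \<Longrightarrow> x' \<in> mspace m' \<Longrightarrow> y' \<in> mspace m' \<Longrightarrow>
     mdist m x y < \<delta> \<Longrightarrow> mdist m' x' y' < \<epsilon>"
  using eqc assms unfolding equicontinuous_with_def by meson

lemma compact_nbhd: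
  assumes "openin T W" "x \<in> W"
  obtains V K where "openin T V" "compactin T K" "x \<in> V" "V \<subseteq> K" "K \<subseteq> W"
proof -
  have "neighbourhood_base_of (compactin T) T"
    using locally_compact_Hausdorff_imp_regular_space[OF loc_compact haus] haus loc_compact
      locally_compact_space_neighbourhood_base by blast
  then show ?thesis using assms that unfolding neighbourhood_base_of by meson
qed

text \<open>On \<open>mspace m\<close> the metric topology is the subspace topology, so the Lebesgue
  number lemma applies to open sets of \<open>T\<close>. That \<open>P\<close> passes to smaller
  open sets allows the cover to be cut down to \<open>mspace m\<close>.\<close>

lemma lebesgue_radius:
  assumes m: "m \<in> C" and K: "compactin T K" "K \<subseteq> mspace m"
    and cov: "\<And>x. x \<in> K \<Longrightarrow> \<exists>G. openin T G \<and> x \<in> G \<and> P G"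
    and mono: "\<And>G G'. P G \<Longrightarrow> openin T G' \<Longrightarrow> G' \<subseteq> G \<Longrightarrow> P G'"
  obtains r where "r > 0" "\<And>x. x \<in> K \<Longrightarrow> \<exists>G. openin T G \<and> P G \<and> mball_of m x r \<subseteq> G"
proof -
  have op: "openin (mtopology_of m) G \<longleftrightarrow> openin T G \<and> G \<subseteq> mspace m" for G
    using quasi_locally_equal_cover_openin[OF cover m] .
  have sub: "mtopology_of m = subtopology T (mspace m)"
    by (rule topology_eq[THEN iffD2]) (simp add: op openin_open_subtopology[OF cover_mspace[OF m]])
  have cK: "compactin (mtopology_of m) K"
    using K by (simp add: sub compactin_subtopology)
  let ?\<C> = "{G. openin (mtopology_of m) G \<and> P G}"
  have "K \<subseteq> \<Union>?\<C>"
  proof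
    fix x assume x: "x \<in> K"
    then obtain G where G: "openin T G" "x \<in> G" "P G" using cov by blast
    have "openin T (G \<inter> mspace m)" using G cover_mspace[OF m] by blast
    then show "x \<in> \<Union>?\<C>" using G x K(2) mono[OF G(3), of "G \<inter> mspace m"] op by blast
  qed
  then have "\<exists>r>0. \<forall>x\<in>K. \<exists>G\<in>?\<C>. mball_of m x r \<subseteq> G"
    unfolding mball_of_def using cK
    by (intro Metric_space.lebesgue_number[OF Metric_space_mspace_mdist]) (auto simp: mtopology_of_def)
  then obtain r where "r > 0" "\<forall>x\<in>K. \<exists>G\<in>?\<C>. mball_of m x r \<subseteq> G" by blast
  then show ?thesis using that[of r] op by blast
qed

end

text \<open>An equivalence of pseudogroups presented in one direction: the charts in \<Phi> cover
  \<open>T\<close> and conjugate \<open>H\<close> into \<open>H'\<close>. The other direction is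
  obtained later as a second instance with the two sides exchanged.\<close>

locale pseudogroup_equivalence = A: eqc_pseudogroup T H S U C + B: eqc_pseudogroup T' H' S' U' C'
  for T :: "'t topology" and H S U C and T' :: "'s topology" and H' S' U' C' +
  fixes \<Phi> :: "('t \<rightharpoonup> 's) set"
  assumes Phi_lhomeo: "\<phi> \<in> \<Phi> \<Longrightarrow> \<phi> \<in> lhomeo T T'"
    and Phi_cov: "x \<in> topspace T \<Longrightarrow> \<exists>\<phi>\<in>\<Phi>. x \<in> dom \<phi>"
    and Phi_comp: "\<phi> \<in> \<Phi> \<Longrightarrow> h \<in> H \<Longrightarrow> \<phi> \<circ>\<^sub>m h \<in> \<Phi>"
    and Phi_conj: "\<phi> \<in> \<Phi> \<Longrightarrow> \<psi> \<in> \<Phi> \<Longrightarrow> h \<in> H \<Longrightarrow> transport \<psi> h \<phi> \<in> H'"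
begin

lemma transport_restrict_S':
  assumes "transport \<psi> (f |` G) \<phi> \<in> S'" "\<phi> \<in> \<Phi>" "openin T V" "V \<subseteq> G"
  shows "transport \<psi> (f |` V) \<phi> \<in> S'"
proof -
  have "f |` V = (f |` G) |` V" using assms(4) by (simp add: Int_absorb1)
  then show ?thesis
    using B.S_restrict[OF assms(1) lhomeo_openin_image[OF Phi_lhomeo[OF assms(2)] assms(3)]]
      transport_restrict[OF Phi_lhomeo[OF assms(2)]] by metis
qed

lemma transport_locally_S':
  assumes h: "h \<in> H" and \<phi>: "\<phi> \<in> \<Phi>" "x \<in> dom \<phi>" and x: "h x = Some y" and \<psi>: "\<psi> \<in> \<Phi>" "y \<in> dom \<psi>"
  obtains G where "openin T G" "x \<in> G" "G \<subseteq> dom \<phi>" "transport \<psi> (h |` G) \<phi> \<in> S'"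
proof -
  obtain a b where ab: "\<phi> x = Some a" "\<psi> y = Some b" using \<phi> \<psi> by blast
  have "transport \<psi> h \<phi> \<in> H'" using Phi_conj \<phi> \<psi> h by blast
  moreover have "a \<in> dom (transport \<psi> h \<phi>)"
    using ab x transport_Some_iff[OF Phi_lhomeo[OF \<phi>(1)]] by blast
  ultimately obtain W where W: "openin T' W" "a \<in> W" "transport \<psi> h \<phi> |` W \<in> S'"
    using B.H_locally_S by metis
  let ?G = "{x. \<exists>a\<in>W. \<phi> x = Some a}"
  have G: "openin T ?G" using lhomeo_openin_preimage[OF Phi_lhomeo[OF \<phi>(1)] W(1)] .
  have "transport \<psi> (h |` ?G) \<phi> = transport \<psi> h \<phi> |` {b. \<exists>x\<in>?G. \<phi> x = Some b}"
    by (rule transport_restrict[OF Phi_lhomeo[OF \<phi>(1)]])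
  also have "\<dots> = transport \<psi> h \<phi> |` W |` {b. \<exists>x\<in>?G. \<phi> x = Some b}"
    by (auto intro!: arg_cong2[of _ _ _ _ restrict_map])
  also have "\<dots> \<in> S'"
    by (rule B.S_restrict[OF W(3) lhomeo_openin_image[OF Phi_lhomeo[OF \<phi>(1)] G]])
  finally show ?thesis using that[of ?G] G W ab by auto
qed

text \<open>A letter cut down until it can be used on both sides, with range in one metric space and
  one chart. Words apply it only on the compact core \<open>L\<close>; the margin between
  \<open>L\<close> and the domain of \<open>s\<close> is what allows composites to be
  extended.\<close>

definition piece :: "('t \<rightharpoonup> 't) \<times> 't set \<times> 't metric \<times> ('t \<rightharpoonup> 's) \<times> ('t \<rightharpoonup> 's) \<Rightarrow> bool" where
  "piece = (\<lambda>(s, L, m, \<phi>, \<psi>). s \<in> S \<and> compactin T L \<and> L \<subseteq> dom s \<and> m \<in> C \<and> ran s \<subseteq> mspace m \<and>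
     \<phi> \<in> \<Phi> \<and> \<psi> \<in> \<Phi> \<and> dom s \<subseteq> dom \<phi> \<and> ran s \<subseteq> dom \<psi> \<and> transport \<psi> s \<phi> \<in> S')"

lemma pieceD:
  assumes "piece (s, L, m, \<phi>, \<psi>)"
  shows "s \<in> S" "compactin T L" "L \<subseteq> dom s" "m \<in> C" "ran s \<subseteq> mspace m"
    "\<phi> \<in> \<Phi>" "\<psi> \<in> \<Phi>" "dom s \<subseteq> dom \<phi>" "ran s \<subseteq> dom \<psi>" "transport \<psi> s \<phi> \<in> S'"
  using assms by (auto simp: piece_def)

lemma piece_exists:
  assumes h: "h \<in> H" and x: "x \<in> dom h"
  shows "\<exists>s L m \<phi> \<psi> G. piece (s, L, m, \<phi>, \<psi>) \<and> s = h |` dom s \<and> openin T G \<and> x \<in> G \<and> G \<subseteq> L"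
proof -
  obtain y where y: "h x = Some y" using x by blast
  have hl: "h \<in> lhomeo T T" using A.H_lhomeo h by blast
  have T: "x \<in> topspace T" "y \<in> topspace T" using lhomeo_in_topspace[OF hl y] by auto
  obtain \<phi> where \<phi>: "\<phi> \<in> \<Phi>" "x \<in> dom \<phi>" using Phi_cov T by blast
  obtain \<psi> where \<psi>: "\<psi> \<in> \<Phi>" "y \<in> dom \<psi>" using Phi_cov T by blast
  obtain m where m: "m \<in> C" "y \<in> mspace m" using A.cover_obtains T by blast
  obtain G1 where G1: "openin T G1" "x \<in> G1" "G1 \<subseteq> dom h" "h |` G1 \<in> S" using A.H_locally_S[OF h x] by blast
  obtain G2 where G2: "openin T G2" "x \<in> G2" "G2 \<subseteq> dom \<phi>" "transport \<psi> (h |` G2) \<phi> \<in> S'"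
    using transport_locally_S'[OF h \<phi> y \<psi>] by blast
  let ?G3 = "{x. \<exists>y\<in>mspace m \<inter> dom \<psi>. h x = Some y}"
  have "openin T (mspace m \<inter> dom \<psi>)"
    using A.cover_mspace[OF m(1)] lhomeo_openin_dom[OF Phi_lhomeo[OF \<psi>(1)]] by blast
  then have G3: "openin T ?G3" by (rule lhomeo_openin_preimage[OF hl])
  \<comment> \<open>On \<open>?W\<close> all requirements hold at once: \<open>h\<close> is in
    \<open>S\<close>, its conjugate is in \<open>S'\<close>, and the image stays in one metric space
    and one chart. The compact neighbourhood inside it becomes the core.\<close>
  let ?W = "G1 \<inter> G2 \<inter> ?G3"
  have W: "openin T ?W" using G1 G2 G3 by blast
  moreover have xW: "x \<in> ?W" using G1 G2 y m \<psi> by blast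
  ultimately obtain V K where VK: "openin T V" "compactin T K" "x \<in> V" "V \<subseteq> K" "K \<subseteq> ?W"
    by (rule A.compact_nbhd)
  have "piece (h |` ?W, K, m, \<phi>, \<psi>)"
    unfolding piece_def prod.case
  proof (intro conjI)
    show "h |` ?W \<in> S" by (rule A.restrict_subset_S[OF G1(4) W]) blast
    show "K \<subseteq> dom (h |` ?W)" using VK(5) G1(3) by auto
    show "ran (h |` ?W) \<subseteq> mspace m" "ran (h |` ?W) \<subseteq> dom \<psi>"
      by (auto simp: ran_def restrict_map_Some_iff)
    show "dom (h |` ?W) \<subseteq> dom \<phi>" using G2(3) by auto
    show "transport \<psi> (h |` ?W) \<phi> \<in> S'" by (rule transport_restrict_S'[OF G2(4) \<phi>(1) W]) blast
  qed (use VK m \<phi> \<psi> in auto)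
  moreover have "h |` ?W = h |` dom (h |` ?W)"
    by (rule map_eqI) (auto simp: restrict_map_Some_iff)
  ultimately show ?thesis using VK by blast
qed

lemma finite_pieces:
  assumes h: "h \<in> H" and D: "compactin T D" "D \<subseteq> dom h"
  shows "\<exists>P. finite P \<and> (\<forall>(s, L, m, \<phi>, \<psi>)\<in>P. piece (s, L, m, \<phi>, \<psi>) \<and> s = h |` dom s) \<and>
     (\<forall>x\<in>D. \<exists>(s, L, m, \<phi>, \<psi>)\<in>P. x \<in> L)"
proof -
  let ?Q = "\<lambda>G p. case p of (s, L, m, \<phi>, \<psi>) \<Rightarrow> piece (s, L, m, \<phi>, \<psi>) \<and> s = h |` dom s \<and> G \<subseteq> L"
  let ?\<G> = "{G. openin T G \<and> (\<exists>p. ?Q G p)}"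
  have "D \<subseteq> \<Union>?\<G>"
  proof
    fix x assume "x \<in> D"
    then have "x \<in> dom h" using D(2) by blast
    from piece_exists[OF h this] obtain s L m \<phi> \<psi> G
      where *: "piece (s, L, m, \<phi>, \<psi>) \<and> s = h |` dom s \<and> openin T G \<and> x \<in> G \<and> G \<subseteq> L"
      by (elim exE)
    then have "?Q G (s, L, m, \<phi>, \<psi>)" by simp
    then show "x \<in> \<Union>?\<G>" using * by (intro UnionI[of G]) (blast, simp)
  qed
  then obtain \<F> where F: "finite \<F>" "\<F> \<subseteq> ?\<G>" "D \<subseteq> \<Union>\<F>"
    using compactinD[OF D(1), of ?\<G>] by blast
  have "\<forall>G\<in>\<F>. \<exists>p. ?Q G p" using F(2) by blast
  from bchoice[OF this] obtain p where p: "\<forall>G\<in>\<F>. ?Q G (p G)" by blast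
  show ?thesis
  proof (intro exI[of _ "p ` \<F>"] conjI ballI)
    fix q assume "q \<in> p ` \<F>"
    then obtain G where "G \<in> \<F>" "q = p G" by blast
    then show "case q of (s, L, m, \<phi>, \<psi>) \<Rightarrow> piece (s, L, m, \<phi>, \<psi>) \<and> s = h |` dom s"
      using bspec[OF p, of G] by (auto split: prod.splits)
  next
    fix x assume "x \<in> D"
    then obtain G where G: "G \<in> \<F>" "x \<in> G" using F by blast
    then have "case p G of (s, L, m, \<phi>, \<psi>) \<Rightarrow> x \<in> L" using bspec[OF p, of G] by (auto split: prod.splits)
    then show "\<exists>(s, L, m, \<phi>, \<psi>)\<in>p ` \<F>. x \<in> L" using G by (intro bexI[of _ "p G"]) auto
  qed (use F in auto)
qed

text \<open>The radius is the tolerance at the junction of two letters. The image of a small set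
  under a word ending in \<open>s\<close> lies in such a ball, so \<open>s2\<close> can follow on
  all of it, and the change from \<psi> to \<phi>2 keeps the conjugate in \<open>S'\<close>.\<close>

definition transition_ok ::
    "real \<Rightarrow> ('t \<rightharpoonup> 't) \<times> 't set \<times> 't metric \<times> ('t \<rightharpoonup> 's) \<times> ('t \<rightharpoonup> 's) \<Rightarrow>
     ('t \<rightharpoonup> 't) \<times> 't set \<times> 't metric \<times> ('t \<rightharpoonup> 's) \<times> ('t \<rightharpoonup> 's) \<Rightarrow> bool" where
  "transition_ok r = (\<lambda>(s, L, m, \<phi>, \<psi>) (s2, L2, m2, \<phi>2, \<psi>2).
     \<forall>y. y \<in> L2 \<and> (\<exists>x\<in>L. s x = Some y) \<longrightarrow> (\<exists>G. openin T G \<and> mball_of m y r \<subseteq> G \<and>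
        G \<subseteq> dom s2 \<and> G \<subseteq> ran s \<and> transport \<phi>2 (Some |` G) \<psi> \<in> S'))"

lemma image_compact:
  assumes s: "s \<in> lhomeo T T" and L: "compactin T L" "L \<subseteq> dom s"
  shows "compactin T {y. \<exists>x\<in>L. s x = Some y}"
proof -
  have "compactin (subtopology T (dom s)) L" using L by (simp add: compactin_subtopology)
  moreover have "continuous_map (subtopology T (dom s)) T (\<lambda>x. the (s x))"
    using s unfolding lhomeo_iff_homeomorphic_map
    by (meson continuous_map_in_subtopology homeomorphic_imp_continuous_map)
  ultimately have "compactin T ((\<lambda>x. the (s x)) ` L)" by (rule image_compactin)
  moreover have "(\<lambda>x. the (s x)) ` L = {y. \<exists>x\<in>L. s x = Some y}" using L(2) by (force simp: image_iff)
  ultimately show ?thesis by simp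
qed

text \<open>A change of chart is the conjugate of the identity, so it lies in \<open>H'\<close>, and
  locally in \<open>S'\<close>.\<close>

lemma id_locally_S':
  assumes x: "\<phi> \<in> \<Phi>" "x \<in> dom \<phi>" "\<psi> \<in> \<Phi>" "x \<in> dom \<psi>"
  obtains G where "openin T G" "x \<in> G" "G \<subseteq> dom \<phi>" "transport \<psi> (Some |` G) \<phi> \<in> S'"
proof -
  have xT: "x \<in> topspace T" using x(1,2) lhomeo_in_topspace(1)[OF Phi_lhomeo] by blast
  obtain G where G: "openin T G" "x \<in> G" "G \<subseteq> dom \<phi>" "transport \<psi> (Some |` topspace T |` G) \<phi> \<in> S'"
    using transport_locally_S'[OF A.H_id x(1,2) _ x(3,4)] xT by (metis restrict_in)
  moreover have "Some |` topspace T |` G = Some |` G"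
    using openin_subset[OF G(1)] by (simp add: Int_absorb1)
  ultimately show ?thesis using that by simp
qed

text \<open>The possible junction points form a compact set, the intersection of \<open>L2\<close>
  with the image of \<open>L\<close> under \<open>s\<close>. The requirements hold near each of
  them, and a Lebesgue number for the target metric of \<open>s\<close> makes them uniform.\<close>

lemma transition_ok_exists:
  assumes p: "piece (s, L, m, \<phi>, \<psi>)" and q: "piece (s2, L2, m2, \<phi>2, \<psi>2)"
  shows "\<exists>r>0. transition_ok r (s, L, m, \<phi>, \<psi>) (s2, L2, m2, \<phi>2, \<psi>2)"
proof -
  let ?sL = "{y. \<exists>x\<in>L. s x = Some y}"
  let ?P = "\<lambda>G. G \<subseteq> dom s2 \<and> G \<subseteq> ran s \<and> transport \<phi>2 (Some |` G) \<psi> \<in> S'"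
  have sl: "s \<in> lhomeo T T" "s2 \<in> lhomeo T T" using A.S_lhomeo pieceD(1)[OF p] pieceD(1)[OF q] by auto
  have "compactin T ?sL" using image_compact[OF sl(1)] pieceD[OF p] by blast
  then have K: "compactin T (L2 \<inter> ?sL)"
    using compactin_Int[OF A.haus pieceD(2)[OF q]] by blast
  have Km: "L2 \<inter> ?sL \<subseteq> mspace m" using pieceD(5)[OF p] by (auto simp: ran_def)
  obtain r where r: "r > 0" "\<And>x. x \<in> L2 \<inter> ?sL \<Longrightarrow> \<exists>G. openin T G \<and> ?P G \<and> mball_of m x r \<subseteq> G"
  proof (rule A.lebesgue_radius[OF pieceD(4)[OF p] K Km, of ?P])
    fix y assume y: "y \<in> L2 \<inter> ?sL"
    have d: "y \<in> dom \<phi>2" "y \<in> dom \<psi>" "y \<in> dom s2" "y \<in> ran s"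
      using y pieceD(3,8)[OF q] pieceD(9)[OF p] ranI[of s _ y] by blast+
    obtain G where G: "openin T G" "y \<in> G" "transport \<phi>2 (Some |` G) \<psi> \<in> S'"
      using id_locally_S'[OF pieceD(7)[OF p] d(2) pieceD(6)[OF q] d(1)] by blast
    let ?G = "G \<inter> dom s2 \<inter> ran s"
    have oG: "openin T ?G" using G(1) lhomeo_openin_dom[OF sl(2)] lhomeo_openin_ran[OF sl(1)] by blast
    have "transport \<phi>2 (Some |` ?G) \<psi> \<in> S'"
      by (rule transport_restrict_S'[OF G(3) pieceD(7)[OF p] oG]) blast
    then show "\<exists>G. openin T G \<and> y \<in> G \<and> ?P G" using oG d G by blast
  next
    fix G G' assume "?P G" "openin T G'" "G' \<subseteq> G"
    then show "?P G'" using transport_restrict_S'[OF _ pieceD(7)[OF p]] by blast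
  qed blast
  have "transition_ok r (s, L, m, \<phi>, \<psi>) (s2, L2, m2, \<phi>2, \<psi>2)"
    unfolding transition_ok_def prod.case
  proof (intro allI impI)
    fix y assume "y \<in> L2 \<and> (\<exists>x\<in>L. s x = Some y)"
    then obtain G where "openin T G \<and> ?P G \<and> mball_of m y r \<subseteq> G" using r(2)[of y] by auto
    then show "\<exists>G. openin T G \<and> mball_of m y r \<subseteq> G \<and>
        G \<subseteq> dom s2 \<and> G \<subseteq> ran s \<and> transport \<phi>2 (Some |` G) \<psi> \<in> S'"
      by (intro exI[of _ G]) simp
  qed
  then show ?thesis using r(1) by (intro exI[of _ r]) simp
qed

text \<open>A neighbourhood \<open>V\<close> is good for a finite set of pieces if every composite of pieces
  that is defined at one point of \<open>V\<close> is defined on all of \<open>V\<close>, and if moreover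
  these composites, read in the charts of the other space, belong to \<open>S'\<close>.\<close>

definition good ::
    "(('t \<rightharpoonup> 't) \<times> 't set \<times> 't metric \<times> ('t \<rightharpoonup> 's) \<times> ('t \<rightharpoonup> 's)) set \<Rightarrow> real \<Rightarrow>
     ('t \<rightharpoonup> 's) \<Rightarrow> 't set \<Rightarrow> bool" where
  "good P \<delta> \<phi> V \<longleftrightarrow> V \<subseteq> dom \<phi> \<and> (\<exists>m\<in>C. V \<subseteq> mspace m \<and> (\<forall>z\<in>V. \<forall>z'\<in>V. mdist m z z' < \<delta>)) \<and>
     (\<forall>(s, L, m, \<theta>, \<psi>)\<in>P.
        (V \<inter> L = {} \<or> (V \<subseteq> dom s \<and> transport \<theta> (Some |` V) \<phi> \<in> S')) \<and>
        (V \<inter> {y. \<exists>x\<in>L. s x = Some y} = {} \<or> (V \<subseteq> ran s \<and> transport \<phi> (Some |` V) \<psi> \<in> S')))"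

lemma good_mono:
  assumes "good P \<delta> \<phi> V" "openin T W" "W \<subseteq> V" "\<phi> \<in> \<Phi>" "\<And>p. p \<in> P \<Longrightarrow> piece p"
  shows "good P \<delta> \<phi> W"
  unfolding good_def
proof (intro conjI ballI)
  show "W \<subseteq> dom \<phi>" using assms by (auto simp: good_def)
  show "\<exists>m\<in>C. W \<subseteq> mspace m \<and> (\<forall>z\<in>W. \<forall>z'\<in>W. mdist m z z' < \<delta>)"
    using assms(1,3) unfolding good_def by (meson subset_iff)
  fix p assume p: "p \<in> P"
  obtain s L m \<theta> \<psi> where [simp]: "p = (s, L, m, \<theta>, \<psi>)" by (cases p) auto
  have pc: "piece (s, L, m, \<theta>, \<psi>)" using assms(5)[OF p] by simp
  have *: "(V \<inter> L = {} \<or> (V \<subseteq> dom s \<and> transport \<theta> (Some |` V) \<phi> \<in> S')) \<and>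
        (V \<inter> {y. \<exists>x\<in>L. s x = Some y} = {} \<or> (V \<subseteq> ran s \<and> transport \<phi> (Some |` V) \<psi> \<in> S'))"
    using bspec[OF conjunct2[OF conjunct2[OF assms(1)[unfolded good_def]]] p] by (simp only: \<open>p = _\<close> prod.case)
  have 1: "transport \<theta> (Some |` W) \<phi> \<in> S'" if "transport \<theta> (Some |` V) \<phi> \<in> S'"
    using transport_restrict_S'[OF that assms(4,2,3)] .
  have 2: "transport \<phi> (Some |` W) \<psi> \<in> S'" if "transport \<phi> (Some |` V) \<psi> \<in> S'"
    using transport_restrict_S'[OF that pieceD(7)[OF pc] assms(2,3)] .
  show "case p of (s, L, m, \<theta>, \<psi>) \<Rightarrow>
        (W \<inter> L = {} \<or> (W \<subseteq> dom s \<and> transport \<theta> (Some |` W) \<phi> \<in> S')) \<and>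
        (W \<inter> {y. \<exists>x\<in>L. s x = Some y} = {} \<or> (W \<subseteq> ran s \<and> transport \<phi> (Some |` W) \<psi> \<in> S'))"
    unfolding \<open>p = _\<close> prod.case
  proof (intro conjI)
    show "W \<inter> L = {} \<or> (W \<subseteq> dom s \<and> transport \<theta> (Some |` W) \<phi> \<in> S')"
      using conjunct1[OF *] 1 assms(3) by blast
    show "W \<inter> {y. \<exists>x\<in>L. s x = Some y} = {} \<or> (W \<subseteq> ran s \<and> transport \<phi> (Some |` W) \<psi> \<in> S')"
      using conjunct2[OF *] 2 assms(3) by blast
  qed
qed

text \<open>A core \<open>L\<close> and its image are compact, hence closed: a point outside has a
  neighbourhood missing them, and at a point inside the change of chart lies in \<open>S'\<close> on
  some neighbourhood. With finitely many pieces the intersection stays open.\<close>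

lemma good_exists:
  assumes P: "finite P" "\<And>p. p \<in> P \<Longrightarrow> piece p" and \<delta>: "\<delta> > 0" and \<phi>: "\<phi> \<in> \<Phi>" "x \<in> dom \<phi>"
  shows "\<exists>V. openin T V \<and> x \<in> V \<and> good P \<delta> \<phi> V"
proof -
  have xT: "x \<in> topspace T" using \<phi> lhomeo_in_topspace(1)[OF Phi_lhomeo] by blast
  obtain m where m: "m \<in> C" "x \<in> mspace m" using A.cover_obtains[OF xT] by blast
  \<comment> \<open>Half of \<delta> as radius, so that any two points of the ball are at distance
    less than \<delta>.\<close>
  let ?B = "mball_of m x (\<delta> / 2)"
  have "openin (mtopology_of m) ?B"
    by (simp add: mball_of_def mtopology_of_def Metric_space.openin_mball Metric_space_mspace_mdist)
  then have B: "openin T ?B" using quasi_locally_equal_cover_openin[OF A.cover m(1)] by blast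
  have Bd: "mdist m z z' < \<delta>" if "z \<in> ?B" "z' \<in> ?B" for z z'
  proof -
    have "mdist m z z' \<le> mdist m x z + mdist m x z'"
      using that mdist_triangle[of z m x z'] by (simp add: mdist_commute)
    then show ?thesis using that by simp
  qed
  let ?W0 = "?B \<inter> dom \<phi>"
  have W0: "openin T ?W0" "x \<in> ?W0"
    using B \<phi>(2) m(2) \<delta> lhomeo_openin_dom[OF Phi_lhomeo[OF \<phi>(1)]] by auto
  \<comment> \<open>With no pieces, \<open>good\<close> retains only the chart and diameter
    conditions, which are settled first.\<close>
  have gW0: "good {} \<delta> \<phi> ?W0"
    using m Bd unfolding good_def by (intro conjI bexI[of _ m]) auto
  have "\<exists>V. openin T V \<and> x \<in> V \<and> (\<forall>p\<in>P. good {p} \<delta> \<phi> V)"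
  proof (rule finite_common_nbhd[OF P(1) xT])
    fix p assume p: "p \<in> P"
    obtain s L n \<theta> \<psi> where [simp]: "p = (s, L, n, \<theta>, \<psi>)" by (cases p) auto
    have pc: "piece (s, L, n, \<theta>, \<psi>)" using P(2)[OF p] by simp
    let ?sL = "{y. \<exists>x\<in>L. s x = Some y}"
    have sl: "s \<in> lhomeo T T" using A.S_lhomeo pieceD(1)[OF pc] by auto
    have cl: "closedin T L" "closedin T ?sL"
      using image_compact[OF sl pieceD(2,3)[OF pc]] pieceD(2)[OF pc] compactin_imp_closedin[OF A.haus] by auto
    have "\<exists>V. openin T V \<and> x \<in> V \<and> (V \<inter> L = {} \<or> (V \<subseteq> dom s \<and> transport \<theta> (Some |` V) \<phi> \<in> S'))"
    proof (cases "x \<in> L")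
      case True
      then have "x \<in> dom \<theta>" "x \<in> dom s" using pieceD(3,8)[OF pc] by blast+
      then obtain G where G: "openin T G" "x \<in> G" "transport \<theta> (Some |` G) \<phi> \<in> S'"
        using id_locally_S'[OF \<phi> pieceD(6)[OF pc]] by blast
      have o: "openin T (G \<inter> dom s)" using G lhomeo_openin_dom[OF sl] by blast
      have "transport \<theta> (Some |` (G \<inter> dom s)) \<phi> \<in> S'"
        by (rule transport_restrict_S'[OF G(3) \<phi>(1) o]) blast
      then show ?thesis using o G \<open>x \<in> dom s\<close> by blast
    next
      case False
      then show ?thesis using cl(1) xT by (intro exI[of _ "topspace T - L"]) auto
    qed
    then obtain V1 where V1: "openin T V1" "x \<in> V1"
      "V1 \<inter> L = {} \<or> (V1 \<subseteq> dom s \<and> transport \<theta> (Some |` V1) \<phi> \<in> S')" by blast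
    have "\<exists>V. openin T V \<and> x \<in> V \<and> (V \<inter> ?sL = {} \<or> (V \<subseteq> ran s \<and> transport \<phi> (Some |` V) \<psi> \<in> S'))"
    proof (cases "x \<in> ?sL")
      case True
      then have d: "x \<in> dom \<psi>" "x \<in> ran s" using pieceD(9)[OF pc] ranI[of s _ x] by blast+
      then obtain G where G: "openin T G" "x \<in> G" "transport \<phi> (Some |` G) \<psi> \<in> S'"
        using id_locally_S'[OF pieceD(7)[OF pc] d(1) \<phi>] by blast
      have o: "openin T (G \<inter> ran s)" using G lhomeo_openin_ran[OF sl] by blast
      have "transport \<phi> (Some |` (G \<inter> ran s)) \<psi> \<in> S'"
        by (rule transport_restrict_S'[OF G(3) pieceD(7)[OF pc] o]) blast
      then show ?thesis using o G d(2) by blast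
    next
      case False
      then show ?thesis using cl(2) xT by (intro exI[of _ "topspace T - ?sL"]) auto
    qed
    then obtain V2 where V2: "openin T V2" "x \<in> V2"
      "V2 \<inter> ?sL = {} \<or> (V2 \<subseteq> ran s \<and> transport \<phi> (Some |` V2) \<psi> \<in> S')" by blast
    let ?V = "?W0 \<inter> V1 \<inter> V2"
    have oV: "openin T ?V" using V1 V2 W0 by blast
    have 1: "transport \<theta> (Some |` ?V) \<phi> \<in> S'" if "transport \<theta> (Some |` V1) \<phi> \<in> S'"
      by (rule transport_restrict_S'[OF that \<phi>(1) oV]) blast
    have 2: "transport \<phi> (Some |` ?V) \<psi> \<in> S'" if "transport \<phi> (Some |` V2) \<psi> \<in> S'"
      by (rule transport_restrict_S'[OF that pieceD(7)[OF pc] oV]) blast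
    have "good {} \<delta> \<phi> ?V" by (rule good_mono[OF gW0 oV]) (use \<phi> in auto)
    moreover have "?V \<inter> L = {} \<or> (?V \<subseteq> dom s \<and> transport \<theta> (Some |` ?V) \<phi> \<in> S')"
      using V1(3) 1 by blast
    moreover have "?V \<inter> ?sL = {} \<or> (?V \<subseteq> ran s \<and> transport \<phi> (Some |` ?V) \<psi> \<in> S')"
      using V2(3) 2 by blast
    ultimately have "good {p} \<delta> \<phi> ?V" unfolding good_def by simp
    then show "\<exists>V. openin T V \<and> x \<in> V \<and> good {p} \<delta> \<phi> V" using oV V1 V2 W0 by blast
  next
    fix p V W assume "p \<in> P" "good {p} \<delta> \<phi> V" "openin T W" "W \<subseteq> V"
    then show "good {p} \<delta> \<phi> W" using good_mono[of "{p}"] P(2) \<phi>(1) by blast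
  qed
  then obtain V where V: "openin T V" "x \<in> V" "\<forall>p\<in>P. good {p} \<delta> \<phi> V" by blast
  let ?V = "V \<inter> ?W0"
  have oV: "openin T ?V" using V W0 by blast
  have gp: "good {p} \<delta> \<phi> ?V" if "p \<in> P" for p
    by (rule good_mono[OF V(3)[rule_format, OF that] oV]) (use P(2) that \<phi> in auto)
  have g0: "good {} \<delta> \<phi> ?V" by (rule good_mono[OF gW0 oV]) (use \<phi> in auto)
  have "good P \<delta> \<phi> ?V"
    unfolding good_def
  proof (intro conjI ballI)
    show "?V \<subseteq> dom \<phi>" using g0 by (simp add: good_def)
    show "\<exists>m\<in>C. ?V \<subseteq> mspace m \<and> (\<forall>z\<in>?V. \<forall>z'\<in>?V. mdist m z z' < \<delta>)"
      using conjunct1[OF conjunct2[OF g0[unfolded good_def]]] .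
    fix p assume "p \<in> P"
    from bspec[OF conjunct2[OF conjunct2[OF gp[OF this, unfolded good_def]]] singletonI]
    show "case p of (s, L, m, \<theta>, \<psi>) \<Rightarrow>
        (?V \<inter> L = {} \<or> (?V \<subseteq> dom s \<and> transport \<theta> (Some |` ?V) \<phi> \<in> S')) \<and>
        (?V \<inter> {y. \<exists>x\<in>L. s x = Some y} = {} \<or> (?V \<subseteq> ran s \<and> transport \<phi> (Some |` ?V) \<psi> \<in> S'))" .
  qed
  then show ?thesis using oV V W0 by blast
qed

end

lemma map_comp_Some_restrict: "f \<circ>\<^sub>m (Some |` V) = f |` V"
  by (rule map_eqI) (auto simp: map_comp_Some_iff restrict_map_Some_iff)

lemma Some_restrict_map_comp: "ran f \<subseteq> G \<Longrightarrow> (Some |` G) \<circ>\<^sub>m f = f"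
  by (rule map_eqI) (auto simp: map_comp_Some_iff restrict_map_Some_iff ran_def)

section \<open>Extension of words to uniform neighbourhoods\<close>

context pseudogroup_equivalence
begin

text \<open>Induction on the word, keeping the whole of \<open>V\<close> as domain at every step.
  The composite \<open>w\<close> is itself in \<open>S\<close>, so equicontinuity keeps the image of
  \<open>V\<close> inside the \<open>r\<close>-ball of the next junction point, whatever the length
  of the word. The piece in the conclusion is the last one applied; its target chart \<psi> is the
  one in which \<open>w\<close> is read.\<close>

lemma word_extension:
  fixes P and E :: "('t set \<times> ('t \<rightharpoonup> 't)) set"
  assumes EH: "snd ` E \<subseteq> H"
    and P: "\<And>p. p \<in> P \<Longrightarrow> piece p"
    and Pcov: "\<And>D h x. (D, h) \<in> E \<Longrightarrow> x \<in> D \<Longrightarrow>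
      \<exists>s L m \<theta> \<psi>. (s, L, m, \<theta>, \<psi>) \<in> P \<and> x \<in> L \<and> s = h |` dom s"
    and trans: "\<And>p q. p \<in> P \<Longrightarrow> q \<in> P \<Longrightarrow> transition_ok r p q"
    and \<delta>: "\<And>h m m' x y x' y'. h \<in> S \<Longrightarrow> m \<in> C \<Longrightarrow> m' \<in> C \<Longrightarrow> x \<in> mspace m \<Longrightarrow>
     y \<in> mspace m \<Longrightarrow> h x = Some x' \<Longrightarrow> h y = Some y' \<Longrightarrow> x' \<in> mspace m' \<Longrightarrow> y' \<in> mspace m' \<Longrightarrow>
     mdist m x y < \<delta> \<Longrightarrow> mdist m' x' y' < r"
    and V: "good P \<delta> \<phi> V" "openin T V" "\<phi> \<in> \<Phi>" "x \<in> V"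
    and word: "germ_word E x k"
  shows "\<exists>w s L m \<theta> \<psi>. w \<in> S \<and> (s, L, m, \<theta>, \<psi>) \<in> P \<and> dom w = V \<and>
     (\<forall>\<^sub>F z in nhdsin T x. w z = k z) \<and> (\<exists>a\<in>L. s a = w x) \<and> ran w \<subseteq> ran s \<and> transport \<psi> w \<phi> \<in> S'"
  using word
proof induction
  case (base D h)
  obtain s L m \<theta> \<psi> where p: "(s, L, m, \<theta>, \<psi>) \<in> P" "x \<in> L" "s = h |` dom s"
    using Pcov[OF base] by blast
  note pc = pieceD[OF P[OF p(1)]]
  have sl: "s \<in> lhomeo T T" using A.S_lhomeo[OF pc(1)] .
  have "(V \<inter> L = {} \<or> (V \<subseteq> dom s \<and> transport \<theta> (Some |` V) \<phi> \<in> S'))"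
    using bspec[OF conjunct2[OF conjunct2[OF V(1)[unfolded good_def]]] p(1)] unfolding prod.case by (rule conjunct1)
  then have Vs: "V \<subseteq> dom s" "transport \<theta> (Some |` V) \<phi> \<in> S'" using V(4) p(2) by blast+
  have "s |` V \<in> S" by (rule A.S_restrict[OF pc(1) V(2)])
  moreover have "dom (s |` V) = V" using Vs(1) by auto
  moreover have "\<forall>\<^sub>F z in nhdsin T x. (s |` V) z = h z"
  proof -
    have "\<forall>\<^sub>F z in nhdsin T x. z \<in> V" using V by (intro eventually_nhdsin_in)
    then show ?thesis
    proof eventually_elim
      case (elim z)
      then have "s z = h z" using Vs(1) p(3) by (metis restrict_in subsetD)
      then show ?case using elim by simp
    qed
  qed
  moreover have "\<exists>a\<in>L. s a = (s |` V) x" using p(2) V(4) by (intro bexI[of _ x]) simp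
  moreover have "ran (s |` V) \<subseteq> ran s" by (auto simp: ran_def restrict_map_Some_iff)
  moreover have "transport \<psi> (s |` V) \<phi> \<in> S'"
  proof -
    have "ran (Some |` V) \<subseteq> dom \<theta>" using Vs(1) pc(8) by (auto simp: ran_def restrict_map_Some_iff)
    then have "transport \<psi> s \<theta> \<circ>\<^sub>m transport \<theta> (Some |` V) \<phi> = transport \<psi> (s \<circ>\<^sub>m (Some |` V)) \<phi>"
      by (intro transport_comp[OF Phi_lhomeo[OF V(3)] Phi_lhomeo[OF pc(6)]])
    then show ?thesis using B.S_comp[OF Vs(2) pc(10)] by (simp add: map_comp_Some_restrict)
  qed
  ultimately show ?case using p(1) by (intro exI conjI)
next
  case (step k y D h)
  obtain w s L m \<theta> \<psi> where w: "w \<in> S" and p: "(s, L, m, \<theta>, \<psi>) \<in> P" and dw: "dom w = V"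
    and wk: "\<forall>\<^sub>F z in nhdsin T x. w z = k z" and a: "\<exists>a\<in>L. s a = w x" and rw: "ran w \<subseteq> ran s"
    and tw: "transport \<psi> w \<phi> \<in> S'"
    using step.IH by (elim exE conjE)
  have xT: "x \<in> topspace T" using V openin_subset by blast
  have wx: "w x = Some y" using eventually_nhdsin_self[OF wk xT] step.hyps(2) by simp
  obtain s2 L2 m2 \<theta>2 \<psi>2 where q: "(s2, L2, m2, \<theta>2, \<psi>2) \<in> P" "y \<in> L2" "s2 = h |` dom s2"
    using Pcov[OF step.hyps(3,4)] by blast
  note pc = pieceD[OF P[OF p]] and qc = pieceD[OF P[OF q(1)]]
  have wl: "w \<in> lhomeo T T" using A.S_lhomeo[OF w] .
  have s2l: "s2 \<in> lhomeo T T" using A.S_lhomeo[OF qc(1)] .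
  have yL: "y \<in> L2 \<and> (\<exists>a\<in>L. s a = Some y)" using a wx q(2) by simp
  obtain G where G: "openin T G" "mball_of m y r \<subseteq> G" "G \<subseteq> dom s2" "G \<subseteq> ran s"
      "transport \<theta>2 (Some |` G) \<psi> \<in> S'"
    using mp[OF spec[OF trans[OF p q(1), unfolded transition_ok_def prod.case]] yL] by (elim exE conjE)
  have rG: "ran w \<subseteq> G"
  proof
    fix z' assume z': "z' \<in> ran w"
    then obtain z where z: "w z = Some z'" by (auto simp: ran_def)
    have zV: "z \<in> V" using z dw by blast
    obtain m0 where m0: "m0 \<in> C" "V \<subseteq> mspace m0" "\<forall>z\<in>V. \<forall>z'\<in>V. mdist m0 z z' < \<delta>"
      using V(1) unfolding good_def by (elim conjE bexE)
    have ym: "y \<in> mspace m" "z' \<in> mspace m"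
      using rw pc(5) z' wx ranI[of w] by blast+
    have "mdist m y z' < r"
      using \<delta>[OF w m0(1) pc(4) _ _ wx z ym] m0 V(4) zV by blast
    then show "z' \<in> G" using G(2) ym by (simp add: subset_iff)
  qed
  have s2w: "s2 \<circ>\<^sub>m w \<in> S" by (rule A.S_comp[OF w qc(1)])
  moreover have "dom (s2 \<circ>\<^sub>m w) = V"
  proof
    show "dom (s2 \<circ>\<^sub>m w) \<subseteq> V" using dw by (auto simp: map_comp_Some_iff)
    show "V \<subseteq> dom (s2 \<circ>\<^sub>m w)"
    proof
      fix z assume "z \<in> V"
      then obtain z' where z': "w z = Some z'" using dw by blast
      then have "z' \<in> dom s2" using rG G(3) ranI[of w] by blast
      then show "z \<in> dom (s2 \<circ>\<^sub>m w)" using z' by auto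
    qed
  qed
  moreover have "\<forall>\<^sub>F z in nhdsin T x. (s2 \<circ>\<^sub>m w) z = (h \<circ>\<^sub>m k) z"
  proof (rule eventually_map_comp_cong[OF wl wx wk])
    have "y \<in> dom s2" using q(2) qc(3) by blast
    then have "\<forall>\<^sub>F z in nhdsin T y. z \<in> dom s2" by (intro eventually_nhdsin_in lhomeo_openin_dom[OF s2l])
    then show "\<forall>\<^sub>F z in nhdsin T y. s2 z = h z"
      by eventually_elim (metis q(3) restrict_in)
  qed
  moreover have "\<exists>a\<in>L2. s2 a = (s2 \<circ>\<^sub>m w) x" using q(2) wx by (intro bexI[of _ y]) auto
  moreover have "ran (s2 \<circ>\<^sub>m w) \<subseteq> ran s2" by (auto simp: ran_def map_comp_Some_iff)
  \<comment> \<open>The conjugate of the longer word is assembled from three elements of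
    \<open>S'\<close>: the conjugate of \<open>w\<close>, the change of chart at the junction, and
    the conjugate of \<open>s2\<close>.\<close>
  moreover have "transport \<psi>2 (s2 \<circ>\<^sub>m w) \<phi> \<in> S'"
  proof -
    have "transport \<theta>2 (Some |` G) \<psi> \<circ>\<^sub>m transport \<psi> w \<phi> = transport \<theta>2 ((Some |` G) \<circ>\<^sub>m w) \<phi>"
      using rw pc(9) by (intro transport_comp[OF Phi_lhomeo[OF V(3)] Phi_lhomeo[OF pc(7)]]) blast
    then have "transport \<theta>2 w \<phi> \<in> S'"
      using B.S_comp[OF tw G(5)] by (simp add: Some_restrict_map_comp[OF rG])
    moreover have "transport \<psi>2 s2 \<theta>2 \<circ>\<^sub>m transport \<theta>2 w \<phi> = transport \<psi>2 (s2 \<circ>\<^sub>m w) \<phi>"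
      using rG G(3) qc(8) by (intro transport_comp[OF Phi_lhomeo[OF V(3)] Phi_lhomeo[OF qc(6)]]) blast
    ultimately show ?thesis using B.S_comp qc(10) by metis
  qed
  ultimately show ?case using q(1) by (intro exI conjI)
qed

text \<open>The order of quantifiers is the point: \<open>V0\<close> and \<open>W0\<close> are fixed
  before \<open>f\<close>. Mapping a compact set containing \<open>V\<close> into \<open>W0\<close>
  is an open condition on \<open>f\<close> in the compact-open topology, so the conclusion is
  available for all approximants of a limit at once.\<close>

definition uniform_transport :: "'t \<Rightarrow> 't \<Rightarrow> ('t \<rightharpoonup> 's) \<Rightarrow> ('t \<rightharpoonup> 's) \<Rightarrow> 't set \<Rightarrow> 't set \<Rightarrow> bool" where
  "uniform_transport x y \<phi> \<psi> V0 W0 \<longleftrightarrow> openin T V0 \<and> x \<in> V0 \<and> V0 \<subseteq> dom \<phi> \<and>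
     openin T W0 \<and> y \<in> W0 \<and> W0 \<subseteq> dom \<psi> \<and>
     (\<forall>f\<in>S. \<forall>V. openin T V \<and> x \<in> V \<and> V \<subseteq> V0 \<and> V \<subseteq> dom f \<and> (\<forall>z\<in>V. the (f z) \<in> W0) \<longrightarrow>
        transport \<psi> (f |` V) \<phi> \<in> S')"

text \<open>A map \<open>f \<in> S\<close> has near \<open>x\<close> the germ of a word in the generators, which
  extends to a uniform neighbourhood by equicontinuity; the extension agrees with \<open>f\<close> there by
  strong quasi-analyticity, applied to the composites with the extension of the inverse word.\<close>

lemma uniform_transport_in_U:
  assumes xy: "x \<in> U" "y \<in> U" and \<phi>: "\<phi> \<in> \<Phi>" "x \<in> dom \<phi>" and \<psi>: "\<psi> \<in> \<Phi>" "y \<in> dom \<psi>"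
  shows "\<exists>V0 W0. uniform_transport x y \<phi> \<psi> V0 W0"
proof -
  obtain E where "finite E" "\<forall>D h. (D, h) \<in> E \<longrightarrow> compactin T D \<and> D \<subseteq> dom h \<and> h \<in> H"
    "\<forall>h x y. h \<in> H \<longrightarrow> x \<in> U \<longrightarrow> h x = Some y \<longrightarrow> y \<in> U \<longrightarrow>
       (\<exists>k. germ_word E x k \<and> (\<forall>\<^sub>F z in nhdsin T x. k z = h z))"
    by (rule compactly_generated_words[OF A.pg A.haus A.comp_gen])
  note E = this(1) this(2)[rule_format] and words = this(3)[rule_format]
  have EH: "snd ` E \<subseteq> H" using E(2) by force
  have "\<forall>e\<in>E. \<exists>P. finite P \<and> (\<forall>p\<in>P. piece p) \<and>
      (\<forall>x\<in>fst e. \<exists>s L m \<theta> \<psi>. (s, L, m, \<theta>, \<psi>) \<in> P \<and> x \<in> L \<and> s = snd e |` dom s)"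
  proof
    fix e assume "e \<in> E"
    then have "compactin T (fst e) \<and> fst e \<subseteq> dom (snd e) \<and> snd e \<in> H" using E(2)[of "fst e" "snd e"] by simp
    then obtain P where P: "finite P" "\<forall>(s, L, m, \<phi>, \<psi>)\<in>P. piece (s, L, m, \<phi>, \<psi>) \<and> s = snd e |` dom s"
       "\<forall>x\<in>fst e. \<exists>(s, L, m, \<phi>, \<psi>)\<in>P. x \<in> L"
      using finite_pieces[of "snd e" "fst e"] by (elim conjE) blast
    have "\<forall>p\<in>P. piece p" using P(2) by (auto split: prod.splits)
    moreover have "\<exists>s L m \<theta> \<psi>. (s, L, m, \<theta>, \<psi>) \<in> P \<and> x \<in> L \<and> s = snd e |` dom s" if x: "x \<in> fst e" for x
    proof -
      obtain s L m \<theta> \<psi> where p: "(s, L, m, \<theta>, \<psi>) \<in> P" "x \<in> L" using bspec[OF P(3) x] by auto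
      moreover have "s = snd e |` dom s" using bspec[OF P(2) p(1)] by auto
      ultimately show ?thesis by (intro exI conjI)
    qed
    ultimately show "\<exists>P. finite P \<and> (\<forall>p\<in>P. piece p) \<and>
      (\<forall>x\<in>fst e. \<exists>s L m \<theta> \<psi>. (s, L, m, \<theta>, \<psi>) \<in> P \<and> x \<in> L \<and> s = snd e |` dom s)"
      using P(1) by (intro exI[of _ P] conjI ballI) auto
  qed
  from bchoice[OF this] obtain PP where PP: "\<forall>e\<in>E. finite (PP e) \<and> (\<forall>p\<in>PP e. piece p) \<and>
      (\<forall>x\<in>fst e. \<exists>s L m \<theta> \<psi>. (s, L, m, \<theta>, \<psi>) \<in> PP e \<and> x \<in> L \<and> s = snd e |` dom s)"
    by (elim exE)
  define P where "P = (\<Union>e\<in>E. PP e)"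
  have P: "finite P" "\<And>p. p \<in> P \<Longrightarrow> piece p"
    using PP E(1) by (auto simp: P_def)
  have Pcov: "\<exists>s L m \<theta> \<psi>. (s, L, m, \<theta>, \<psi>) \<in> P \<and> x \<in> L \<and> s = h |` dom s"
    if "(D, h) \<in> E" "x \<in> D" for D h x
  proof -
    have "\<exists>s L m \<theta> \<psi>. (s, L, m, \<theta>, \<psi>) \<in> PP (D, h) \<and> x \<in> L \<and> s = h |` dom s"
      using bspec[OF conjunct2[OF conjunct2[OF bspec[OF PP that(1)]]], of x] that(2) by simp
    then obtain s L m \<theta> \<psi> where "(s, L, m, \<theta>, \<psi>) \<in> PP (D, h)" "x \<in> L" "s = h |` dom s" by (elim exE conjE)
    then show ?thesis using that(1) unfolding P_def by (intro exI conjI UN_I)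
  qed
  have "\<exists>r>0. \<forall>pq\<in>P \<times> P. transition_ok r (fst pq) (snd pq)"
  proof (rule finite_common_radius)
    show "finite (P \<times> P)" using P(1) by simp
    fix pq assume "pq \<in> P \<times> P"
    then have "piece (fst pq)" "piece (snd pq)" using P(2) by auto
    then show "\<exists>r>0. transition_ok r (fst pq) (snd pq)"
      using transition_ok_exists by (cases "fst pq"; cases "snd pq") auto
  next
    fix pq r r' assume *: "transition_ok r (fst pq) (snd pq)" "r' \<le> r"
    have mb: "mball_of m y r' \<subseteq> mball_of m y r" for m :: "'t metric" and y using *(2) by auto
    show "transition_ok r' (fst pq) (snd pq)"
    proof (cases "fst pq"; cases "snd pq")
      fix s L m \<theta> \<psi> s2 L2 m2 \<theta>2 \<psi>2
      assume pq: "fst pq = (s, L, m, \<theta>, \<psi>)" "snd pq = (s2, L2, m2, \<theta>2, \<psi>2)"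
      show ?thesis
        using *(1) unfolding pq transition_ok_def prod.case
        by (meson mb subset_trans)
    qed
  qed
  then obtain r where r: "r > 0" "\<forall>pq\<in>P \<times> P. transition_ok r (fst pq) (snd pq)" by blast
  have trans: "transition_ok r p q" if "p \<in> P" "q \<in> P" for p q
    using bspec[OF r(2), of "(p, q)"] that by simp
  obtain \<delta> where \<delta>: "\<delta> > 0" "\<And>h m m' x y x' y'. h \<in> S \<Longrightarrow> m \<in> C \<Longrightarrow> m' \<in> C \<Longrightarrow> x \<in> mspace m \<Longrightarrow>
     y \<in> mspace m \<Longrightarrow> h x = Some x' \<Longrightarrow> h y = Some y' \<Longrightarrow> x' \<in> mspace m' \<Longrightarrow> y' \<in> mspace m' \<Longrightarrow>
     mdist m x y < \<delta> \<Longrightarrow> mdist m' x' y' < r"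
    using A.equicontinuity[OF r(1)] by metis
  have ext: "\<exists>w s L m \<theta> \<psi>. w \<in> S \<and> (s, L, m, \<theta>, \<psi>) \<in> P \<and> dom w = V \<and>
     (\<forall>\<^sub>F z in nhdsin T x. w z = k z) \<and> (\<exists>a\<in>L. s a = w x) \<and> ran w \<subseteq> ran s \<and> transport \<psi> w \<phi> \<in> S'"
    if "good P \<delta> \<phi> V" "openin T V" "\<phi> \<in> \<Phi>" "x \<in> V" "germ_word E x k" for \<phi> V x k
    by (rule word_extension[OF EH _ _ _ _ that]) (fact P(2) Pcov trans \<delta>(2))+
  have U: "openin T U" using A.comp_gen by (simp add: compactly_generated_with_def)
  obtain V0 where V0: "openin T V0" "x \<in> V0" "good P \<delta> \<phi> V0"
    using good_exists[OF P \<delta>(1) \<phi>] by blast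
  obtain W0 where W0: "openin T W0" "y \<in> W0" "good P \<delta> \<psi> W0"
    using good_exists[OF P \<delta>(1) \<psi>] by blast
  \<comment> \<open>Inside \<open>U\<close>, words represent both the germ of \<open>f\<close> at
    \<open>x\<close> and the germ of its inverse at the image point.\<close>
  let ?W = "W0 \<inter> U"
  have oW: "openin T ?W" using W0 U by blast
  have gW: "good P \<delta> \<psi> ?W" by (rule good_mono[OF W0(3) oW _ \<psi>(1) P(2)]) auto
  have "uniform_transport x y \<phi> \<psi> V0 ?W"
    unfolding uniform_transport_def
  proof (intro conjI ballI allI impI)
    show "V0 \<subseteq> dom \<phi>" using V0(3) by (simp add: good_def)
    show "?W \<subseteq> dom \<psi>" using gW by (simp add: good_def)
    fix f V assume f: "f \<in> S" and V: "openin T V \<and> x \<in> V \<and> V \<subseteq> V0 \<and> V \<subseteq> dom f \<and> (\<forall>z\<in>V. the (f z) \<in> ?W)"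
    have fl: "f \<in> lhomeo T T" using A.S_lhomeo[OF f] .
    have xV: "x \<in> V" and oV: "openin T V" using V by auto
    have gV: "good P \<delta> \<phi> V" by (rule good_mono[OF V0(3) oV _ \<phi>(1) P(2)]) (use V in auto)
    obtain y' where y': "f x = Some y'" using V by blast
    have y'W: "y' \<in> ?W" using V y' by force
    have fH: "f \<in> H" using f A.S_sub_H by blast
    obtain k where k: "germ_word E x k" "\<forall>\<^sub>F z in nhdsin T x. k z = f z"
      using words[OF fH xy(1) y'] y'W by blast
    obtain w s L m \<theta> \<psi>1 where w: "w \<in> S" and p: "(s, L, m, \<theta>, \<psi>1) \<in> P" and dw: "dom w = V"
      and wk: "\<forall>\<^sub>F z in nhdsin T x. w z = k z" and a: "\<exists>a\<in>L. s a = w x" and rw: "ran w \<subseteq> ran s"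
      and tw: "transport \<psi>1 w \<phi> \<in> S'"
      using ext[OF gV oV \<phi>(1) xV k(1)] by (elim exE conjE)
    have wf: "\<forall>\<^sub>F z in nhdsin T x. w z = f z" using wk k(2) by eventually_elim simp
    have xT: "x \<in> topspace T" and y'T: "y' \<in> topspace T" using lhomeo_in_topspace[OF fl y'] by auto
    have wx: "w x = Some y'" using eventually_nhdsin_self[OF wf xT] y' by simp
    have mf: "minv f \<in> H" "minv f y' = Some x"
      using A.H_minv[OF fH] minv_Some_iff[OF fl] y' by auto
    \<comment> \<open>The image point \<open>y'\<close> varies with \<open>f\<close>, but
      \<open>?W\<close> does not: as a good set it carries the extension of a word based at any of
      its points.\<close>
    obtain k' where k': "germ_word E y' k'" "\<forall>\<^sub>F z in nhdsin T y'. k' z = minv f z"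
      using words[OF mf(1) _ mf(2) xy(1)] y'W by blast
    obtain w' where w': "w' \<in> S" and dw': "dom w' = ?W" and wk': "\<forall>\<^sub>F z in nhdsin T y'. w' z = k' z"
      using ext[OF gW oW \<psi>(1) y'W k'(1)] by (elim exE conjE)
    have wf': "\<forall>\<^sub>F z in nhdsin T y'. w' z = minv f z" using wk' k'(2) by eventually_elim simp
    have w'y: "w' y' = Some x" using eventually_nhdsin_self[OF wf' y'T] mf(2) by simp
    have 1: "\<forall>\<^sub>F z in nhdsin T x. (w' \<circ>\<^sub>m f) z = Some z"
      using eventually_map_comp_cong[OF fl y' _ wf', of f] eventually_minv_comp[OF fl y']
      by (auto elim: eventually_elim2)
    have 2: "\<forall>\<^sub>F z in nhdsin T y'. (w \<circ>\<^sub>m w') z = Some z"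
    proof -
      have "\<forall>\<^sub>F z in nhdsin T y'. (w \<circ>\<^sub>m w') z = (f \<circ>\<^sub>m minv f) z"
        by (rule eventually_map_comp_cong[OF A.S_lhomeo[OF w'] w'y wf' wf])
      moreover have "\<forall>\<^sub>F z in nhdsin T y'. (f \<circ>\<^sub>m minv f) z = Some z"
        using eventually_minv_comp[OF lhomeo_minv[OF fl] mf(2)] by (simp add: minv_minv[OF fl])
      ultimately show ?thesis by eventually_elim simp
    qed
    \<comment> \<open>The germs of \<open>w' \<circ>\<^sub>m f\<close> at \<open>x\<close> and of
      \<open>w \<circ>\<^sub>m w'\<close> at \<open>y'\<close> are trivial, so both maps are
      identities on their domains: \<open>w'\<close> undoes \<open>f\<close> on \<open>V\<close>,
      and applying \<open>w\<close> afterwards gives \<open>w z = f z\<close>.\<close>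
    have weq: "w z = f z" if z: "z \<in> V" for z
    proof -
      obtain z' where z': "f z = Some z'" using V z by blast
      then have "z' \<in> ?W" using V z by force
      then obtain z2 where z2: "w' z' = Some z2" using dw' by blast
      have "(w' \<circ>\<^sub>m f) x = Some x" "(w' \<circ>\<^sub>m f) z = Some z2" using y' w'y z' z2 by auto
      then have "z2 = z" using A.S_identity[OF A.S_comp[OF f w'] _ 1] by blast
      obtain z3 where z3: "w z = Some z3" using dw z by blast
      have "(w \<circ>\<^sub>m w') y' = Some y'" "(w \<circ>\<^sub>m w') z' = Some z3" using wx w'y z2 \<open>z2 = z\<close> z3 by auto
      then have "z3 = z'" using A.S_identity[OF A.S_comp[OF w' w] _ 2] by blast
      then show ?thesis using z' z3 by simp
    qed
    have wfV: "w = f |` V"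
      using dw weq by (auto simp: fun_eq_iff restrict_map_def)
    note pc = pieceD[OF P(2)[OF p]]
    \<comment> \<open>The word arrives in the target chart \<psi>1 of its last piece; the second
      clause of \<open>good\<close> for \<open>?W\<close> changes it to \<psi> within
      \<open>S'\<close>.\<close>
    have "y' \<in> ?W \<inter> {y. \<exists>x\<in>L. s x = Some y}" using y'W a wx by auto
    then have tW: "transport \<psi> (Some |` ?W) \<psi>1 \<in> S'"
      using conjunct2[OF bspec[OF conjunct2[OF conjunct2[OF gW[unfolded good_def]]] p, unfolded prod.case]] by blast
    have rw2: "ran w \<subseteq> ?W"
      using V unfolding wfV by (auto simp: ran_def restrict_map_Some_iff)
    have "transport \<psi> (Some |` ?W) \<psi>1 \<circ>\<^sub>m transport \<psi>1 w \<phi> = transport \<psi> ((Some |` ?W) \<circ>\<^sub>m w) \<phi>"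
      using rw pc(9) by (intro transport_comp[OF Phi_lhomeo[OF \<phi>(1)] Phi_lhomeo[OF pc(7)]]) blast
    then show "transport \<psi> (f |` V) \<phi> \<in> S'"
      using B.S_comp[OF tw tW] unfolding Some_restrict_map_comp[OF rw2] by (simp add: wfV)
  qed (use V0 W0 xy oW in auto)
  then show ?thesis by blast
qed

text \<open>Every orbit meets \<open>U\<close>, so \<open>x\<close> and \<open>y\<close> can be
  moved into \<open>U\<close> by elements \<open>g\<close> and \<open>g'\<close> of
  \<open>S\<close>. Stability of \<Phi> under composition with \<open>H\<close> lets the charts
  absorb these moves.\<close>

lemma uniform_transport_exists:
  assumes \<phi>: "\<phi> \<in> \<Phi>" "x \<in> dom \<phi>" and \<psi>: "\<psi> \<in> \<Phi>" "y \<in> dom \<psi>"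
  shows "\<exists>V0 W0. uniform_transport x y \<phi> \<psi> V0 W0"
proof -
  have T: "x \<in> topspace T" "y \<in> topspace T"
    using \<phi> \<psi> lhomeo_in_topspace(1)[OF Phi_lhomeo] by blast+
  have mv: "\<exists>g\<in>S. \<exists>x1\<in>U. g x = Some x1" if "x \<in> topspace T" for x
  proof -
    have "pg_orbit H x \<inter> U \<noteq> {}" using A.comp_gen that by (simp add: compactly_generated_with_def)
    then obtain h x1 where h: "h \<in> H" "h x = Some x1" "x1 \<in> U" by (auto simp: pg_orbit_def)
    then obtain G where "x \<in> G" "h |` G \<in> S" using A.H_locally_S[OF h(1), of x] by blast
    then show ?thesis using h by (intro bexI[of _ "h |` G"] bexI[of _ x1]) auto
  qed
  obtain g x1 where g: "g \<in> S" "x1 \<in> U" "g x = Some x1" using mv[OF T(1)] by blast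
  obtain g' y1 where g': "g' \<in> S" "y1 \<in> U" "g' y = Some y1" using mv[OF T(2)] by blast
  have gl: "g \<in> lhomeo T T" "g' \<in> lhomeo T T" using A.S_lhomeo g g' by auto
  have \<phi>1: "\<phi> \<circ>\<^sub>m minv g \<in> \<Phi>" "\<psi> \<circ>\<^sub>m minv g' \<in> \<Phi>"
    using Phi_comp[OF \<phi>(1) A.H_minv] Phi_comp[OF \<psi>(1) A.H_minv] g g' A.S_sub_H by blast+
  have d: "x1 \<in> dom (\<phi> \<circ>\<^sub>m minv g)" "y1 \<in> dom (\<psi> \<circ>\<^sub>m minv g')"
    using \<phi>(2) \<psi>(2) g(3) g'(3) by (auto simp: map_comp_Some_iff minv_Some_iff[OF gl(1)] minv_Some_iff[OF gl(2)])
  obtain V1 W1 where "uniform_transport x1 y1 (\<phi> \<circ>\<^sub>m minv g) (\<psi> \<circ>\<^sub>m minv g') V1 W1"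
    using uniform_transport_in_U[OF g(2) g'(2) \<phi>1(1) d(1) \<phi>1(2) d(2)] by blast
  note ut = this[unfolded uniform_transport_def]
  have oV1: "openin T V1" "x1 \<in> V1" and oW1: "openin T W1" "y1 \<in> W1" using ut by auto
  have tr: "transport (\<psi> \<circ>\<^sub>m minv g') (f |` V) (\<phi> \<circ>\<^sub>m minv g) \<in> S'"
    if "f \<in> S" "openin T V" "x1 \<in> V" "V \<subseteq> V1" "V \<subseteq> dom f" "\<forall>z\<in>V. the (f z) \<in> W1" for f V
    using ut that by simp
  let ?V0 = "dom \<phi> \<inter> {x. \<exists>x1\<in>V1. g x = Some x1}" and ?W0 = "dom \<psi> \<inter> {y. \<exists>y1\<in>W1. g' y = Some y1}"
  have "uniform_transport x y \<phi> \<psi> ?V0 ?W0"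
    unfolding uniform_transport_def
  proof (intro conjI ballI allI impI)
    show "openin T ?V0"
      using lhomeo_openin_dom[OF Phi_lhomeo[OF \<phi>(1)]] lhomeo_openin_preimage[OF gl(1) oV1(1)] by blast
    show "openin T ?W0"
      using lhomeo_openin_dom[OF Phi_lhomeo[OF \<psi>(1)]] lhomeo_openin_preimage[OF gl(2) oW1(1)] by blast
    fix f V assume f: "f \<in> S" and V: "openin T V \<and> x \<in> V \<and> V \<subseteq> ?V0 \<and> V \<subseteq> dom f \<and> (\<forall>z\<in>V. the (f z) \<in> ?W0)"
    \<comment> \<open>\<open>?F\<close> is in \<open>S\<close> and is defined near the moved point
      \<open>x1\<close> of \<open>U\<close>. Its conjugate by the modified charts is the conjugate
      of \<open>f\<close> by \<phi> and \<psi>, because the factors \<open>g\<close> and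
      \<open>g'\<close> cancel.\<close>
    let ?F = "g' \<circ>\<^sub>m (f \<circ>\<^sub>m minv g)" and ?gV = "{y. \<exists>x\<in>V. g x = Some y}"
    have F: "?F \<in> S" using f g(1) g'(1) A.S_comp A.S_minv by blast
    have Fg: "\<exists>v\<in>W1. f z = Some y2 \<and> g' y2 = Some v \<and> ?F u = Some v"
      if "z \<in> V" "g z = Some u" "f z = Some y2" for z u y2
    proof -
      have "y2 \<in> ?W0" using V that by force
      then obtain v where "v \<in> W1" "g' y2 = Some v" by blast
      then show ?thesis using that by (auto simp: map_comp_Some_iff minv_Some_iff[OF gl(1)])
    qed
    have dF: "\<exists>v\<in>W1. ?F u = Some v" if u: "u \<in> ?gV" for u
    proof -
      obtain z where z: "z \<in> V" "g z = Some u" using u by blast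
      obtain y2 where "f z = Some y2" using z V by blast
      then show ?thesis using Fg[OF z] by blast
    qed
    have "transport (\<psi> \<circ>\<^sub>m minv g') (?F |` ?gV) (\<phi> \<circ>\<^sub>m minv g) \<in> S'"
    proof (rule tr[OF F])
      show "openin T ?gV" using lhomeo_openin_image[OF gl(1)] V by blast
      show "x1 \<in> ?gV" using V g by blast
      show "?gV \<subseteq> V1" using V by auto
      show "?gV \<subseteq> dom ?F" using dF by blast
      show "\<forall>z\<in>?gV. the (?F z) \<in> W1" using dF by force
    qed
    moreover have "transport (\<psi> \<circ>\<^sub>m minv g') (?F |` ?gV) (\<phi> \<circ>\<^sub>m minv g) = transport \<psi> (f |` V) \<phi>"
    proof (rule map_eqI)
      fix a b
      have p1: "(\<phi> \<circ>\<^sub>m minv g) u = Some a \<longleftrightarrow> (\<exists>z. g z = Some u \<and> \<phi> z = Some a)" for u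
        by (auto simp: map_comp_Some_iff minv_Some_iff[OF gl(1)])
      have p2: "(\<psi> \<circ>\<^sub>m minv g') v = Some b \<longleftrightarrow> (\<exists>z. g' z = Some v \<and> \<psi> z = Some b)" for v
        by (auto simp: map_comp_Some_iff minv_Some_iff[OF gl(2)])
      have p3: "?F u = Some v \<longleftrightarrow> (\<exists>z y2. g z = Some u \<and> f z = Some y2 \<and> g' y2 = Some v)" for u v
        by (auto simp: map_comp_Some_iff minv_Some_iff[OF gl(1)])
      show "transport (\<psi> \<circ>\<^sub>m minv g') (?F |` ?gV) (\<phi> \<circ>\<^sub>m minv g) a = Some b \<longleftrightarrow>
          transport \<psi> (f |` V) \<phi> a = Some b"
        unfolding transport_Some_iff[OF Phi_lhomeo[OF \<phi>1(1)]] transport_Some_iff[OF Phi_lhomeo[OF \<phi>(1)]]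
          restrict_map_Some_iff p1 p2 p3
      proof
        assume "\<exists>u v. (\<exists>z. g z = Some u \<and> \<phi> z = Some a) \<and>
          (u \<in> ?gV \<and> (\<exists>z y2. g z = Some u \<and> f z = Some y2 \<and> g' y2 = Some v)) \<and>
          (\<exists>z. g' z = Some v \<and> \<psi> z = Some b)"
        then obtain u v z z1 z2 y2 y3 where *: "g z = Some u" "\<phi> z = Some a" "z1 \<in> V" "g z1 = Some u"
          "g z2 = Some u" "f z2 = Some y2" "g' y2 = Some v" "g' y3 = Some v" "\<psi> y3 = Some b" by blast
        have "z1 = z" "z2 = z" "y3 = y2"
          using lhomeo_inj[OF gl(1) *(4) *(1)] lhomeo_inj[OF gl(1) *(5) *(1)] lhomeo_inj[OF gl(2) *(8) *(7)] .
        then show "\<exists>z y. \<phi> z = Some a \<and> (z \<in> V \<and> f z = Some y) \<and> \<psi> y = Some b"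
          using * by (intro exI[of _ z] exI[of _ y2]) simp
      next
        assume "\<exists>z y. \<phi> z = Some a \<and> (z \<in> V \<and> f z = Some y) \<and> \<psi> y = Some b"
        then obtain z y2 where *: "\<phi> z = Some a" "z \<in> V" "f z = Some y2" "\<psi> y2 = Some b" by blast
        obtain u where u: "g z = Some u" using V * by blast
        then show "\<exists>u v. (\<exists>z. g z = Some u \<and> \<phi> z = Some a) \<and>
          (u \<in> ?gV \<and> (\<exists>z y2. g z = Some u \<and> f z = Some y2 \<and> g' y2 = Some v)) \<and>
          (\<exists>z. g' z = Some v \<and> \<psi> z = Some b)"
          using * Fg[OF *(2) u *(3)] by blast
      qed
    qed
    ultimately show "transport \<psi> (f |` V) \<phi> \<in> S'" by simp
  qed (use \<phi> \<psi> g g' oV1 oW1 in auto)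
  then show ?thesis by blast
qed

end

section \<open>Closures and the germ space\<close>

lemma topspace_compact_open_topology:
  "topspace (compact_open_topology T W) = {f. dom f = W \<and> continuous_map (subtopology T W) T (\<lambda>x. the (f x))}"
  unfolding compact_open_topology_def topology_generated_by_topspace
proof (intro equalityI subsetI)
  fix f assume "f \<in> {f. dom f = W \<and> continuous_map (subtopology T W) T (\<lambda>x. the (f x))}"
  then show "f \<in> \<Union> {{f. dom f = W \<and> continuous_map (subtopology T W) T (\<lambda>x. the (f x)) \<and>
      (\<lambda>x. the (f x)) ` K \<subseteq> V} | K V. compactin T K \<and> K \<subseteq> W \<and> openin T V}"
    by (intro UnionI[of "{f. dom f = W \<and> continuous_map (subtopology T W) T (\<lambda>x. the (f x)) \<and>
      (\<lambda>x. the (f x)) ` {} \<subseteq> {}}"] CollectI exI[of _ "{}"]) auto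
qed auto

lemma openin_compact_open_topology:
  assumes "compactin T K" "K \<subseteq> W" "openin T V"
  shows "openin (compact_open_topology T W)
    {f. dom f = W \<and> continuous_map (subtopology T W) T (\<lambda>x. the (f x)) \<and> (\<lambda>x. the (f x)) ` K \<subseteq> V}"
  unfolding compact_open_topology_def by (rule topology_generated_by_Basis) (use assms in blast)

lemma lhomeo_continuous_map:
  assumes "f \<in> lhomeo T T'" shows "continuous_map (subtopology T (dom f)) T' (\<lambda>x. the (f x))"
  using assms unfolding lhomeo_iff_homeomorphic_map
  by (meson continuous_map_in_subtopology homeomorphic_imp_continuous_map)

text \<open>Points of the compact-open space over \<open>W\<close> are maps with domain exactly
  \<open>W\<close>, so the open set in the definition can only be \<open>dom h\<close>.\<close>

lemma pseudostar_closure_iff: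
  "h \<in> pseudostar_closure T S \<longleftrightarrow> h \<in> lhomeo T T \<and>
     h \<in> compact_open_topology T (dom h) closure_of {f \<in> S. dom f = dom h}" (is "?L \<longleftrightarrow> ?R")
proof
  assume L: ?L
  then obtain W where W: "h \<in> compact_open_topology T W closure_of {f \<in> S. dom f = W}"
    by (auto simp: pseudostar_closure_def)
  then have "h \<in> topspace (compact_open_topology T W)" by (simp add: in_closure_of)
  then have "dom h = W" by (simp add: topspace_compact_open_topology)
  with W L show ?R by (simp add: pseudostar_closure_def loct_eq_lhomeo)
next
  assume ?R
  then show ?L using lhomeo_openin_dom[of h T T] by (auto simp: pseudostar_closure_def loct_eq_lhomeo)
qed

lemma pseudostar_closure_lhomeo: "h \<in> pseudostar_closure T S \<Longrightarrow> h \<in> lhomeo T T"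
  by (simp add: pseudostar_closure_iff)

lemma pseudogroup_closure_iff:
  "h \<in> pseudogroup_closure T S \<longleftrightarrow> h \<in> lhomeo T T \<and>
     (\<forall>x\<in>dom h. \<exists>W. openin T W \<and> x \<in> W \<and> W \<subseteq> dom h \<and> h |` W \<in> pseudostar_closure T S)"
proof -
  have *: "(openin T W \<and> x \<in> W \<and> W \<subseteq> dom h \<and>
      h |` W \<in> compact_open_topology T W closure_of {f \<in> S. dom f = W}) \<longleftrightarrow>
    (openin T W \<and> x \<in> W \<and> W \<subseteq> dom h \<and> h |` W \<in> pseudostar_closure T S)" if "h \<in> lhomeo T T" for W x
  proof -
    have "dom (h |` W) = W" if "W \<subseteq> dom h" using that by auto
    then show ?thesis using lhomeo_restrict[OF \<open>h \<in> lhomeo T T\<close>] by (auto simp: pseudostar_closure_iff)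
  qed
  show ?thesis by (simp add: pseudogroup_closure_def loct_eq_lhomeo * cong: conj_cong)
qed

lemma pseudogroup_closure_lhomeo: "h \<in> pseudogroup_closure T S \<Longrightarrow> h \<in> lhomeo T T"
  by (simp add: pseudogroup_closure_iff)

lemma pseudostar_closure_sub: "pseudostar_closure T S \<subseteq> pseudogroup_closure T S"
proof
  fix h assume h: "h \<in> pseudostar_closure T S"
  have "h |` dom h = h" by (rule map_eqI) (auto simp: restrict_map_Some_iff)
  then show "h \<in> pseudogroup_closure T S"
    using h lhomeo_openin_dom[OF pseudostar_closure_lhomeo[OF h]]
    unfolding pseudogroup_closure_iff by (auto intro!: exI[of _ "dom h"] dest: pseudostar_closure_lhomeo)
qed

section \<open>Germs and their transport\<close>

lemma in_snd_germ:
  assumes h: "h \<in> lhomeo T T" "x \<in> dom h"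
  shows "f \<in> snd (germ T h x) \<longleftrightarrow> f \<in> lhomeo T T \<and> (\<forall>\<^sub>F z in nhdsin T x. f z = h z)"
proof -
  have xT: "x \<in> topspace T" using h lhomeo_in_topspace(1)[OF h(1)] by blast
  have "(\<exists>W. openin T W \<and> x \<in> W \<and> W \<subseteq> dom h \<inter> dom f \<and> (\<forall>y\<in>W. f y = h y)) \<longleftrightarrow>
      (\<forall>\<^sub>F z in nhdsin T x. f z = h z)"
  proof
    assume "\<forall>\<^sub>F z in nhdsin T x. f z = h z"
    then obtain W where W: "openin T W" "x \<in> W" "\<And>z. z \<in> W \<Longrightarrow> f z = h z"
      using xT by (elim eventually_nhdsinD) auto
    have "openin T (W \<inter> dom h)" using W(1) lhomeo_openin_dom[OF h(1)] by blast
    moreover have "W \<inter> dom h \<subseteq> dom h \<inter> dom f" using W(3) by (auto simp: dom_def)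
    ultimately show "\<exists>W. openin T W \<and> x \<in> W \<and> W \<subseteq> dom h \<inter> dom f \<and> (\<forall>y\<in>W. f y = h y)"
      using W h(2) by (intro exI[of _ "W \<inter> dom h"]) simp
  qed (auto simp: eventually_nhdsin)
  then show ?thesis by (simp add: germ_def loct_eq_lhomeo)
qed

lemma fst_germ [simp]: "fst (germ T h x) = x"
  by (simp add: germ_def)

lemma germ_eq_iff:
  assumes h: "h \<in> lhomeo T T" "x \<in> dom h" and k: "k \<in> lhomeo T T" "x' \<in> dom k"
  shows "germ T h x = germ T k x' \<longleftrightarrow> x = x' \<and> (\<forall>\<^sub>F z in nhdsin T x. h z = k z)"
proof
  assume eq: "germ T h x = germ T k x'"
  then have x: "x = x'" using fst_germ by metis
  have "h \<in> snd (germ T h x)" using in_snd_germ[OF h] h(1) by simp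
  then show "x = x' \<and> (\<forall>\<^sub>F z in nhdsin T x. h z = k z)" using eq in_snd_germ[OF k] x by simp
next
  assume R: "x = x' \<and> (\<forall>\<^sub>F z in nhdsin T x. h z = k z)"
  have ev: "\<forall>\<^sub>F z in nhdsin T x. h z = k z" using conjunct2[OF R] .
  have "f \<in> snd (germ T h x) \<longleftrightarrow> f \<in> snd (germ T k x)" for f
  proof -
    have "(\<forall>\<^sub>F z in nhdsin T x. f z = h z) \<longleftrightarrow> (\<forall>\<^sub>F z in nhdsin T x. f z = k z)"
      by (rule eventually_cong[OF ev]) auto
    then show ?thesis using in_snd_germ[OF h] in_snd_germ[OF k] R by simp
  qed
  then have "snd (germ T h x) = snd (germ T k x')" using R by blast
  then show "germ T h x = germ T k x'" using R by (simp add: prod_eq_iff)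
qed

text \<open>The action of conjugation on germs. As in \<open>germ_lift\<close> the representative is
  arbitrary; \<open>germ_transport_germ\<close> shows that the choice does not matter.\<close>

definition germ_transport ::
    "'s topology \<Rightarrow> ('t \<rightharpoonup> 's) \<Rightarrow> ('t \<rightharpoonup> 's) \<Rightarrow> 't germ \<Rightarrow> 's germ" where
  "germ_transport T' \<psi> \<phi> \<gamma> =
     germ T' (transport \<psi> (SOME g. g \<in> snd \<gamma>) \<phi>) (the (\<phi> (fst \<gamma>)))"

lemma lhomeo_transport:
  "\<phi> \<in> lhomeo T T' \<Longrightarrow> \<psi> \<in> lhomeo T T' \<Longrightarrow> f \<in> lhomeo T T \<Longrightarrow> transport \<psi> f \<phi> \<in> lhomeo T' T'"
  unfolding transport_def by (intro lhomeo_comp lhomeo_minv)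

lemma eventually_transport_cong:
  assumes \<phi>: "\<phi> \<in> lhomeo T T'" "\<phi> x = Some a" and fg: "\<forall>\<^sub>F z in nhdsin T x. f z = g z"
    and \<phi>': "\<phi>' \<in> lhomeo T T'" "\<forall>\<^sub>F z in nhdsin T x. \<phi> z = \<phi>' z"
    and f: "f \<in> lhomeo T T" "f x = Some y" and \<psi>': "\<forall>\<^sub>F z in nhdsin T y. \<psi> z = \<psi>' z"
  shows "\<forall>\<^sub>F b in nhdsin T' a. transport \<psi> f \<phi> b = transport \<psi>' g \<phi>' b"
proof -
  have mi: "minv \<phi> \<in> lhomeo T' T" "minv \<phi> a = Some x"
    using lhomeo_minv[OF \<phi>(1)] minv_Some_iff[OF \<phi>(1)] \<phi>(2) by auto
  have "\<forall>\<^sub>F b in nhdsin T' a. (f \<circ>\<^sub>m minv \<phi>) b = (g \<circ>\<^sub>m minv \<phi>') b"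
    by (rule eventually_map_comp_cong[OF mi eventually_minv_cong[OF \<phi> \<phi>'] fg])
  note ev = this
  show ?thesis
    unfolding transport_def
    by (rule eventually_map_comp_cong[OF lhomeo_comp[OF mi(1) f(1)] _ ev \<psi>']) (simp add: mi(2) f(2))
qed

lemma germ_transport_germ:
  assumes \<phi>: "\<phi> \<in> lhomeo T T'" "\<phi> x = Some a" and \<psi>: "\<psi> \<in> lhomeo T T'"
    and f: "f \<in> lhomeo T T" "f x = Some y" "y \<in> dom \<psi>"
  shows "germ_transport T' \<psi> \<phi> (germ T f x) = germ T' (transport \<psi> f \<phi>) a"
proof -
  let ?g = "SOME g. g \<in> snd (germ T f x)"
  have xd: "x \<in> dom f" using f by blast
  have "f \<in> snd (germ T f x)" using in_snd_germ[OF f(1) xd] f(1) by simp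
  then have "?g \<in> snd (germ T f x)" by (rule someI[of "\<lambda>g. g \<in> snd (germ T f x)"])
  then have g: "?g \<in> lhomeo T T" "\<forall>\<^sub>F z in nhdsin T x. f z = ?g z"
    using in_snd_germ[OF f(1) xd] by (auto elim: eventually_mono)
  have xT: "x \<in> topspace T" using lhomeo_in_topspace[OF f(1,2)] by auto
  have gx: "?g x = Some y" using eventually_nhdsin_self[OF g(2) xT] f(2) by simp
  obtain b where b: "\<psi> y = Some b" using f(3) by blast
  have d: "a \<in> dom (transport \<psi> f \<phi>)" "a \<in> dom (transport \<psi> ?g \<phi>)"
    using transport_Some_iff[OF \<phi>(1)] \<phi>(2) f(2) b gx by blast+
  have ev: "\<forall>\<^sub>F z in nhdsin T' a. transport \<psi> f \<phi> z = transport \<psi> ?g \<phi> z"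
    by (rule eventually_transport_cong[OF \<phi> g(2) \<phi>(1) _ f(1,2)]) auto
  have "germ T' (transport \<psi> f \<phi>) a = germ T' (transport \<psi> ?g \<phi>) a"
    using germ_eq_iff[OF lhomeo_transport[OF \<phi>(1) \<psi> f(1)] d(1) lhomeo_transport[OF \<phi>(1) \<psi> g(1)] d(2)] ev
    by blast
  then show ?thesis by (simp add: germ_transport_def \<phi>(2))
qed

section \<open>Topologies on the closure of \<open>S\<close> and on the space of germs\<close>

lemma topspace_pseudostar_closure_topology:
  "topspace (pseudostar_closure_topology T S) = pseudostar_closure T S"
  unfolding pseudostar_closure_topology_def topology_generated_by_topspace
proof (intro equalityI subsetI)
  fix f assume "f \<in> pseudostar_closure T S"
  then show "f \<in> \<Union> {{h \<in> pseudostar_closure T S. K \<subseteq> dom h \<and> (\<lambda>x. the (h x)) ` K \<subseteq> V}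
      | K V. compactin T K \<and> openin T V}"
    by (intro UnionI[of "{h \<in> pseudostar_closure T S. {} \<subseteq> dom h \<and> (\<lambda>x. the (h x)) ` {} \<subseteq> {}}"]
        CollectI exI[of _ "{}"]) auto
qed auto

lemma openin_pseudostar_closure_topology:
  assumes "compactin T K" "openin T V"
  shows "openin (pseudostar_closure_topology T S)
    {h \<in> pseudostar_closure T S. K \<subseteq> dom h \<and> (\<lambda>x. the (h x)) ` K \<subseteq> V}"
  unfolding pseudostar_closure_topology_def by (rule topology_generated_by_Basis) (use assms in blast)

abbreviation pointed_closure :: "'t topology \<Rightarrow> ('t \<rightharpoonup> 't) set \<Rightarrow> (('t \<rightharpoonup> 't) \<times> 't) topology" where
  "pointed_closure T S \<equiv> subtopology (prod_topology (pseudostar_closure_topology T S) T) {(f, x). x \<in> dom f}"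

lemma topspace_pointed_closure:
  "topspace (pointed_closure T S) = {(f, x). f \<in> pseudostar_closure T S \<and> x \<in> dom f}"
  using lhomeo_in_topspace(1)[OF pseudostar_closure_lhomeo]
  by (auto simp: topspace_pseudostar_closure_topology)

lemma openin_germ_space:
  "openin (germ_space T S) W \<longleftrightarrow> W \<subseteq> {germ T h x | h x. h \<in> pseudogroup_closure T S \<and> x \<in> dom h} \<and>
     openin (pointed_closure T S) {(f, x). f \<in> pseudostar_closure T S \<and> x \<in> dom f \<and> germ T f x \<in> W}"
proof -
  have "{p \<in> topspace (pointed_closure T S). (case p of (f, x) \<Rightarrow> germ T f x) \<in> W} =
     {(f, x). f \<in> pseudostar_closure T S \<and> x \<in> dom f \<and> germ T f x \<in> W}"
    unfolding topspace_pointed_closure by auto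
  then show ?thesis by (simp add: germ_space_def openin_quotient_topology)
qed

lemma topspace_germ_space:
  "topspace (germ_space T S) = {germ T h x | h x. h \<in> pseudogroup_closure T S \<and> x \<in> dom h}" (is "_ = ?G")
proof
  show "topspace (germ_space T S) \<subseteq> ?G" using openin_germ_space[of T S "topspace (germ_space T S)"] openin_topspace by blast
  have "{(f, x). f \<in> pseudostar_closure T S \<and> x \<in> dom f \<and> germ T f x \<in> ?G} = topspace (pointed_closure T S)"
  proof -
    have "germ T f x \<in> ?G" if "f \<in> pseudostar_closure T S" "x \<in> dom f" for f x
      using that pseudostar_closure_sub[of T S] by blast
    then show ?thesis unfolding topspace_pointed_closure by blast
  qed
  then have "openin (germ_space T S) ?G" unfolding openin_germ_space using openin_topspace[of "pointed_closure T S"] by simp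
  then show "?G \<subseteq> topspace (germ_space T S)" by (rule openin_subset)
qed

lemma based_germs_sub: "based_germs T S t0 \<subseteq> topspace (germ_space T S)"
  unfolding based_germs_def topspace_germ_space by blast

lemma topspace_based_germ_space: "topspace (based_germ_space T S t0) = based_germs T S t0"
  using based_germs_sub[of T S t0] by (auto simp: based_germ_space_def)

lemma openin_germ_space_base_point:
  assumes "openin T D" shows "openin (germ_space T S) {\<gamma> \<in> topspace (germ_space T S). fst \<gamma> \<in> D}"
  unfolding openin_germ_space
proof
  show "{\<gamma> \<in> topspace (germ_space T S). fst \<gamma> \<in> D} \<subseteq> {germ T h x | h x. h \<in> pseudogroup_closure T S \<and> x \<in> dom h}"
    by (auto simp: topspace_germ_space)
  have "openin (prod_topology (pseudostar_closure_topology T S) T) (pseudostar_closure T S \<times> D)"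
    using assms openin_topspace[of "pseudostar_closure_topology T S"]
    by (simp add: openin_prod_Times_iff topspace_pseudostar_closure_topology)
  then have "openin (pointed_closure T S) ((pseudostar_closure T S \<times> D) \<inter> {(f, x). x \<in> dom f})"
    by (auto simp: openin_subtopology)
  moreover have "{(f, x). f \<in> pseudostar_closure T S \<and> x \<in> dom f \<and> germ T f x \<in> {\<gamma> \<in> topspace (germ_space T S). fst \<gamma> \<in> D}}
     = (pseudostar_closure T S \<times> D) \<inter> {(f, x). x \<in> dom f}"
    using pseudostar_closure_sub[of T S] by (auto simp: topspace_germ_space)
  ultimately show "openin (pointed_closure T S) {(f, x). f \<in> pseudostar_closure T S \<and> x \<in> dom f \<and>
      germ T f x \<in> {\<gamma> \<in> topspace (germ_space T S). fst \<gamma> \<in> D}}" by simp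
qed

lemma openin_based_germ_space_base_point:
  assumes "openin T D" shows "openin (based_germ_space T S t0) {\<gamma> \<in> based_germs T S t0. fst \<gamma> \<in> D}"
proof -
  have "{\<gamma> \<in> based_germs T S t0. fst \<gamma> \<in> D} = {\<gamma> \<in> topspace (germ_space T S). fst \<gamma> \<in> D} \<inter> based_germs T S t0"
    using based_germs_sub[of T S t0] by auto
  then show ?thesis
    unfolding based_germ_space_def openin_subtopology using openin_germ_space_base_point[OF assms] by blast
qed

lemma preimage_compact:
  assumes \<phi>: "\<phi> \<in> lhomeo T T'" and K: "compactin T' K" "K \<subseteq> ran \<phi>"
  shows "compactin T {x. \<exists>a\<in>K. \<phi> x = Some a}"
proof -
  have "compactin (subtopology T' (dom (minv \<phi>))) K"
    using K by (simp add: compactin_subtopology dom_minv[OF \<phi>])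
  then have "compactin T ((\<lambda>x. the (minv \<phi> x)) ` K)"
    by (rule image_compactin[OF _ lhomeo_continuous_map[OF lhomeo_minv[OF \<phi>]]])
  moreover have "(\<lambda>x. the (minv \<phi> x)) ` K = {x. \<exists>a\<in>K. \<phi> x = Some a}"
  proof (intro equalityI subsetI)
    fix x assume "x \<in> (\<lambda>x. the (minv \<phi> x)) ` K"
    then obtain a where a: "a \<in> K" "x = the (minv \<phi> a)" by blast
    obtain x' where "\<phi> x' = Some a" using K(2) a(1) by (auto simp: ran_def)
    then have x': "\<phi> x' = Some a" "minv \<phi> a = Some x'" using minv_Some_iff[OF \<phi>] by auto
    then have "x = x'" using a(2) by simp
    then show "x \<in> {x. \<exists>a\<in>K. \<phi> x = Some a}" using a(1) x'(1) by blast
  next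
    fix x assume "x \<in> {x. \<exists>a\<in>K. \<phi> x = Some a}"
    then obtain a where "a \<in> K" "minv \<phi> a = Some x" using minv_Some_iff[OF \<phi>] by blast
    then show "x \<in> (\<lambda>x. the (minv \<phi> x)) ` K" by force
  qed
  ultimately show ?thesis by simp
qed

lemma image_subset_domD:
  "(\<lambda>x. the (g x)) ` K \<subseteq> W0 \<Longrightarrow> W0 \<subseteq> dom \<psi> \<Longrightarrow> V \<subseteq> K \<Longrightarrow> \<forall>z\<in>V. the (g z) \<in> dom \<psi>"
  by blast

lemma dom_transport_restrict:
  assumes "\<phi> \<in> lhomeo T T'" "V \<subseteq> dom f" "\<forall>z\<in>V. the (f z) \<in> dom \<psi>"
  shows "dom (transport \<psi> (f |` V) \<phi>) = {a. \<exists>x\<in>V. \<phi> x = Some a}"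
proof (intro equalityI subsetI)
  fix a assume "a \<in> {a. \<exists>x\<in>V. \<phi> x = Some a}"
  then obtain x where x: "x \<in> V" "\<phi> x = Some a" by blast
  then obtain y b where "f x = Some y" "\<psi> y = Some b" using assms(2,3) by force
  then show "a \<in> dom (transport \<psi> (f |` V) \<phi>)"
    using x transport_Some_iff[OF assms(1), of \<psi> "f |` V" a b] by (auto simp: restrict_map_Some_iff)
qed (auto simp: transport_Some_iff[OF assms(1)] restrict_map_Some_iff)

text \<open>Translates a subbasic compact-open condition on the conjugate into one on
  \<open>f\<close>; this is the source of the continuity of conjugation.\<close>

lemma transport_image_subset_iff:
  assumes \<phi>: "\<phi> \<in> lhomeo T T'" and f: "V \<subseteq> dom f" "\<forall>z\<in>V. the (f z) \<in> dom \<psi>"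
    and K': "K' \<subseteq> {a. \<exists>x\<in>V. \<phi> x = Some a}"
  shows "(\<lambda>a. the (transport \<psi> (f |` V) \<phi> a)) ` K' \<subseteq> V' \<longleftrightarrow>
    (\<lambda>x. the (f x)) ` {x. \<exists>a\<in>K'. \<phi> x = Some a} \<subseteq> {y. \<exists>b\<in>V'. \<psi> y = Some b}" (is "?L \<longleftrightarrow> ?R")
proof -
  have key: "\<exists>y b. f x = Some y \<and> \<psi> y = Some b \<and> transport \<psi> (f |` V) \<phi> a = Some b"
    if a: "a \<in> K'" "\<phi> x = Some a" for a x
  proof -
    obtain x' where "x' \<in> V" "\<phi> x' = Some a" using K' a(1) by blast
    then have x: "x \<in> V" using lhomeo_inj[OF \<phi> _ a(2)] by metis
    then obtain y b where yb: "f x = Some y" "\<psi> y = Some b" using f by force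
    then have "transport \<psi> (f |` V) \<phi> a = Some b"
      using x a(2) by (auto simp: transport_Some_iff[OF \<phi>] restrict_map_Some_iff)
    then show ?thesis using yb by blast
  qed
  show ?thesis
  proof
    assume L: ?L
    show ?R
    proof clarify
      fix x a assume xa: "a \<in> K'" "\<phi> x = Some a"
      obtain y b where "f x = Some y" "\<psi> y = Some b" "transport \<psi> (f |` V) \<phi> a = Some b" using key[OF xa] by blast
      then show "\<exists>b\<in>V'. \<psi> (the (f x)) = Some b" using L xa(1) by force
    qed
  next
    assume R: ?R
    show ?L
    proof clarify
      fix a assume a: "a \<in> K'"
      then obtain x where x: "\<phi> x = Some a" using K' by blast
      obtain y b where yb: "f x = Some y" "\<psi> y = Some b" "transport \<psi> (f |` V) \<phi> a = Some b" using key[OF a x] by blast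
      have "the (f x) \<in> {y. \<exists>b\<in>V'. \<psi> y = Some b}" using R a x by blast
      then show "the (transport \<psi> (f |` V) \<phi> a) \<in> V'" using yb by simp
    qed
  qed
qed

section \<open>Conjugation of compact-open limits and of germs\<close>

context pseudogroup_equivalence
begin

text \<open>Mapping \<open>K\<close> into \<open>W0\<close> is an open condition satisfied by
  \<open>f\<close>, so elements of \<open>S\<close> close to \<open>f\<close> satisfy it and have
  their conjugates in \<open>S'\<close> by uniformity. Conjugation is continuous on these maps,
  hence the conjugate of \<open>f\<close> is a limit of elements of \<open>S'\<close>.\<close>

lemma uniform_transport_closure:
  assumes ut: "uniform_transport x y \<phi> \<psi> V0 W0" and \<phi>: "\<phi> \<in> \<Phi>" and \<psi>: "\<psi> \<in> \<Phi>"
    and V: "openin T V" "x \<in> V" "V \<subseteq> V0" and K: "compactin T K" "V \<subseteq> K"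
    and f: "f \<in> pseudostar_closure T S" "K \<subseteq> dom f" "\<forall>z\<in>K. the (f z) \<in> W0"
  shows "transport \<psi> (f |` V) \<phi> \<in> pseudostar_closure T' S'"
proof -
  note \<phi>l = Phi_lhomeo[OF \<phi>] and \<psi>l = Phi_lhomeo[OF \<psi>]
  have fl: "f \<in> lhomeo T T" using f pseudostar_closure_lhomeo by blast
  let ?W = "dom f" and ?\<Theta> = "\<lambda>f. transport \<psi> (f |` V) \<phi>"
  let ?W' = "{a. \<exists>x\<in>V. \<phi> x = Some a}"
  have W0: "openin T W0" "W0 \<subseteq> dom \<psi>" using ut by (auto simp: uniform_transport_def)
  let ?B = "{g. dom g = ?W \<and> continuous_map (subtopology T ?W) T (\<lambda>x. the (g x)) \<and> (\<lambda>x. the (g x)) ` K \<subseteq> W0}"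
  have oB: "openin (compact_open_topology T ?W) ?B" by (rule openin_compact_open_topology[OF K(1) f(2) W0(1)])
  \<comment> \<open>Besides the open condition, \<open>?Y\<close> keeps only local homeomorphisms,
    as \<open>f\<close> and the elements of \<open>S\<close> are; their conjugates are then
    continuous on their domains.\<close>
  let ?Y = "subtopology (compact_open_topology T ?W) (?B \<inter> lhomeo T T)"
  have Yt: "topspace ?Y \<subseteq> ?B \<inter> lhomeo T T" by auto
  have gV: "V \<subseteq> dom g" "\<forall>z\<in>V. the (g z) \<in> dom \<psi>" if "g \<in> ?B" for g
  proof -
    have g: "dom g = ?W" "(\<lambda>x. the (g x)) ` K \<subseteq> W0" using that by simp_all
    show "V \<subseteq> dom g" unfolding g(1) using K(2) f(2) by (rule subset_trans)
    show "\<forall>z\<in>V. the (g z) \<in> dom \<psi>" by (rule image_subset_domD[OF g(2) W0(2) K(2)])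
  qed
  have dom\<Theta>: "dom (?\<Theta> g) = ?W'" if "g \<in> ?B" for g
    by (rule dom_transport_restrict[OF \<phi>l gV[OF that]])
  have \<Theta>l: "?\<Theta> g \<in> lhomeo T' T'" if "g \<in> lhomeo T T" for g
    by (rule lhomeo_transport[OF \<phi>l \<psi>l lhomeo_restrict[OF that V(1)]])
  have cont: "continuous_map ?Y (compact_open_topology T' ?W') ?\<Theta>"
    unfolding compact_open_topology_def[of T' ?W']
  proof (rule continuous_on_generated_topo)
    fix Q assume "Q \<in> {{f. dom f = ?W' \<and> continuous_map (subtopology T' ?W') T' (\<lambda>x. the (f x)) \<and>
          (\<lambda>x. the (f x)) ` K' \<subseteq> V'} | K' V'. compactin T' K' \<and> K' \<subseteq> ?W' \<and> openin T' V'}"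
    then obtain K' V' where Q: "Q = {f. dom f = ?W' \<and> continuous_map (subtopology T' ?W') T' (\<lambda>x. the (f x)) \<and>
          (\<lambda>x. the (f x)) ` K' \<subseteq> V'}" and K': "compactin T' K'" "K' \<subseteq> ?W'" "openin T' V'" by blast
    let ?K = "{x. \<exists>a\<in>K'. \<phi> x = Some a}" and ?V = "{y. \<exists>b\<in>V'. \<psi> y = Some b}"
    have "K' \<subseteq> ran \<phi>" using K'(2) by (auto simp: ran_def)
    then have cK: "compactin T ?K" by (rule preimage_compact[OF \<phi>l K'(1)])
    have KV: "?K \<subseteq> V"
    proof
      fix z assume "z \<in> ?K"
      then obtain a where a: "a \<in> K'" "\<phi> z = Some a" by blast
      then obtain z' where "z' \<in> V" "\<phi> z' = Some a" using K'(2) by blast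
      then show "z \<in> V" using lhomeo_inj[OF \<phi>l _ a(2)] by metis
    qed
    have KW: "?K \<subseteq> ?W" using KV K(2) f(2) by blast
    have oV: "openin T ?V" by (rule lhomeo_openin_preimage[OF \<psi>l K'(3)])
    have o: "openin (compact_open_topology T ?W)
       {g. dom g = ?W \<and> continuous_map (subtopology T ?W) T (\<lambda>x. the (g x)) \<and> (\<lambda>x. the (g x)) ` ?K \<subseteq> ?V}"
      by (rule openin_compact_open_topology[OF cK KW oV])
    have "?\<Theta> -` Q \<inter> topspace ?Y =
       {g. dom g = ?W \<and> continuous_map (subtopology T ?W) T (\<lambda>x. the (g x)) \<and> (\<lambda>x. the (g x)) ` ?K \<subseteq> ?V}
       \<inter> (?B \<inter> lhomeo T T)" (is "?L = ?R")
    proof (intro equalityI subsetI)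
      fix g assume g: "g \<in> ?L"
      then have gB: "g \<in> ?B" "g \<in> lhomeo T T" using Yt by blast+
      then show "g \<in> ?R"
        using g transport_image_subset_iff[OF \<phi>l gV[OF gB(1)] K'(2)] unfolding Q by auto
    next
      fix g assume g: "g \<in> ?R"
      then have gB: "g \<in> ?B" "g \<in> lhomeo T T" by blast+
      have "continuous_map (subtopology T' ?W') T' (\<lambda>x. the (?\<Theta> g x))"
        using lhomeo_continuous_map[OF \<Theta>l[OF gB(2)]] dom\<Theta>[OF gB(1)] by simp
      then have "?\<Theta> g \<in> Q"
        using g dom\<Theta>[OF gB(1)] transport_image_subset_iff[OF \<phi>l gV[OF gB(1)] K'(2)] unfolding Q by auto
      moreover have "g \<in> topspace ?Y"
        using gB by (auto simp: topspace_compact_open_topology)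
      ultimately show "g \<in> ?L" by blast
    qed
    then show "openin ?Y (?\<Theta> -` Q \<inter> topspace ?Y)" using o unfolding openin_subtopology by blast
  next
    have "?\<Theta> g \<in> topspace (compact_open_topology T' ?W')" if "g \<in> topspace ?Y" for g
    proof -
      have gB: "g \<in> ?B" "g \<in> lhomeo T T" using that Yt by blast+
      show ?thesis
        unfolding topspace_compact_open_topology
        using lhomeo_continuous_map[OF \<Theta>l[OF gB(2)]] dom\<Theta>[OF gB(1)] by simp
    qed
    then show "?\<Theta> ` topspace ?Y \<subseteq> \<Union> {{f. dom f = ?W' \<and> continuous_map (subtopology T' ?W') T' (\<lambda>x. the (f x)) \<and>
          (\<lambda>x. the (f x)) ` K' \<subseteq> V'} | K' V'. compactin T' K' \<and> K' \<subseteq> ?W' \<and> openin T' V'}"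
      unfolding compact_open_topology_def topology_generated_by_topspace by blast
  qed
  have fcl: "f \<in> compact_open_topology T ?W closure_of {g \<in> S. dom g = ?W}"
    using f(1) pseudostar_closure_iff by blast
  have ft: "f \<in> topspace (compact_open_topology T ?W)" using fcl by (simp add: in_closure_of)
  have fB: "f \<in> ?B" using ft f(3) by (auto simp: topspace_compact_open_topology)
  have fY: "f \<in> topspace ?Y" using ft fB fl by simp
  have "?\<Theta> f \<in> compact_open_topology T' ?W' closure_of {g \<in> S'. dom g = ?W'}"
    unfolding in_closure_of
  proof (intro conjI allI impI)
    show "?\<Theta> f \<in> topspace (compact_open_topology T' ?W')"
      using cont fY unfolding continuous_map_def by blast
    fix Q assume Q: "?\<Theta> f \<in> Q \<and> openin (compact_open_topology T' ?W') Q"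
    then have "openin ?Y {g \<in> topspace ?Y. ?\<Theta> g \<in> Q}" using cont unfolding continuous_map_def by blast
    then obtain G where G: "openin (compact_open_topology T ?W) G"
      "{g \<in> topspace ?Y. ?\<Theta> g \<in> Q} = G \<inter> (?B \<inter> lhomeo T T)" unfolding openin_subtopology by blast
    have "f \<in> G" using G(2) fY Q by blast
    then have fGB: "f \<in> G \<inter> ?B" using fB by (rule IntI)
    have oGB: "openin (compact_open_topology T ?W) (G \<inter> ?B)" using G(1) oB by (rule openin_Int)
    have "\<exists>g. g \<in> {g \<in> S. dom g = ?W} \<and> g \<in> G \<inter> ?B"
      by (rule mp[OF spec[OF conjunct2[OF fcl[unfolded in_closure_of]]] conjI[OF fGB oGB]])
    then obtain g where g: "g \<in> S" "dom g = ?W" "g \<in> G" and gB: "g \<in> ?B" by blast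
    have gl: "g \<in> lhomeo T T" by (rule A.S_lhomeo[OF g(1)])
    have "g \<in> G \<inter> (?B \<inter> lhomeo T T)" using g(3) gB gl by (intro IntI)
    then have "?\<Theta> g \<in> Q" unfolding G(2)[symmetric] by simp
    moreover have "V \<subseteq> dom g" by (rule gV(1)[OF gB])
    moreover have "\<forall>z\<in>V. the (g z) \<in> W0" using gB K(2) by blast
    ultimately have "?\<Theta> g \<in> Q" "?\<Theta> g \<in> S'"
      using ut[unfolded uniform_transport_def, THEN conjunct2, THEN conjunct2, THEN conjunct2,
          THEN conjunct2, THEN conjunct2, THEN conjunct2, THEN bspec, OF g(1), THEN spec, of V] V by simp_all
    then
    show "\<exists>g. g \<in> {g \<in> S'. dom g = ?W'} \<and> g \<in> Q"
      using dom\<Theta>[OF gB] by (intro exI[of _ "?\<Theta> g"]) simp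
  qed
  then show ?thesis
    unfolding pseudostar_closure_iff dom\<Theta>[OF fB] using \<Theta>l[OF fl] by blast
qed

text \<open>The compact \<open>K\<close> between \<open>V\<close> and \<open>W\<close> turns the
  bound \<open>W0\<close> on the values into a subbasic condition.\<close>

lemma uniform_nbhd:
  assumes h: "h \<in> lhomeo T T" "h x = Some y" and \<phi>: "\<phi> \<in> \<Phi>" "x \<in> dom \<phi>" and \<psi>: "\<psi> \<in> \<Phi>" "y \<in> dom \<psi>"
    and W: "openin T W" "x \<in> W"
  obtains V0 W0 V K where "uniform_transport x y \<phi> \<psi> V0 W0" "openin T V" "x \<in> V" "V \<subseteq> V0" "V \<subseteq> W"
    "compactin T K" "V \<subseteq> K" "K \<subseteq> W" "K \<subseteq> dom h" "\<forall>z\<in>K. the (h z) \<in> W0"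
proof -
  obtain V0 W0 where ut: "uniform_transport x y \<phi> \<psi> V0 W0" using uniform_transport_exists[OF \<phi> \<psi>] by blast
  then have o: "openin T V0" "x \<in> V0" "openin T W0" "y \<in> W0" by (auto simp: uniform_transport_def)
  let ?N = "W \<inter> V0 \<inter> {x. \<exists>y\<in>W0. h x = Some y}"
  have "openin T ?N" using W(1) o lhomeo_openin_preimage[OF h(1) o(3)] by blast
  moreover have "x \<in> ?N" using W o h by blast
  ultimately obtain V K where "openin T V" "compactin T K" "x \<in> V" "V \<subseteq> K" "K \<subseteq> ?N"
    by (rule A.compact_nbhd)
  moreover from this have "V \<subseteq> V0" "V \<subseteq> W" "K \<subseteq> W" "K \<subseteq> dom h" by blast+
  moreover have "\<forall>z\<in>K. the (h z) \<in> W0" using \<open>K \<subseteq> ?N\<close> by force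
  ultimately show ?thesis using ut that by blast
qed

lemma transport_closure:
  assumes h: "h \<in> pseudogroup_closure T S" and \<phi>: "\<phi> \<in> \<Phi>" and \<psi>: "\<psi> \<in> \<Phi>"
  shows "transport \<psi> h \<phi> \<in> pseudogroup_closure T' S'"
  unfolding pseudogroup_closure_iff
proof (intro conjI ballI)
  note \<phi>l = Phi_lhomeo[OF \<phi>] and \<psi>l = Phi_lhomeo[OF \<psi>] and hl = pseudogroup_closure_lhomeo[OF h]
  show "transport \<psi> h \<phi> \<in> lhomeo T' T'" by (rule lhomeo_transport[OF \<phi>l \<psi>l hl])
  fix a assume "a \<in> dom (transport \<psi> h \<phi>)"
  then obtain x y b where x: "\<phi> x = Some a" "h x = Some y" "\<psi> y = Some b"
    by (auto simp: transport_Some_iff[OF \<phi>l])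
  obtain W where W: "openin T W" "x \<in> W" "W \<subseteq> dom h" "h |` W \<in> pseudostar_closure T S"
    using h x unfolding pseudogroup_closure_iff by blast
  obtain V0 W0 V K where ut: "uniform_transport x y \<phi> \<psi> V0 W0" and V: "openin T V" "x \<in> V" "V \<subseteq> V0" "V \<subseteq> W"
    and K: "compactin T K" "V \<subseteq> K" "K \<subseteq> W" "K \<subseteq> dom h" "\<forall>z\<in>K. the (h z) \<in> W0"
    using uniform_nbhd[OF hl x(2) \<phi> _ \<psi> _ W(1,2)] x by blast
  have "transport \<psi> ((h |` W) |` V) \<phi> \<in> pseudostar_closure T' S'"
    by (rule uniform_transport_closure[OF ut \<phi> \<psi> V(1,2,3) K(1,2) W(4)]) (use K in auto)
  then have tr: "transport \<psi> (h |` V) \<phi> \<in> pseudostar_closure T' S'" using V(4) by (simp add: Int_absorb1)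
  have d: "dom (transport \<psi> (h |` V) \<phi>) = {a. \<exists>x\<in>V. \<phi> x = Some a}"
  proof (rule dom_transport_restrict[OF \<phi>l])
    show "V \<subseteq> dom h" using K(2,4) by (rule subset_trans)
    have "W0 \<subseteq> dom \<psi>" using ut by (simp add: uniform_transport_def)
    then show "\<forall>z\<in>V. the (h z) \<in> dom \<psi>" using K(2,5) by blast
  qed
  show "\<exists>W. openin T' W \<and> a \<in> W \<and> W \<subseteq> dom (transport \<psi> h \<phi>) \<and> transport \<psi> h \<phi> |` W \<in> pseudostar_closure T' S'"
  proof (intro exI[of _ "{a. \<exists>x\<in>V. \<phi> x = Some a}"] conjI)
    show "openin T' {a. \<exists>x\<in>V. \<phi> x = Some a}" by (rule lhomeo_openin_image[OF \<phi>l V(1)])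
    show "a \<in> {a. \<exists>x\<in>V. \<phi> x = Some a}" using V x by blast
    show "transport \<psi> h \<phi> |` {a. \<exists>x\<in>V. \<phi> x = Some a} \<in> pseudostar_closure T' S'"
      using tr transport_restrict[OF \<phi>l] by metis
    show "{a. \<exists>x\<in>V. \<phi> x = Some a} \<subseteq> dom (transport \<psi> h \<phi>)"
    proof -
      have "dom (transport \<psi> (h |` V) \<phi>) \<subseteq> dom (transport \<psi> h \<phi>)"
        unfolding transport_restrict[OF \<phi>l] by simp
      then show ?thesis unfolding d .
    qed
  qed
qed

text \<open>Restricting to \<open>V\<close> before conjugating gives all the conjugates on
  \<open>N\<close> the same domain, the image of \<open>V\<close> under \<phi>. A subbasic condition
  on them for \<open>K'\<close> is then either never satisfied, or equivalent to a subbasic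
  condition on \<open>g\<close> for the preimage of \<open>K'\<close>.\<close>

lemma transport_pointed_continuous:
  assumes ut: "uniform_transport x y \<phi> \<psi> V0 W0" and \<phi>: "\<phi> \<in> \<Phi>" and \<psi>: "\<psi> \<in> \<Phi>"
    and V: "openin T V" "x \<in> V" "V \<subseteq> V0" and K: "compactin T K" "V \<subseteq> K"
  defines "N \<equiv> {g \<in> pseudostar_closure T S. K \<subseteq> dom g \<and> (\<lambda>x. the (g x)) ` K \<subseteq> W0}"
  shows "continuous_map (subtopology (prod_topology (pseudostar_closure_topology T S) T) (N \<times> V))
      (pointed_closure T' S') (\<lambda>(g, z). (transport \<psi> (g |` V) \<phi>, the (\<phi> z)))"
proof -
  note \<phi>l = Phi_lhomeo[OF \<phi>] and \<psi>l = Phi_lhomeo[OF \<psi>]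
  let ?\<Theta> = "\<lambda>g. transport \<psi> (g |` V) \<phi>"
  let ?P = "subtopology (prod_topology (pseudostar_closure_topology T S) T) (N \<times> V)"
  have W0: "openin T W0" "W0 \<subseteq> dom \<psi>" "V \<subseteq> dom \<phi>" using ut V by (auto simp: uniform_transport_def)
  have gV: "V \<subseteq> dom g" "\<forall>z\<in>V. the (g z) \<in> dom \<psi>" if "g \<in> N" for g
  proof -
    have g: "K \<subseteq> dom g" "(\<lambda>x. the (g x)) ` K \<subseteq> W0" using that unfolding N_def by simp_all
    show "V \<subseteq> dom g" using K(2) g(1) by (rule subset_trans)
    show "\<forall>z\<in>V. the (g z) \<in> dom \<psi>" by (rule image_subset_domD[OF g(2) W0(2) K(2)])
  qed
  have dom\<Theta>: "dom (?\<Theta> g) = {a. \<exists>x\<in>V. \<phi> x = Some a}" if "g \<in> N" for g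
    by (rule dom_transport_restrict[OF \<phi>l gV[OF that]])
  have \<Theta>S: "?\<Theta> g \<in> pseudostar_closure T' S'" if "g \<in> N" for g
    by (rule uniform_transport_closure[OF ut \<phi> \<psi> V K]) (use that in \<open>auto simp: N_def\<close>)
  have NT: "N \<inter> topspace (pseudostar_closure_topology T S) = N"
    by (auto simp: N_def topspace_pseudostar_closure_topology)
  have 1: "continuous_map (subtopology (pseudostar_closure_topology T S) N) (pseudostar_closure_topology T' S') ?\<Theta>"
    unfolding pseudostar_closure_topology_def[of T' S']
  proof (rule continuous_on_generated_topo)
    fix Q assume "Q \<in> {{h \<in> pseudostar_closure T' S'. K \<subseteq> dom h \<and> (\<lambda>x. the (h x)) ` K \<subseteq> V}
      | K V. compactin T' K \<and> openin T' V}"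
    then obtain K' V' where Q: "Q = {h \<in> pseudostar_closure T' S'. K' \<subseteq> dom h \<and> (\<lambda>x. the (h x)) ` K' \<subseteq> V'}"
      and K': "compactin T' K'" "openin T' V'" by blast
    have tN: "topspace (subtopology (pseudostar_closure_topology T S) N) = N" using NT by auto
    show "openin (subtopology (pseudostar_closure_topology T S) N)
       (?\<Theta> -` Q \<inter> topspace (subtopology (pseudostar_closure_topology T S) N))"
    proof (cases "K' \<subseteq> {a. \<exists>x\<in>V. \<phi> x = Some a}")
      case False
      then have "?\<Theta> g \<notin> Q" if "g \<in> N" for g unfolding Q using dom\<Theta>[OF that] by simp
      then have "?\<Theta> -` Q \<inter> N = {}" by blast
      then show ?thesis unfolding tN by simp
    next
      case True
      let ?K = "{x. \<exists>a\<in>K'. \<phi> x = Some a}" and ?V = "{y. \<exists>b\<in>V'. \<psi> y = Some b}"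
      have "K' \<subseteq> ran \<phi>" using True by (auto simp: ran_def)
      then have cK: "compactin T ?K" by (rule preimage_compact[OF \<phi>l K'(1)])
      have KV: "?K \<subseteq> V"
      proof
        fix z assume "z \<in> ?K"
        then obtain a where a: "a \<in> K'" "\<phi> z = Some a" by blast
        then obtain z' where "z' \<in> V" "\<phi> z' = Some a" using True by blast
        then show "z \<in> V" using lhomeo_inj[OF \<phi>l _ a(2)] by metis
      qed
      have oV: "openin T ?V" by (rule lhomeo_openin_preimage[OF \<psi>l K'(2)])
      have "?\<Theta> -` Q \<inter> N = {h \<in> pseudostar_closure T S. ?K \<subseteq> dom h \<and> (\<lambda>x. the (h x)) ` ?K \<subseteq> ?V} \<inter> N"
      proof -
        have "?\<Theta> g \<in> Q \<longleftrightarrow> ?K \<subseteq> dom g \<and> (\<lambda>x. the (g x)) ` ?K \<subseteq> ?V" if g: "g \<in> N" for g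
        proof -
          have "?\<Theta> g \<in> Q \<longleftrightarrow> (\<lambda>x. the (?\<Theta> g x)) ` K' \<subseteq> V'"
            unfolding Q using \<Theta>S[OF g] dom\<Theta>[OF g] True by simp
          also have "\<dots> \<longleftrightarrow> (\<lambda>x. the (g x)) ` ?K \<subseteq> ?V"
            by (rule transport_image_subset_iff[OF \<phi>l gV[OF g] True])
          also have "\<dots> \<longleftrightarrow> ?K \<subseteq> dom g \<and> (\<lambda>x. the (g x)) ` ?K \<subseteq> ?V"
            using subset_trans[OF KV gV(1)[OF g]] by simp
          finally show ?thesis .
        qed
        moreover have "N \<subseteq> pseudostar_closure T S" unfolding N_def by (rule Collect_restrict)
        ultimately show ?thesis by blast
      qed
      note eq = this
      show ?thesis
        unfolding tN openin_subtopology
        by (intro exI conjI, rule openin_pseudostar_closure_topology[OF cK oV], rule eq)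
    qed
  next
    show "?\<Theta> ` topspace (subtopology (pseudostar_closure_topology T S) N)
       \<subseteq> \<Union> {{h \<in> pseudostar_closure T' S'. K \<subseteq> dom h \<and> (\<lambda>x. the (h x)) ` K \<subseteq> V}
      | K V. compactin T' K \<and> openin T' V}"
    proof -
      have "?\<Theta> ` topspace (subtopology (pseudostar_closure_topology T S) N) \<subseteq>
          topspace (pseudostar_closure_topology T' S')"
        unfolding topspace_subtopology topspace_pseudostar_closure_topology using \<Theta>S by blast
      then show ?thesis
        unfolding pseudostar_closure_topology_def[of T' S'] topology_generated_by_topspace .
    qed
  qed
  have c1: "continuous_map ?P (pseudostar_closure_topology T' S') (\<lambda>p. ?\<Theta> (fst p))"
  proof -
    have "continuous_map ?P (subtopology (pseudostar_closure_topology T S) N) fst"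
      by (auto simp: continuous_map_in_subtopology continuous_map_from_subtopology continuous_map_fst)
    then show ?thesis using continuous_map_compose[OF _ 1] by (simp add: o_def)
  qed
  have c2: "continuous_map ?P T' (\<lambda>p. the (\<phi> (snd p)))"
  proof -
    have "continuous_map ?P (subtopology T (dom \<phi>)) snd"
      using W0(3) by (auto simp: continuous_map_in_subtopology continuous_map_from_subtopology continuous_map_snd)
    then show ?thesis using continuous_map_compose[OF _ lhomeo_continuous_map[OF \<phi>l]] by (simp add: o_def)
  qed
  have "continuous_map ?P (prod_topology (pseudostar_closure_topology T' S') T') (\<lambda>p. (?\<Theta> (fst p), the (\<phi> (snd p))))"
    using c1 c2 by (simp add: continuous_map_paired)
  moreover have "the (\<phi> z) \<in> dom (?\<Theta> g)" if gz: "g \<in> N" "z \<in> V" for g z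
  proof -
    obtain a where a: "\<phi> z = Some a" using gz(2) W0(3) by blast
    show ?thesis unfolding dom\<Theta>[OF gz(1)] using gz(2) a by auto
  qed
  ultimately show ?thesis
    unfolding continuous_map_in_subtopology case_prod_beta topspace_subtopology
    by (intro conjI funcsetI) (assumption, simp only: mem_Collect_eq fst_conv snd_conv Int_iff mem_Times_iff)
qed

text \<open>Openness in the quotient is tested on pairs \<open>(f, x)\<close>. Near such a pair,
  \<open>g\<close> may be replaced by its restriction to \<open>V\<close>, which has the same germs
  at points of \<open>V\<close> and whose conjugate lies in the closure of \<open>S'\<close>;
  \<open>transport_pointed_continuous\<close> then pulls back the open set that \<open>G\<close>
  defines.\<close>

lemma openin_germ_transport:
  assumes \<phi>: "\<phi> \<in> \<Phi>" and \<psi>: "\<psi> \<in> \<Phi>" and G: "openin (germ_space T' S') G"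
  shows "openin (germ_space T S) {germ T f x | f x y. f \<in> pseudogroup_closure T S \<and> f x = Some y \<and>
     x \<in> dom \<phi> \<and> y \<in> dom \<psi> \<and> germ_transport T' \<psi> \<phi> (germ T f x) \<in> G}" (is "openin _ ?G")
  unfolding openin_germ_space
proof
  note \<phi>l = Phi_lhomeo[OF \<phi>] and \<psi>l = Phi_lhomeo[OF \<psi>]
  show "?G \<subseteq> {germ T h x | h x. h \<in> pseudogroup_closure T S \<and> x \<in> dom h}" by blast
  let ?R = "{(f, x). f \<in> pseudostar_closure T S \<and> x \<in> dom f \<and> germ T f x \<in> ?G}"
  have Riff: "(f, x) \<in> ?R \<longleftrightarrow> f \<in> pseudostar_closure T S \<and> (\<exists>y. f x = Some y \<and> x \<in> dom \<phi> \<and> y \<in> dom \<psi> \<and>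
      germ_transport T' \<psi> \<phi> (germ T f x) \<in> G)" for f x
  proof
    assume "(f, x) \<in> ?R"
    then have f: "f \<in> pseudostar_closure T S" "x \<in> dom f" "germ T f x \<in> ?G" by auto
    then obtain g z y where g: "germ T f x = germ T g z" "g \<in> pseudogroup_closure T S" "g z = Some y"
      "z \<in> dom \<phi>" "y \<in> dom \<psi>" "germ_transport T' \<psi> \<phi> (germ T g z) \<in> G" by blast
    have fl: "f \<in> lhomeo T T" "g \<in> lhomeo T T" using f g pseudostar_closure_lhomeo pseudogroup_closure_lhomeo by blast+
    have xT: "x \<in> topspace T" using f(2) lhomeo_in_topspace(1)[OF fl(1)] by blast
    have e: "x = z" "\<forall>\<^sub>F w in nhdsin T x. f w = g w"
      using germ_eq_iff[OF fl(1) f(2) fl(2)] g(1,3) by blast+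
    then have "f x = Some y" using eventually_nhdsin_self[OF e(2) xT] g(3) by simp
    then show "f \<in> pseudostar_closure T S \<and> (\<exists>y. f x = Some y \<and> x \<in> dom \<phi> \<and> y \<in> dom \<psi> \<and>
      germ_transport T' \<psi> \<phi> (germ T f x) \<in> G)" using f g e by auto
  next
    assume "f \<in> pseudostar_closure T S \<and> (\<exists>y. f x = Some y \<and> x \<in> dom \<phi> \<and> y \<in> dom \<psi> \<and>
      germ_transport T' \<psi> \<phi> (germ T f x) \<in> G)"
    then show "(f, x) \<in> ?R" using pseudostar_closure_sub[of T S] by blast
  qed
  let ?PT = "prod_topology (pseudostar_closure_topology T S) T"
  have oR: "openin ?PT ?R"
  proof (subst openin_subopen, intro ballI)
    fix p assume "p \<in> ?R"
    then obtain f x where p: "p = (f, x)" and "(f, x) \<in> ?R" by (cases p) blast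
    then obtain y where f: "f \<in> pseudostar_closure T S" "f x = Some y" "x \<in> dom \<phi>" "y \<in> dom \<psi>"
      "germ_transport T' \<psi> \<phi> (germ T f x) \<in> G" unfolding Riff by blast
    have fl: "f \<in> lhomeo T T" using pseudostar_closure_lhomeo[OF f(1)] .
    have xT: "x \<in> topspace T" using lhomeo_in_topspace[OF fl f(2)] by auto
    obtain V0 W0 V K where ut: "uniform_transport x y \<phi> \<psi> V0 W0" and V: "openin T V" "x \<in> V" "V \<subseteq> V0"
      and K: "compactin T K" "V \<subseteq> K" "K \<subseteq> dom f" "\<forall>z\<in>K. the (f z) \<in> W0"
      using uniform_nbhd[OF fl f(2) \<phi> f(3) \<psi> f(4) openin_topspace xT] by metis
    have W0: "openin T W0" "W0 \<subseteq> dom \<psi>" "V \<subseteq> dom \<phi>" using ut V by (auto simp: uniform_transport_def)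
    let ?N = "{g \<in> pseudostar_closure T S. K \<subseteq> dom g \<and> (\<lambda>x. the (g x)) ` K \<subseteq> W0}"
    let ?\<Theta> = "\<lambda>(g, z). (transport \<psi> (g |` V) \<phi>, the (\<phi> z))"
    let ?G' = "{(f, x). f \<in> pseudostar_closure T' S' \<and> x \<in> dom f \<and> germ T' f x \<in> G}"
    let ?Q = "{q \<in> topspace (subtopology ?PT (?N \<times> V)). ?\<Theta> q \<in> ?G'}"
    have "openin (pointed_closure T' S') ?G'" using G unfolding openin_germ_space by blast
    then have "openin (subtopology ?PT (?N \<times> V)) ?Q"
      using transport_pointed_continuous[OF ut \<phi> \<psi> V K(1,2)] unfolding continuous_map_def by blast
    moreover have "openin ?PT (?N \<times> V)"
      unfolding openin_prod_Times_iff using openin_pseudostar_closure_topology[OF K(1) W0(1)] V(1) by blast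
    ultimately have oQ: "openin ?PT ?Q" using openin_open_subtopology by blast
    have NV: "topspace (subtopology ?PT (?N \<times> V)) = ?N \<times> V"
      using openin_subset[OF V(1)] by (auto simp: topspace_pseudostar_closure_topology)
    have eqv: "germ_transport T' \<psi> \<phi> (germ T g z) = germ T' (transport \<psi> (g |` V) \<phi>) (the (\<phi> z)) \<and>
        z \<in> dom g \<and> the (g z) \<in> dom \<psi> \<and> z \<in> dom \<phi> \<and> transport \<psi> (g |` V) \<phi> \<in> pseudostar_closure T' S' \<and>
        the (\<phi> z) \<in> dom (transport \<psi> (g |` V) \<phi>)"
      if g: "g \<in> ?N" "z \<in> V" for g z
    proof -
      have gl: "g \<in> lhomeo T T" using g pseudostar_closure_lhomeo by blast
      have zd: "z \<in> dom g" "the (g z) \<in> dom \<psi>" "z \<in> dom \<phi>" using g K(2) W0 by blast+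
      obtain y2 where "g z = Some y2" using zd(1) by blast
      moreover obtain a where "\<phi> z = Some a" using zd(3) by blast
      ultimately have y2: "g z = Some y2" "y2 \<in> dom \<psi>" "\<phi> z = Some a" using zd(2) by simp_all
      have gVd: "V \<subseteq> dom g" "\<forall>z\<in>V. the (g z) \<in> dom \<psi>" using g(1) K(2) W0(2) by blast+
      have gt: "germ_transport T' \<psi> \<phi> (germ T g z) = germ T' (transport \<psi> g \<phi>) a"
        by (rule germ_transport_germ[OF \<phi>l y2(3) \<psi>l gl y2(1,2)])
      have tl: "transport \<psi> g \<phi> \<in> lhomeo T' T'" "transport \<psi> (g |` V) \<phi> \<in> lhomeo T' T'"
        using lhomeo_transport[OF \<phi>l \<psi>l] gl lhomeo_restrict[OF gl V(1)] by blast+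
      have ad: "a \<in> dom (transport \<psi> (g |` V) \<phi>)"
        unfolding dom_transport_restrict[OF \<phi>l gVd] using g(2) y2(3) by blast
      have ad2: "a \<in> dom (transport \<psi> g \<phi>)"
        using ad unfolding transport_restrict[OF \<phi>l] by simp
      have "\<forall>\<^sub>F b in nhdsin T z. g b = (g |` V) b"
        using eventually_nhdsin_in[OF V(1) g(2)] by eventually_elim simp
      then have "\<forall>\<^sub>F b in nhdsin T' a. transport \<psi> g \<phi> b = transport \<psi> (g |` V) \<phi> b"
        by (rule eventually_transport_cong[OF \<phi>l y2(3) _ \<phi>l _ gl y2(1)]) auto
      then have "germ T' (transport \<psi> g \<phi>) a = germ T' (transport \<psi> (g |` V) \<phi>) a"
        using germ_eq_iff[OF tl(1) ad2 tl(2) ad] by blast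
      moreover have "transport \<psi> (g |` V) \<phi> \<in> pseudostar_closure T' S'"
        by (rule uniform_transport_closure[OF ut \<phi> \<psi> V K(1,2)]) (use g in auto)
      ultimately show ?thesis using gt zd ad y2(3) by simp
    qed
    have fN: "f \<in> ?N" using f K by auto
    have pQ: "p \<in> ?Q" unfolding NV p using eqv[OF fN V(2)] fN V(2) f(5) by simp
    have QR: "?Q \<subseteq> ?R"
    proof
      fix q assume q: "q \<in> ?Q"
      then obtain g z where gz: "q = (g, z)" "g \<in> ?N" "z \<in> V" unfolding NV by blast
      have "germ T' (transport \<psi> (g |` V) \<phi>) (the (\<phi> z)) \<in> G" using q gz(1) by simp
      then show "q \<in> ?R" unfolding gz(1) Riff using eqv[OF gz(2,3)] gz(2) by auto
    qed
    show "\<exists>Q. openin ?PT Q \<and> p \<in> Q \<and> Q \<subseteq> ?R" by (intro exI[of _ ?Q] conjI oQ pQ QR)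
  qed
  have eqR: "?R = ?R \<inter> {(f, x). x \<in> dom f}"
  proof (rule Int_absorb2[symmetric], rule subsetI)
    fix p assume "p \<in> ?R"
    then obtain f x where fx: "p = (f, x)" "(f, x) \<in> ?R" by (cases p) simp
    have "x \<in> dom f" using fx(2) unfolding mem_Collect_eq prod.case by (elim conjE)
    then show "p \<in> {(f, x). x \<in> dom f}" unfolding fx(1) by simp
  qed
  show "openin (pointed_closure T S) ?R"
    unfolding openin_subtopology by (intro exI[of _ ?R] conjI oR eqR)
qed

lemma germ_transport_based:
  assumes \<phi>: "\<phi> \<in> \<Phi>" and \<psi>: "\<psi> \<in> \<Phi>" "\<psi> t0 = Some t0'"
    and \<gamma>: "\<gamma> \<in> based_germs T S t0" "fst \<gamma> \<in> dom \<phi>"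
  shows "germ_transport T' \<psi> \<phi> \<gamma> \<in> based_germs T' S' t0'" "fst (germ_transport T' \<psi> \<phi> \<gamma>) = the (\<phi> (fst \<gamma>))"
proof -
  note \<phi>l = Phi_lhomeo[OF \<phi>] and \<psi>l = Phi_lhomeo[OF \<psi>(1)]
  obtain g x where g: "\<gamma> = germ T g x" "g \<in> pseudogroup_closure T S" "g x = Some t0"
    using \<gamma>(1) by (auto simp: based_germs_def)
  then obtain a where a: "\<phi> x = Some a" using \<gamma>(2) by auto
  have "germ_transport T' \<psi> \<phi> \<gamma> = germ T' (transport \<psi> g \<phi>) a"
    unfolding g(1) using germ_transport_germ[OF \<phi>l a \<psi>l pseudogroup_closure_lhomeo[OF g(2)] g(3)] \<psi>(2) by blast
  moreover have "transport \<psi> g \<phi> a = Some t0'"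
    using transport_Some_iff[OF \<phi>l] a g(3) \<psi>(2) by blast
  ultimately show "germ_transport T' \<psi> \<phi> \<gamma> \<in> based_germs T' S' t0'"
    using transport_closure[OF g(2) \<phi> \<psi>(1)] unfolding based_germs_def by blast
  show "fst (germ_transport T' \<psi> \<phi> \<gamma>) = the (\<phi> (fst \<gamma>))" by (simp add: germ_transport_def)
qed

lemma continuous_germ_transport:
  assumes \<phi>: "\<phi> \<in> \<Phi>" and \<psi>: "\<psi> \<in> \<Phi>" "\<psi> t0 = Some t0'"
  shows "continuous_map (subtopology (based_germ_space T S t0) {\<gamma>. fst \<gamma> \<in> dom \<phi>})
     (based_germ_space T' S' t0') (germ_transport T' \<psi> \<phi>)"
proof -
  let ?D = "{\<gamma>. fst \<gamma> \<in> dom \<phi>}"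
  let ?F = "germ_transport T' \<psi> \<phi>"
  have ts: "topspace (subtopology (based_germ_space T S t0) ?D) = based_germs T S t0 \<inter> ?D"
    unfolding topspace_subtopology topspace_based_germ_space ..
  show ?thesis
    unfolding continuous_map_def ts topspace_based_germ_space
  proof (intro conjI allI impI)
    show "?F \<in> based_germs T S t0 \<inter> ?D \<rightarrow> based_germs T' S' t0'"
      using germ_transport_based(1)[OF \<phi> \<psi>] by auto
    fix G assume "openin (based_germ_space T' S' t0') G"
    then obtain G' where G': "openin (germ_space T' S') G'" "G = G' \<inter> based_germs T' S' t0'"
      unfolding based_germ_space_def openin_subtopology by blast
    let ?G = "{germ T f x | f x y. f \<in> pseudogroup_closure T S \<and> f x = Some y \<and>
     x \<in> dom \<phi> \<and> y \<in> dom \<psi> \<and> ?F (germ T f x) \<in> G'}"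
    have eq: "{\<gamma> \<in> based_germs T S t0 \<inter> ?D. ?F \<gamma> \<in> G} = ?G \<inter> (based_germs T S t0 \<inter> ?D)"
    proof (intro equalityI subsetI)
      fix \<gamma> assume \<gamma>: "\<gamma> \<in> {\<gamma> \<in> based_germs T S t0 \<inter> ?D. ?F \<gamma> \<in> G}"
      obtain g x where g: "\<gamma> = germ T g x" "g \<in> pseudogroup_closure T S" "g x = Some t0"
        using \<gamma> unfolding based_germs_def by blast
      have "x \<in> dom \<phi>" using \<gamma> unfolding g(1) by simp
      moreover have "?F (germ T g x) \<in> G'" using \<gamma> G'(2) unfolding g(1) by blast
      ultimately have "\<gamma> \<in> ?G"
        unfolding g(1) mem_Collect_eq using g(2,3) \<psi>(2) by (intro exI conjI) (rule refl, assumption+, blast, assumption)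
      then show "\<gamma> \<in> ?G \<inter> (based_germs T S t0 \<inter> ?D)" using \<gamma> by blast
    next
      fix \<gamma> assume \<gamma>: "\<gamma> \<in> ?G \<inter> (based_germs T S t0 \<inter> ?D)"
      then have "?F \<gamma> \<in> G'" by blast
      then show "\<gamma> \<in> {\<gamma> \<in> based_germs T S t0 \<inter> ?D. ?F \<gamma> \<in> G}"
        using \<gamma> G'(2) germ_transport_based(1)[OF \<phi> \<psi>] by blast
    qed
    show "openin (subtopology (based_germ_space T S t0) ?D) {\<gamma> \<in> based_germs T S t0 \<inter> ?D. ?F \<gamma> \<in> G}"
      unfolding based_germ_space_def subtopology_subtopology openin_subtopology
      by (intro exI conjI, rule openin_germ_transport[OF \<phi> \<psi>(1) G'(1)], rule eq)
  qed
qed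

end

section \<open>Foliated charts and transitions between transversals\<close>

text \<open>Used with transverse coordinates as values, and with truth values as an open-closed
  argument along a plaque.\<close>

lemma connectedin_locally_constant:
  assumes C: "connectedin X C" and loc: "\<And>z. z \<in> C \<Longrightarrow> \<exists>N. openin X N \<and> z \<in> N \<and> (\<forall>w\<in>N \<inter> C. g w = g z)"
    and zw: "z \<in> C" "w \<in> C"
  shows "g z = g w"
proof (rule ccontr)
  assume ne: "g z \<noteq> g w"
  let ?E1 = "\<Union>{N. openin X N \<and> (\<forall>v\<in>N \<inter> C. g v = g z)}" and ?E2 = "\<Union>{N. openin X N \<and> (\<forall>v\<in>N \<inter> C. g v \<noteq> g z)}"
  have E: "v \<in> ?E1" if "v \<in> C" "g v = g z" for v
  proof -
    obtain N where N: "openin X N" "v \<in> N" "\<forall>w\<in>N \<inter> C. g w = g v" using loc \<open>v \<in> C\<close> by blast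
    then have "\<forall>w\<in>N \<inter> C. g w = g z" using that(2) by simp
    then show ?thesis using N(1,2) by blast
  qed
  have E': "v \<in> ?E2" if "v \<in> C" "g v \<noteq> g z" for v
  proof -
    obtain N where N: "openin X N" "v \<in> N" "\<forall>w\<in>N \<inter> C. g w = g v" using loc \<open>v \<in> C\<close> by blast
    then have "\<forall>w\<in>N \<inter> C. g w \<noteq> g z" using that(2) by simp
    then show ?thesis using N(1,2) by blast
  qed
  have o: "openin X ?E1" "openin X ?E2" by (rule openin_Union, blast)+
  have s1: "C \<subseteq> ?E1 \<union> ?E2" using E E' by blast
  have s2: "?E1 \<inter> ?E2 \<inter> C = {}" by blast
  have n1: "?E1 \<inter> C \<noteq> {}" using E[OF zw(1) refl] zw(1) by blast
  have n2: "?E2 \<inter> C \<noteq> {}" using E'[OF zw(2) ne[symmetric]] zw(2) by blast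
  have "\<nexists>E1 E2. openin X E1 \<and> openin X E2 \<and> C \<subseteq> E1 \<union> E2 \<and> E1 \<inter> E2 \<inter> C = {} \<and> E1 \<inter> C \<noteq> {} \<and> E2 \<inter> C \<noteq> {}"
    using C unfolding connectedin by (rule conjunct2)
  moreover have "\<exists>E1 E2. openin X E1 \<and> openin X E2 \<and> C \<subseteq> E1 \<union> E2 \<and> E1 \<inter> E2 \<inter> C = {} \<and> E1 \<inter> C \<noteq> {} \<and> E2 \<inter> C \<noteq> {}"
    using o s1 s2 n1 n2 by (intro exI conjI)
  ultimately show False by (rule notE)
qed

section \<open>Euclidean balls and local connectedness\<close>

lemma openin_open_ball_in_Euclidean:
  assumes "open_ball_in_Euclidean n B" shows "openin (Euclidean_space n) B"
proof -
  obtain c r where c: "r > 0" "B = {v \<in> topspace (Euclidean_space n). sqrt (\<Sum>i<n. (v i - c i)\<^sup>2) < r}"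
    using assms by (auto simp: open_ball_in_Euclidean_def)
  have "continuous_map (Euclidean_space n) euclideanreal (\<lambda>v. \<Sum>i<n. (v i - c i)\<^sup>2)"
    unfolding Euclidean_space_def
    by (intro continuous_map_sum continuous_map_real_pow continuous_map_diff
        continuous_map_from_subtopology continuous_map_product_projection) auto
  then have "openin (Euclidean_space n) {v \<in> topspace (Euclidean_space n). (\<Sum>i<n. (v i - c i)\<^sup>2) \<in> {..<r\<^sup>2}}"
    by (rule openin_continuous_map_preimage) auto
  moreover have "sqrt s < r \<longleftrightarrow> s < r\<^sup>2" for s
    using real_sqrt_less_iff[of s "r\<^sup>2"] c(1) by simp
  ultimately show ?thesis using c by simp
qed

text \<open>The ball is the union of the segments from its centre to its points.\<close>

lemma connectedin_open_ball_in_Euclidean: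
  assumes "open_ball_in_Euclidean n B" shows "connectedin (Euclidean_space n) B" "B \<noteq> {}"
proof -
  obtain c r where c: "c \<in> topspace (Euclidean_space n)" "r > 0"
    "B = {v \<in> topspace (Euclidean_space n). sqrt (\<Sum>i<n. (v i - c i)\<^sup>2) < r}"
    using assms by (auto simp: open_ball_in_Euclidean_def)
  have cB: "c \<in> B" using c by simp
  then show "B \<noteq> {}" by blast
  let ?seg = "\<lambda>v. (\<lambda>t::real. (\<lambda>i. c i + t * (v i - c i))) ` {0..1}"
  have seg: "connectedin (Euclidean_space n) (?seg v)" if "v \<in> B" for v
  proof (rule connectedin_continuous_map_image)
    show "continuous_map (top_of_set {0..1}) (Euclidean_space n) (\<lambda>t i. c i + t * (v i - c i))"
      using that c unfolding Euclidean_space_def continuous_map_in_subtopology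
      by (auto simp: continuous_map_componentwise_UNIV topspace_Euclidean_space intro!: continuous_intros)
    show "connectedin (top_of_set {0..1::real}) {0..1}" by (simp add: connectedin_subtopology)
  qed
  have sub: "?seg v \<subseteq> B" if v: "v \<in> B" for v
  proof clarify
    fix t :: real assume t: "t \<in> {0..1}"
    let ?w = "\<lambda>i. c i + t * (v i - c i)"
    have "(\<Sum>i<n. (?w i - c i)\<^sup>2) = t\<^sup>2 * (\<Sum>i<n. (v i - c i)\<^sup>2)"
      by (simp add: sum_distrib_left power_mult_distrib)
    then have "sqrt (\<Sum>i<n. (?w i - c i)\<^sup>2) = t * sqrt (\<Sum>i<n. (v i - c i)\<^sup>2)"
      using t by (simp add: real_sqrt_mult)
    also have "\<dots> \<le> 1 * sqrt (\<Sum>i<n. (v i - c i)\<^sup>2)"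
      using t by (intro mult_right_mono real_sqrt_ge_zero sum_nonneg) auto
    also have "\<dots> < r" using v c(3) by simp
    finally show "?w \<in> B" using v c by (simp add: topspace_Euclidean_space)
  qed
  have "v \<in> ?seg v" for v by (rule image_eqI[of _ _ 1]) auto
  then have "B \<subseteq> \<Union>(?seg ` B)" by blast
  moreover have "\<Union>(?seg ` B) \<subseteq> B" using sub by (rule UN_least)
  ultimately have "B = \<Union>(?seg ` B)" by (rule equalityI)
  moreover have "c \<in> \<Inter>(?seg ` B)" by (auto intro!: image_eqI[of _ _ 0])
  then have "connectedin (Euclidean_space n) (\<Union>(?seg ` B))"
    by (intro connectedin_Union) (use seg in blast)+
  ultimately show "connectedin (Euclidean_space n) B" by simp
qed

text \<open>\<open>Euclidean_space n\<close> consists of the real sequences vanishing from index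
  \<open>n\<close> on. Truncation retracts the product of countably many lines onto it, and that
  product is locally connected because its factors are connected and locally connected.\<close>

lemma locally_connected_Euclidean_space: "locally_connected_space (Euclidean_space n)"
proof (rule locally_connected_space_retraction_map_image)
  show "locally_connected_space (powertop_real UNIV)"
    unfolding locally_connected_space_product_topology
    using connectedin_topspace[of euclideanreal] connected_UNIV[where 'a=real]
    by (simp add: locally_connected_space_euclideanreal connectedin_iff_connected del: connectedin_topspace)
  have "retraction_maps (powertop_real UNIV) (Euclidean_space n) (\<lambda>x i. if i < n then x i else 0) id"
    unfolding retraction_maps_def continuous_map_componentwise_Euclidean_space
    by (auto simp: Euclidean_space_def fun_eq_iff intro: continuous_map_product_projection continuous_map_from_subtopology)
  then show "retraction_map (powertop_real UNIV) (Euclidean_space n) (\<lambda>x i. if i < n then x i else 0)"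
    unfolding retraction_map_def by blast
qed

section \<open>Product structure of foliated charts\<close>

lemma foliated_chart_obtains:
  assumes "foliated_chart n X Z \<psi>"
  obtains B V g where "openin X (dom \<psi>)" "open_ball_in_Euclidean n B" "openin Z V"
    "dist_submersion \<psi> ` dom \<psi> = V"
    "homeomorphic_maps (subtopology X (dom \<psi>))
       (prod_topology (subtopology (Euclidean_space n) B) (subtopology Z V)) (\<lambda>x. the (\<psi> x)) g"
    "\<forall>b\<in>B. \<forall>v\<in>V. g (b, v) \<in> dom \<psi> \<and> \<psi> (g (b, v)) = Some (b, v)"
    "\<forall>x\<in>dom \<psi>. fst (the (\<psi> x)) \<in> B \<and> dist_submersion \<psi> x \<in> V \<and>
       g (fst (the (\<psi> x)), dist_submersion \<psi> x) = x"
proof -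
  obtain B V where BV: "openin X (dom \<psi>)" "open_ball_in_Euclidean n B" "openin Z V"
    "homeomorphic_map (subtopology X (dom \<psi>))
          (prod_topology (subtopology (Euclidean_space n) B) (subtopology Z V)) (\<lambda>x. the (\<psi> x))"
    using assms unfolding foliated_chart_def by blast
  then obtain g where g: "homeomorphic_maps (subtopology X (dom \<psi>))
       (prod_topology (subtopology (Euclidean_space n) B) (subtopology Z V)) (\<lambda>x. the (\<psi> x)) g"
    unfolding homeomorphic_map_maps by blast
  have B: "B \<subseteq> topspace (Euclidean_space n)" using openin_open_ball_in_Euclidean[OF BV(2)] openin_subset by blast
  have V: "V \<subseteq> topspace Z" using BV(3) openin_subset by blast
  have D: "dom \<psi> \<subseteq> topspace X" using BV(1) openin_subset by blast
  have tp: "topspace (prod_topology (subtopology (Euclidean_space n) B) (subtopology Z V)) = B \<times> V"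
    "topspace (subtopology X (dom \<psi>)) = dom \<psi>" using B V D by auto
  have 1: "g (b, v) \<in> dom \<psi> \<and> \<psi> (g (b, v)) = Some (b, v)" if "b \<in> B" "v \<in> V" for b v
  proof -
    have "g (b, v) \<in> dom \<psi>" "the (\<psi> (g (b, v))) = (b, v)"
      using g that unfolding homeomorphic_maps_def continuous_map_def tp by auto
    then show ?thesis by auto
  qed
  have 2: "fst (the (\<psi> x)) \<in> B \<and> dist_submersion \<psi> x \<in> V \<and> g (fst (the (\<psi> x)), dist_submersion \<psi> x) = x"
    if "x \<in> dom \<psi>" for x
  proof -
    have "the (\<psi> x) \<in> B \<times> V" "g (the (\<psi> x)) = x"
      using g that unfolding homeomorphic_maps_def continuous_map_def tp by auto
    then show ?thesis by (auto simp: dist_submersion_def)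
  qed
  have "dist_submersion \<psi> ` dom \<psi> = V"
  proof
    show "V \<subseteq> dist_submersion \<psi> ` dom \<psi>"
    proof
      fix v assume v: "v \<in> V"
      obtain b where "b \<in> B" using connectedin_open_ball_in_Euclidean(2)[OF BV(2)] by blast
      then show "v \<in> dist_submersion \<psi> ` dom \<psi>"
        using 1[OF _ v] by (intro image_eqI[of _ _ "g (b, v)"]) (auto simp: dist_submersion_def)
    qed
  qed (use 2 in auto)
  then show ?thesis using that[of B V g] BV g 1 2 by simp
qed

text \<open>The intersection of a plaque with \<open>W\<close> may be disconnected. In a product box
  \<open>A \<times> O2\<close> with connected \<open>A\<close>, however, two points of equal
  transverse coordinate lie on a common connected slice, and the slice stays in
  \<open>W\<close>.\<close>

lemma foliated_chart_box:
  assumes ch: "foliated_chart n X Z \<psi>" and W: "openin X W" "x \<in> W" "W \<subseteq> dom \<psi>"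
  obtains N where "openin X N" "x \<in> N" "N \<subseteq> W"
    "\<forall>z\<in>N. \<forall>w\<in>N. dist_submersion \<psi> z = dist_submersion \<psi> w \<longrightarrow>
       (\<exists>C. connectedin X C \<and> z \<in> C \<and> w \<in> C \<and> C \<subseteq> W \<and> (\<forall>c\<in>C. dist_submersion \<psi> c = dist_submersion \<psi> z))"
proof -
  obtain B V g where "openin X (dom \<psi>)" "open_ball_in_Euclidean n B" "openin Z V"
    "dist_submersion \<psi> ` dom \<psi> = V"
    "homeomorphic_maps (subtopology X (dom \<psi>))
       (prod_topology (subtopology (Euclidean_space n) B) (subtopology Z V)) (\<lambda>x. the (\<psi> x)) g"
    "\<forall>b\<in>B. \<forall>v\<in>V. g (b, v) \<in> dom \<psi> \<and> \<psi> (g (b, v)) = Some (b, v)"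
    "\<forall>x\<in>dom \<psi>. fst (the (\<psi> x)) \<in> B \<and> dist_submersion \<psi> x \<in> V \<and>
       g (fst (the (\<psi> x)), dist_submersion \<psi> x) = x"
    by (rule foliated_chart_obtains[OF ch])
  note \<psi> = this(1-4) and hm = this(5) and g1 = this(6)[rule_format] and g2 = this(7)[rule_format]
  let ?E = "subtopology (Euclidean_space n) B" and ?V = "subtopology Z V"
  let ?P = "prod_topology ?E ?V" and ?X = "subtopology X (dom \<psi>)"
  have tp: "topspace ?E = B" "topspace ?V = V"
    using openin_subset[OF openin_open_ball_in_Euclidean[OF \<psi>(2)]] openin_subset[OF \<psi>(3)] by auto
  have cg: "continuous_map ?P ?X g" and ch: "continuous_map ?X ?P (\<lambda>x. the (\<psi> x))"
    using hm by (auto simp: homeomorphic_maps_def)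
  have "openin ?X W" using W \<psi>(1) by (simp add: openin_open_subtopology)
  then have "openin ?P {p \<in> topspace ?P. g p \<in> W}" using cg by (simp add: continuous_map_def)
  note oP = this
  obtain b v where bv: "the (\<psi> x) = (b, v)" by (cases "the (\<psi> x)")
  have "x \<in> dom \<psi>" using W(2,3) by blast
  then have "(b, v) \<in> {p \<in> topspace ?P. g p \<in> W}"
    using g2[of x] W(2) unfolding topspace_prod_topology tp by (simp add: dist_submersion_def bv)
  then have "\<exists>O1 O2. openin ?E O1 \<and> openin ?V O2 \<and> b \<in> O1 \<and> v \<in> O2 \<and> O1 \<times> O2 \<subseteq> {p \<in> topspace ?P. g p \<in> W}"
    using oP unfolding openin_prod_topology_alt by blast
  then obtain O1 O2 where O: "openin ?E O1" "openin ?V O2" "the (\<psi> x) \<in> O1 \<times> O2"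
     "O1 \<times> O2 \<subseteq> {p \<in> topspace ?P. g p \<in> W}"
    unfolding bv by blast
  have "locally_connected_space ?E"
    by (rule locally_connected_space_open_subset[OF locally_connected_Euclidean_space openin_open_ball_in_Euclidean[OF \<psi>(2)]])
  then obtain A where A: "openin ?E A" "connectedin ?E A" "fst (the (\<psi> x)) \<in> A" "A \<subseteq> O1"
    using O(1,3) unfolding locally_connected_space mem_Times_iff by blast
  let ?N = "{z \<in> dom \<psi>. the (\<psi> z) \<in> A \<times> O2}"
  have "openin ?P (A \<times> O2)" using A(1) O(2) by (simp add: openin_prod_Times_iff)
  then have "openin ?X {z \<in> topspace ?X. the (\<psi> z) \<in> A \<times> O2}" using ch by (simp add: continuous_map_def)
  moreover have "topspace ?X = dom \<psi>" using openin_subset[OF \<psi>(1)] by auto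
  ultimately have "openin ?X ?N" by (simp only:)
  then have oN: "openin X ?N" using openin_open_subtopology[OF \<psi>(1)] by blast
  have gW: "g p \<in> W" if "p \<in> A \<times> O2" for p using that O(4) A(4) by blast
  have NW: "?N \<subseteq> W"
  proof
    fix z assume z: "z \<in> ?N"
    then have "the (\<psi> z) \<in> A \<times> O2" by (simp only: mem_Collect_eq)
    then have "g (the (\<psi> z)) \<in> W" by (rule gW)
    moreover have "g (the (\<psi> z)) = z" using g2[of z] z by (simp add: dist_submersion_def)
    ultimately show "z \<in> W" by simp
  qed
  have "\<exists>C. connectedin X C \<and> z \<in> C \<and> w \<in> C \<and> C \<subseteq> W \<and> (\<forall>c\<in>C. dist_submersion \<psi> c = dist_submersion \<psi> z)"
    if z: "z \<in> ?N" and w: "w \<in> ?N" and eq: "dist_submersion \<psi> z = dist_submersion \<psi> w" for z w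
  proof (intro exI conjI ballI)
    let ?v = "dist_submersion \<psi> z"
    let ?C = "g ` (A \<times> {?v})"
    have vO: "?v \<in> O2" using z by (simp add: dist_submersion_def mem_Times_iff)
    have OV: "O2 \<subseteq> V" "A \<subseteq> B" using openin_subset[OF O(2)] openin_subset[OF A(1)] unfolding tp .
    have "connectedin ?P (A \<times> {?v})"
      unfolding connectedin_Times connectedin_sing tp using A(2) vO OV by blast
    then have "connectedin ?X ?C" by (rule connectedin_continuous_map_image[OF cg])
    then show "connectedin X ?C" by (simp add: connectedin_subtopology)
    have "z = g (fst (the (\<psi> z)), ?v)" "fst (the (\<psi> z)) \<in> A" using g2[of z] z by (auto simp: mem_Times_iff)
    then show "z \<in> ?C" by blast
    have "w = g (fst (the (\<psi> w)), ?v)" "fst (the (\<psi> w)) \<in> A" using g2[of w] w eq by (auto simp: mem_Times_iff)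
    then show "w \<in> ?C" by blast
    show "?C \<subseteq> W" using gW vO by blast
    fix c assume "c \<in> ?C"
    then obtain b where b: "b \<in> A" "c = g (b, ?v)" by blast
    have "b \<in> B" "?v \<in> V" using b(1) OV vO by blast+
    then have "\<psi> c = Some (b, ?v)" using g1[of b ?v] b(2) by blast
    then show "dist_submersion \<psi> c = ?v" by (simp add: dist_submersion_def)
  qed
  then have con: "\<forall>z\<in>?N. \<forall>w\<in>?N. dist_submersion \<psi> z = dist_submersion \<psi> w \<longrightarrow>
       (\<exists>C. connectedin X C \<and> z \<in> C \<and> w \<in> C \<and> C \<subseteq> W \<and> (\<forall>c\<in>C. dist_submersion \<psi> c = dist_submersion \<psi> z))"
    by (intro ballI impI)
  have "x \<in> ?N" using W(2,3) A(3) O(3) by (auto simp: mem_Times_iff)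
  then show ?thesis by (rule that[OF oN _ NW con])
qed

lemma connectedin_fibre:
  assumes ch: "foliated_chart n X Z \<psi>"
  shows "connectedin X {z \<in> dom \<psi>. dist_submersion \<psi> z = v}"
proof (cases "v \<in> dist_submersion \<psi> ` dom \<psi>")
  case False
  then have "{z \<in> dom \<psi>. dist_submersion \<psi> z = v} = {}" by blast
  then show ?thesis by (simp only: connectedin_empty)
next
  case True
  obtain B V g where "openin X (dom \<psi>)" "open_ball_in_Euclidean n B" "openin Z V"
    "dist_submersion \<psi> ` dom \<psi> = V"
    "homeomorphic_maps (subtopology X (dom \<psi>))
       (prod_topology (subtopology (Euclidean_space n) B) (subtopology Z V)) (\<lambda>x. the (\<psi> x)) g"
    "\<forall>b\<in>B. \<forall>v\<in>V. g (b, v) \<in> dom \<psi> \<and> \<psi> (g (b, v)) = Some (b, v)"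
    "\<forall>x\<in>dom \<psi>. fst (the (\<psi> x)) \<in> B \<and> dist_submersion \<psi> x \<in> V \<and>
       g (fst (the (\<psi> x)), dist_submersion \<psi> x) = x"
    by (rule foliated_chart_obtains[OF ch])
  note \<psi> = this(1-4) and hm = this(5) and g1 = this(6)[rule_format] and g2 = this(7)[rule_format]
  have "connectedin (prod_topology (subtopology (Euclidean_space n) B) (subtopology Z V)) (B \<times> {v})"
    unfolding connectedin_Times
    using connectedin_open_ball_in_Euclidean[OF \<psi>(2)] True \<psi>(4) openin_subset[OF \<psi>(3)]
    by (auto simp: connectedin_subtopology)
  then have "connectedin (subtopology X (dom \<psi>)) (g ` (B \<times> {v}))"
    using hm by (intro connectedin_continuous_map_image) (auto simp: homeomorphic_maps_def)
  moreover have "g ` (B \<times> {v}) = {z \<in> dom \<psi>. dist_submersion \<psi> z = v}"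
  proof (intro equalityI subsetI)
    fix z assume "z \<in> g ` (B \<times> {v})"
    then obtain b where "b \<in> B" "z = g (b, v)" by blast
    then show "z \<in> {z \<in> dom \<psi>. dist_submersion \<psi> z = v}" using g1[of b v] True \<psi>(4) by (auto simp: dist_submersion_def)
  next
    fix z assume "z \<in> {z \<in> dom \<psi>. dist_submersion \<psi> z = v}"
    then have "z = g (fst (the (\<psi> z)), v)" "fst (the (\<psi> z)) \<in> B" using g2[of z] by auto
    then show "z \<in> g ` (B \<times> {v})" by blast
  qed
  ultimately show ?thesis by (simp add: connectedin_subtopology)
qed

section \<open>Submersions and transverse transitions\<close>

definition submersion :: "'x topology \<Rightarrow> 't topology \<Rightarrow> 'x set \<Rightarrow> ('x \<Rightarrow> 't) \<Rightarrow> bool" where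
  "submersion X T U p \<longleftrightarrow> openin X U \<and> (\<forall>x\<in>U. p x \<in> topspace T) \<and>
     (\<forall>W. openin X W \<longrightarrow> W \<subseteq> U \<longrightarrow> openin T (p ` W)) \<and>
     (\<forall>W. openin T W \<longrightarrow> openin X {x \<in> U. p x \<in> W})"

text \<open>Continuity and openness together say that \<open>p\<close> maps the neighbourhood filter
  of \<open>x\<close> onto that of \<open>p x\<close>, so germs on the transversal can be compared
  by working in \<open>X\<close>.\<close>

lemma eventually_submersion:
  assumes p: "submersion X T U p" and x: "x \<in> U"
  shows "(\<forall>\<^sub>F t in nhdsin T (p x). P t) \<longleftrightarrow> (\<forall>\<^sub>F z in nhdsin X x. P (p z))"
proof -
  have T: "p x \<in> topspace T" "x \<in> topspace X" using p x openin_subset by (auto simp: submersion_def)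
  show ?thesis
  proof
    assume "\<forall>\<^sub>F t in nhdsin T (p x). P t"
    then obtain W where "openin T W" "p x \<in> W" "\<And>t. t \<in> W \<Longrightarrow> P t" using T by (elim eventually_nhdsinD) auto
    then show "\<forall>\<^sub>F z in nhdsin X x. P (p z)"
      unfolding eventually_nhdsin using p x by (intro disjI2 exI[of _ "{x \<in> U. p x \<in> W}"]) (auto simp: submersion_def)
  next
    assume "\<forall>\<^sub>F z in nhdsin X x. P (p z)"
    then obtain W where W: "openin X W" "x \<in> W" "\<And>t. t \<in> W \<Longrightarrow> P (p t)" using T by (elim eventually_nhdsinD) auto
    have "openin X (W \<inter> U)" using W p by (auto simp: submersion_def)
    then have "openin T (p ` (W \<inter> U))" using p by (simp add: submersion_def)
    then show "\<forall>\<^sub>F t in nhdsin T (p x). P t"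
      unfolding eventually_nhdsin using W x by (intro disjI2 exI[of _ "p ` (W \<inter> U)"]) auto
  qed
qed

text \<open>No domain is prescribed: the condition concerns only the germ at \<open>p x\<close>, and
  one \<tau> remains a transition at all points near \<open>x\<close>.\<close>

definition transition ::
    "'x topology \<Rightarrow> 't topology \<Rightarrow> 's topology \<Rightarrow> ('x \<Rightarrow> 't) \<Rightarrow> ('x \<Rightarrow> 's) \<Rightarrow> 'x \<Rightarrow> ('t \<rightharpoonup> 's) \<Rightarrow> bool" where
  "transition X T T' p p' x \<tau> \<longleftrightarrow> \<tau> \<in> lhomeo T T' \<and> (\<forall>\<^sub>F z in nhdsin X x. \<tau> (p z) = Some (p' z))"

lemma transition_self:
  "transition X T T' p p' x \<tau> \<Longrightarrow> x \<in> topspace X \<Longrightarrow> \<tau> (p x) = Some (p' x)"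
  unfolding transition_def using eventually_nhdsin_self by fastforce

lemma transition_move:
  "transition X T T' p p' x \<tau> \<Longrightarrow> \<forall>\<^sub>F z in nhdsin X x. transition X T T' p p' z \<tau>"
  unfolding transition_def using eventually_eventually_nhdsin by fastforce

lemma transition_swap:
  assumes "transition X T T' p p' x \<tau>" shows "transition X T' T p' p x (minv \<tau>)"
  using assms unfolding transition_def by (auto simp: lhomeo_minv minv_Some_iff)

lemma transition_comp:
  assumes "transition X T T' p p' x \<tau>" "transition X T' T'' p' p'' x \<tau>'"
  shows "transition X T T'' p p'' x (\<tau>' \<circ>\<^sub>m \<tau>)"
proof -
  have "\<forall>\<^sub>F z in nhdsin X x. \<tau> (p z) = Some (p' z)" "\<forall>\<^sub>F z in nhdsin X x. \<tau>' (p' z) = Some (p'' z)"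
    using assms by (auto simp: transition_def)
  then have "\<forall>\<^sub>F z in nhdsin X x. (\<tau>' \<circ>\<^sub>m \<tau>) (p z) = Some (p'' z)" by eventually_elim simp
  then show ?thesis using assms lhomeo_comp by (auto simp: transition_def)
qed

lemma transition_unique:
  assumes "submersion X T U p" "x \<in> U" "transition X T T' p p' x \<tau>" "transition X T T' p p' x \<tau>'"
  shows "\<forall>\<^sub>F t in nhdsin T (p x). \<tau> t = \<tau>' t"
proof -
  have "\<forall>\<^sub>F z in nhdsin X x. \<tau> (p z) = Some (p' z)" "\<forall>\<^sub>F z in nhdsin X x. \<tau>' (p z) = Some (p' z)"
    using assms by (auto simp: transition_def)
  then have "\<forall>\<^sub>F z in nhdsin X x. \<tau> (p z) = \<tau>' (p z)" by eventually_elim simp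
  then show ?thesis using eventually_submersion[OF assms(1,2)] by blast
qed

lemma transition_id:
  assumes "submersion X T U p" "x \<in> U" shows "transition X T T p p x (Some |` topspace T)"
proof -
  have "\<forall>\<^sub>F z in nhdsin X x. z \<in> U" using assms by (auto intro: eventually_nhdsin_in simp: submersion_def)
  then have "\<forall>\<^sub>F z in nhdsin X x. (Some |` topspace T) (p z) = Some (p z)"
    by eventually_elim (use assms in \<open>auto simp: submersion_def\<close>)
  then show ?thesis by (simp add: transition_def lhomeo_id)
qed

text \<open>On \<open>N\<close> the maps \<open>p\<close> and \<open>p'\<close> have the same
  fibres, so sending \<open>p z\<close> to \<open>p' z\<close> is well defined and injective. Images
  and preimages of open sets under it are images under \<open>p'\<close> and \<open>p\<close> of
  open subsets of \<open>N\<close>.\<close>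

lemma transition_exists:
  assumes p: "submersion X T U p" and p': "submersion X T' U' p'" and N: "openin X N" "x \<in> N" "N \<subseteq> U \<inter> U'"
    and eq: "\<And>z w. z \<in> N \<Longrightarrow> w \<in> N \<Longrightarrow> p z = p w \<longleftrightarrow> p' z = p' w"
  shows "\<exists>\<tau>. transition X T T' p p' x \<tau>"
proof -
  define \<tau> where "\<tau> t = (if t \<in> p ` N then Some (p' (SOME z. z \<in> N \<and> p z = t)) else None)" for t
  have \<tau>: "\<tau> (p z) = Some (p' z)" if "z \<in> N" for z
  proof -
    have "\<exists>w. w \<in> N \<and> p w = p z" using that by blast
    then have s: "(SOME w. w \<in> N \<and> p w = p z) \<in> N \<and> p (SOME w. w \<in> N \<and> p w = p z) = p z" by (rule someI_ex)
    then show ?thesis using eq that by (auto simp: \<tau>_def)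
  qed
  have \<tau>D: "\<exists>z\<in>N. t = p z \<and> s = p' z" if "\<tau> t = Some s" for t s
  proof -
    have "t \<in> p ` N" using that by (auto simp: \<tau>_def split: if_splits)
    then show ?thesis using \<tau> that by force
  qed
  have "\<tau> \<in> lhomeo T T'"
    unfolding lhomeo_def
  proof (intro CollectI conjI allI impI)
    fix t u s assume "\<tau> t = Some s" "\<tau> u = Some s"
    then obtain z w where "z \<in> N" "t = p z" "s = p' z" "w \<in> N" "u = p w" "s = p' w" using \<tau>D by meson
    then show "t = u" using eq by simp
  next
    have pT: "\<forall>x\<in>U. p x \<in> topspace T" "\<forall>x\<in>U'. p' x \<in> topspace T'" using p p' by (simp_all add: submersion_def)
    show "dom \<tau> \<subseteq> topspace T"
    proof
      fix t assume "t \<in> dom \<tau>"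
      then obtain s where "\<tau> t = Some s" by blast
      then obtain z where "z \<in> N" "t = p z" using \<tau>D by blast
      then show "t \<in> topspace T" using pT(1) N(3) by blast
    qed
    show "ran \<tau> \<subseteq> topspace T'"
    proof
      fix s assume "s \<in> ran \<tau>"
      then obtain t where "\<tau> t = Some s" by (auto simp: ran_def)
      then obtain z where "z \<in> N" "s = p' z" using \<tau>D by blast
      then show "s \<in> topspace T'" using pT(2) N(3) by blast
    qed
  next
    fix W assume W: "openin T W"
    have "{s. \<exists>t\<in>W. \<tau> t = Some s} = p' ` (N \<inter> {x \<in> U. p x \<in> W})"
    proof (intro equalityI subsetI)
      fix s assume "s \<in> {s. \<exists>t\<in>W. \<tau> t = Some s}"
      then obtain t z where "t \<in> W" "z \<in> N" "t = p z" "s = p' z" using \<tau>D by blast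
      then show "s \<in> p' ` (N \<inter> {x \<in> U. p x \<in> W})" using N by blast
    qed (use \<tau> in auto)
    moreover have "openin X (N \<inter> {x \<in> U. p x \<in> W})" using N p W by (auto simp: submersion_def)
    ultimately show "openin T' {s. \<exists>t\<in>W. \<tau> t = Some s}" using p' N(3) by (auto simp: submersion_def)
  next
    fix W assume W: "openin T' W"
    have "{t. \<exists>s\<in>W. \<tau> t = Some s} = p ` (N \<inter> {x \<in> U'. p' x \<in> W})"
    proof (intro equalityI subsetI)
      fix t assume "t \<in> {t. \<exists>s\<in>W. \<tau> t = Some s}"
      then obtain s z where "s \<in> W" "z \<in> N" "t = p z" "s = p' z" using \<tau>D by blast
      then show "t \<in> p ` (N \<inter> {x \<in> U'. p' x \<in> W})" using N by blast
    qed (use \<tau> in auto)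
    moreover have "openin X (N \<inter> {x \<in> U'. p' x \<in> W})" using N p' W by (auto simp: submersion_def)
    ultimately show "openin T {t. \<exists>s\<in>W. \<tau> t = Some s}" using p N(3) by (auto simp: submersion_def)
  qed
  moreover have "\<forall>\<^sub>F z in nhdsin X x. z \<in> N" using N by (auto intro: eventually_nhdsin_in)
  then have "\<forall>\<^sub>F z in nhdsin X x. \<tau> (p z) = Some (p' z)" by eventually_elim (rule \<tau>)
  ultimately show ?thesis unfolding transition_def by blast
qed

text \<open>A connected set inside a plaque of \<phi> meets each plaque of \<psi> in a relatively
  open set, so the transverse coordinate of \<psi> is locally constant on it, hence
  constant.\<close>

lemma dist_submersion_locally_finer:
  assumes A: "foliated_atlas n X Z F" and \<phi>: "\<phi> \<in> F" and \<psi>: "\<psi> \<in> F" and x: "x \<in> dom \<phi> \<inter> dom \<psi>"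
  shows "\<exists>N. openin X N \<and> x \<in> N \<and> N \<subseteq> dom \<phi> \<inter> dom \<psi> \<and>
    (\<forall>z\<in>N. \<forall>w\<in>N. dist_submersion \<phi> z = dist_submersion \<phi> w \<longrightarrow> dist_submersion \<psi> z = dist_submersion \<psi> w)"
proof -
  have ch: "foliated_chart n X Z \<phi>" "foliated_chart n X Z \<psi>" using A \<phi> \<psi> by (auto simp: foliated_atlas_def)
  have "openin X (dom \<phi> \<inter> dom \<psi>)" using ch by (auto simp: foliated_chart_def)
  then obtain N where N: "openin X N" "x \<in> N" "N \<subseteq> dom \<phi> \<inter> dom \<psi>"
    "\<forall>z\<in>N. \<forall>w\<in>N. dist_submersion \<phi> z = dist_submersion \<phi> w \<longrightarrow>
       (\<exists>C. connectedin X C \<and> z \<in> C \<and> w \<in> C \<and> C \<subseteq> dom \<phi> \<inter> dom \<psi> \<and> (\<forall>c\<in>C. dist_submersion \<phi> c = dist_submersion \<phi> z))"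
    by (rule foliated_chart_box[OF ch(1) _ x]) (rule inf_le1)
  have "dist_submersion \<psi> z = dist_submersion \<psi> w"
    if zw: "z \<in> N" "w \<in> N" "dist_submersion \<phi> z = dist_submersion \<phi> w" for z w
  proof -
    obtain C where C: "connectedin X C" "z \<in> C" "w \<in> C" "C \<subseteq> dom \<phi> \<inter> dom \<psi>"
      "\<forall>c\<in>C. dist_submersion \<phi> c = dist_submersion \<phi> z" using N(4) zw by blast
    show ?thesis
    proof (rule connectedin_locally_constant[OF C(1) _ C(2,3)])
      fix c assume c: "c \<in> C"
      let ?P = "{x \<in> dom \<phi>. dist_submersion \<phi> x = dist_submersion \<phi> c}"
      let ?Q = "{x \<in> dom \<psi>. dist_submersion \<psi> x = dist_submersion \<psi> c}"
      have PQ: "?P \<in> plaques \<phi>" "?Q \<in> plaques \<psi>" using c C(4) unfolding plaques_def by blast+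
      have "open_in_both X ?P ?Q" using A \<phi> \<psi> PQ unfolding foliated_atlas_def by blast
      then obtain G where G: "openin X G" "?P \<inter> ?Q = G \<inter> ?P"
        unfolding open_in_both_def openin_subtopology by blast
      have CP: "C \<subseteq> ?P" using C(4,5) c by auto
      have "c \<in> ?P \<inter> ?Q" using c C(4) by blast
      then have cG: "c \<in> G" using G(2) by blast
      have "\<forall>w\<in>G \<inter> C. dist_submersion \<psi> w = dist_submersion \<psi> c"
      proof
        fix w assume "w \<in> G \<inter> C"
        then have "w \<in> ?P \<inter> ?Q" unfolding G(2) using CP by blast
        then show "dist_submersion \<psi> w = dist_submersion \<psi> c" by blast
      qed
      then show "\<exists>N. openin X N \<and> c \<in> N \<and> (\<forall>w\<in>N \<inter> C. dist_submersion \<psi> w = dist_submersion \<psi> c)"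
        using G(1) cG by blast
    qed
  qed
  then show ?thesis using N(1-3) by blast
qed

section \<open>The holonomy pseudogroup of a regular atlas\<close>

lemma Hausdorff_space_sum_topology:
  assumes "\<And>i. i \<in> I \<Longrightarrow> Hausdorff_space (Y i)" shows "Hausdorff_space (sum_topology Y I)"
  unfolding Hausdorff_space_def
proof (intro allI impI)
  fix p q assume pq: "p \<in> topspace (sum_topology Y I) \<and> q \<in> topspace (sum_topology Y I) \<and> p \<noteq> q"
  obtain i z j w where e: "p = (i, z)" "q = (j, w)" by (cases p; cases q)
  have ij: "i \<in> I" "j \<in> I" "z \<in> topspace (Y i)" "w \<in> topspace (Y j)" using pq e by auto
  have o: "openin (sum_topology Y I) ({k} \<times> G)" if "k \<in> I" "openin (Y k) G" for k G
  proof -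
    have "{x. (l, x) \<in> {k} \<times> G} = (if l = k then G else {})" for l by auto
    then show ?thesis using that openin_subset[OF that(2)] by (auto simp: openin_sum_topology)
  qed
  show "\<exists>G K. openin (sum_topology Y I) G \<and> openin (sum_topology Y I) K \<and> p \<in> G \<and> q \<in> K \<and> disjnt G K"
  proof (cases "i = j")
    case True
    then obtain G K where "openin (Y i) G" "openin (Y i) K" "z \<in> G" "w \<in> K" "disjnt G K"
      using assms[OF ij(1)] ij pq e unfolding Hausdorff_space_def by blast
    then show ?thesis using o[OF ij(1)] e True
      by (intro exI[of _ "{i} \<times> G"] exI[of _ "{i} \<times> K"]) (auto simp: disjnt_def)
  next
    case False
    then show ?thesis using o[OF ij(1) openin_topspace] o[OF ij(2) openin_topspace] e ij
      by (intro exI[of _ "{i} \<times> topspace (Y i)"] exI[of _ "{j} \<times> topspace (Y j)"]) (auto simp: disjnt_def)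
  qed
qed

lemma openin_dist_submersion_image:
  assumes ch: "foliated_chart n X Z \<psi>" and W: "openin X W" "W \<subseteq> dom \<psi>"
  shows "openin Z (dist_submersion \<psi> ` W)"
proof -
  obtain B V where V: "openin X (dom \<psi>)" "openin Z V"
    and h: "homeomorphic_map (subtopology X (dom \<psi>))
          (prod_topology (subtopology (Euclidean_space n) B) (subtopology Z V)) (\<lambda>x. the (\<psi> x))"
    using ch unfolding foliated_chart_def by blast
  have "openin (subtopology X (dom \<psi>)) W" using W V by (simp add: openin_open_subtopology)
  then have "openin (prod_topology (subtopology (Euclidean_space n) B) (subtopology Z V)) ((\<lambda>x. the (\<psi> x)) ` W)"
    using h by (simp add: homeomorphic_eq_everything_map open_map_def)
  then have "openin (subtopology Z V) (snd ` (\<lambda>x. the (\<psi> x)) ` W)"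
    using open_map_snd unfolding open_map_def by blast
  moreover have "snd ` (\<lambda>x. the (\<psi> x)) ` W = dist_submersion \<psi> ` W"
    unfolding image_image dist_submersion_def ..
  ultimately show ?thesis using openin_open_subtopology[OF V(2)] by simp
qed

lemma continuous_map_dist_submersion:
  assumes ch: "foliated_chart n X Z \<psi>"
  shows "continuous_map (subtopology X (dom \<psi>)) Z (dist_submersion \<psi>)"
proof -
  obtain B V where "homeomorphic_map (subtopology X (dom \<psi>))
          (prod_topology (subtopology (Euclidean_space n) B) (subtopology Z V)) (\<lambda>x. the (\<psi> x))"
    using ch unfolding foliated_chart_def by blast
  then have "continuous_map (subtopology X (dom \<psi>))
          (prod_topology (subtopology (Euclidean_space n) B) (subtopology Z V)) (\<lambda>x. the (\<psi> x))"
    by (rule homeomorphic_imp_continuous_map)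
  from continuous_map_compose[OF this continuous_map_snd]
  have "continuous_map (subtopology X (dom \<psi>)) (subtopology Z V) (snd \<circ> (\<lambda>x. the (\<psi> x)))" .
  moreover have "snd \<circ> (\<lambda>x. the (\<psi> x)) = dist_submersion \<psi>" by (simp add: fun_eq_iff dist_submersion_def)
  ultimately show ?thesis by (simp add: continuous_map_in_subtopology)
qed

section \<open>One regular atlas with the choices entering the construction\<close>

locale hol =
  fixes n :: nat and X :: "'x topology" and Z :: "'z topology" and F :: "('x, 'z) fchart set" and x0 :: 'x
    and I :: "'i set" and \<phi> :: "'i \<Rightarrow> ('x, 'z) fchart" and i0 :: 'i and U S C C0
  assumes fs: "foliated_space n X Z F"
    and reg: "regular_foliated_atlas n X Z F I \<phi>"
    and i0: "i0 \<in> I" and x0: "x0 \<in> dom (\<phi> i0)"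
    and cc: "construction_choice (transversal Z I \<phi>) (holonomy_pseudogroup Z I \<phi>)
      (to_transversal \<phi> i0 x0) U S C C0"
begin

abbreviation "T \<equiv> transversal Z I \<phi>"
abbreviation "H \<equiv> holonomy_pseudogroup Z I \<phi>"
abbreviation "p \<equiv> to_transversal \<phi>"
abbreviation "t0 \<equiv> to_transversal \<phi> i0 x0"

lemma atlas: "foliated_atlas n X Z F"
  using fs by (simp add: foliated_space_def foliated_structure_def)

lemma chart_in: "i \<in> I \<Longrightarrow> \<phi> i \<in> F"
  using reg by (simp add: regular_foliated_atlas_def)

lemma chart: "i \<in> I \<Longrightarrow> foliated_chart n X Z (\<phi> i)"
  using atlas chart_in by (simp add: foliated_atlas_def)

lemma chart_cover: "x \<in> topspace X \<Longrightarrow> \<exists>i\<in>I. x \<in> dom (\<phi> i)"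
proof -
  have "(\<Union>i\<in>I. dom (\<phi> i)) = topspace X" using reg by (simp add: regular_foliated_atlas_def)
  then show "x \<in> topspace X \<Longrightarrow> \<exists>i\<in>I. x \<in> dom (\<phi> i)" by blast
qed

lemma openin_chart_dom: "i \<in> I \<Longrightarrow> openin X (dom (\<phi> i))"
  using chart by (simp add: foliated_chart_def)

lemma chart_dom_topspace: "i \<in> I \<Longrightarrow> x \<in> dom (\<phi> i) \<Longrightarrow> x \<in> topspace X"
  using openin_chart_dom openin_subset by blast

lemma p_eq_iff: "p i x = p j y \<longleftrightarrow> i = j \<and> dist_submersion (\<phi> i) x = dist_submersion (\<phi> j) y"
  by (simp add: to_transversal_def)

lemma openin_image_dom: "i \<in> I \<Longrightarrow> openin Z (dist_submersion (\<phi> i) ` dom (\<phi> i))"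
  using openin_dist_submersion_image[OF chart openin_chart_dom] by blast

lemma submersion_p:
  assumes i: "i \<in> I" shows "submersion X T (dom (\<phi> i)) (p i)"
  unfolding submersion_def
proof (intro conjI ballI allI impI)
  show "openin X (dom (\<phi> i))" by (rule openin_chart_dom[OF i])
  fix x assume "x \<in> dom (\<phi> i)"
  then show "p i x \<in> topspace T"
    using i openin_subset[OF openin_image_dom[OF i]] by (auto simp: transversal_def to_transversal_def)
next
  fix W assume W: "openin X W" "W \<subseteq> dom (\<phi> i)"
  have e: "{z. (k, z) \<in> p i ` W} = (if k = i then dist_submersion (\<phi> i) ` W else {})" for k
    by (auto simp: to_transversal_def image_iff)
  have o: "openin (subtopology Z (dist_submersion (\<phi> i) ` dom (\<phi> i))) (dist_submersion (\<phi> i) ` W)"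
    using openin_dist_submersion_image[OF chart[OF i] W] openin_open_subtopology[OF openin_image_dom[OF i]] W(2)
    by blast
  have s: "p i ` W \<subseteq> Sigma I (topspace \<circ> (\<lambda>i. subtopology Z (dist_submersion (\<phi> i) ` dom (\<phi> i))))"
  proof (rule subrelI)
    fix k z assume "(k, z) \<in> p i ` W"
    then obtain x where x: "x \<in> W" "k = i" "z = dist_submersion (\<phi> i) x"
      unfolding to_transversal_def by (elim imageE) simp
    have "x \<in> dom (\<phi> i)" using x(1) W(2) by (rule subsetD[rotated])
    then have "z \<in> dist_submersion (\<phi> i) ` dom (\<phi> i)" unfolding x(3) by (rule imageI)
    then show "(k, z) \<in> Sigma I (topspace \<circ> (\<lambda>i. subtopology Z (dist_submersion (\<phi> i) ` dom (\<phi> i))))"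
      using i x(2) openin_subset[OF openin_image_dom[OF i]] by auto
  qed
  show "openin T (p i ` W)" unfolding transversal_def openin_sum_topology
  proof (intro conjI ballI s)
    fix k assume "k \<in> I"
    show "openin (subtopology Z (dist_submersion (\<phi> k) ` dom (\<phi> k))) {z. (k, z) \<in> p i ` W}"
      unfolding e using o by (cases "k = i") simp_all
  qed
next
  fix W assume W: "openin T W"
  then have "openin (subtopology Z (dist_submersion (\<phi> i) ` dom (\<phi> i))) {z. (i, z) \<in> W}"
    using i unfolding transversal_def openin_sum_topology by blast
  then have "openin Z {z. (i, z) \<in> W}" using openin_open_subtopology[OF openin_image_dom[OF i]] by blast
  then have "openin (subtopology X (dom (\<phi> i))) {x \<in> topspace (subtopology X (dom (\<phi> i))). dist_submersion (\<phi> i) x \<in> {z. (i, z) \<in> W}}"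
    by (rule openin_continuous_map_preimage[OF continuous_map_dist_submersion[OF chart[OF i]]])
  moreover have "{x \<in> topspace (subtopology X (dom (\<phi> i))). dist_submersion (\<phi> i) x \<in> {z. (i, z) \<in> W}} = {x \<in> dom (\<phi> i). p i x \<in> W}"
    using chart_dom_topspace[OF i] unfolding to_transversal_def topspace_subtopology
    by (intro Collect_cong) blast
  ultimately show "openin X {x \<in> dom (\<phi> i). p i x \<in> W}"
    using openin_open_subtopology[OF openin_chart_dom[OF i]] by simp
qed

lemma topspace_T: "t \<in> topspace T \<longleftrightarrow> (\<exists>i\<in>I. \<exists>x\<in>dom (\<phi> i). t = p i x)"
proof
  assume "t \<in> topspace T"
  then obtain i z where "i \<in> I" "z \<in> dist_submersion (\<phi> i) ` dom (\<phi> i)" "t = (i, z)"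
    by (auto simp: transversal_def)
  then show "\<exists>i\<in>I. \<exists>x\<in>dom (\<phi> i). t = p i x" unfolding to_transversal_def by blast
next
  assume "\<exists>i\<in>I. \<exists>x\<in>dom (\<phi> i). t = p i x"
  then obtain i x where "i \<in> I" "x \<in> dom (\<phi> i)" "t = p i x" by (elim bexE)
  then show "t \<in> topspace T" using submersion_p[of i] by (simp add: submersion_def)
qed

text \<open>The closure of \<open>S\<close> generates a pseudogroup, which contains the identity.
  Near \<open>t\<close> the identity is thus a compact-open limit of elements of \<open>S\<close>
  with a fixed domain containing \<open>t\<close>; since the closure of the empty set is empty,
  there is such an element.\<close>

lemma covered:
  assumes "t \<in> topspace T" shows "\<exists>f\<in>S. t \<in> dom f"
proof -
  have sq: "strongly_quasi_analytic_with T (pseudogroup_closure T S) (pseudostar_closure T S)"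
    using cc by (simp add: construction_choice_def)
  have "pseudostar_closure T S \<subseteq> lhomeo T T" using pseudostar_closure_lhomeo by blast
  then have "pseudogroup T (pseudogroup_closure T S)"
    using sq pseudogroup_generated[of "pseudostar_closure T S" T] by (simp add: strongly_quasi_analytic_with_def)
  then have "Some |` topspace T \<in> pseudogroup_closure T S" by (rule pg_id)
  then obtain W where W: "t \<in> W" "Some |` topspace T |` W \<in> pseudostar_closure T S"
    using assms unfolding pseudogroup_closure_iff by force
  let ?h = "Some |` topspace T |` W"
  have td: "t \<in> dom ?h" using W assms by simp
  have "?h \<in> compact_open_topology T (dom ?h) closure_of {f \<in> S. dom f = dom ?h}"
    using W(2) by (simp add: pseudostar_closure_iff)
  then have "{f \<in> S. dom f = dom ?h} \<noteq> {}" by (metis closure_of_empty empty_iff)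
  then obtain f where "f \<in> S" "dom f = dom ?h" by (auto simp only: mem_Collect_eq ex_in_conv[symmetric])
  then show ?thesis using td by metis
qed

sublocale eqc_pseudogroup T H S U C
proof
  have Z: "Hausdorff_space Z" "locally_compact_space Z"
    using fs by (auto simp: foliated_space_def locally_compact_Polish_def
        intro: metrizable_imp_Hausdorff_space completely_metrizable_imp_metrizable_space)
  show "Hausdorff_space T"
    unfolding transversal_def by (intro Hausdorff_space_sum_topology Hausdorff_space_subtopology Z)
  show "locally_compact_space T"
    unfolding transversal_def locally_compact_space_sum_topology
    using locally_compact_space_open_subset[OF _ Z(2) openin_image_dom] Z(1) by blast
  show "compactly_generated_with T H U" "local_pseudostar_group T S" "equicontinuous_with T H S C"
    "strongly_quasi_analytic_with T H S"
    using cc by (simp_all add: construction_choice_def)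
qed (rule covered)

lemma cocycle_in_H: "i \<in> I \<Longrightarrow> j \<in> I \<Longrightarrow> cocycle_map \<phi> i j \<in> H"
  unfolding holonomy_pseudogroup_def by (rule subsetD[OF generated_pseudogroup_superset]) blast

text \<open>By regularity the plaque of \<open>\<phi> i\<close> through \<open>z\<close> meets only
  one plaque of \<open>\<phi> j\<close>, so the description defining the cocycle map has a unique
  solution.\<close>

lemma cocycle_map_p:
  assumes ij: "i \<in> I" "j \<in> I" and z: "z \<in> dom (\<phi> i) \<inter> dom (\<phi> j)"
  shows "cocycle_map \<phi> i j (p i z) = Some (p j z)"
proof -
  have "p j x = p j z" if x: "x \<in> dom (\<phi> i) \<inter> dom (\<phi> j)" "p i x = p i z" for x
  proof -
    let ?P = "{y \<in> dom (\<phi> i). dist_submersion (\<phi> i) y = dist_submersion (\<phi> i) z}"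
    let ?Q = "\<lambda>w. {y \<in> dom (\<phi> j). dist_submersion (\<phi> j) y = dist_submersion (\<phi> j) w}"
    have "?P \<in> plaques (\<phi> i)" "?Q x \<in> plaques (\<phi> j)" "?Q z \<in> plaques (\<phi> j)"
      using x z unfolding plaques_def by blast+
    moreover have "?P \<inter> ?Q x \<noteq> {}" "?P \<inter> ?Q z \<noteq> {}" using x z by (auto simp: p_eq_iff)
    moreover have "\<forall>i\<in>I. \<forall>j\<in>I. \<forall>P\<in>plaques (\<phi> i). \<forall>Q\<in>plaques (\<phi> j). \<forall>Q'\<in>plaques (\<phi> j).
        P \<inter> Q \<noteq> {} \<and> P \<inter> Q' \<noteq> {} \<longrightarrow> Q = Q'" using reg by (simp add: regular_foliated_atlas_def)
    ultimately have "?Q x = ?Q z" using ij by (metis (no_types, lifting))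
    moreover have "x \<in> ?Q x" using x(1) by simp
    ultimately have "x \<in> ?Q z" by (simp only:)
    then show ?thesis by (simp add: p_eq_iff)
  qed
  then have "(THE s. \<exists>x\<in>dom (\<phi> i) \<inter> dom (\<phi> j). p i x = p i z \<and> p j x = s) = p j z"
    using z by (intro the_equality) blast+
  then show ?thesis using z by (simp add: cocycle_map_def)
qed

lemma cocycle_map_dom: "cocycle_map \<phi> i j t = Some s \<Longrightarrow> \<exists>z\<in>dom (\<phi> i) \<inter> dom (\<phi> j). t = p i z"
  by (auto simp: cocycle_map_def split: if_splits)

text \<open>The cocycle map is a local homeomorphism as an element of \<open>H\<close>, which is a
  pseudogroup because it is generated by \<open>S\<close>.\<close>

lemma cocycle_transition:
  assumes ij: "i \<in> I" "j \<in> I" and z: "z \<in> dom (\<phi> i) \<inter> dom (\<phi> j)"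
  shows "transition X T T (p i) (p j) z (cocycle_map \<phi> i j)"
proof -
  have "\<forall>\<^sub>F w in nhdsin X z. w \<in> dom (\<phi> i) \<inter> dom (\<phi> j)"
    using z openin_chart_dom[OF ij(1)] openin_chart_dom[OF ij(2)] by (intro eventually_nhdsin_in openin_Int)
  then have "\<forall>\<^sub>F w in nhdsin X z. cocycle_map \<phi> i j (p i w) = Some (p j w)"
    by eventually_elim (rule cocycle_map_p[OF ij])
  then show ?thesis using H_lhomeo[OF cocycle_in_H[OF ij]] by (simp add: transition_def)
qed

end

section \<open>Equivalence of the holonomy pseudogroups of two atlases\<close>

locale hol_pair = A: hol n X Z F x0 I \<phi> i0 U S C C0 + B: hol n X Z F x0 I' \<phi>' j0 U' S' C' C0'
  for n :: nat and X :: "'x topology" and Z :: "'z topology" and F :: "('x, 'z) fchart set" and x0 :: 'x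
    and I :: "'i set" and \<phi> :: "'i \<Rightarrow> ('x, 'z) fchart" and i0 :: 'i and U S C C0
    and I' :: "'j set" and \<phi>' :: "'j \<Rightarrow> ('x, 'z) fchart" and j0 :: 'j and U' S' C' C0'
begin

abbreviation "tr i a \<equiv> transition X A.T B.T (A.p i) (B.p a)"

lemma tr_exists:
  assumes "i \<in> I" "a \<in> I'" "x \<in> dom (\<phi> i) \<inter> dom (\<phi>' a)"
  shows "\<exists>\<sigma>. tr i a x \<sigma>"
proof -
  obtain N1 where N1: "openin X N1" "x \<in> N1" "N1 \<subseteq> dom (\<phi> i) \<inter> dom (\<phi>' a)"
    "\<forall>z\<in>N1. \<forall>w\<in>N1. dist_submersion (\<phi> i) z = dist_submersion (\<phi> i) w \<longrightarrow> dist_submersion (\<phi>' a) z = dist_submersion (\<phi>' a) w"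
    using dist_submersion_locally_finer[OF A.atlas A.chart_in[OF assms(1)] B.chart_in[OF assms(2)] assms(3)] by blast
  obtain N2 where N2: "openin X N2" "x \<in> N2" "N2 \<subseteq> dom (\<phi>' a) \<inter> dom (\<phi> i)"
    "\<forall>z\<in>N2. \<forall>w\<in>N2. dist_submersion (\<phi>' a) z = dist_submersion (\<phi>' a) w \<longrightarrow> dist_submersion (\<phi> i) z = dist_submersion (\<phi> i) w"
    using dist_submersion_locally_finer[OF A.atlas B.chart_in[OF assms(2)] A.chart_in[OF assms(1)], of x] assms(3) by blast
  show ?thesis
  proof (rule transition_exists[OF A.submersion_p[OF assms(1)] B.submersion_p[OF assms(2)]])
    show "openin X (N1 \<inter> N2)" "x \<in> N1 \<inter> N2" "N1 \<inter> N2 \<subseteq> dom (\<phi> i) \<inter> dom (\<phi>' a)"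
      using openin_Int[OF N1(1) N2(1)] N1(2,3) N2(2) by blast+
    fix z w assume "z \<in> N1 \<inter> N2" "w \<in> N1 \<inter> N2"
    then show "A.p i z = A.p i w \<longleftrightarrow> B.p a z = B.p a w"
      using N1(4) N2(4) unfolding A.p_eq_iff B.p_eq_iff by blast
  qed
qed

text \<open>Two charts of the second atlas at the same point differ by a cocycle map, and
  transitions are unique as germs.\<close>

lemma tr_change:
  assumes ia: "i \<in> I" "a \<in> I'" "b \<in> I'" and x: "x \<in> dom (\<phi> i)" "x \<in> dom (\<phi>' a)" "x \<in> dom (\<phi>' b)"
    and \<sigma>: "tr i a x \<sigma>" "tr i b x \<sigma>'"
  shows "\<exists>g\<in>B.H. \<forall>\<^sub>F t in nhdsin A.T (A.p i x). (g \<circ>\<^sub>m \<sigma>) t = \<sigma>' t"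
proof -
  have "tr i b x (cocycle_map \<phi>' a b \<circ>\<^sub>m \<sigma>)"
    using transition_comp[OF \<sigma>(1) B.cocycle_transition] ia x by blast
  then show ?thesis
    using transition_unique[OF A.submersion_p[OF ia(1)] x(1) _ \<sigma>(2)] B.cocycle_in_H ia by blast
qed

lemma eventually_comp_trans:
  assumes "\<sigma> \<in> lhomeo T1 T2" "\<sigma> t = Some s" "\<forall>\<^sub>F z in nhdsin T1 t. (g \<circ>\<^sub>m \<sigma>) z = f z"
    and "\<forall>\<^sub>F z in nhdsin T1 t. (h \<circ>\<^sub>m f) z = k z"
  shows "\<forall>\<^sub>F z in nhdsin T1 t. ((h \<circ>\<^sub>m g) \<circ>\<^sub>m \<sigma>) z = k z"
  using assms(3,4) by eventually_elim (metis map_comp_assoc map_comp_def)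

text \<open>The set of points of the plaque where the claim holds is open and closed, as a transition at
  one point is also a transition at the nearby points.\<close>

lemma tr_plaque:
  assumes ia: "i \<in> I" "a \<in> I'" "b \<in> I'" and x: "x \<in> dom (\<phi> i)" "x \<in> dom (\<phi>' a)"
    and z: "z \<in> dom (\<phi> i)" "z \<in> dom (\<phi>' b)" and xz: "A.p i x = A.p i z"
    and \<sigma>: "tr i a x \<sigma>" "tr i b z \<sigma>'"
  shows "\<exists>g\<in>B.H. \<forall>\<^sub>F t in nhdsin A.T (A.p i x). (g \<circ>\<^sub>m \<sigma>) t = \<sigma>' t"
proof -
  let ?t = "A.p i x"
  let ?P = "{w \<in> dom (\<phi> i). dist_submersion (\<phi> i) w = dist_submersion (\<phi> i) x}"
  let ?E = "\<lambda>\<sigma>1. \<exists>g\<in>B.H. \<forall>\<^sub>F t in nhdsin A.T ?t. (g \<circ>\<^sub>m \<sigma>) t = \<sigma>1 t"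
  let ?G = "\<lambda>w. \<exists>c\<in>I'. \<exists>\<sigma>1. w \<in> dom (\<phi>' c) \<and> tr i c w \<sigma>1 \<and> ?E \<sigma>1"
  have \<sigma>x: "\<sigma> \<in> lhomeo A.T B.T" "\<sigma> ?t = Some (B.p a x)"
    using \<sigma>(1) transition_self[OF \<sigma>(1) A.chart_dom_topspace[OF ia(1) x(1)]] by (auto simp: transition_def)
  have pP: "A.p i w = ?t" if "w \<in> ?P" for w using that by (simp add: A.p_eq_iff)
  \<comment> \<open>At a given point of the plaque, the claim for one transition implies it for all:
    two of them differ by an element of \<open>B.H\<close>, with which \<open>g\<close> can be
    composed.\<close>
  have any: "?E \<sigma>1" if w: "w \<in> ?P" "?G w" and c: "c \<in> I'" "w \<in> dom (\<phi>' c)" "tr i c w \<sigma>1" for w c \<sigma>1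
  proof -
    obtain c' \<sigma>2 g where g: "c' \<in> I'" "w \<in> dom (\<phi>' c')" "tr i c' w \<sigma>2" "g \<in> B.H"
      "\<forall>\<^sub>F t in nhdsin A.T ?t. (g \<circ>\<^sub>m \<sigma>) t = \<sigma>2 t" using w(2) by blast
    have "w \<in> dom (\<phi> i)" using w by blast
    then obtain h where h: "h \<in> B.H" "\<forall>\<^sub>F t in nhdsin A.T ?t. (h \<circ>\<^sub>m \<sigma>2) t = \<sigma>1 t"
      using tr_change[OF ia(1) g(1) c(1) _ g(2) c(2) g(3) c(3)] pP[OF w(1)] by auto
    have "\<forall>\<^sub>F t in nhdsin A.T ?t. ((h \<circ>\<^sub>m g) \<circ>\<^sub>m \<sigma>) t = \<sigma>1 t"
      by (rule eventually_comp_trans[OF \<sigma>x g(5) h(2)])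
    then show ?thesis using B.H_comp[OF g(4) h(1)] by blast
  qed
  have "?G x = ?G z"
  proof (rule connectedin_locally_constant[OF connectedin_fibre[OF A.chart[OF ia(1)], of "dist_submersion (\<phi> i) x"], of ?G])
    fix w assume w: "w \<in> ?P"
    then have wX: "w \<in> topspace X" using A.chart_dom_topspace[OF ia(1)] by blast
    obtain c where c: "c \<in> I'" "w \<in> dom (\<phi>' c)" using B.chart_cover[OF wX] by blast
    then obtain \<sigma>1 where \<sigma>1: "tr i c w \<sigma>1" using tr_exists[OF ia(1) c(1)] w by blast
    have "\<forall>\<^sub>F v in nhdsin X w. tr i c v \<sigma>1 \<and> v \<in> dom (\<phi>' c)"
      using transition_move[OF \<sigma>1] eventually_nhdsin_in[OF B.openin_chart_dom[OF c(1)] c(2)]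
      by eventually_elim simp
    then obtain N where N: "openin X N" "w \<in> N" "\<And>v. v \<in> N \<Longrightarrow> tr i c v \<sigma>1 \<and> v \<in> dom (\<phi>' c)"
      using wX by (elim eventually_nhdsinD) auto
    have G: "?G v \<longleftrightarrow> ?E \<sigma>1" if v: "v \<in> N" "v \<in> ?P" for v
    proof
      assume "?G v"
      then show "?E \<sigma>1" using any[OF v(2)] N(3)[OF v(1)] c(1) by blast
    next
      assume "?E \<sigma>1"
      then show "?G v" using N(3)[OF v(1)] c(1) by blast
    qed
    have "\<forall>v\<in>N \<inter> ?P. ?G v = ?G w" using G G[OF N(2) w] by blast
    then show "\<exists>N. openin X N \<and> w \<in> N \<and> (\<forall>v\<in>N \<inter> ?P. ?G v = ?G w)" using N(1,2) by blast
  qed (use x z xz in \<open>auto simp: A.p_eq_iff\<close>)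
  moreover have "?G x"
  proof -
    have "\<forall>\<^sub>F t in nhdsin A.T ?t. (Some |` topspace B.T \<circ>\<^sub>m \<sigma>) t = \<sigma> t"
      by (rule always_eventually) (use lhomeo_in_topspace(2)[OF \<sigma>x(1)] in
          \<open>auto simp: map_comp_def split: option.splits\<close>)
    then show ?thesis using B.H_id ia(2) x(2) \<sigma>(1) by blast
  qed
  ultimately have "?G z" by simp
  moreover have "z \<in> ?P" using z(1) xz by (simp add: A.p_eq_iff)
  ultimately show ?thesis using any ia(3) z(2) \<sigma>(2) by blast
qed

text \<open>The condition ranges over all points and transitions above \<open>t\<close> and
  \<open>h t\<close>, not over some: for a composite it then suffices to pick any point above the
  intermediate value.\<close>

definition conjugated :: "'i \<times> 'z \<Rightarrow> ('i \<times> 'z \<rightharpoonup> 'i \<times> 'z) \<Rightarrow> bool" where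
  "conjugated t h \<longleftrightarrow> (\<forall>i\<in>I. \<forall>a\<in>I'. \<forall>j\<in>I. \<forall>b\<in>I'. \<forall>x \<sigma> y \<sigma>'. x \<in> dom (\<phi> i) \<longrightarrow> x \<in> dom (\<phi>' a) \<longrightarrow>
     tr i a x \<sigma> \<longrightarrow> y \<in> dom (\<phi> j) \<longrightarrow> y \<in> dom (\<phi>' b) \<longrightarrow> tr j b y \<sigma>' \<longrightarrow> t = A.p i x \<longrightarrow> h t = Some (A.p j y) \<longrightarrow>
     (\<exists>g\<in>B.H. \<forall>\<^sub>F z in nhdsin A.T t. (g \<circ>\<^sub>m \<sigma>) z = (\<sigma>' \<circ>\<^sub>m h) z))"

lemma conjugatedD:
  assumes "conjugated t h" "i \<in> I" "a \<in> I'" "j \<in> I" "b \<in> I'" "x \<in> dom (\<phi> i)" "x \<in> dom (\<phi>' a)"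
    "tr i a x \<sigma>" "y \<in> dom (\<phi> j)" "y \<in> dom (\<phi>' b)" "tr j b y \<sigma>'" "t = A.p i x" "h t = Some (A.p j y)"
  shows "\<exists>g\<in>B.H. \<forall>\<^sub>F z in nhdsin A.T t. (g \<circ>\<^sub>m \<sigma>) z = (\<sigma>' \<circ>\<^sub>m h) z"
  using assms unfolding conjugated_def by blast

lemma point_chart:
  assumes "t \<in> topspace A.T"
  obtains i x a \<sigma> where "i \<in> I" "x \<in> dom (\<phi> i)" "a \<in> I'" "x \<in> dom (\<phi>' a)" "tr i a x \<sigma>" "t = A.p i x"
proof -
  obtain i x where ix: "i \<in> I" "x \<in> dom (\<phi> i)" "t = A.p i x" using assms A.topspace_T by blast
  obtain a where a: "a \<in> I'" "x \<in> dom (\<phi>' a)" using B.chart_cover[OF A.chart_dom_topspace[OF ix(1,2)]] by blast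
  obtain \<sigma> where "tr i a x \<sigma>" using tr_exists[OF ix(1) a(1)] ix a by blast
  then show ?thesis using that ix a by blast
qed

lemma trD:
  assumes "tr i a x \<sigma>" "i \<in> I" "x \<in> dom (\<phi> i)"
  shows "\<sigma> \<in> lhomeo A.T B.T" "\<sigma> (A.p i x) = Some (B.p a x)"
  using assms transition_self[OF assms(1) A.chart_dom_topspace[OF assms(2,3)]] by (auto simp: transition_def)

text \<open>Induction over the generated pseudogroup. The points above \<open>t\<close> and
  \<open>h t\<close> are arbitrary in their plaques, so already the identity requires
  \<open>tr_plaque\<close>, that is, the connectedness of plaques.\<close>

lemma holonomy_conjugated: "A.H \<subseteq> {h \<in> lhomeo A.T A.T. \<forall>t\<in>dom h. conjugated t h}"
  unfolding holonomy_pseudogroup_def[of Z I \<phi>]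
proof (rule generated_pseudogroup_minimal)
  show "pseudogroup A.T {h \<in> lhomeo A.T A.T. \<forall>t\<in>dom h. conjugated t h}"
  proof (rule pseudogroup_germ_closed)
    fix t and h k :: "'i \<times> 'z \<rightharpoonup> 'i \<times> 'z"
    assume h: "h \<in> lhomeo A.T A.T" "t \<in> dom h" and hk: "\<forall>\<^sub>F z in nhdsin A.T t. h z = k z" and c: "conjugated t h"
    have "h t = k t" using eventually_nhdsin_self[OF hk] h lhomeo_in_topspace(1)[OF h(1)] by blast
    show "conjugated t k"
      unfolding conjugated_def
    proof (intro ballI allI impI)
      fix i a j b x \<sigma> y \<sigma>'
      assume *: "i \<in> I" "a \<in> I'" "j \<in> I" "b \<in> I'" "x \<in> dom (\<phi> i)" "x \<in> dom (\<phi>' a)" "tr i a x \<sigma>"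
        "y \<in> dom (\<phi> j)" "y \<in> dom (\<phi>' b)" "tr j b y \<sigma>'" "t = A.p i x" "k t = Some (A.p j y)"
      then have "h t = Some (A.p j y)" using \<open>h t = k t\<close> by simp
      from conjugatedD[OF c *(1-11) this] obtain g where
        g: "g \<in> B.H" "\<forall>\<^sub>F z in nhdsin A.T t. (g \<circ>\<^sub>m \<sigma>) z = (\<sigma>' \<circ>\<^sub>m h) z" by blast
      have "\<forall>\<^sub>F z in nhdsin A.T t. (g \<circ>\<^sub>m \<sigma>) z = (\<sigma>' \<circ>\<^sub>m k) z"
        using g(2) hk by eventually_elim (simp add: map_comp_def)
      then show "\<exists>g\<in>B.H. \<forall>\<^sub>F z in nhdsin A.T t. (g \<circ>\<^sub>m \<sigma>) z = (\<sigma>' \<circ>\<^sub>m k) z" using g(1) by blast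
    qed
  next
    fix t assume t: "t \<in> topspace A.T"
    show "conjugated t (Some |` topspace A.T)"
      unfolding conjugated_def
    proof (intro ballI allI impI)
      fix i a j b x \<sigma> y \<sigma>'
      assume *: "i \<in> I" "a \<in> I'" "j \<in> I" "b \<in> I'" "x \<in> dom (\<phi> i)" "x \<in> dom (\<phi>' a)" "tr i a x \<sigma>"
        "y \<in> dom (\<phi> j)" "y \<in> dom (\<phi>' b)" "tr j b y \<sigma>'" "t = A.p i x" "(Some |` topspace A.T) t = Some (A.p j y)"
      then have e: "A.p i x = A.p j y" using t by simp
      then have ij: "i = j" by (simp add: A.p_eq_iff)
      from tr_plaque[OF *(1,2,4,5,6) _ *(9) _ *(7)] obtain g where
        g: "g \<in> B.H" "\<forall>\<^sub>F z in nhdsin A.T t. (g \<circ>\<^sub>m \<sigma>) z = \<sigma>' z"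
        using *(8,10,11) e unfolding ij by blast
      have "\<forall>\<^sub>F z in nhdsin A.T t. z \<in> topspace A.T" using t by (intro eventually_nhdsin_in) auto
      with g(2) have "\<forall>\<^sub>F z in nhdsin A.T t. (g \<circ>\<^sub>m \<sigma>) z = (\<sigma>' \<circ>\<^sub>m (Some |` topspace A.T)) z"
        by eventually_elim (simp add: map_comp_def restrict_map_def)
      then show "\<exists>g\<in>B.H. \<forall>\<^sub>F z in nhdsin A.T t. (g \<circ>\<^sub>m \<sigma>) z = (\<sigma>' \<circ>\<^sub>m (Some |` topspace A.T)) z" using g(1) by blast
    qed
  next
    fix t s and h k :: "'i \<times> 'z \<rightharpoonup> 'i \<times> 'z"
    assume h: "h \<in> lhomeo A.T A.T" and k: "k \<in> lhomeo A.T A.T" and hs: "h t = Some s"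
      and c: "conjugated t h" "conjugated s k"
    show "conjugated t (k \<circ>\<^sub>m h)"
      unfolding conjugated_def
    proof (intro ballI allI impI)
      fix i a j b x \<sigma> y \<sigma>'
      assume *: "i \<in> I" "a \<in> I'" "j \<in> I" "b \<in> I'" "x \<in> dom (\<phi> i)" "x \<in> dom (\<phi>' a)" "tr i a x \<sigma>"
        "y \<in> dom (\<phi> j)" "y \<in> dom (\<phi>' b)" "tr j b y \<sigma>'" "t = A.p i x" "(k \<circ>\<^sub>m h) t = Some (A.p j y)"
      have sT: "s \<in> topspace A.T" using lhomeo_in_topspace(2)[OF h hs] .
      \<comment> \<open>Any point and transition above the intermediate \<open>s\<close> will do,
        since both hypotheses hold for all choices.\<close>
      obtain i1 x1 a1 \<sigma>1 where 1: "i1 \<in> I" "x1 \<in> dom (\<phi> i1)" "a1 \<in> I'" "x1 \<in> dom (\<phi>' a1)" "tr i1 a1 x1 \<sigma>1" "s = A.p i1 x1"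
        by (rule point_chart[OF sT])
      have ks: "k s = Some (A.p j y)" using *(12) hs by simp
      obtain g where g: "g \<in> B.H" "\<forall>\<^sub>F z in nhdsin A.T t. (g \<circ>\<^sub>m \<sigma>) z = (\<sigma>1 \<circ>\<^sub>m h) z"
        using conjugatedD[OF c(1) *(1,2) 1(1,3) *(5,6,7) 1(2,4,5) *(11)] hs 1(6) by blast
      obtain g' where g': "g' \<in> B.H" "\<forall>\<^sub>F z in nhdsin A.T s. (g' \<circ>\<^sub>m \<sigma>1) z = (\<sigma>' \<circ>\<^sub>m k) z"
        using conjugatedD[OF c(2) 1(1,3) *(3,4) 1(2,4,5) *(8,9,10) 1(6) ks] by blast
      have "\<forall>\<^sub>F z in nhdsin A.T t. ((g' \<circ>\<^sub>m \<sigma>1) \<circ>\<^sub>m h) z = ((\<sigma>' \<circ>\<^sub>m k) \<circ>\<^sub>m h) z"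
        by (rule eventually_map_comp_cong[OF h hs _ g'(2)]) simp
      then have "\<forall>\<^sub>F z in nhdsin A.T t. (g' \<circ>\<^sub>m (\<sigma>1 \<circ>\<^sub>m h)) z = (\<sigma>' \<circ>\<^sub>m (k \<circ>\<^sub>m h)) z"
        unfolding map_comp_assoc .
      with g(2) have "\<forall>\<^sub>F z in nhdsin A.T t. ((g' \<circ>\<^sub>m g) \<circ>\<^sub>m \<sigma>) z = (\<sigma>' \<circ>\<^sub>m (k \<circ>\<^sub>m h)) z"
        unfolding map_comp_assoc by eventually_elim (simp add: map_comp_def)
      then show "\<exists>g\<in>B.H. \<forall>\<^sub>F z in nhdsin A.T t. (g \<circ>\<^sub>m \<sigma>) z = (\<sigma>' \<circ>\<^sub>m (k \<circ>\<^sub>m h)) z"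
        using B.H_comp[OF g(1) g'(1)] by blast
    qed
  next
    fix t s and h :: "'i \<times> 'z \<rightharpoonup> 'i \<times> 'z"
    assume h: "h \<in> lhomeo A.T A.T" and hs: "h t = Some s" and c: "conjugated t h"
    show "conjugated s (minv h)"
      unfolding conjugated_def
    proof (intro ballI allI impI)
      fix i a j b x \<sigma> y \<sigma>'
      assume *: "i \<in> I" "a \<in> I'" "j \<in> I" "b \<in> I'" "x \<in> dom (\<phi> i)" "x \<in> dom (\<phi>' a)" "tr i a x \<sigma>"
        "y \<in> dom (\<phi> j)" "y \<in> dom (\<phi>' b)" "tr j b y \<sigma>'" "s = A.p i x" "minv h s = Some (A.p j y)"
      have ty: "t = A.p j y" using *(12) hs minv_Some_iff[OF h] by (metis option.inject)
      have hx: "h t = Some (A.p i x)" using hs *(11) by simp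
      obtain g where g: "g \<in> B.H" "\<forall>\<^sub>F z in nhdsin A.T t. (g \<circ>\<^sub>m \<sigma>') z = (\<sigma> \<circ>\<^sub>m h) z"
        using conjugatedD[OF c *(3,4,1,2,8,9,10,5,6,7) ty hx] by blast
      have gl: "g \<in> lhomeo B.T B.T" using B.H_lhomeo[OF g(1)] .
      have \<sigma>l: "\<sigma>' \<in> lhomeo A.T B.T" "\<sigma>' t = Some (B.p b y)" using trD[OF *(10,3,8)] ty by auto
      have d: "\<forall>\<^sub>F z in nhdsin A.T t. z \<in> dom \<sigma>'" "\<forall>\<^sub>F z in nhdsin A.T t. z \<in> dom h"
        "\<forall>\<^sub>F z in nhdsin A.T t. z \<in> dom (\<sigma> \<circ>\<^sub>m h)"
        using \<sigma>l h hs trD[OF *(7,1,5)] *(11) lhomeo_comp[OF h trD(1)[OF *(7,1,5)]]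
        by (auto intro!: eventually_nhdsin_in lhomeo_openin_dom simp: map_comp_Some_iff)
      have "\<forall>\<^sub>F z in nhdsin A.T t. \<exists>w. h z = Some w \<and> (minv g \<circ>\<^sub>m \<sigma>) w = (\<sigma>' \<circ>\<^sub>m minv h) w"
        using g(2) d
      proof eventually_elim
        case (elim z)
        obtain w where w: "h z = Some w" using elim(3) by blast
        obtain u where u: "\<sigma> w = Some u" using elim(4) w by (auto simp: map_comp_Some_iff)
        obtain v where v: "\<sigma>' z = Some v" using elim(2) by blast
        have "g v = Some u" using elim(1) w u v by simp
        then have "minv g u = Some v" using minv_Some_iff[OF gl] by blast
        moreover have "minv h w = Some z" using minv_Some_iff[OF h] w by blast
        ultimately show ?case using w u v by simp
      qed
      then have "\<forall>\<^sub>F w in nhdsin A.T s. (minv g \<circ>\<^sub>m \<sigma>) w = (\<sigma>' \<circ>\<^sub>m minv h) w"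
        using eventually_nhdsin_lhomeo[OF h hs] by blast
      then show "\<exists>g\<in>B.H. \<forall>\<^sub>F z in nhdsin A.T s. (g \<circ>\<^sub>m \<sigma>) z = (\<sigma>' \<circ>\<^sub>m minv h) z"
        using B.H_minv[OF g(1)] by blast
    qed
  qed
  show "{cocycle_map \<phi> i j |i j. i \<in> I \<and> j \<in> I} \<subseteq> {h \<in> lhomeo A.T A.T. \<forall>t\<in>dom h. conjugated t h}"
  proof clarify
    fix k l assume kl: "k \<in> I" "l \<in> I"
    let ?h = "cocycle_map \<phi> k l"
    have "conjugated t ?h" for t
      unfolding conjugated_def
    proof (intro ballI allI impI)
      fix i a j b x \<sigma> y \<sigma>'
      assume *: "i \<in> I" "a \<in> I'" "j \<in> I" "b \<in> I'" "x \<in> dom (\<phi> i)" "x \<in> dom (\<phi>' a)" "tr i a x \<sigma>"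
        "y \<in> dom (\<phi> j)" "y \<in> dom (\<phi>' b)" "tr j b y \<sigma>'" "t = A.p i x" "?h t = Some (A.p j y)"
      \<comment> \<open>The point \<open>z\<close>, common to both charts, separates two moves: from
        \<open>x\<close> to \<open>z\<close> along a plaque of \<open>\<phi> k\<close>, and from
        \<open>z\<close> to \<open>y\<close> along a plaque of \<open>\<phi> l\<close>. At
        \<open>z\<close> itself the cocycle map is compared with transitions.\<close>
      obtain z where z: "z \<in> dom (\<phi> k) \<inter> dom (\<phi> l)" "t = A.p k z" using A.cocycle_map_dom[OF *(12)] by blast
      have e: "A.p i x = A.p k z" "A.p l z = A.p j y" using z *(11,12) A.cocycle_map_p[OF kl z(1)] by auto
      have ik: "i = k" "j = l" using e by (auto simp: A.p_eq_iff)
      obtain c where c: "c \<in> I'" "z \<in> dom (\<phi>' c)" using B.chart_cover A.chart_dom_topspace[OF kl(1)] z(1) by blast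
      obtain \<sigma>1 where \<sigma>1: "tr k c z \<sigma>1" using tr_exists[OF kl(1) c(1)] z c by blast
      obtain \<sigma>2 where \<sigma>2: "tr l c z \<sigma>2" using tr_exists[OF kl(2) c(1)] z c by blast
      obtain g1 where g1: "g1 \<in> B.H" "\<forall>\<^sub>F s in nhdsin A.T t. (g1 \<circ>\<^sub>m \<sigma>) s = \<sigma>1 s"
        using tr_plaque[OF *(1,2) c(1) *(5,6) _ c(2) _ *(7)] z(1) \<sigma>1 e(1) *(11) unfolding ik by blast
      obtain g2 where g2: "g2 \<in> B.H" "\<forall>\<^sub>F s in nhdsin A.T (A.p l z). (g2 \<circ>\<^sub>m \<sigma>2) s = \<sigma>' s"
        using tr_plaque[OF kl(2) c(1) *(4) _ c(2) _ *(9) _ \<sigma>2] z(1) *(8,10) e(2) unfolding ik by blast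
      have ht: "?h \<in> lhomeo A.T A.T" "?h t = Some (A.p l z)"
        using A.H_lhomeo[OF A.cocycle_in_H[OF kl]] A.cocycle_map_p[OF kl z(1)] z(2) by auto
      have 1: "\<forall>\<^sub>F s in nhdsin A.T t. (\<sigma>2 \<circ>\<^sub>m ?h) s = \<sigma>1 s"
        using transition_unique[OF A.submersion_p[OF kl(1)] _ transition_comp[OF A.cocycle_transition[OF kl z(1)] \<sigma>2] \<sigma>1]
          z by auto
      have 2: "\<forall>\<^sub>F s in nhdsin A.T t. ((g2 \<circ>\<^sub>m \<sigma>2) \<circ>\<^sub>m ?h) s = (\<sigma>' \<circ>\<^sub>m ?h) s"
        by (rule eventually_map_comp_cong[OF ht _ g2(2)]) simp
      have "\<forall>\<^sub>F s in nhdsin A.T t. ((g2 \<circ>\<^sub>m g1) \<circ>\<^sub>m \<sigma>) s = (\<sigma>' \<circ>\<^sub>m ?h) s"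
        using g1(2) 1 2 unfolding map_comp_assoc
      proof eventually_elim
        case (elim s)
        have "(g2 \<circ>\<^sub>m (g1 \<circ>\<^sub>m \<sigma>)) s = (g2 \<circ>\<^sub>m (\<sigma>2 \<circ>\<^sub>m ?h)) s" using elim(1,2) by (simp add: map_comp_def)
        then show ?case using elim(3) by simp
      qed
      then show "\<exists>g\<in>B.H. \<forall>\<^sub>F z in nhdsin A.T t. (g \<circ>\<^sub>m \<sigma>) z = (\<sigma>' \<circ>\<^sub>m ?h) z"
        using B.H_comp[OF g1(1) g2(1)] by blast
    qed
    then show "?h \<in> lhomeo A.T A.T \<and> (\<forall>t\<in>dom ?h. conjugated t ?h)"
      using A.H_lhomeo[OF A.cocycle_in_H[OF kl]] by blast
  qed
qed

text \<open>Local homeomorphisms that are locally a transition preceded by a holonomy map; the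
  holonomy factor makes the family stable under composition with \<open>A.H\<close> on the
  right.\<close>

definition \<Phi> :: "('i \<times> 'z \<rightharpoonup> 'j \<times> 'z) set" where
  "\<Phi> = {\<tau> \<in> lhomeo A.T B.T. \<forall>t\<in>dom \<tau>. \<exists>i\<in>I. \<exists>a\<in>I'. \<exists>x \<sigma> h. x \<in> dom (\<phi> i) \<and> x \<in> dom (\<phi>' a) \<and>
     tr i a x \<sigma> \<and> h \<in> A.H \<and> h t = Some (A.p i x) \<and> (\<forall>\<^sub>F z in nhdsin A.T t. \<tau> z = (\<sigma> \<circ>\<^sub>m h) z)}"

lemma PhiE:
  assumes "\<tau> \<in> \<Phi>" "t \<in> dom \<tau>"
  obtains i a x \<sigma> h where "i \<in> I" "a \<in> I'" "x \<in> dom (\<phi> i)" "x \<in> dom (\<phi>' a)" "tr i a x \<sigma>" "h \<in> A.H"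
    "h t = Some (A.p i x)" "\<forall>\<^sub>F z in nhdsin A.T t. \<tau> z = (\<sigma> \<circ>\<^sub>m h) z"
  using assms unfolding \<Phi>_def by blast

text \<open>A transition is controlled only near \<open>x\<close>. Restricting it to the image of a
  neighbourhood \<open>N\<close> at whose points it is still a transition puts it into \<Phi>
  without changing its germ.\<close>

lemma Phi_of_tr:
  assumes tr: "tr i a x \<sigma>" and i: "i \<in> I" "a \<in> I'" "x \<in> dom (\<phi> i)" "x \<in> dom (\<phi>' a)"
  obtains \<tau> where "\<tau> \<in> \<Phi>" "A.p i x \<in> dom \<tau>" "tr i a x \<tau>"
proof -
  have xX: "x \<in> topspace X" using A.chart_dom_topspace i by blast
  have "\<forall>\<^sub>F z in nhdsin X x. tr i a z \<sigma> \<and> z \<in> dom (\<phi> i) \<and> z \<in> dom (\<phi>' a)"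
    using transition_move[OF tr] eventually_nhdsin_in[OF A.openin_chart_dom[OF i(1)] i(3)]
      eventually_nhdsin_in[OF B.openin_chart_dom[OF i(2)] i(4)] by eventually_elim simp
  then obtain N where N: "openin X N" "x \<in> N" "\<And>z. z \<in> N \<Longrightarrow> tr i a z \<sigma> \<and> z \<in> dom (\<phi> i) \<and> z \<in> dom (\<phi>' a)"
    using xX by (elim eventually_nhdsinD) auto
  have "N \<subseteq> dom (\<phi> i)" using N(3) by blast
  then have oN: "openin A.T (A.p i ` N)" using A.submersion_p[OF i(1)] N(1) unfolding submersion_def by blast
  let ?\<tau> = "\<sigma> |` (A.p i ` N)"
  have \<sigma>l: "\<sigma> \<in> lhomeo A.T B.T" using trD(1)[OF tr i(1,3)] .
  have "?\<tau> \<in> \<Phi>"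
    unfolding \<Phi>_def
  proof (intro CollectI conjI ballI)
    show "?\<tau> \<in> lhomeo A.T B.T" by (rule lhomeo_restrict[OF \<sigma>l oN])
    fix t assume "t \<in> dom ?\<tau>"
    then obtain z where z: "z \<in> N" "t = A.p i z" by auto
    have "\<forall>\<^sub>F s in nhdsin A.T t. s \<in> A.p i ` N" using oN z by (intro eventually_nhdsin_in) auto
    then have "\<forall>\<^sub>F s in nhdsin A.T t. ?\<tau> s = (\<sigma> \<circ>\<^sub>m (Some |` topspace A.T)) s"
      by eventually_elim (use openin_subset[OF oN] in \<open>auto simp: map_comp_def restrict_map_def\<close>)
    moreover have "(Some |` topspace A.T) t = Some (A.p i z)"
      using z(1) openin_subset[OF oN] unfolding z(2) by (auto simp: restrict_map_def)
    ultimately show "\<exists>i\<in>I. \<exists>a\<in>I'. \<exists>x \<sigma> h. x \<in> dom (\<phi> i) \<and> x \<in> dom (\<phi>' a) \<and>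
     tr i a x \<sigma> \<and> h \<in> A.H \<and> h t = Some (A.p i x) \<and> (\<forall>\<^sub>F z in nhdsin A.T t. ?\<tau> z = (\<sigma> \<circ>\<^sub>m h) z)"
      using N(3)[OF z(1)] i(1,2) A.H_id by blast
  qed
  moreover have "A.p i x \<in> dom ?\<tau>" using N(2) trD(2)[OF tr i(1,3)] by auto
  moreover have "tr i a x ?\<tau>"
  proof -
    have "\<forall>\<^sub>F z in nhdsin X x. z \<in> N" using N by (intro eventually_nhdsin_in) auto
    moreover have "\<forall>\<^sub>F z in nhdsin X x. \<sigma> (A.p i z) = Some (B.p a z)" using tr by (simp add: transition_def)
    ultimately have "\<forall>\<^sub>F z in nhdsin X x. ?\<tau> (A.p i z) = Some (B.p a z)"
      by eventually_elim (simp add: restrict_map_def)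
    then show ?thesis using lhomeo_restrict[OF \<sigma>l oN] by (simp add: transition_def)
  qed
  ultimately show ?thesis by (rule that)
qed

sublocale pseudogroup_equivalence A.T A.H S U C B.T B.H S' U' C' \<Phi>
proof
  show "\<tau> \<in> lhomeo A.T B.T" if "\<tau> \<in> \<Phi>" for \<tau> using that by (simp add: \<Phi>_def)
  show "\<exists>\<tau>\<in>\<Phi>. t \<in> dom \<tau>" if "t \<in> topspace A.T" for t
  proof -
    obtain i x a \<sigma> where 1: "i \<in> I" "x \<in> dom (\<phi> i)" "a \<in> I'" "x \<in> dom (\<phi>' a)" "tr i a x \<sigma>" "t = A.p i x"
      using point_chart[OF \<open>t \<in> topspace A.T\<close>] by blast
    obtain \<tau> where "\<tau> \<in> \<Phi>" "A.p i x \<in> dom \<tau>" by (rule Phi_of_tr[OF 1(5,1,3,2,4)])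
    then show ?thesis using 1(6) by blast
  qed
  show "\<tau> \<circ>\<^sub>m h \<in> \<Phi>" if \<tau>: "\<tau> \<in> \<Phi>" and h: "h \<in> A.H" for \<tau> h
    unfolding \<Phi>_def
  proof (intro CollectI conjI ballI)
    have \<tau>l: "\<tau> \<in> lhomeo A.T B.T" using \<tau> by (simp add: \<Phi>_def)
    have hl: "h \<in> lhomeo A.T A.T" using A.H_lhomeo[OF h] .
    show "\<tau> \<circ>\<^sub>m h \<in> lhomeo A.T B.T" by (rule lhomeo_comp[OF hl \<tau>l])
    fix t assume "t \<in> dom (\<tau> \<circ>\<^sub>m h)"
    then obtain v where "(\<tau> \<circ>\<^sub>m h) t = Some v" by (rule domD[THEN exE])
    then obtain s where s: "h t = Some s" "s \<in> dom \<tau>" unfolding map_comp_Some_iff by blast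
    obtain i a x \<sigma> k where 1: "i \<in> I" "a \<in> I'" "x \<in> dom (\<phi> i)" "x \<in> dom (\<phi>' a)" "tr i a x \<sigma>" "k \<in> A.H"
      "k s = Some (A.p i x)" "\<forall>\<^sub>F z in nhdsin A.T s. \<tau> z = (\<sigma> \<circ>\<^sub>m k) z" by (rule PhiE[OF \<tau> s(2)])
    have "\<forall>\<^sub>F z in nhdsin A.T t. (\<tau> \<circ>\<^sub>m h) z = ((\<sigma> \<circ>\<^sub>m k) \<circ>\<^sub>m h) z"
      by (rule eventually_map_comp_cong[OF hl s(1) _ 1(8)]) simp
    then have "\<forall>\<^sub>F z in nhdsin A.T t. (\<tau> \<circ>\<^sub>m h) z = (\<sigma> \<circ>\<^sub>m (k \<circ>\<^sub>m h)) z" unfolding map_comp_assoc .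
    moreover have "(k \<circ>\<^sub>m h) t = Some (A.p i x)" using s 1(7) by simp
    ultimately show "\<exists>i\<in>I. \<exists>a\<in>I'. \<exists>x \<sigma> h'. x \<in> dom (\<phi> i) \<and> x \<in> dom (\<phi>' a) \<and>
     tr i a x \<sigma> \<and> h' \<in> A.H \<and> h' t = Some (A.p i x) \<and> (\<forall>\<^sub>F z in nhdsin A.T t. (\<tau> \<circ>\<^sub>m h) z = (\<sigma> \<circ>\<^sub>m h') z)"
      using 1(1-5) A.H_comp[OF h 1(6)] by blast
  qed
  show "transport \<psi> h \<tau> \<in> B.H" if \<tau>: "\<tau> \<in> \<Phi>" and \<psi>: "\<psi> \<in> \<Phi>" and h: "h \<in> A.H" for \<tau> \<psi> h
  proof (rule B.H_localI)
    have \<tau>l: "\<tau> \<in> lhomeo A.T B.T" and \<psi>l: "\<psi> \<in> lhomeo A.T B.T" using \<tau> \<psi> by (auto simp: \<Phi>_def)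
    have hl: "h \<in> lhomeo A.T A.T" using A.H_lhomeo[OF h] .
    show "transport \<psi> h \<tau> \<in> lhomeo B.T B.T" by (rule lhomeo_transport[OF \<tau>l \<psi>l hl])
    fix s assume "s \<in> dom (transport \<psi> h \<tau>)"
    then obtain t u v where tu: "\<tau> t = Some s" "h t = Some u" "\<psi> u = Some v"
      by (auto simp: transport_Some_iff[OF \<tau>l])
    obtain i a x \<sigma> k where 1: "i \<in> I" "a \<in> I'" "x \<in> dom (\<phi> i)" "x \<in> dom (\<phi>' a)" "tr i a x \<sigma>" "k \<in> A.H"
      "k t = Some (A.p i x)" "\<forall>\<^sub>F z in nhdsin A.T t. \<tau> z = (\<sigma> \<circ>\<^sub>m k) z" by (rule PhiE[OF \<tau> domI[of \<tau>, OF tu(1)]])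
    obtain j b y \<sigma>' k' where 2: "j \<in> I" "b \<in> I'" "y \<in> dom (\<phi> j)" "y \<in> dom (\<phi>' b)" "tr j b y \<sigma>'" "k' \<in> A.H"
      "k' u = Some (A.p j y)" "\<forall>\<^sub>F z in nhdsin A.T u. \<psi> z = (\<sigma>' \<circ>\<^sub>m k') z" by (rule PhiE[OF \<psi> domI[of \<psi>, OF tu(3)]])
    \<comment> \<open>Near \<open>t\<close>, \<tau> is \<open>\<sigma> \<circ>\<^sub>m k\<close>,
      and near \<open>u\<close>, \<psi> is \<open>\<sigma>' \<circ>\<^sub>m k'\<close>. So the
      conjugate of \<open>h\<close> by \<tau> and \<psi> has locally the form of \<open>?h\<close>
      conjugated by \<sigma> and \<sigma>', to which \<open>holonomy_conjugated\<close>
      applies.\<close>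
    let ?h = "k' \<circ>\<^sub>m (h \<circ>\<^sub>m minv k)"
    have kl: "k \<in> lhomeo A.T A.T" using A.H_lhomeo[OF 1(6)] .
    have hH: "?h \<in> A.H" using A.H_comp A.H_minv 1(6) 2(6) h by blast
    have hx: "?h (A.p i x) = Some (A.p j y)"
      using 1(7) 2(7) tu(2) by (auto simp: map_comp_Some_iff minv_Some_iff[OF kl])
    have "conjugated (A.p i x) ?h" using holonomy_conjugated hH hx by blast
    from conjugatedD[OF this 1(1,2) 2(1,2) 1(3,4,5) 2(3,4,5) refl hx]
    obtain g where g: "g \<in> B.H" "\<forall>\<^sub>F z in nhdsin A.T (A.p i x). (g \<circ>\<^sub>m \<sigma>) z = (\<sigma>' \<circ>\<^sub>m ?h) z" by blast
    have 3: "\<forall>\<^sub>F z in nhdsin A.T t. \<exists>w. k z = Some w \<and> (g \<circ>\<^sub>m \<sigma>) w = (\<sigma>' \<circ>\<^sub>m ?h) w"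
      using eventually_nhdsin_lhomeoD[OF kl 1(7) g(2)] .
    have 4: "\<forall>\<^sub>F z in nhdsin A.T t. \<exists>w. h z = Some w \<and> \<psi> w = (\<sigma>' \<circ>\<^sub>m k') w"
      using eventually_nhdsin_lhomeoD[OF hl tu(2) 2(8)] .
    have 5: "\<forall>\<^sub>F z in nhdsin A.T t. z \<in> dom \<tau>" using tu \<tau>l by (intro eventually_nhdsin_in lhomeo_openin_dom) auto
    have "\<forall>\<^sub>F z in nhdsin A.T t. \<exists>w. \<tau> z = Some w \<and> g w = transport \<psi> h \<tau> w"
      using 1(8) 3 4 5
    proof eventually_elim
      case (elim z)
      obtain w where w: "\<tau> z = Some w" using elim(4) by blast
      obtain z1 where z1: "k z = Some z1" "(g \<circ>\<^sub>m \<sigma>) z1 = (\<sigma>' \<circ>\<^sub>m ?h) z1" using elim(2) by blast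
      obtain z2 where z2: "h z = Some z2" "\<psi> z2 = (\<sigma>' \<circ>\<^sub>m k') z2" using elim(3) by blast
      have "minv k z1 = Some z" using minv_Some_iff[OF kl] z1(1) by blast
      then have e: "(\<sigma>' \<circ>\<^sub>m ?h) z1 = (\<sigma>' \<circ>\<^sub>m k') z2" using z2(1) by (simp add: map_comp_def)
      have "\<sigma> z1 = Some w" using elim(1) w z1(1) by simp
      then have "g w = \<psi> z2" using z1(2) e z2(2) by simp
      moreover have "transport \<psi> h \<tau> w = \<psi> z2"
        using w z2(1) minv_Some_iff[OF \<tau>l, of w z] by (simp add: transport_def)
      ultimately show ?case using w by simp
    qed
    then have "\<forall>\<^sub>F w in nhdsin B.T s. g w = transport \<psi> h \<tau> w"
      using eventually_nhdsin_lhomeo[OF \<tau>l tu(1)] by blast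
    then show "\<exists>k\<in>B.H. \<forall>\<^sub>F z in nhdsin B.T s. k z = transport \<psi> h \<tau> z" using g(1) by blast
  qed
qed

end

section \<open>Correspondence of germs under transitions\<close>

text \<open>Source and target are recorded without reference to \<open>S\<close>, so that the
  algebra of \<open>germ_transport\<close> is done for germs of arbitrary local
  homeomorphisms.\<close>

definition pointed_germ :: "'t topology \<Rightarrow> 't \<Rightarrow> 't \<Rightarrow> 't germ \<Rightarrow> bool" where
  "pointed_germ T s t \<gamma> \<longleftrightarrow> (\<exists>g\<in>lhomeo T T. g s = Some t \<and> \<gamma> = germ T g s)"

lemma based_germs_pointed: "\<gamma> \<in> based_germs T S t0 \<Longrightarrow> pointed_germ T (fst \<gamma>) t0 \<gamma>"
  unfolding based_germs_def pointed_germ_def using pseudogroup_closure_lhomeo fst_germ by fastforce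

section \<open>Functoriality of the transport of germs\<close>

lemma germ_transport_cong:
  assumes \<gamma>: "pointed_germ T s t \<gamma>"
    and \<phi>: "\<phi> \<in> lhomeo T T'" "\<phi> s = Some a" and \<psi>: "\<psi> \<in> lhomeo T T'" "\<psi> t = Some b"
    and \<phi>': "\<phi>' \<in> lhomeo T T'" "\<forall>\<^sub>F z in nhdsin T s. \<phi> z = \<phi>' z"
    and \<psi>': "\<psi>' \<in> lhomeo T T'" "\<forall>\<^sub>F z in nhdsin T t. \<psi> z = \<psi>' z"
  shows "germ_transport T' \<psi> \<phi> \<gamma> = germ_transport T' \<psi>' \<phi>' \<gamma>"
proof -
  obtain g where g: "g \<in> lhomeo T T" "g s = Some t" "\<gamma> = germ T g s" using \<gamma> unfolding pointed_germ_def by blast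
  have "s \<in> topspace T" "t \<in> topspace T" using lhomeo_in_topspace[OF g(1,2)] by auto
  then have e: "\<phi>' s = Some a" "\<psi>' t = Some b"
    using eventually_nhdsin_self[OF \<phi>'(2)] eventually_nhdsin_self[OF \<psi>'(2)] \<phi>(2) \<psi>(2) by auto
  have d: "a \<in> dom (transport \<psi> g \<phi>)" "a \<in> dom (transport \<psi>' g \<phi>')"
    using transport_Some_iff[OF \<phi>(1)] transport_Some_iff[OF \<phi>'(1)] \<phi>(2) \<psi>(2) g(2) e by blast+
  have ev: "\<forall>\<^sub>F z in nhdsin T' a. transport \<psi> g \<phi> z = transport \<psi>' g \<phi>' z"
    by (rule eventually_transport_cong[OF \<phi> _ \<phi>' g(1,2) \<psi>'(2)]) simp
  have "germ_transport T' \<psi> \<phi> \<gamma> = germ T' (transport \<psi> g \<phi>) a"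
    unfolding g(3) using germ_transport_germ[OF \<phi> \<psi>(1) g(1,2)] \<psi>(2) by blast
  moreover have "germ_transport T' \<psi>' \<phi>' \<gamma> = germ T' (transport \<psi>' g \<phi>') a"
    unfolding g(3) using germ_transport_germ[OF \<phi>'(1) e(1) \<psi>'(1) g(1,2)] e(2) by blast
  moreover have "germ T' (transport \<psi> g \<phi>) a = germ T' (transport \<psi>' g \<phi>') a"
    using germ_eq_iff[OF lhomeo_transport[OF \<phi>(1) \<psi>(1) g(1)] d(1) lhomeo_transport[OF \<phi>'(1) \<psi>'(1) g(1)] d(2)] ev
    by blast
  ultimately show ?thesis by simp
qed

lemma germ_transport_comp:
  assumes \<gamma>: "pointed_germ T s t \<gamma>"
    and \<phi>: "\<phi> \<in> lhomeo T T'" "\<phi> s = Some a" and \<psi>: "\<psi> \<in> lhomeo T T'" "\<psi> t = Some b"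
    and \<phi>': "\<phi>' \<in> lhomeo T' T''" "\<phi>' a = Some a'" and \<psi>': "\<psi>' \<in> lhomeo T' T''" "\<psi>' b = Some b'"
  shows "germ_transport T'' \<psi>' \<phi>' (germ_transport T' \<psi> \<phi> \<gamma>) = germ_transport T'' (\<psi>' \<circ>\<^sub>m \<psi>) (\<phi>' \<circ>\<^sub>m \<phi>) \<gamma>"
proof -
  obtain g where g: "g \<in> lhomeo T T" "g s = Some t" "\<gamma> = germ T g s" using \<gamma> unfolding pointed_germ_def by blast
  have l: "\<phi>' \<circ>\<^sub>m \<phi> \<in> lhomeo T T''" "\<psi>' \<circ>\<^sub>m \<psi> \<in> lhomeo T T''"
    using lhomeo_comp \<phi>(1) \<phi>'(1) \<psi>(1) \<psi>'(1) by blast+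
  have tl: "transport \<psi> g \<phi> \<in> lhomeo T' T'" "transport \<psi> g \<phi> a = Some b"
    using lhomeo_transport[OF \<phi>(1) \<psi>(1) g(1)] transport_Some_iff[OF \<phi>(1)] \<phi>(2) g(2) \<psi>(2) by blast+
  have "germ_transport T'' \<psi>' \<phi>' (germ_transport T' \<psi> \<phi> \<gamma>) = germ_transport T'' \<psi>' \<phi>' (germ T' (transport \<psi> g \<phi>) a)"
    unfolding g(3) using germ_transport_germ[OF \<phi> \<psi>(1) g(1,2)] \<psi>(2) by (metis domI)
  also have "\<dots> = germ T'' (transport \<psi>' (transport \<psi> g \<phi>) \<phi>') a'"
    using germ_transport_germ[OF \<phi>' \<psi>'(1) tl] \<psi>'(2) by blast
  also have "transport \<psi>' (transport \<psi> g \<phi>) \<phi>' = transport (\<psi>' \<circ>\<^sub>m \<psi>) g (\<phi>' \<circ>\<^sub>m \<phi>)"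
    by (rule map_eqI) (unfold transport_Some_iff[OF \<phi>'(1)] transport_Some_iff[OF \<phi>(1)] transport_Some_iff[OF l(1)]
        map_comp_Some_iff, blast)
  also have "germ T'' \<dots> a' = germ_transport T'' (\<psi>' \<circ>\<^sub>m \<psi>) (\<phi>' \<circ>\<^sub>m \<phi>) \<gamma>"
    unfolding g(3)
    by (rule germ_transport_germ[OF l(1) _ l(2) g(1,2), symmetric])
      (use \<phi>(2) \<phi>'(2) \<psi>(2) \<psi>'(2) in \<open>simp_all add: domIff\<close>)
  finally show ?thesis .
qed

lemma germ_transport_id:
  assumes "pointed_germ T s t \<gamma>"
  shows "germ_transport T (Some |` topspace T) (Some |` topspace T) \<gamma> = \<gamma>"
proof -
  obtain g where g: "g \<in> lhomeo T T" "g s = Some t" "\<gamma> = germ T g s" using assms unfolding pointed_germ_def by blast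
  have id: "Some |` topspace T \<in> lhomeo T T" by (simp add: lhomeo_id)
  have st: "s \<in> topspace T" "t \<in> topspace T" using lhomeo_in_topspace[OF g(1,2)] by auto
  have "transport (Some |` topspace T) g (Some |` topspace T) = g"
    by (rule map_eqI) (use lhomeo_in_topspace[OF g(1)] in \<open>auto simp: transport_Some_iff[OF id] restrict_map_Some_iff\<close>)
  moreover have "germ_transport T (Some |` topspace T) (Some |` topspace T) \<gamma>
      = germ T (transport (Some |` topspace T) g (Some |` topspace T)) s"
    unfolding g(3) by (rule germ_transport_germ[OF id _ id g(1,2)]) (use st in simp_all)
  ultimately show ?thesis using g(3) by simp
qed

lemma germ_transport_inverse:
  assumes \<gamma>: "pointed_germ T s t \<gamma>"
    and \<phi>: "\<phi> \<in> lhomeo T T'" "\<phi> s = Some a" and \<psi>: "\<psi> \<in> lhomeo T T'" "\<psi> t = Some b"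
    and \<phi>': "\<phi>' \<in> lhomeo T' T" "\<forall>\<^sub>F z in nhdsin T s. (\<phi>' \<circ>\<^sub>m \<phi>) z = Some z"
    and \<psi>': "\<psi>' \<in> lhomeo T' T" "\<forall>\<^sub>F z in nhdsin T t. (\<psi>' \<circ>\<^sub>m \<psi>) z = Some z"
  shows "germ_transport T \<psi>' \<phi>' (germ_transport T' \<psi> \<phi> \<gamma>) = \<gamma>"
proof -
  obtain g where g: "g \<in> lhomeo T T" "g s = Some t" using \<gamma> unfolding pointed_germ_def by blast
  have st: "s \<in> topspace T" "t \<in> topspace T" using lhomeo_in_topspace[OF g] by auto
  have e: "(\<phi>' \<circ>\<^sub>m \<phi>) s = Some s" "(\<psi>' \<circ>\<^sub>m \<psi>) t = Some t"
    using eventually_nhdsin_self[OF \<phi>'(2) st(1)] eventually_nhdsin_self[OF \<psi>'(2) st(2)] by auto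
  have e': "\<phi>' a = Some s" "\<psi>' b = Some t" using e \<phi>(2) \<psi>(2) by auto
  have id: "Some |` topspace T \<in> lhomeo T T" by (simp add: lhomeo_id)
  have ev: "\<forall>\<^sub>F z in nhdsin T u. f z = (Some |` topspace T) z"
    if f: "\<forall>\<^sub>F z in nhdsin T u. f z = Some z" and u: "u \<in> topspace T" for f u
    using f eventually_nhdsin_in[OF openin_topspace u] by eventually_elim simp
  have "germ_transport T \<psi>' \<phi>' (germ_transport T' \<psi> \<phi> \<gamma>) = germ_transport T (\<psi>' \<circ>\<^sub>m \<psi>) (\<phi>' \<circ>\<^sub>m \<phi>) \<gamma>"
    by (rule germ_transport_comp[OF \<gamma> \<phi> \<psi> \<phi>'(1) e'(1) \<psi>'(1) e'(2)])
  also have "\<dots> = germ_transport T (Some |` topspace T) (Some |` topspace T) \<gamma>"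
    by (rule germ_transport_cong[OF \<gamma> lhomeo_comp[OF \<phi>(1) \<phi>'(1)] e(1) lhomeo_comp[OF \<psi>(1) \<psi>'(1)] e(2)
          id ev[OF \<phi>'(2) st(1)] id ev[OF \<psi>'(2) st(2)]])
  also have "\<dots> = \<gamma>" by (rule germ_transport_id[OF \<gamma>])
  finally show ?thesis .
qed

lemma transition_lhomeo: "transition X T T' p p' x \<tau> \<Longrightarrow> \<tau> \<in> lhomeo T T'"
  by (simp add: transition_def)

lemma submersion_in_topspace: "submersion X T U p \<Longrightarrow> x \<in> U \<Longrightarrow> x \<in> topspace X"
  by (meson openin_subset submersion_def subsetD)

text \<open>For one atlas this is the equivalence relation defining \<open>\<hat>X\<^sub>0\<close>, for two atlases
  it is the graph of the homeomorphism. The germ does not depend on the choice of the transitions.\<close>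

definition corr :: "'x topology \<Rightarrow> 'z topology \<Rightarrow> 'x \<Rightarrow> 'i set \<Rightarrow> ('i \<Rightarrow> ('x, 'z) fchart) \<Rightarrow> 'i
    \<Rightarrow> 'j set \<Rightarrow> ('j \<Rightarrow> ('x, 'z) fchart) \<Rightarrow> 'j
    \<Rightarrow> 'i \<times> 'x \<times> ('i \<times> 'z) germ \<Rightarrow> 'j \<times> 'x \<times> ('j \<times> 'z) germ \<Rightarrow> bool" where
  "corr X Z x0 I \<phi> i0 I' \<phi>' j0 = (\<lambda>(i, x, \<gamma>) (a, y, \<gamma>'). y = x \<and>
     (\<exists>\<sigma> \<sigma>0. transition X (transversal Z I \<phi>) (transversal Z I' \<phi>') (to_transversal \<phi> i) (to_transversal \<phi>' a) x \<sigma> \<and>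
        transition X (transversal Z I \<phi>) (transversal Z I' \<phi>') (to_transversal \<phi> i0) (to_transversal \<phi>' j0) x0 \<sigma>0 \<and>
        \<gamma>' = germ_transport (transversal Z I' \<phi>') \<sigma>0 \<sigma> \<gamma>))"

lemma corr_comp:
  assumes X: "x \<in> topspace X" "x0 \<in> topspace X"
    and \<gamma>: "pointed_germ (transversal Z I \<phi>) (to_transversal \<phi> i x) (to_transversal \<phi> i0 x0) \<gamma>"
    and c: "corr X Z x0 I \<phi> i0 I' \<phi>' j0 (i, x, \<gamma>) (a, y, \<gamma>')"
    and c': "corr X Z x0 I' \<phi>' j0 I'' \<phi>'' k0 (a, y, \<gamma>') (k, z, \<gamma>'')"
  shows "corr X Z x0 I \<phi> i0 I'' \<phi>'' k0 (i, x, \<gamma>) (k, z, \<gamma>'')"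
proof -
  let ?T = "transversal Z I \<phi>" and ?T' = "transversal Z I' \<phi>'" and ?T'' = "transversal Z I'' \<phi>''"
  obtain \<sigma> \<sigma>0 where \<sigma>: "transition X ?T ?T' (to_transversal \<phi> i) (to_transversal \<phi>' a) x \<sigma>"
    "transition X ?T ?T' (to_transversal \<phi> i0) (to_transversal \<phi>' j0) x0 \<sigma>0" "\<gamma>' = germ_transport ?T' \<sigma>0 \<sigma> \<gamma>" "y = x"
    using c unfolding corr_def by blast
  obtain \<tau> \<tau>0 where \<tau>: "transition X ?T' ?T'' (to_transversal \<phi>' a) (to_transversal \<phi>'' k) x \<tau>"
    "transition X ?T' ?T'' (to_transversal \<phi>' j0) (to_transversal \<phi>'' k0) x0 \<tau>0" "\<gamma>'' = germ_transport ?T'' \<tau>0 \<tau> \<gamma>'" "z = x"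
    using c' \<sigma>(4) unfolding corr_def by blast
  have "\<gamma>'' = germ_transport ?T'' (\<tau>0 \<circ>\<^sub>m \<sigma>0) (\<tau> \<circ>\<^sub>m \<sigma>) \<gamma>"
    unfolding \<tau>(3) \<sigma>(3)
    by (rule germ_transport_comp[OF \<gamma> transition_lhomeo[OF \<sigma>(1)] transition_self[OF \<sigma>(1) X(1)]
          transition_lhomeo[OF \<sigma>(2)] transition_self[OF \<sigma>(2) X(2)] transition_lhomeo[OF \<tau>(1)]
          transition_self[OF \<tau>(1) X(1)] transition_lhomeo[OF \<tau>(2)] transition_self[OF \<tau>(2) X(2)]])
  then show ?thesis
    using transition_comp[OF \<sigma>(1) \<tau>(1)] transition_comp[OF \<sigma>(2) \<tau>(2)] \<tau>(4) unfolding corr_def by blast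
qed

text \<open>Transitions at a point have a unique germ, and \<open>germ_transport\<close> depends
  only on the germs of its two charts at the source and the target of \<gamma>.\<close>

lemma corr_unique:
  assumes p: "submersion X (transversal Z I \<phi>) (dom (\<phi> i)) (to_transversal \<phi> i)" "x \<in> dom (\<phi> i)"
    and p0: "submersion X (transversal Z I \<phi>) (dom (\<phi> i0)) (to_transversal \<phi> i0)" "x0 \<in> dom (\<phi> i0)"
    and \<gamma>: "pointed_germ (transversal Z I \<phi>) (to_transversal \<phi> i x) (to_transversal \<phi> i0 x0) \<gamma>"
    and \<sigma>: "transition X (transversal Z I \<phi>) (transversal Z I' \<phi>') (to_transversal \<phi> i) (to_transversal \<phi>' a) x \<sigma>"
    and \<sigma>0: "transition X (transversal Z I \<phi>) (transversal Z I' \<phi>') (to_transversal \<phi> i0) (to_transversal \<phi>' j0) x0 \<sigma>0"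
  shows "corr X Z x0 I \<phi> i0 I' \<phi>' j0 (i, x, \<gamma>) (a, y, \<gamma>') \<longleftrightarrow> y = x \<and> \<gamma>' = germ_transport (transversal Z I' \<phi>') \<sigma>0 \<sigma> \<gamma>"
proof -
  let ?T = "transversal Z I \<phi>" and ?T' = "transversal Z I' \<phi>'"
  have X: "x \<in> topspace X" "x0 \<in> topspace X"
    by (rule submersion_in_topspace[OF p], rule submersion_in_topspace[OF p0])
  have *: "germ_transport ?T' \<sigma>0 \<sigma> \<gamma> = germ_transport ?T' \<tau>0 \<tau> \<gamma>"
    if \<tau>: "transition X ?T ?T' (to_transversal \<phi> i) (to_transversal \<phi>' a) x \<tau>"
    "transition X ?T ?T' (to_transversal \<phi> i0) (to_transversal \<phi>' j0) x0 \<tau>0" for \<tau> \<tau>0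
    by (rule germ_transport_cong[OF \<gamma> transition_lhomeo[OF \<sigma>] transition_self[OF \<sigma> X(1)]
          transition_lhomeo[OF \<sigma>0] transition_self[OF \<sigma>0 X(2)] transition_lhomeo[OF \<tau>(1)]
          transition_unique[OF p \<sigma> \<tau>(1)] transition_lhomeo[OF \<tau>(2)] transition_unique[OF p0 \<sigma>0 \<tau>(2)]])
  show ?thesis
  proof
    assume "corr X Z x0 I \<phi> i0 I' \<phi>' j0 (i, x, \<gamma>) (a, y, \<gamma>')"
    then obtain \<tau> \<tau>0 where \<tau>: "transition X ?T ?T' (to_transversal \<phi> i) (to_transversal \<phi>' a) x \<tau>"
      "transition X ?T ?T' (to_transversal \<phi> i0) (to_transversal \<phi>' j0) x0 \<tau>0"
      "\<gamma>' = germ_transport ?T' \<tau>0 \<tau> \<gamma>" "y = x"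
      unfolding corr_def by blast
    then show "y = x \<and> \<gamma>' = germ_transport ?T' \<sigma>0 \<sigma> \<gamma>" using *[OF \<tau>(1,2)] by simp
  next
    assume "y = x \<and> \<gamma>' = germ_transport ?T' \<sigma>0 \<sigma> \<gamma>"
    then show "corr X Z x0 I \<phi> i0 I' \<phi>' j0 (i, x, \<gamma>) (a, y, \<gamma>')"
      unfolding corr_def prod.case using \<sigma> \<sigma>0 by (intro conjI exI[of _ \<sigma>] exI[of _ \<sigma>0]) simp_all
  qed
qed

lemma corr_refl_iff:
  assumes p: "submersion X (transversal Z I \<phi>) (dom (\<phi> i)) (to_transversal \<phi> i)" "x \<in> dom (\<phi> i)"
    and p0: "submersion X (transversal Z I \<phi>) (dom (\<phi> i0)) (to_transversal \<phi> i0)" "x0 \<in> dom (\<phi> i0)"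
    and \<gamma>: "pointed_germ (transversal Z I \<phi>) (to_transversal \<phi> i x) (to_transversal \<phi> i0 x0) \<gamma>"
  shows "corr X Z x0 I \<phi> i0 I \<phi> i0 (i, x, \<gamma>) (i, y, \<gamma>') \<longleftrightarrow> y = x \<and> \<gamma>' = \<gamma>"
  using corr_unique[OF p p0 \<gamma> transition_id[OF p] transition_id[OF p0]] germ_transport_id[OF \<gamma>] by simp

text \<open>Inverting the transitions leads back to some germ over \<open>x\<close>. Composed with
  \<open>c\<close> it is a correspondence from \<open>(i, x, \<gamma>)\<close> to the same chart,
  where uniqueness forces the germ to be \<gamma>.\<close>

lemma corr_sym:
  assumes p: "submersion X (transversal Z I \<phi>) (dom (\<phi> i)) (to_transversal \<phi> i)" "x \<in> dom (\<phi> i)"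
    and p0: "submersion X (transversal Z I \<phi>) (dom (\<phi> i0)) (to_transversal \<phi> i0)" "x0 \<in> dom (\<phi> i0)"
    and \<gamma>: "pointed_germ (transversal Z I \<phi>) (to_transversal \<phi> i x) (to_transversal \<phi> i0 x0) \<gamma>"
    and c: "corr X Z x0 I \<phi> i0 I' \<phi>' j0 (i, x, \<gamma>) (a, y, \<gamma>')"
  shows "corr X Z x0 I' \<phi>' j0 I \<phi> i0 (a, y, \<gamma>') (i, x, \<gamma>)"
proof -
  let ?T = "transversal Z I \<phi>" and ?T' = "transversal Z I' \<phi>'"
  have X: "x \<in> topspace X" "x0 \<in> topspace X"
    by (rule submersion_in_topspace[OF p], rule submersion_in_topspace[OF p0])
  obtain \<sigma> \<sigma>0 where \<sigma>: "transition X ?T ?T' (to_transversal \<phi> i) (to_transversal \<phi>' a) x \<sigma>"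
    "transition X ?T ?T' (to_transversal \<phi> i0) (to_transversal \<phi>' j0) x0 \<sigma>0" "y = x"
    using c unfolding corr_def by blast
  let ?\<delta> = "germ_transport ?T (minv \<sigma>0) (minv \<sigma>) \<gamma>'"
  have d: "corr X Z x0 I' \<phi>' j0 I \<phi> i0 (a, y, \<gamma>') (i, x, ?\<delta>)"
    unfolding corr_def using transition_swap[OF \<sigma>(1)] transition_swap[OF \<sigma>(2)] \<sigma>(3) by blast
  have "?\<delta> = \<gamma>" using corr_comp[OF X \<gamma> c d] corr_refl_iff[OF p p0 \<gamma>] by blast
  then show ?thesis using d by simp
qed

text \<open>The lift of \<open>h\<close> changes only the source of a germ, so it is the transport
  with \<open>h\<close> at the source and the identity at the target.\<close>

lemma germ_lift_eq_Some_iff: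
  assumes h: "h \<in> lhomeo T T"
  shows "germ_lift T S t0 h \<delta> = Some \<gamma> \<longleftrightarrow>
     \<delta> \<in> based_germs T S t0 \<and> fst \<delta> \<in> dom h \<and> \<gamma> = germ_transport T (Some |` topspace T) h \<delta>"
proof -
  have "(SOME g. g \<in> snd \<delta>) \<circ>\<^sub>m pinv h = transport (Some |` topspace T) (SOME g. g \<in> snd \<delta>) h"
    if \<delta>: "\<delta> \<in> based_germs T S t0"
  proof -
    obtain g where g: "g \<in> lhomeo T T" "g (fst \<delta>) = Some t0" "\<delta> = germ T g (fst \<delta>)"
      using based_germs_pointed[OF \<delta>] unfolding pointed_germ_def by blast
    have gd: "fst \<delta> \<in> dom g" using g(2) by blast
    have "g \<in> snd \<delta>" using in_snd_germ[OF g(1) gd] g(1,3) by simp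
    then have "(SOME g. g \<in> snd \<delta>) \<in> snd \<delta>" by (rule someI[of "\<lambda>g. g \<in> snd \<delta>"])
    then have l: "(SOME g. g \<in> snd \<delta>) \<in> lhomeo T T" using in_snd_germ[OF g(1) gd] g(3) by simp
    show ?thesis
      unfolding transport_def pinv_eq_minv
      by (rule map_eqI) (use lhomeo_in_topspace(2)[OF l] in \<open>auto simp: map_comp_Some_iff restrict_map_Some_iff\<close>)
  qed
  then show ?thesis by (auto simp: germ_lift_def germ_transport_def)
qed

section \<open>The space \<open>\<hat>X\<^sub>0\<close>\<close>

lemma continuous_map_locally:
  assumes "\<And>x. x \<in> topspace X \<Longrightarrow> \<exists>N. openin X N \<and> x \<in> N \<and> continuous_map (subtopology X N) Y f"
  shows "continuous_map X Y f"
  by (rule pasting_lemma[where I = "{N. openin X N \<and> continuous_map (subtopology X N) Y f}" and T = id and f = "\<lambda>_. f"])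
    (use assms in \<open>simp_all, blast\<close>)

lemma openin_sum_component:
  assumes "i \<in> I" "openin (Y i) G" shows "openin (sum_topology Y I) ({i} \<times> G)"
proof -
  have e: "{x. (k, x) \<in> {i} \<times> G} = (if k = i then G else {})" for k by auto
  have "{i} \<times> G \<subseteq> Sigma I (topspace \<circ> Y)" using assms openin_subset[OF assms(2)] by auto
  moreover have "openin (Y k) {x. (k, x) \<in> {i} \<times> G}" for k unfolding e using assms(2) by simp
  ultimately show ?thesis unfolding openin_sum_topology by blast
qed

lemma continuous_map_sum_component_snd:
  assumes "i \<in> I" shows "continuous_map (subtopology (sum_topology Y I) ({i} \<times> UNIV)) (Y i) snd"
  unfolding continuous_map_def
proof (intro conjI allI impI)
  show "snd \<in> topspace (subtopology (sum_topology Y I) ({i} \<times> UNIV)) \<rightarrow> topspace (Y i)" by auto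
  fix G assume G: "openin (Y i) G"
  have "{w \<in> topspace (subtopology (sum_topology Y I) ({i} \<times> UNIV)). snd w \<in> G} = ({i} \<times> G) \<inter> ({i} \<times> UNIV)"
    using assms openin_subset[OF G] by auto
  then show "openin (subtopology (sum_topology Y I) ({i} \<times> UNIV))
      {w \<in> topspace (subtopology (sum_topology Y I) ({i} \<times> UNIV)). snd w \<in> G}"
    unfolding openin_subtopology using openin_sum_component[where Y = Y and i = i and G = G, OF assms G] by blast
qed

section \<open>The equivalence relation and the quotient for one atlas\<close>

context hol
begin

abbreviation "Xt \<equiv> X_tilde X Z I \<phi> S t0"
abbreviation "R \<equiv> X_rel X Z I \<phi> S t0"
abbreviation "Xh \<equiv> X_hat X Z I \<phi> S t0"
abbreviation "G \<equiv> based_germ_space T S t0"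
abbreviation "q w \<equiv> R `` {w}"
abbreviation "ph \<equiv> p_hat X Z I \<phi> S t0"
abbreviation "Uh \<equiv> U_hat X Z I \<phi> S t0"

lemma x0_in: "x0 \<in> topspace X"
  by (rule chart_dom_topspace[OF i0 x0])

lemma Xt_iff: "(i, x, \<gamma>) \<in> topspace Xt \<longleftrightarrow> i \<in> I \<and> x \<in> dom (\<phi> i) \<and> \<gamma> \<in> based_germs T S t0 \<and> p i x = fst \<gamma>"
proof -
  have "(i, x, \<gamma>) \<in> topspace Xt \<longleftrightarrow> i \<in> I \<and> (x \<in> topspace X \<and> x \<in> dom (\<phi> i)) \<and>
      (\<gamma> \<in> based_germs T S t0 \<and> fst (fst \<gamma>) = i) \<and> p i x = fst \<gamma>"
    unfolding X_tilde_def X_check_def topspace_subtopology topspace_sum_topology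
    by (simp add: topspace_based_germ_space)
  moreover have "fst (fst \<gamma>) = i" if "p i x = fst \<gamma>" using that by (simp add: to_transversal_def prod_eq_iff)
  ultimately show ?thesis using chart_dom_topspace[of i x] by blast
qed

lemma Xt_pointed: "(i, x, \<gamma>) \<in> topspace Xt \<Longrightarrow> pointed_germ T (p i x) t0 \<gamma>"
  unfolding Xt_iff using based_germs_pointed[of \<gamma> T S t0] by simp

lemma Xt_in_topspace: "(i, x, \<gamma>) \<in> topspace Xt \<Longrightarrow> x \<in> topspace X"
  unfolding Xt_iff using chart_dom_topspace by blast

lemmas sub_Xt = submersion_p[OF conjunct1[OF iffD1[OF Xt_iff]]] conjunct1[OF conjunct2[OF iffD1[OF Xt_iff]]]

abbreviation "E \<equiv> corr X Z x0 I \<phi> i0 I \<phi> i0"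

lemma E_refl_iff: "(i, x, \<gamma>) \<in> topspace Xt \<Longrightarrow> E (i, x, \<gamma>) (i, y, \<gamma>') \<longleftrightarrow> y = x \<and> \<gamma>' = \<gamma>"
  by (rule corr_refl_iff[OF sub_Xt submersion_p[OF i0] x0 Xt_pointed])

lemma E_sym: "(i, x, \<gamma>) \<in> topspace Xt \<Longrightarrow> E (i, x, \<gamma>) (j, y, \<delta>) \<Longrightarrow> E (j, y, \<delta>) (i, x, \<gamma>)"
  by (rule corr_sym[OF sub_Xt submersion_p[OF i0] x0 Xt_pointed])

text \<open>The cocycle map from \<open>j\<close> to \<open>i\<close> is a transition at the common
  point and the identity is one at \<open>x0\<close>; by uniqueness, the lift of the cocycle map is
  the correspondence read from \<open>v\<close> to \<open>w\<close>, which is then reversed by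
  symmetry.\<close>

lemma X_rel_iff: "(w, v) \<in> R \<longleftrightarrow> w \<in> topspace Xt \<and> v \<in> topspace Xt \<and> E w v"
proof -
  obtain i x \<gamma> where w: "w = (i, x, \<gamma>)" by (cases w)
  obtain j y \<delta> where v: "v = (j, y, \<delta>)" by (cases v)
  have "x = y \<and> germ_lift T S t0 (cocycle_map \<phi> j i) \<delta> = Some \<gamma> \<longleftrightarrow> E (i, x, \<gamma>) (j, y, \<delta>)"
    if w': "(i, x, \<gamma>) \<in> topspace Xt" and v': "(j, y, \<delta>) \<in> topspace Xt"
  proof -
    have ji: "j \<in> I" "i \<in> I" "y \<in> dom (\<phi> j)" "x \<in> dom (\<phi> i)" "p j y = fst \<delta>" "\<delta> \<in> based_germs T S t0"
      using w' v' unfolding Xt_iff by auto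
    have sym: "E (i, x, \<gamma>) (j, y, \<delta>) \<longleftrightarrow> E (j, y, \<delta>) (i, x, \<gamma>)"
      using E_sym[OF w'] E_sym[OF v'] by blast
    show ?thesis
    proof (cases "x = y")
      case True
      have yy: "y \<in> dom (\<phi> j) \<inter> dom (\<phi> i)" using ji True by blast
      have "fst \<delta> \<in> dom (cocycle_map \<phi> j i)" using cocycle_map_p[OF ji(1,2) yy] ji(5) by (metis domI)
      then have "germ_lift T S t0 (cocycle_map \<phi> j i) \<delta> = Some \<gamma> \<longleftrightarrow>
          \<gamma> = germ_transport T (Some |` topspace T) (cocycle_map \<phi> j i) \<delta>"
        using germ_lift_eq_Some_iff[OF H_lhomeo[OF cocycle_in_H[OF ji(1,2)]]] ji(6) by blast
      also have "\<dots> \<longleftrightarrow> E (j, y, \<delta>) (i, x, \<gamma>)"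
        using corr_unique[OF sub_Xt[OF v'] submersion_p[OF i0] x0 Xt_pointed[OF v'] cocycle_transition[OF ji(1,2) yy]
            transition_id[OF submersion_p[OF i0] x0]] True by simp
      finally show ?thesis using sym True by simp
    next
      case False
      then show ?thesis by (simp add: corr_def)
    qed
  qed
  then show ?thesis unfolding w v X_rel_def by auto
qed

lemma equiv_R: "equiv (topspace Xt) R"
proof (rule equivI)
  show "refl_on (topspace Xt) R"
  proof (rule refl_onI)
    fix w assume w: "w \<in> topspace Xt"
    obtain i x \<gamma> where e: "w = (i, x, \<gamma>)" by (cases w)
    show "(w, w) \<in> R" using E_refl_iff w unfolding X_rel_iff e by blast
  qed
  show "R \<subseteq> topspace Xt \<times> topspace Xt" by (auto simp: X_rel_iff)
  show "sym R"
  proof (rule symI)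
    fix w v assume wv: "(w, v) \<in> R"
    obtain i x \<gamma> where w: "w = (i, x, \<gamma>)" by (cases w)
    obtain j y \<delta> where v: "v = (j, y, \<delta>)" by (cases v)
    have w': "(i, x, \<gamma>) \<in> topspace Xt" using wv unfolding X_rel_iff w by blast
    show "(v, w) \<in> R"
      using wv E_sym[OF w'] unfolding X_rel_iff w v by blast
  qed
  show "trans R"
  proof (rule transI)
    fix w v u assume wvu: "(w, v) \<in> R" "(v, u) \<in> R"
    obtain i x \<gamma> where w: "w = (i, x, \<gamma>)" by (cases w)
    obtain j y \<delta> where v: "v = (j, y, \<delta>)" by (cases v)
    obtain k z \<epsilon> where u: "u = (k, z, \<epsilon>)" by (cases u)
    have w': "(i, x, \<gamma>) \<in> topspace Xt" using wvu unfolding X_rel_iff w by blast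
    show "(w, u) \<in> R"
      using wvu corr_comp[OF Xt_in_topspace[OF w'] x0_in Xt_pointed[OF w'], of I \<phi> i0 j y \<delta> I \<phi> i0 k z \<epsilon>]
      unfolding X_rel_iff w v u by blast
  qed
qed

lemma quotient_q: "quotient_map Xt Xh (\<lambda>w. q w)"
  unfolding X_hat_def by (rule quotient_map_quotient_topology) (auto simp: quotient_def)

lemma topspace_Xh: "topspace Xh = (\<lambda>w. q w) ` topspace Xt"
  using quotient_imp_surjective_map[OF quotient_q] by simp

lemma q_in: "w \<in> topspace Xt \<Longrightarrow> q w \<in> topspace Xh"
  unfolding topspace_Xh by (rule imageI)

lemma XhE:
  assumes "\<xi> \<in> topspace Xh"
  obtains i x \<gamma> where "(i, x, \<gamma>) \<in> topspace Xt" "\<xi> = q (i, x, \<gamma>)"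
  using assms unfolding topspace_Xh by (elim imageE) (metis prod_cases3)

lemma q_eq_iff: "w \<in> topspace Xt \<Longrightarrow> v \<in> topspace Xt \<Longrightarrow> q w = q v \<longleftrightarrow> (w, v) \<in> R"
  using eq_equiv_class_iff[OF equiv_R] by blast

lemma q_self: "w \<in> topspace Xt \<Longrightarrow> w \<in> q w"
  using equiv_class_self[OF equiv_R] by blast

lemma pi_hat_q: "(i, x, \<gamma>) \<in> topspace Xt \<Longrightarrow> pi_hat (q (i, x, \<gamma>)) = x"
  unfolding pi_hat_def
proof (rule the_equality)
  assume w: "(i, x, \<gamma>) \<in> topspace Xt"
  show "\<exists>i' \<gamma>'. (i', x, \<gamma>') \<in> q (i, x, \<gamma>)" using q_self[OF w] by blast
  fix y assume "\<exists>i' \<gamma>'. (i', y, \<gamma>') \<in> q (i, x, \<gamma>)"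
  then show "y = x" by (auto simp: X_rel_iff corr_def)
qed

lemma p_hat_q:
  assumes w: "(i, x, \<gamma>) \<in> topspace Xt" shows "ph i (q (i, x, \<gamma>)) = \<gamma>"
  unfolding p_hat_def
proof (rule the_equality)
  show "\<exists>y. (i, y, \<gamma>) \<in> topspace Xt \<and> q (i, x, \<gamma>) = q (i, y, \<gamma>)" using w by blast
  fix \<delta> assume "\<exists>y. (i, y, \<delta>) \<in> topspace Xt \<and> q (i, x, \<gamma>) = q (i, y, \<delta>)"
  then obtain y where y: "(i, y, \<delta>) \<in> topspace Xt" "q (i, x, \<gamma>) = q (i, y, \<delta>)" by blast
  then have "E (i, x, \<gamma>) (i, y, \<delta>)" using q_eq_iff[OF w y(1)] unfolding X_rel_iff by blast
  then show "\<delta> = \<gamma>" using E_refl_iff[OF w] by blast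
qed

text \<open>The germ stays fixed and only the point moves; these are the sets with which the charts
  of \<open>F_hat\<close> have to be compatible.\<close>

lemma fibre: "{\<xi> \<in> Uh i. ph i \<xi> = \<gamma>} = {q (i, x, \<gamma>) | x. (i, x, \<gamma>) \<in> topspace Xt}"
proof (intro equalityI subsetI)
  fix \<xi> assume \<xi>: "\<xi> \<in> {\<xi> \<in> Uh i. ph i \<xi> = \<gamma>}"
  then obtain x \<delta> where x: "\<xi> = q (i, x, \<delta>)" "(i, x, \<delta>) \<in> topspace Xt" unfolding U_hat_def by blast
  then have "\<delta> = \<gamma>" using \<xi> p_hat_q[OF x(2)] by simp
  then show "\<xi> \<in> {q (i, x, \<gamma>) | x. (i, x, \<gamma>) \<in> topspace Xt}" using x by blast
next
  fix \<xi> assume "\<xi> \<in> {q (i, x, \<gamma>) | x. (i, x, \<gamma>) \<in> topspace Xt}"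
  then obtain x where x: "\<xi> = q (i, x, \<gamma>)" "(i, x, \<gamma>) \<in> topspace Xt" by blast
  then have "\<xi> \<in> Uh i" unfolding U_hat_def by blast
  then show "\<xi> \<in> {\<xi> \<in> Uh i. ph i \<xi> = \<gamma>}" using p_hat_q[OF x(2)] x(1) by simp
qed

section \<open>Continuity of the coordinates before and after the quotient\<close>

lemma Xt_subtopology:
  "Xt = subtopology (sum_topology (\<lambda>i. subtopology (prod_topology X G) (dom (\<phi> i) \<times> {\<gamma>. fst (fst \<gamma>) = i})) I)
    {(i, x, \<gamma>). p i x = fst \<gamma>}"
  unfolding X_tilde_def X_check_def subtopology_Times ..

lemma continuous_map_piece:
  assumes "i \<in> I" shows "continuous_map (subtopology Xt ({i} \<times> UNIV)) (prod_topology X G) snd"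
proof -
  have "continuous_map (subtopology (sum_topology (\<lambda>i. subtopology (prod_topology X G) (dom (\<phi> i) \<times> {\<gamma>. fst (fst \<gamma>) = i})) I) ({i} \<times> UNIV))
      (prod_topology X G) snd"
    using continuous_map_sum_component_snd[OF assms] by (rule continuous_map_into_fulltopology)
  then show ?thesis
    unfolding Xt_subtopology subtopology_subtopology
    by (rule continuous_map_from_subtopology_mono) blast
qed

lemma openin_piece:
  assumes "i \<in> I" shows "openin Xt {w \<in> topspace Xt. fst w = i}"
proof -
  have "openin (sum_topology (\<lambda>i. subtopology (prod_topology X G) (dom (\<phi> i) \<times> {\<gamma>. fst (fst \<gamma>) = i})) I)
      ({i} \<times> topspace (subtopology (prod_topology X G) (dom (\<phi> i) \<times> {\<gamma>. fst (fst \<gamma>) = i})))"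
    by (rule openin_sum_component[OF assms openin_topspace])
  moreover have "{w \<in> topspace Xt. fst w = i} = ({i} \<times> topspace (subtopology (prod_topology X G)
      (dom (\<phi> i) \<times> {\<gamma>. fst (fst \<gamma>) = i}))) \<inter> {(i, x, \<gamma>). p i x = fst \<gamma>}"
    unfolding Xt_subtopology topspace_subtopology topspace_sum_topology using assms by auto
  ultimately show ?thesis
    unfolding Xt_subtopology openin_subtopology by blast
qed

lemma continuous_map_base: "continuous_map Xt X (\<lambda>w. fst (snd w))"
proof (rule continuous_map_locally)
  fix w assume w: "w \<in> topspace Xt"
  obtain i x \<gamma> where e: "w = (i, x, \<gamma>)" by (cases w)
  have i: "i \<in> I" using w unfolding e Xt_iff by blast
  have "continuous_map (subtopology Xt ({i} \<times> UNIV)) X (fst \<circ> snd)"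
    by (rule continuous_map_compose[OF continuous_map_piece[OF i] continuous_map_fst])
  then have "continuous_map (subtopology Xt ({i} \<times> UNIV)) X (\<lambda>w. fst (snd w))" by (simp add: comp_def)
  then have "continuous_map (subtopology Xt {w \<in> topspace Xt. fst w = i}) X (\<lambda>w. fst (snd w))"
    by (rule continuous_map_from_subtopology_mono) auto
  then show "\<exists>N. openin Xt N \<and> w \<in> N \<and> continuous_map (subtopology Xt N) X (\<lambda>w. fst (snd w))"
    using openin_piece[OF i] w e by (intro exI[of _ "{w \<in> topspace Xt. fst w = i}"]) simp
qed

lemma continuous_map_into_Xt:
  assumes i: "i \<in> I" and m: "continuous_map M (prod_topology X G) m"
    and im: "\<And>w. w \<in> topspace M \<Longrightarrow> (i, m w) \<in> topspace Xt"
  shows "continuous_map M Xt (\<lambda>w. (i, m w))"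
proof -
  let ?Y = "\<lambda>i. subtopology (prod_topology X G) (dom (\<phi> i) \<times> {\<gamma>. fst (fst \<gamma>) = i})"
  have D: "m w \<in> dom (\<phi> i) \<times> {\<gamma>. fst (fst \<gamma>) = i}" "p i (fst (m w)) = fst (snd (m w))" if "w \<in> topspace M" for w
  proof -
    obtain x \<gamma> where e: "m w = (x, \<gamma>)" by (cases "m w")
    have 1: "x \<in> dom (\<phi> i)" "p i x = fst \<gamma>" using im[OF that] unfolding e Xt_iff by auto
    then have "fst (fst \<gamma>) = i" by (simp add: to_transversal_def prod_eq_iff)
    with 1 show "m w \<in> dom (\<phi> i) \<times> {\<gamma>. fst (fst \<gamma>) = i}" "p i (fst (m w)) = fst (snd (m w))" unfolding e by auto
  qed
  have "continuous_map M (?Y i) m"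
    unfolding continuous_map_in_subtopology using m D(1) by blast
  from continuous_map_compose[OF this continuous_map_component_injection[of i I ?Y, OF i]]
  have c: "continuous_map M (sum_topology ?Y I) (\<lambda>w. (i, m w))" by (simp add: comp_def)
  have "(\<lambda>w. (i, m w)) \<in> topspace M \<rightarrow> {(i, x, \<gamma>). p i x = fst \<gamma>}" using D(2) by (auto simp: case_prod_unfold)
  then show ?thesis unfolding Xt_subtopology continuous_map_in_subtopology using c by blast
qed

lemma continuous_pi_hat: "continuous_map Xh X pi_hat"
proof (rule continuous_compose_quotient_map[OF quotient_q])
  show "continuous_map Xt X (pi_hat \<circ> (\<lambda>w. q w))"
    by (rule continuous_map_eq[OF continuous_map_base]) (auto simp: pi_hat_q)
qed

end

section \<open>Plaques under homeomorphisms\<close>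

lemma transition_inverse:
  assumes p: "submersion X T U p" "x \<in> U" and \<tau>: "transition X T T' p p' x \<tau>" "transition X T' T p' p x \<tau>'"
  shows "\<forall>\<^sub>F t in nhdsin T (p x). (\<tau>' \<circ>\<^sub>m \<tau>) t = Some t"
  unfolding eventually_submersion[OF p] using transition_comp[OF \<tau>] by (simp add: transition_def)

lemma openin_preimage_in:
  assumes "continuous_map X Y f" "openin (subtopology Y P) (P \<inter> Q)"
  shows "openin (subtopology X {x \<in> topspace X. f x \<in> P}) ({x \<in> topspace X. f x \<in> P} \<inter> {x \<in> topspace X. f x \<in> Q})"
proof -
  obtain G where G: "openin Y G" "P \<inter> Q = G \<inter> P" using assms(2) unfolding openin_subtopology by blast
  have "openin X {x \<in> topspace X. f x \<in> G}" by (rule openin_continuous_map_preimage[OF assms(1) G(1)])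
  moreover have "{x \<in> topspace X. f x \<in> P} \<inter> {x \<in> topspace X. f x \<in> Q} = {x \<in> topspace X. f x \<in> G} \<inter> {x \<in> topspace X. f x \<in> P}"
    using G(2) by blast
  ultimately show ?thesis unfolding openin_subtopology by blast
qed

lemma open_in_both_preimage:
  assumes "continuous_map X Y f" "open_in_both Y P Q"
  shows "open_in_both X {x \<in> topspace X. f x \<in> P} {x \<in> topspace X. f x \<in> Q}"
  using assms(2) openin_preimage_in[OF assms(1), of P Q] openin_preimage_in[OF assms(1), of Q P]
  unfolding open_in_both_def by (simp add: Int_commute)

text \<open>The two foliated spaces have different transverse models, so composing \<psi> with
  \<open>f\<close> does not yet give a chart: the transverse coordinate is moved from
  \<open>Z'\<close> to \<open>Z\<close> by \<open>k'\<close>, after cutting the domain down to where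
  \<open>k'\<close> is available.\<close>

lemma foliated_chart_pullback:
  assumes fg: "homeomorphic_maps X Y f g" and ch: "foliated_chart n Y Z' \<psi>"
    and W: "openin Z' W'" "openin Z W" and k: "homeomorphic_maps (subtopology Z' W') (subtopology Z W) k' k"
  shows "foliated_chart n X Z (\<lambda>x. if x \<in> topspace X \<and> f x \<in> dom \<psi> \<and> dist_submersion \<psi> (f x) \<in> W'
    then Some (fst (the (\<psi> (f x))), k' (dist_submersion \<psi> (f x))) else None)"
proof -
  obtain B V h where V: "openin Y (dom \<psi>)" "open_ball_in_Euclidean n B" "openin Z' V"
    "dist_submersion \<psi> ` dom \<psi> = V"
    and h: "homeomorphic_maps (subtopology Y (dom \<psi>))
       (prod_topology (subtopology (Euclidean_space n) B) (subtopology Z' V)) (\<lambda>x. the (\<psi> x)) h"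
    and hB: "\<forall>b\<in>B. \<forall>v\<in>V. h (b, v) \<in> dom \<psi> \<and> \<psi> (h (b, v)) = Some (b, v)"
    and hx: "\<forall>x\<in>dom \<psi>. fst (the (\<psi> x)) \<in> B \<and> dist_submersion \<psi> x \<in> V \<and>
       h (fst (the (\<psi> x)), dist_submersion \<psi> x) = x"
    by (rule foliated_chart_obtains[OF ch])
  let ?d = "dist_submersion \<psi>"
  let ?D = "{x \<in> topspace X. f x \<in> dom \<psi> \<and> ?d (f x) \<in> W'}"
  let ?\<theta> = "\<lambda>x. if x \<in> topspace X \<and> f x \<in> dom \<psi> \<and> ?d (f x) \<in> W'
    then Some (fst (the (\<psi> (f x))), k' (?d (f x))) else None"
  \<comment> \<open>The part of \<open>W\<close> that \<open>k\<close> sends into the transverse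
    image \<open>V\<close> of \<psi>, so that the new chart is onto
    \<open>B \<times> ?V\<close>.\<close>
  let ?V = "{w \<in> W. k w \<in> V}"
  let ?F = "\<lambda>x. (fst (the (\<psi> (f x))), k' (?d (f x)))"
  let ?G = "\<lambda>(b, w). g (h (b, k w))"
  have dom: "dom ?\<theta> = ?D" by (auto simp: dom_def)
  have fc: "continuous_map X Y f" and gc: "continuous_map Y X g"
    and gf: "\<And>x. x \<in> topspace X \<Longrightarrow> g (f x) = x" and fg': "\<And>y. y \<in> topspace Y \<Longrightarrow> f (g y) = y"
    using fg unfolding homeomorphic_maps_def by auto
  have WZ: "W \<subseteq> topspace Z" "W' \<subseteq> topspace Z'" "V \<subseteq> topspace Z'" "dom \<psi> \<subseteq> topspace Y"
    using W V(1,3) openin_subset by blast+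
  have kc: "continuous_map (subtopology Z' W') (subtopology Z W) k'" "continuous_map (subtopology Z W) (subtopology Z' W') k"
    and kk: "\<And>v. v \<in> W' \<Longrightarrow> k (k' v) = v" "\<And>w. w \<in> W \<Longrightarrow> k' (k w) = w"
    using k WZ unfolding homeomorphic_maps_def by (auto simp: subset_iff)
  have kW: "k' v \<in> W" if "v \<in> W'" for v
  proof -
    have "v \<in> topspace (subtopology Z' W')" using that WZ by auto
    then show ?thesis using continuous_map_funspace[OF kc(1)] by auto
  qed
  have kW': "k w \<in> W'" if "w \<in> W" for w
  proof -
    have "w \<in> topspace (subtopology Z W)" using that WZ by auto
    then show ?thesis using continuous_map_funspace[OF kc(2)] by auto
  qed
  have dc: "continuous_map (subtopology Y (dom \<psi>)) Z' ?d" by (rule continuous_map_dist_submersion[OF ch])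
  have oD: "openin X ?D"
  proof -
    have "openin (subtopology Y (dom \<psi>)) {y \<in> topspace (subtopology Y (dom \<psi>)). ?d y \<in> W'}"
      by (rule openin_continuous_map_preimage[OF dc W(1)])
    then have "openin Y {y \<in> topspace (subtopology Y (dom \<psi>)). ?d y \<in> W'}"
      using openin_open_subtopology[OF V(1)] by blast
    from openin_continuous_map_preimage[OF fc this]
    show ?thesis using WZ(4) by (elim back_subst[of "openin X"]) auto
  qed
  have oV: "openin Z ?V"
  proof -
    have "openin (subtopology Z W) {w \<in> topspace (subtopology Z W). k w \<in> V \<inter> W'}"
      by (rule openin_continuous_map_preimage[OF kc(2)]) (use V(3) in \<open>auto simp: openin_subtopology\<close>)
    moreover have "{w \<in> topspace (subtopology Z W). k w \<in> V \<inter> W'} = ?V" using WZ kW' by auto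
    ultimately show ?thesis using openin_open_subtopology[OF W(2)] by simp
  qed
  have oB: "B \<subseteq> topspace (Euclidean_space n)" using openin_open_ball_in_Euclidean[OF V(2)] openin_subset by blast
  let ?X = "subtopology X ?D" and ?P = "prod_topology (subtopology (Euclidean_space n) B) (subtopology Z ?V)"
  have tX: "topspace ?X = ?D" by auto
  have tP: "topspace ?P = B \<times> ?V" using oB WZ(1) by auto
  have fD: "continuous_map ?X (subtopology Y (dom \<psi>)) f"
    unfolding continuous_map_in_subtopology using continuous_map_from_subtopology[OF fc] by auto
  have 1: "continuous_map ?X (subtopology (Euclidean_space n) B) (\<lambda>x. fst (the (\<psi> (f x))))"
  proof -
    have "continuous_map (subtopology Y (dom \<psi>)) (prod_topology (subtopology (Euclidean_space n) B) (subtopology Z' V)) (\<lambda>x. the (\<psi> x))"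
      using h unfolding homeomorphic_maps_def by blast
    from continuous_map_compose[OF continuous_map_compose[OF fD this] continuous_map_fst]
    show ?thesis by (simp add: comp_def)
  qed
  have 2: "continuous_map ?X (subtopology Z ?V) (\<lambda>x. k' (?d (f x)))"
  proof -
    have "continuous_map ?X (subtopology Z' W') (?d \<circ> f)"
      unfolding continuous_map_in_subtopology using continuous_map_compose[OF fD dc] by auto
    from continuous_map_compose[OF this continuous_map_into_fulltopology[OF kc(1)]]
    have "continuous_map ?X Z (\<lambda>x. k' (?d (f x)))" by (simp add: comp_def)
    moreover have "(\<lambda>x. k' (?d (f x))) \<in> topspace ?X \<rightarrow> ?V"
      unfolding tX using kW kk(1) hx by auto
    ultimately show ?thesis unfolding continuous_map_in_subtopology by blast
  qed
  have 3: "continuous_map ?X ?P ?F" by (rule continuous_map_pairedI[OF 1 2])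
  have hh: "h (b, k w) \<in> dom \<psi> \<and> \<psi> (h (b, k w)) = Some (b, k w)" if "b \<in> B" "w \<in> ?V" for b w
    using hB that by blast
  have hd: "?d (h (b, k w)) = k w" if "b \<in> B" "w \<in> ?V" for b w
    using hh[OF that] by (simp add: dist_submersion_def)
  have 4: "continuous_map ?P ?X ?G"
  proof -
    have "continuous_map ?P (subtopology Z W) snd"
      by (rule continuous_map_into_subtopology[OF continuous_map_into_fulltopology[OF continuous_map_snd]]) (unfold tP, auto)
    from continuous_map_compose[OF this kc(2)]
    have "continuous_map ?P (subtopology Z' W') (\<lambda>z. k (snd z))" by (simp add: comp_def)
    then have "continuous_map ?P Z' (\<lambda>z. k (snd z))" by (rule continuous_map_into_fulltopology)
    then have "continuous_map ?P (subtopology Z' V) (\<lambda>z. k (snd z))"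
      by (rule continuous_map_into_subtopology) (unfold tP, auto)
    from continuous_map_pairedI[OF continuous_map_fst this]
    have "continuous_map ?P (prod_topology (subtopology (Euclidean_space n) B) (subtopology Z' V)) (\<lambda>z. (fst z, k (snd z)))" .
    moreover have "continuous_map (prod_topology (subtopology (Euclidean_space n) B) (subtopology Z' V)) Y h"
      using h unfolding homeomorphic_maps_def by (blast intro: continuous_map_into_fulltopology)
    ultimately have "continuous_map ?P X (g \<circ> (h \<circ> (\<lambda>z. (fst z, k (snd z)))))"
      by (intro continuous_map_compose[OF _ gc] continuous_map_compose)
    moreover have "g \<circ> (h \<circ> (\<lambda>z. (fst z, k (snd z)))) = ?G" by (simp add: fun_eq_iff)
    moreover have "?G \<in> topspace ?P \<rightarrow> ?D"
    proof
      fix z assume "z \<in> topspace ?P"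
      then obtain b w where z: "z = (b, w)" "b \<in> B" "w \<in> ?V" unfolding tP by (elim SigmaE)
      have hY: "h (b, k w) \<in> topspace Y" using hh[OF z(2,3)] WZ(4) by blast
      have "g (h (b, k w)) \<in> topspace X" using continuous_map_funspace[OF gc] hY by blast
      moreover have "k w \<in> W'" using kW' z(3) by blast
      ultimately show "?G z \<in> ?D" using hh[OF z(2,3)] hd[OF z(2,3)] fg'[OF hY] z(1) by simp
    qed
    ultimately show ?thesis unfolding continuous_map_in_subtopology by simp
  qed
  have "homeomorphic_maps ?X ?P ?F ?G"
    unfolding homeomorphic_maps_def
  proof (intro conjI ballI 3 4)
    fix x assume "x \<in> topspace ?X"
    then have x: "x \<in> topspace X" "f x \<in> dom \<psi>" "?d (f x) \<in> W'" unfolding tX by auto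
    show "?G (?F x) = x" using kk(1)[OF x(3)] hx x(2) gf[OF x(1)] by simp
  next
    fix z assume "z \<in> topspace ?P"
    then obtain b w where z: "z = (b, w)" "b \<in> B" "w \<in> ?V" unfolding tP by (elim SigmaE)
    have hY: "h (b, k w) \<in> topspace Y" using hh[OF z(2,3)] WZ(4) by blast
    show "?F (?G z) = z" using fg'[OF hY] hh[OF z(2,3)] hd[OF z(2,3)] kk(2) z by simp
  qed
  then have "homeomorphic_map ?X ?P ?F" by (rule homeomorphic_maps_map[THEN iffD1, THEN conjunct1])
  then have "homeomorphic_map ?X ?P (\<lambda>x. the (?\<theta> x))"
    by (rule homeomorphic_map_eq) (unfold tX, simp)
  then show ?thesis unfolding foliated_chart_def dom using oD V(2) oV by blast
qed

text \<open>Plaques generate the leaf topologies, so \<open>f\<close> is continuous for them when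
  plaques pull back to plaques; leaves are components, and continuous images of connected sets are
  connected. The set \<open>D\<close> stands for the whole space, so that \<open>f\<close> is only
  considered there.\<close>

lemma foliated_map_of_plaque_pullback:
  assumes pull: "\<And>\<psi> P. \<psi> \<in> F' \<Longrightarrow> P \<in> plaques \<psi> \<Longrightarrow> \<exists>\<theta>\<in>F. {x \<in> D. f x \<in> P} \<in> plaques \<theta>"
    and D: "\<And>\<psi> P. \<psi> \<in> F \<Longrightarrow> P \<in> plaques \<psi> \<Longrightarrow> P \<subseteq> D"
    and cov: "\<And>\<psi> P x. \<psi> \<in> F \<Longrightarrow> P \<in> plaques \<psi> \<Longrightarrow> x \<in> P \<Longrightarrow> \<exists>\<theta>\<in>F'. \<exists>Q\<in>plaques \<theta>. f x \<in> Q"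
  shows "foliated_map F F' f"
proof -
  have t1: "topspace (leaf_topology F) = \<Union>(\<Union>\<phi>\<in>F. plaques \<phi>)"
    unfolding leaf_topology_def topology_generated_by_topspace ..
  have "continuous_map (leaf_topology F) (leaf_topology F') f"
    unfolding leaf_topology_def[of F'] continuous_on_generated_topo_iff
  proof (intro conjI allI impI)
    fix P assume "P \<in> (\<Union>\<phi>\<in>F'. plaques \<phi>)"
    then obtain \<psi> where "\<psi> \<in> F'" "P \<in> plaques \<psi>" by blast
    then obtain \<theta> where \<theta>: "\<theta> \<in> F" "{x \<in> D. f x \<in> P} \<in> plaques \<theta>" using pull by blast
    then have o: "openin (leaf_topology F) ({x \<in> D. f x \<in> P})"
      unfolding leaf_topology_def by (intro topology_generated_by_Basis) blast
    have "topspace (leaf_topology F) \<subseteq> D" unfolding t1 using D by blast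
    then have "f -` P \<inter> topspace (leaf_topology F) = {x \<in> D. f x \<in> P}" using openin_subset[OF o] by blast
    then show "openin (leaf_topology F) (f -` P \<inter> topspace (leaf_topology F))" using o by simp
  next
    show "f ` topspace (leaf_topology F) \<subseteq> \<Union>(\<Union>\<phi>\<in>F'. plaques \<phi>)"
    proof clarify
      fix x assume "x \<in> topspace (leaf_topology F)"
      then obtain \<psi> P where "\<psi> \<in> F" "P \<in> plaques \<psi>" "x \<in> P" unfolding t1 by blast
      then obtain \<theta> Q where "\<theta> \<in> F'" "Q \<in> plaques \<theta>" "f x \<in> Q" using cov by blast
      then show "f x \<in> \<Union>(\<Union>\<phi>\<in>F'. plaques \<phi>)" by blast
    qed
  qed
  note cont = this
  show ?thesis
    unfolding foliated_map_def leaves_def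
  proof
    fix L assume L: "L \<in> connected_components_of (leaf_topology F)"
    have c: "connectedin (leaf_topology F') (f ` L)"
      by (rule connectedin_continuous_map_image[OF cont connectedin_connected_components_of[OF L]])
    have "L \<noteq> {}" by (rule nonempty_connected_components_of[OF L])
    then have "leaf_topology F' \<noteq> trivial_topology" using connectedin_subset_topspace[OF c] by auto
    then show "\<exists>L'\<in>connected_components_of (leaf_topology F'). f ` L \<subseteq> L'"
      using exists_connected_component_of_superset[OF c] by blast
  qed
qed

section \<open>The homeomorphism between the two spaces\<close>

text \<open>A relational image of the class, taken without choosing a representative; that the
  result is again a class is \<open>hat_map_q\<close>.\<close>

definition hat_map :: "'x topology \<Rightarrow> 'z topology \<Rightarrow> 'x \<Rightarrow> 'i set \<Rightarrow> ('i \<Rightarrow> ('x, 'z) fchart) \<Rightarrow> 'i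
    \<Rightarrow> 'j set \<Rightarrow> ('j \<Rightarrow> ('x, 'z) fchart) \<Rightarrow> 'j \<Rightarrow> (('j \<times> 'z) \<rightharpoonup> ('j \<times> 'z)) set
    \<Rightarrow> ('x, 'z, 'i) hat_point \<Rightarrow> ('x, 'z, 'j) hat_point" where
  "hat_map X Z x0 I \<phi> i0 I' \<phi>' j0 S' c = {w' \<in> topspace (X_tilde X Z I' \<phi>' S' (to_transversal \<phi>' j0 x0)).
     \<exists>w\<in>c. corr X Z x0 I \<phi> i0 I' \<phi>' j0 w w'}"

section \<open>The map induced by the correspondence between two atlases\<close>

context hol_pair
begin

abbreviation "K \<equiv> corr X Z x0 I \<phi> i0 I' \<phi>' j0"
abbreviation "K' \<equiv> corr X Z x0 I' \<phi>' j0 I \<phi> i0"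
abbreviation "f \<equiv> hat_map X Z x0 I \<phi> i0 I' \<phi>' j0 S'"
abbreviation "g \<equiv> hat_map X Z x0 I' \<phi>' j0 I \<phi> i0 S"

text \<open>The exchanged instance turns each result about \<open>f\<close> into one about its
  inverse \<open>g\<close>, in particular the continuity.\<close>

lemma swap: "hol_pair n X Z F x0 I' \<phi>' j0 U' S' C' C0' I \<phi> i0 U S C C0"
  by (rule hol_pair.intro) unfold_locales

lemma base_transition:
  obtains \<tau>0 where "\<tau>0 \<in> \<Phi>" "tr i0 j0 x0 \<tau>0" "\<tau>0 A.t0 = Some B.t0"
proof -
  have xx: "x0 \<in> dom (\<phi> i0) \<inter> dom (\<phi>' j0)" using A.x0 B.x0 by (rule IntI)
  obtain \<sigma> where \<sigma>: "tr i0 j0 x0 \<sigma>" using tr_exists[OF A.i0 B.i0 xx] by (elim exE)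
  obtain \<tau> where \<tau>: "\<tau> \<in> \<Phi>" "A.p i0 x0 \<in> dom \<tau>" "tr i0 j0 x0 \<tau>" by (rule Phi_of_tr[OF \<sigma> A.i0 B.i0 A.x0 B.x0])
  show ?thesis by (rule that[OF \<tau>(1,3) trD(2)[OF \<tau>(3) A.i0 A.x0]])
qed

text \<open>A transition at \<open>x\<close> is one at all nearby points, so a single pair \<tau>,
  \<tau>0 describes the correspondence over \<open>N\<close>. Taking both from \<Phi> makes the
  resulting transport of germs continuous.\<close>

lemma K_local:
  assumes ia: "i \<in> I" "a \<in> I'" and x: "x \<in> dom (\<phi> i)" "x \<in> dom (\<phi>' a)"
  obtains \<tau> \<tau>0 N where "\<tau> \<in> \<Phi>" "\<tau>0 \<in> \<Phi>" "\<tau>0 A.t0 = Some B.t0" "openin X N" "x \<in> N"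
    "\<forall>z\<in>N. A.p i z \<in> dom \<tau>"
    "\<forall>z\<in>N. \<forall>\<gamma>. (i, z, \<gamma>) \<in> topspace A.Xt \<longrightarrow> (a, z, germ_transport B.T \<tau>0 \<tau> \<gamma>) \<in> topspace B.Xt \<and>
       (\<forall>y \<gamma>'. K (i, z, \<gamma>) (a, y, \<gamma>') \<longleftrightarrow> y = z \<and> \<gamma>' = germ_transport B.T \<tau>0 \<tau> \<gamma>)"
proof -
  have xX: "x \<in> topspace X" by (rule A.chart_dom_topspace[OF ia(1) x(1)])
  have xx: "x \<in> dom (\<phi> i) \<inter> dom (\<phi>' a)" using x by (rule IntI)
  obtain \<sigma> where \<sigma>: "tr i a x \<sigma>" using tr_exists[OF ia xx] by (elim exE)
  obtain \<tau> where \<tau>: "\<tau> \<in> \<Phi>" "A.p i x \<in> dom \<tau>" "tr i a x \<tau>" by (rule Phi_of_tr[OF \<sigma> ia x])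
  obtain \<tau>0 where \<tau>0: "\<tau>0 \<in> \<Phi>" "tr i0 j0 x0 \<tau>0" "\<tau>0 A.t0 = Some B.t0" by (rule base_transition)
  have "\<forall>\<^sub>F z in nhdsin X x. tr i a z \<tau> \<and> z \<in> dom (\<phi> i) \<and> z \<in> dom (\<phi>' a)"
    using transition_move[OF \<tau>(3)] eventually_nhdsin_in[OF A.openin_chart_dom[OF ia(1)] x(1)]
      eventually_nhdsin_in[OF B.openin_chart_dom[OF ia(2)] x(2)] by eventually_elim simp
  then obtain N where N: "openin X N" "x \<in> N" "\<And>z. z \<in> N \<Longrightarrow> tr i a z \<tau> \<and> z \<in> dom (\<phi> i) \<and> z \<in> dom (\<phi>' a)"
    using xX by (elim eventually_nhdsinD) auto
  have pz: "\<tau> (A.p i z) = Some (B.p a z)" if "z \<in> N" for z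
    using N(3)[OF that] trD(2)[OF _ ia(1)] by blast
  have K: "(a, z, germ_transport B.T \<tau>0 \<tau> \<gamma>) \<in> topspace B.Xt \<and>
       (\<forall>y \<gamma>'. K (i, z, \<gamma>) (a, y, \<gamma>') \<longleftrightarrow> y = z \<and> \<gamma>' = germ_transport B.T \<tau>0 \<tau> \<gamma>)"
    if z: "z \<in> N" and w: "(i, z, \<gamma>) \<in> topspace A.Xt" for z \<gamma>
  proof
    have g: "\<gamma> \<in> based_germs A.T S A.t0" "fst \<gamma> = A.p i z" using w unfolding A.Xt_iff by auto
    have d: "fst \<gamma> \<in> dom \<tau>" using pz[OF z] unfolding g(2) by (rule domI)
    have "fst (germ_transport B.T \<tau>0 \<tau> \<gamma>) = B.p a z"
      using germ_transport_based(2)[OF \<tau>(1) \<tau>0(1,3) g(1) d] pz[OF z] g(2) by simp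
    then show "(a, z, germ_transport B.T \<tau>0 \<tau> \<gamma>) \<in> topspace B.Xt"
      unfolding B.Xt_iff using germ_transport_based(1)[OF \<tau>(1) \<tau>0(1,3) g(1) d] ia(2) N(3)[OF z] by simp
    have zt: "tr i a z \<tau>" using N(3)[OF z] by (rule conjunct1)
    show "\<forall>y \<gamma>'. K (i, z, \<gamma>) (a, y, \<gamma>') \<longleftrightarrow> y = z \<and> \<gamma>' = germ_transport B.T \<tau>0 \<tau> \<gamma>"
      using corr_unique[OF A.sub_Xt[OF w] A.submersion_p[OF A.i0] A.x0 A.Xt_pointed[OF w] zt \<tau>0(2)] by blast
  qed
  have 1: "\<forall>z\<in>N. A.p i z \<in> dom \<tau>" using pz by (intro ballI) (rule domI)
  show ?thesis by (rule that[OF \<tau>(1) \<tau>0(1,3) N(1,2) 1]) (intro ballI allI impI K)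
qed

lemma K_exists:
  assumes w: "(i, x, \<gamma>) \<in> topspace A.Xt" and a: "a \<in> I'" "x \<in> dom (\<phi>' a)"
  shows "\<exists>\<gamma>'. (a, x, \<gamma>') \<in> topspace B.Xt \<and> K (i, x, \<gamma>) (a, x, \<gamma>')"
proof -
  have i: "i \<in> I" "x \<in> dom (\<phi> i)" using w unfolding A.Xt_iff by auto
  obtain \<tau> \<tau>0 N where "x \<in> N" and K: "\<forall>z\<in>N. \<forall>\<gamma>. (i, z, \<gamma>) \<in> topspace A.Xt \<longrightarrow> (a, z, germ_transport B.T \<tau>0 \<tau> \<gamma>) \<in> topspace B.Xt \<and>
       (\<forall>y \<gamma>'. K (i, z, \<gamma>) (a, y, \<gamma>') \<longleftrightarrow> y = z \<and> \<gamma>' = germ_transport B.T \<tau>0 \<tau> \<gamma>)"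
    by (rule K_local[OF i(1) a(1) i(2) a(2)])
  then show ?thesis using w by blast
qed

lemma K_sym: "(i, x, \<gamma>) \<in> topspace A.Xt \<Longrightarrow> K (i, x, \<gamma>) (a, y, \<gamma>') \<Longrightarrow> K' (a, y, \<gamma>') (i, x, \<gamma>)"
  by (rule corr_sym[OF A.sub_Xt A.submersion_p[OF A.i0] A.x0 A.Xt_pointed])

text \<open>Correspondences compose across atlases: any two points corresponding to \<open>w\<close>
  are related by going back to \<open>w\<close> and forth again, and a point related to
  \<open>w'\<close> still corresponds to \<open>w\<close>.\<close>

lemma hat_map_q:
  assumes w: "w \<in> topspace A.Xt" and w': "w' \<in> topspace B.Xt" and K: "K w w'"
  shows "f (A.q w) = B.q w'"
proof (intro equalityI subsetI)
  obtain i x \<gamma> where e: "w = (i, x, \<gamma>)" by (cases w)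
  obtain a y \<gamma>' where e': "w' = (a, y, \<gamma>')" by (cases w')
  note we = w[unfolded e]
  note we' = w'[unfolded e']
  note Ke = K[unfolded e e']
  note C = corr_comp[OF A.Xt_in_topspace[OF we] A.x0_in A.Xt_pointed[OF we]]
  note C' = corr_comp[OF B.Xt_in_topspace[OF we'] A.x0_in B.Xt_pointed[OF we']]
  {
    fix v' assume "v' \<in> f (A.q w)"
    then obtain v where v: "v' \<in> topspace B.Xt" "A.E w v" "K v v'"
      unfolding hat_map_def Image_singleton A.X_rel_iff by blast
    obtain j z \<delta> where ev: "v = (j, z, \<delta>)" by (cases v)
    obtain b u \<delta>' where ev': "v' = (b, u, \<delta>')" by (cases v')
    have "K (i, x, \<gamma>) (b, u, \<delta>')" by (rule C[OF v(2)[unfolded e ev] v(3)[unfolded ev ev']])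
    then have "B.E (a, y, \<gamma>') (b, u, \<delta>')" by (rule C'[OF K_sym[OF we Ke]])
    then show "v' \<in> B.q w'" unfolding Image_singleton B.X_rel_iff ev' e' using we' v(1)[unfolded ev'] by blast
  next
    fix v' assume "v' \<in> B.q w'"
    then have v: "v' \<in> topspace B.Xt" "B.E w' v'" unfolding Image_singleton B.X_rel_iff by auto
    obtain b u \<delta>' where ev': "v' = (b, u, \<delta>')" by (cases v')
    have "K (i, x, \<gamma>) (b, u, \<delta>')" by (rule C[OF Ke v(2)[unfolded e' ev']])
    then show "v' \<in> f (A.q w)" unfolding hat_map_def using v(1) A.q_self[OF w] unfolding e ev' by blast
  }
qed

lemma hat_map_cases:
  assumes w: "(i, x, \<gamma>) \<in> topspace A.Xt" and a: "a \<in> I'" "x \<in> dom (\<phi>' a)"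
  obtains \<gamma>' where "(a, x, \<gamma>') \<in> topspace B.Xt" "K (i, x, \<gamma>) (a, x, \<gamma>')" "f (A.q (i, x, \<gamma>)) = B.q (a, x, \<gamma>')"
  using K_exists[OF w a] hat_map_q[OF w] by blast

lemma hat_map_obtain:
  assumes \<xi>: "\<xi> \<in> topspace A.Xh"
  obtains i x \<gamma> a \<gamma>' where "(i, x, \<gamma>) \<in> topspace A.Xt" "\<xi> = A.q (i, x, \<gamma>)" "a \<in> I'" "x \<in> dom (\<phi>' a)"
    "(a, x, \<gamma>') \<in> topspace B.Xt" "K (i, x, \<gamma>) (a, x, \<gamma>')" "f \<xi> = B.q (a, x, \<gamma>')"
proof -
  obtain i x \<gamma> where 1: "(i, x, \<gamma>) \<in> topspace A.Xt" "\<xi> = A.q (i, x, \<gamma>)" by (rule A.XhE[OF \<xi>])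
  obtain a where a: "a \<in> I'" "x \<in> dom (\<phi>' a)" using B.chart_cover[OF A.Xt_in_topspace[OF 1(1)]] by blast
  obtain \<gamma>' where "(a, x, \<gamma>') \<in> topspace B.Xt" "K (i, x, \<gamma>) (a, x, \<gamma>')" "f (A.q (i, x, \<gamma>)) = B.q (a, x, \<gamma>')"
    by (rule hat_map_cases[OF 1(1) a])
  then show ?thesis using that 1 a by blast
qed

lemma hat_map_in: "\<xi> \<in> topspace A.Xh \<Longrightarrow> f \<xi> \<in> topspace B.Xh"
proof (erule hat_map_obtain)
  fix a x \<gamma>' assume "(a, x, \<gamma>') \<in> topspace B.Xt" "f \<xi> = B.q (a, x, \<gamma>')"
  then show "f \<xi> \<in> topspace B.Xh" using B.q_in by metis
qed

lemma pi_hat_hat_map: "\<xi> \<in> topspace A.Xh \<Longrightarrow> pi_hat (f \<xi>) = pi_hat \<xi>"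
proof (erule hat_map_obtain)
  fix i x \<gamma> a \<gamma>' assume "(i, x, \<gamma>) \<in> topspace A.Xt" "\<xi> = A.q (i, x, \<gamma>)"
    "(a, x, \<gamma>') \<in> topspace B.Xt" "f \<xi> = B.q (a, x, \<gamma>')"
  then show "pi_hat (f \<xi>) = pi_hat \<xi>" using A.pi_hat_q B.pi_hat_q by metis
qed

lemma hat_map_inverse:
  assumes \<xi>: "\<xi> \<in> topspace A.Xh" shows "g (f \<xi>) = \<xi>"
proof -
  interpret Sw: hol_pair n X Z F x0 I' \<phi>' j0 U' S' C' C0' I \<phi> i0 U S C C0 by (rule swap)
  obtain i x \<gamma> a \<gamma>' where 1: "(i, x, \<gamma>) \<in> topspace A.Xt" "\<xi> = A.q (i, x, \<gamma>)" "a \<in> I'" "x \<in> dom (\<phi>' a)"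
    "(a, x, \<gamma>') \<in> topspace B.Xt" "K (i, x, \<gamma>) (a, x, \<gamma>')" "f \<xi> = B.q (a, x, \<gamma>')" by (rule hat_map_obtain[OF \<xi>])
  show ?thesis unfolding 1(7) unfolding 1(2) by (rule Sw.hat_map_q[OF 1(5,1) K_sym[OF 1(1,6)]])
qed

text \<open>By the quotient property it suffices to work before the quotient and locally. There the
  map keeps the point and applies to the germ one fixed transport, whose continuity is
  \<open>continuous_germ_transport\<close>.\<close>

lemma continuous_hat_map: "continuous_map A.Xh B.Xh f"
proof (rule continuous_compose_quotient_map[OF A.quotient_q], rule continuous_map_locally)
  fix w assume w: "w \<in> topspace A.Xt"
  obtain i x \<gamma> where e: "w = (i, x, \<gamma>)" by (cases w)
  note we = w[unfolded e]
  have i: "i \<in> I" "x \<in> dom (\<phi> i)" using we unfolding A.Xt_iff by auto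
  obtain a where a: "a \<in> I'" "x \<in> dom (\<phi>' a)" using B.chart_cover[OF A.Xt_in_topspace[OF we]] by blast
  obtain \<tau> \<tau>0 N where \<tau>: "\<tau> \<in> \<Phi>" "\<tau>0 \<in> \<Phi>" "\<tau>0 A.t0 = Some B.t0" "openin X N" "x \<in> N"
    "\<forall>z\<in>N. A.p i z \<in> dom \<tau>"
    and K: "\<forall>z\<in>N. \<forall>\<gamma>. (i, z, \<gamma>) \<in> topspace A.Xt \<longrightarrow> (a, z, germ_transport B.T \<tau>0 \<tau> \<gamma>) \<in> topspace B.Xt \<and>
       (\<forall>y \<gamma>'. K (i, z, \<gamma>) (a, y, \<gamma>') \<longleftrightarrow> y = z \<and> \<gamma>' = germ_transport B.T \<tau>0 \<tau> \<gamma>)"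
    by (rule K_local[OF i(1) a(1) i(2) a(2)])
  let ?N = "{w \<in> topspace A.Xt. fst w = i} \<inter> {w \<in> topspace A.Xt. fst (snd w) \<in> N}"
  let ?M = "subtopology A.Xt ?N"
  let ?k = "germ_transport B.T \<tau>0 \<tau>"
  have oN: "openin A.Xt ?N"
    by (rule openin_Int[OF A.openin_piece[OF i(1)] openin_continuous_map_preimage[OF A.continuous_map_base \<tau>(4)]])
  have tM: "topspace ?M = ?N" by auto
  have s: "continuous_map ?M (prod_topology X A.G) snd"
    by (rule continuous_map_from_subtopology_mono[OF A.continuous_map_piece[OF i(1)]]) auto
  have "continuous_map ?M A.G (snd \<circ> snd)" by (rule continuous_map_compose[OF s continuous_map_snd])
  moreover have "(snd \<circ> snd) \<in> topspace ?M \<rightarrow> {\<gamma>. fst \<gamma> \<in> dom \<tau>}"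
  proof
    fix v assume "v \<in> topspace ?M"
    then have v: "v \<in> topspace A.Xt" "fst v = i" "fst (snd v) \<in> N" unfolding tM by auto
    obtain z \<delta> where ev: "v = (i, z, \<delta>)" using v(2) by (metis prod.collapse)
    have "fst \<delta> = A.p i z" using v(1) unfolding ev A.Xt_iff by simp
    then show "(snd \<circ> snd) v \<in> {\<gamma>. fst \<gamma> \<in> dom \<tau>}" using \<tau>(6) v(3) unfolding ev by simp
  qed
  ultimately have "continuous_map ?M (subtopology A.G {\<gamma>. fst \<gamma> \<in> dom \<tau>}) (snd \<circ> snd)"
    by (rule continuous_map_into_subtopology)
  from continuous_map_compose[OF this continuous_germ_transport[OF \<tau>(1-3)]]
  have 1: "continuous_map ?M B.G (\<lambda>v. ?k (snd (snd v)))" by (simp add: comp_def)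
  have "continuous_map ?M X (fst \<circ> snd)" by (rule continuous_map_compose[OF s continuous_map_fst])
  then have 2: "continuous_map ?M X (\<lambda>v. fst (snd v))" by (simp add: comp_def)
  have Nw: "(a, fst (snd v), ?k (snd (snd v))) \<in> topspace B.Xt \<and> (f \<circ> (\<lambda>w. A.q w)) v = B.q (a, fst (snd v), ?k (snd (snd v)))"
    if "v \<in> topspace ?M" for v
  proof -
    have v: "v \<in> topspace A.Xt" "fst v = i" "fst (snd v) \<in> N" using that unfolding tM by auto
    obtain z \<delta> where ev: "v = (i, z, \<delta>)" using v(2) by (metis prod.collapse)
    have z: "z \<in> N" using v(3) unfolding ev by simp
    have m: "(a, z, ?k \<delta>) \<in> topspace B.Xt" "K (i, z, \<delta>) (a, z, ?k \<delta>)" using K z v(1) unfolding ev by blast+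
    show ?thesis using hat_map_q[OF v(1)[unfolded ev] m] m(1) unfolding ev by simp
  qed
  have "continuous_map ?M B.Xt (\<lambda>v. (a, fst (snd v), ?k (snd (snd v))))"
    by (rule B.continuous_map_into_Xt[OF a(1) continuous_map_pairedI[OF 2 1]]) (rule conjunct1[OF Nw])
  from continuous_map_compose[OF this quotient_imp_continuous_map[OF B.quotient_q]]
  have "continuous_map ?M B.Xh (f \<circ> (\<lambda>w. A.q w))"
    by (rule continuous_map_eq) (use Nw in \<open>simp only: comp_def\<close>)
  then show "\<exists>N. openin A.Xt N \<and> w \<in> N \<and> continuous_map (subtopology A.Xt N) B.Xh (f \<circ> (\<lambda>w. A.q w))"
    using oN w \<tau>(5) by (intro exI[of _ ?N] conjI) (simp_all add: e)
qed

section \<open>Plaques and their transverse models\<close>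

abbreviation "fibA i \<gamma> \<equiv> {\<xi> \<in> A.Uh i. A.ph i \<xi> = \<gamma>}"
abbreviation "fibB a \<gamma> \<equiv> {\<xi> \<in> B.Uh a. B.ph a \<xi> = \<gamma>}"

lemma fibre_sub: "fibA i \<gamma> \<subseteq> topspace A.Xh"
  unfolding A.fibre using A.q_in by blast

text \<open>Along \<open>fibA i \<gamma>\<close> the germ is constant, and near \<xi> the
  correspondence uses one fixed transport, so the germ of the image is constant as well.\<close>

lemma openin_fibre:
  assumes a: "a \<in> I'"
  shows "openin (subtopology A.Xh (fibA i \<gamma>)) (fibA i \<gamma> \<inter> {\<xi> \<in> topspace A.Xh. f \<xi> \<in> fibB a \<gamma>'})"
proof (subst openin_subopen, intro ballI)
  fix \<xi> assume \<xi>: "\<xi> \<in> fibA i \<gamma> \<inter> {\<xi> \<in> topspace A.Xh. f \<xi> \<in> fibB a \<gamma>'}"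
  obtain x where x: "\<xi> = A.q (i, x, \<gamma>)" "(i, x, \<gamma>) \<in> topspace A.Xt" using \<xi> unfolding A.fibre by blast
  obtain y where y: "f \<xi> = B.q (a, y, \<gamma>')" "(a, y, \<gamma>') \<in> topspace B.Xt" using \<xi> unfolding B.fibre by blast
  have "y = x" using pi_hat_hat_map[of \<xi>] \<xi> x y A.pi_hat_q[OF x(2)] B.pi_hat_q[OF y(2)] by simp
  have i: "i \<in> I" "x \<in> dom (\<phi> i)" using x(2) unfolding A.Xt_iff by auto
  have ax: "x \<in> dom (\<phi>' a)" using y(2) \<open>y = x\<close> unfolding B.Xt_iff by simp
  obtain \<tau> \<tau>0 N where \<tau>: "openin X N" "x \<in> N"
    and K: "\<forall>z\<in>N. \<forall>\<gamma>. (i, z, \<gamma>) \<in> topspace A.Xt \<longrightarrow> (a, z, germ_transport B.T \<tau>0 \<tau> \<gamma>) \<in> topspace B.Xt \<and>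
       (\<forall>y \<gamma>'. K (i, z, \<gamma>) (a, y, \<gamma>') \<longleftrightarrow> y = z \<and> \<gamma>' = germ_transport B.T \<tau>0 \<tau> \<gamma>)"
    by (rule K_local[OF i(1) a i(2) ax])
  have K': "(a, z, germ_transport B.T \<tau>0 \<tau> \<gamma>) \<in> topspace B.Xt" "f (A.q (i, z, \<gamma>)) = B.q (a, z, germ_transport B.T \<tau>0 \<tau> \<gamma>)"
    if "z \<in> N" "(i, z, \<gamma>) \<in> topspace A.Xt" for z
    using K that hat_map_q[OF that(2)] by blast+
  have \<gamma>': "germ_transport B.T \<tau>0 \<tau> \<gamma> = \<gamma>'"
    using B.p_hat_q[OF K'(1)[OF \<tau>(2) x(2)]] B.p_hat_q[OF y(2)] K'(2)[OF \<tau>(2) x(2)] y(1) x(1) by simp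
  let ?O = "{\<eta> \<in> topspace A.Xh. pi_hat \<eta> \<in> N}"
  have "openin A.Xh ?O" by (rule openin_continuous_map_preimage[OF A.continuous_pi_hat \<tau>(1)])
  then have "openin (subtopology A.Xh (fibA i \<gamma>)) (?O \<inter> fibA i \<gamma>)" unfolding openin_subtopology by blast
  moreover have "\<xi> \<in> ?O \<inter> fibA i \<gamma>" using \<xi> \<tau>(2) A.pi_hat_q[OF x(2)] x(1) by simp
  moreover have "?O \<inter> fibA i \<gamma> \<subseteq> fibA i \<gamma> \<inter> {\<xi> \<in> topspace A.Xh. f \<xi> \<in> fibB a \<gamma>'}"
  proof
    fix \<eta> assume \<eta>: "\<eta> \<in> ?O \<inter> fibA i \<gamma>"
    obtain z where z: "\<eta> = A.q (i, z, \<gamma>)" "(i, z, \<gamma>) \<in> topspace A.Xt" using \<eta> unfolding A.fibre by blast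
    have "z \<in> N" using \<eta> A.pi_hat_q[OF z(2)] z(1) by simp
    then have "f \<eta> \<in> fibB a \<gamma>'" unfolding B.fibre z(1) using K'[OF _ z(2)] \<gamma>' by blast
    then show "\<eta> \<in> fibA i \<gamma> \<inter> {\<xi> \<in> topspace A.Xh. f \<xi> \<in> fibB a \<gamma>'}" using \<eta> by blast
  qed
  ultimately show "\<exists>V. openin (subtopology A.Xh (fibA i \<gamma>)) V \<and> \<xi> \<in> V \<and>
      V \<subseteq> fibA i \<gamma> \<inter> {\<xi> \<in> topspace A.Xh. f \<xi> \<in> fibB a \<gamma>'}" by blast
qed

text \<open>One half is \<open>openin_fibre\<close>; the other is the same statement for the
  exchanged atlases, pulled back along \<open>f\<close>.\<close>

lemma open_in_both_fibre:
  assumes ia: "i \<in> I" "a \<in> I'"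
  shows "open_in_both A.Xh (fibA i \<gamma>) {\<xi> \<in> topspace A.Xh. f \<xi> \<in> fibB a \<gamma>'}"
proof -
  interpret Sw: hol_pair n X Z F x0 I' \<phi>' j0 U' S' C' C0' I \<phi> i0 U S C C0 by (rule swap)
  let ?Q = "{\<eta> \<in> topspace B.Xh. g \<eta> \<in> fibA i \<gamma>}"
  have "openin (subtopology B.Xh (fibB a \<gamma>')) (fibB a \<gamma>' \<inter> ?Q)" by (rule Sw.openin_fibre[OF ia(1)])
  from openin_preimage_in[OF continuous_hat_map this]
  have "openin (subtopology A.Xh {\<xi> \<in> topspace A.Xh. f \<xi> \<in> fibB a \<gamma>'})
    ({\<xi> \<in> topspace A.Xh. f \<xi> \<in> fibB a \<gamma>'} \<inter> {\<xi> \<in> topspace A.Xh. f \<xi> \<in> ?Q})" .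
  moreover have "{\<xi> \<in> topspace A.Xh. f \<xi> \<in> ?Q} = fibA i \<gamma>"
  proof (intro equalityI subsetI)
    fix \<xi> assume "\<xi> \<in> {\<xi> \<in> topspace A.Xh. f \<xi> \<in> ?Q}"
    then have *: "\<xi> \<in> topspace A.Xh" "g (f \<xi>) \<in> fibA i \<gamma>" by blast+
    from *(2) show "\<xi> \<in> fibA i \<gamma>" unfolding hat_map_inverse[OF *(1)] .
  next
    fix \<xi> assume \<xi>: "\<xi> \<in> fibA i \<gamma>"
    have \<xi>X: "\<xi> \<in> topspace A.Xh" by (rule subsetD[OF fibre_sub \<xi>])
    have "g (f \<xi>) \<in> fibA i \<gamma>" using \<xi> unfolding hat_map_inverse[OF \<xi>X] .
    with hat_map_in[OF \<xi>X] have "f \<xi> \<in> ?Q" by blast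
    with \<xi>X show "\<xi> \<in> {\<xi> \<in> topspace A.Xh. f \<xi> \<in> ?Q}" by blast
  qed
  ultimately show ?thesis
    unfolding open_in_both_def
    using openin_fibre[OF ia(2), of i \<gamma> \<gamma>'] Int_commute[of "fibA i \<gamma>" "{\<xi> \<in> topspace A.Xh. f \<xi> \<in> fibB a \<gamma>'}"]
    by (simp only:)
qed

text \<open>Charts of the two spaces take transverse values in different spaces of germs.
  Conjugation by \<tau>0 and \<tau> identifies these locally, with conjugation by inverse
  transitions as the inverse.\<close>

lemma germ_chart:
  assumes v: "v \<in> based_germs B.T S' B.t0"
  shows "\<exists>W' W k' k. openin B.G W' \<and> v \<in> W' \<and> openin A.G W \<and>
    homeomorphic_maps (subtopology B.G W') (subtopology A.G W) k' k"
proof -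
  interpret Sw: hol_pair n X Z F x0 I' \<phi>' j0 U' S' C' C0' I \<phi> i0 U S C C0 by (rule swap)
  obtain h where h: "h \<in> lhomeo B.T B.T" "h (fst v) = Some B.t0"
    using based_germs_pointed[OF v] unfolding pointed_germ_def by blast
  have "fst v \<in> topspace B.T" by (rule lhomeo_in_topspace(1)[OF h])
  then obtain a x where a: "a \<in> I'" "x \<in> dom (\<phi>' a)" "fst v = B.p a x" unfolding B.topspace_T by blast
  obtain i where i: "i \<in> I" "x \<in> dom (\<phi> i)" using A.chart_cover[OF B.chart_dom_topspace[OF a(1,2)]] by blast
  obtain \<sigma> where \<sigma>: "tr i a x \<sigma>" using tr_exists[OF i(1) a(1) IntI[OF i(2) a(2)]] by (elim exE)
  obtain \<tau> where \<tau>: "\<tau> \<in> \<Phi>" "A.p i x \<in> dom \<tau>" "tr i a x \<tau>" by (rule Phi_of_tr[OF \<sigma> i(1) a(1) i(2) a(2)])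
  \<comment> \<open>The inverse transition is taken from the reverse family
    \<open>Sw.\<Phi>\<close>, so that the transport back is continuous too; it inverts \<tau> only
    near \<open>A.p i x\<close>.\<close>
  obtain \<tau>' where \<tau>': "\<tau>' \<in> Sw.\<Phi>" "B.p a x \<in> dom \<tau>'" "Sw.tr a i x \<tau>'"
    by (rule Sw.Phi_of_tr[OF transition_swap[OF \<sigma>] a(1) i(1) a(2) i(2)])
  obtain \<tau>0 where \<tau>0: "\<tau>0 \<in> \<Phi>" "tr i0 j0 x0 \<tau>0" "\<tau>0 A.t0 = Some B.t0" by (rule base_transition)
  obtain \<tau>0' where \<tau>0': "\<tau>0' \<in> Sw.\<Phi>" "Sw.tr j0 i0 x0 \<tau>0'" "\<tau>0' B.t0 = Some A.t0" by (rule Sw.base_transition)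
  note l = Phi_lhomeo[OF \<tau>(1)] Phi_lhomeo[OF \<tau>0(1)] Sw.Phi_lhomeo[OF \<tau>'(1)] Sw.Phi_lhomeo[OF \<tau>0'(1)]
  have pT: "A.p i x \<in> topspace A.T" unfolding A.topspace_T using i by blast
  \<comment> \<open>The set where \<tau>' undoes \<tau>. Germs based in \<open>W0\<close> are paired
    with germs based in its image under \<tau>; the other end of all these germs is the base point,
    where \<tau>0' undoes \<tau>0 near \<open>A.t0\<close>.\<close>
  obtain W0 where W0: "openin A.T W0" "A.p i x \<in> W0" "\<And>t. t \<in> W0 \<Longrightarrow> (\<tau>' \<circ>\<^sub>m \<tau>) t = Some t"
    using transition_inverse[OF A.submersion_p[OF i(1)] i(2) \<tau>(3) \<tau>'(3)] pT by (elim eventually_nhdsinD) auto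
  have e0: "\<forall>\<^sub>F t in nhdsin A.T A.t0. (\<tau>0' \<circ>\<^sub>m \<tau>0) t = Some t"
    by (rule transition_inverse[OF A.submersion_p[OF A.i0] A.x0 \<tau>0(2) \<tau>0'(2)])
  have e0': "\<forall>\<^sub>F t in nhdsin B.T B.t0. (\<tau>0 \<circ>\<^sub>m \<tau>0') t = Some t"
    by (rule transition_inverse[OF B.submersion_p[OF B.i0] B.x0 \<tau>0'(2) \<tau>0(2)])
  let ?Wa = "{s. \<exists>t\<in>W0. \<tau> t = Some s}"
  have oW0': "openin B.T ?Wa" by (rule lhomeo_openin_image[OF l(1) W0(1)])
  have W0D: "\<exists>s. \<tau> t = Some s \<and> \<tau>' s = Some t" if "t \<in> W0" for t
    using W0(3)[OF that] unfolding map_comp_Some_iff .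
  have W0D': "\<exists>t\<in>W0. \<tau>' s = Some t \<and> \<tau> t = Some s" if s: "s \<in> ?Wa" for s
  proof -
    obtain t where t: "t \<in> W0" "\<tau> t = Some s" using s by blast
    obtain s' where "\<tau> t = Some s'" "\<tau>' s' = Some t" using W0D[OF t(1)] by blast
    then show ?thesis using t by (intro bexI[of _ t]) simp_all
  qed
  have e1: "\<forall>\<^sub>F z in nhdsin A.T t. (\<tau>' \<circ>\<^sub>m \<tau>) z = Some z" if "t \<in> W0" for t
    using eventually_nhdsin_in[OF W0(1) that] by (rule eventually_mono) (rule W0(3))
  have e1': "\<forall>\<^sub>F z in nhdsin B.T s. (\<tau> \<circ>\<^sub>m \<tau>') z = Some z" if "s \<in> ?Wa" for s
    using eventually_nhdsin_in[OF oW0' that]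
  proof (rule eventually_mono)
    fix z assume "z \<in> ?Wa"
    then obtain t where "\<tau>' z = Some t" "\<tau> t = Some z" using W0D' by blast
    then show "(\<tau> \<circ>\<^sub>m \<tau>') z = Some z" by simp
  qed
  let ?k = "germ_transport B.T \<tau>0 \<tau>" and ?k' = "germ_transport A.T \<tau>0' \<tau>'"
  let ?W = "{\<gamma> \<in> based_germs A.T S A.t0. fst \<gamma> \<in> W0}" and ?W' = "{\<gamma> \<in> based_germs B.T S' B.t0. fst \<gamma> \<in> ?Wa}"
  have oW: "openin A.G ?W" by (rule openin_based_germ_space_base_point[OF W0(1)])
  have oW': "openin B.G ?W'" by (rule openin_based_germ_space_base_point[OF oW0'])
  have tW: "topspace (subtopology A.G ?W) = ?W" "topspace (subtopology B.G ?W') = ?W'"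
    unfolding topspace_subtopology topspace_based_germ_space by auto
  have kW: "?k \<gamma> \<in> ?W' \<and> ?k' (?k \<gamma>) = \<gamma>" if "\<gamma> \<in> ?W" for \<gamma>
  proof -
    have \<gamma>: "\<gamma> \<in> based_germs A.T S A.t0" "fst \<gamma> \<in> W0" using that by simp_all
    obtain s where s: "\<tau> (fst \<gamma>) = Some s" "\<tau>' s = Some (fst \<gamma>)" using W0D[OF \<gamma>(2)] by blast
    have "?k \<gamma> \<in> based_germs B.T S' B.t0" "fst (?k \<gamma>) = s"
      using germ_transport_based[OF \<tau>(1) \<tau>0(1,3) \<gamma>(1) domI[of \<tau>, OF s(1)]] s(1) by simp_all
    moreover have "s \<in> ?Wa" using \<gamma>(2) s(1) by blast
    moreover have "?k' (?k \<gamma>) = \<gamma>"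
      by (rule germ_transport_inverse[OF based_germs_pointed[OF \<gamma>(1)] l(1) s(1) l(2) \<tau>0(3) l(3) e1[OF \<gamma>(2)] l(4) e0])
    ultimately show ?thesis by simp
  qed
  have kW': "?k' \<gamma> \<in> ?W \<and> ?k (?k' \<gamma>) = \<gamma>" if "\<gamma> \<in> ?W'" for \<gamma>
  proof -
    have \<gamma>: "\<gamma> \<in> based_germs B.T S' B.t0" "fst \<gamma> \<in> ?Wa" using that by simp_all
    obtain t where t: "t \<in> W0" "\<tau>' (fst \<gamma>) = Some t" using W0D'[OF \<gamma>(2)] by blast
    have "?k' \<gamma> \<in> based_germs A.T S A.t0" "fst (?k' \<gamma>) = t"
      using Sw.germ_transport_based[OF \<tau>'(1) \<tau>0'(1,3) \<gamma>(1) domI[of \<tau>', OF t(2)]] t(2) by simp_all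
    moreover have "?k (?k' \<gamma>) = \<gamma>"
      by (rule germ_transport_inverse[OF based_germs_pointed[OF \<gamma>(1)] l(3) t(2) l(4) \<tau>0'(3) l(1) e1'[OF \<gamma>(2)] l(2) e0'])
    ultimately show ?thesis using t(1) by simp
  qed
  have "continuous_map (subtopology A.G ?W) B.G ?k"
  proof (rule continuous_map_from_subtopology_mono[OF continuous_germ_transport[OF \<tau>(1) \<tau>0(1,3)]])
    show "?W \<subseteq> {\<gamma>. fst \<gamma> \<in> dom \<tau>}" using W0D by blast
  qed
  then have c: "continuous_map (subtopology A.G ?W) (subtopology B.G ?W') ?k"
    by (rule continuous_map_into_subtopology) (unfold tW, use kW in blast)
  have "continuous_map (subtopology B.G ?W') A.G ?k'"
  proof (rule continuous_map_from_subtopology_mono[OF Sw.continuous_germ_transport[OF \<tau>'(1) \<tau>0'(1,3)]])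
    show "?W' \<subseteq> {\<gamma>. fst \<gamma> \<in> dom \<tau>'}" using W0D' by blast
  qed
  then have c': "continuous_map (subtopology B.G ?W') (subtopology A.G ?W) ?k'"
    by (rule continuous_map_into_subtopology) (unfold tW, use kW' in blast)
  have "homeomorphic_maps (subtopology B.G ?W') (subtopology A.G ?W) ?k' ?k"
    unfolding homeomorphic_maps_def tW using c c' kW kW' by blast
  moreover have "v \<in> ?W'"
    by (intro CollectI conjI v bexI[OF _ W0(2)]) (unfold a(3), rule trD(2)[OF \<tau>(3) i])
  ultimately show ?thesis using oW oW' by (intro exI conjI)
qed

section \<open>Preservation of the leaf topologies\<close>

abbreviation "FA \<equiv> F_hat n X Z I \<phi> S A.t0"
abbreviation "FB \<equiv> F_hat n X Z I' \<phi>' S' B.t0"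

lemma fibre_cover:
  assumes "\<xi> \<in> topspace A.Xh" shows "\<exists>i\<in>I. \<exists>\<gamma>. \<xi> \<in> fibA i \<gamma>"
proof -
  obtain i x \<gamma> where x: "(i, x, \<gamma>) \<in> topspace A.Xt" "\<xi> = A.q (i, x, \<gamma>)" by (rule A.XhE[OF assms])
  have "\<xi> \<in> fibA i \<gamma>" unfolding A.fibre using x by blast
  then show ?thesis using x(1) unfolding A.Xt_iff by blast
qed

lemma plaque_sub:
  assumes "\<psi> \<in> FA" "P \<in> plaques \<psi>" shows "P \<subseteq> topspace A.Xh"
proof -
  have "openin A.Xh (dom \<psi>)" using assms(1) by (simp add: F_hat_def cocycle_foliation_def foliated_chart_def)
  then have "dom \<psi> \<subseteq> topspace A.Xh" by (rule openin_subset)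
  moreover have "P \<subseteq> dom \<psi>" using assms(2) unfolding plaques_def by blast
  ultimately show ?thesis by (rule subset_trans[rotated])
qed

text \<open>The chart \<psi> is pulled back by \<open>f\<close>, with its transverse coordinate
  moved by a local homeomorphism of germ spaces. That coordinate change is injective, so plaques of
  the new chart are exact preimages of plaques of \<psi>.\<close>

lemma plaque_pullback:
  assumes \<psi>: "\<psi> \<in> FB" and P: "P \<in> plaques \<psi>"
  shows "\<exists>\<theta>\<in>FA. {\<xi> \<in> topspace A.Xh. f \<xi> \<in> P} \<in> plaques \<theta>"
proof -
  interpret Sw: hol_pair n X Z F x0 I' \<phi>' j0 U' S' C' C0' I \<phi> i0 U S C C0 by (rule swap)
  let ?d = "dist_submersion \<psi>"
  have ch: "foliated_chart n B.Xh B.G \<psi>"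
    and compat: "\<And>P a y. P \<in> plaques \<psi> \<Longrightarrow> a \<in> I' \<Longrightarrow> y \<in> B.ph a ` B.Uh a \<Longrightarrow> open_in_both B.Xh P (fibB a y)"
    using \<psi> unfolding F_hat_def cocycle_foliation_def by blast+
  have fg: "homeomorphic_maps A.Xh B.Xh f g"
    unfolding homeomorphic_maps_def
    using continuous_hat_map Sw.continuous_hat_map hat_map_inverse Sw.hat_map_inverse by (intro conjI ballI)
  have BX: "dom \<psi> \<subseteq> topspace B.Xh" using ch openin_subset unfolding foliated_chart_def by blast
  obtain \<eta> where \<eta>: "\<eta> \<in> dom \<psi>" "P = {x \<in> dom \<psi>. ?d x = ?d \<eta>}" using P unfolding plaques_def by blast
  have "?d \<eta> \<in> topspace B.G"
    using continuous_map_funspace[OF continuous_map_dist_submersion[OF ch]] \<eta>(1) BX by auto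
  then have "?d \<eta> \<in> based_germs B.T S' B.t0" unfolding topspace_based_germ_space .
  then obtain W' W k' k where W: "openin B.G W'" "?d \<eta> \<in> W'" "openin A.G W"
    and k: "homeomorphic_maps (subtopology B.G W') (subtopology A.G W) k' k" using germ_chart by blast
  have kk: "k (k' v) = v" if "v \<in> W'" for v
  proof -
    have "v \<in> topspace (subtopology B.G W')" using that openin_subset[OF W(1)] by auto
    then show ?thesis using k unfolding homeomorphic_maps_def by blast
  qed
  define \<theta> where "\<theta> = (\<lambda>x. if x \<in> topspace A.Xh \<and> f x \<in> dom \<psi> \<and> ?d (f x) \<in> W'
    then Some (fst (the (\<psi> (f x))), k' (?d (f x))) else None)"
  have ch\<theta>: "foliated_chart n A.Xh A.G \<theta>" unfolding \<theta>_def by (rule foliated_chart_pullback[OF fg ch W(1,3) k])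
  have dom\<theta>: "x \<in> dom \<theta> \<longleftrightarrow> x \<in> topspace A.Xh \<and> f x \<in> dom \<psi> \<and> ?d (f x) \<in> W'" for x
  proof (cases "x \<in> topspace A.Xh \<and> f x \<in> dom \<psi> \<and> ?d (f x) \<in> W'")
    case True
    show ?thesis unfolding \<theta>_def domIff[of x] if_P[OF True] using True by blast
  next
    case False
    show ?thesis unfolding \<theta>_def domIff[of x] if_not_P[OF False] using False by blast
  qed
  have d\<theta>: "dist_submersion \<theta> x = k' (?d (f x))" if "x \<in> dom \<theta>" for x
    using that unfolding dom\<theta> by (simp add: \<theta>_def dist_submersion_def)
  have plaq: "{x \<in> dom \<theta>. dist_submersion \<theta> x = k' v} = {x \<in> topspace A.Xh. f x \<in> {y \<in> dom \<psi>. ?d y = v}}"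
    if v: "v \<in> W'" for v
  proof (intro equalityI subsetI)
    fix x assume "x \<in> {x \<in> dom \<theta>. dist_submersion \<theta> x = k' v}"
    then have x: "x \<in> dom \<theta>" "dist_submersion \<theta> x = k' v" by blast+
    from x(2) have e: "k' (?d (f x)) = k' v" unfolding d\<theta>[OF x(1)] .
    have "?d (f x) = v" using kk[OF v] kk[of "?d (f x)"] x(1) e unfolding dom\<theta> by metis
    then show "x \<in> {x \<in> topspace A.Xh. f x \<in> {y \<in> dom \<psi>. ?d y = v}}" using x(1) unfolding dom\<theta> by simp
  next
    fix x assume "x \<in> {x \<in> topspace A.Xh. f x \<in> {y \<in> dom \<psi>. ?d y = v}}"
    then have x: "x \<in> topspace A.Xh" "f x \<in> dom \<psi>" "?d (f x) = v" by simp_all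
    then have "x \<in> dom \<theta>" unfolding dom\<theta> using v by simp
    with d\<theta>[OF this] x(3) show "x \<in> {x \<in> dom \<theta>. dist_submersion \<theta> x = k' v}" by blast
  qed
  \<comment> \<open>A plaque of \<theta> and a fibre of the first space are compared through the
    pullback of a fibre of the second space, which is compatible with both;
    \<open>open_in_both_trans\<close> joins the two comparisons.\<close>
  have "open_in_both A.Xh Q (fibA i \<gamma>)" if Q: "Q \<in> plaques \<theta>" and i: "i \<in> I" for Q i \<gamma>
  proof -
    obtain x where x: "x \<in> dom \<theta>" "Q = {z \<in> dom \<theta>. dist_submersion \<theta> z = dist_submersion \<theta> x}"
      using Q unfolding plaques_def by blast
    let ?P = "{y \<in> dom \<psi>. ?d y = ?d (f x)}"
    have fx: "f x \<in> dom \<psi>" "?d (f x) \<in> W'" using x(1) unfolding dom\<theta> by simp_all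
    have Qe: "Q = {x \<in> topspace A.Xh. f x \<in> ?P}" using plaq[OF fx(2)] unfolding x(2) d\<theta>[OF x(1)] .
    have Pp: "?P \<in> plaques \<psi>" using fx(1) unfolding plaques_def by blast
    show ?thesis
    proof (rule open_in_both_trans)
      show "Q \<subseteq> topspace A.Xh" unfolding Qe by (rule Collect_restrict)
      show "fibA i \<gamma> \<subseteq> topspace A.Xh" by (rule fibre_sub)
      fix \<xi> assume \<xi>: "\<xi> \<in> Q \<inter> fibA i \<gamma>"
      have \<xi>X: "\<xi> \<in> topspace A.Xh" using \<xi> unfolding Qe by blast
      obtain a \<delta> where a: "a \<in> I'" "f \<xi> \<in> fibB a \<delta>" using Sw.fibre_cover[OF hat_map_in[OF \<xi>X]] by (elim bexE exE)
      let ?R = "{\<zeta> \<in> topspace A.Xh. f \<zeta> \<in> fibB a \<delta>}"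
      have "\<delta> \<in> B.ph a ` B.Uh a" using a(2) by (intro image_eqI[of _ _ "f \<xi>"]) simp_all
      then have "open_in_both B.Xh ?P (fibB a \<delta>)" by (rule compat[OF Pp a(1)])
      then have "open_in_both A.Xh Q ?R" unfolding Qe by (rule open_in_both_preimage[OF continuous_hat_map])
      moreover have "open_in_both A.Xh (fibA i \<gamma>) ?R" by (rule open_in_both_fibre[OF i a(1)])
      moreover have "\<xi> \<in> ?R" using \<xi>X a(2) by blast
      ultimately show "\<exists>R. \<xi> \<in> R \<and> open_in_both A.Xh Q R \<and> open_in_both A.Xh (fibA i \<gamma>) R" by (intro exI conjI)
    qed
  qed
  then have "\<theta> \<in> FA" unfolding F_hat_def cocycle_foliation_def using ch\<theta> by blast
  moreover have "{\<xi> \<in> topspace A.Xh. f \<xi> \<in> P} \<in> plaques \<theta>"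
  proof -
    \<comment> \<open>A plaque belongs to an attained transverse value; \<open>g \<eta>\<close>
      attains this one.\<close>
    have gX: "g \<eta> \<in> topspace A.Xh" "f (g \<eta>) = \<eta>"
      using \<eta>(1) BX Sw.hat_map_in[of \<eta>] Sw.hat_map_inverse[of \<eta>] by blast+
    then have "g \<eta> \<in> dom \<theta>" unfolding dom\<theta> using \<eta>(1) W(2) by simp
    moreover have "dist_submersion \<theta> (g \<eta>) = k' (?d \<eta>)" using d\<theta>[OF calculation] gX(2) by simp
    ultimately have im: "k' (?d \<eta>) \<in> dist_submersion \<theta> ` dom \<theta>" by (intro image_eqI[of _ _ "g \<eta>"]) simp_all
    show ?thesis
      unfolding plaques_def \<eta>(2) plaq[OF W(2), symmetric] using im by (intro CollectI exI[of _ "k' (?d \<eta>)"] conjI refl)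
  qed
  ultimately show ?thesis by (rule bexI[of _ \<theta>, rotated])
qed

text \<open>The plaque through \<open>f x\<close> is the pullback of \<open>P\<close> along the
  inverse \<open>g\<close>, by the exchanged instance of \<open>plaque_pullback\<close>.\<close>

lemma plaque_image:
  assumes \<psi>: "\<psi> \<in> FA" and P: "P \<in> plaques \<psi>" "x \<in> P"
  shows "\<exists>\<theta>\<in>FB. \<exists>Q\<in>plaques \<theta>. f x \<in> Q"
proof -
  interpret Sw: hol_pair n X Z F x0 I' \<phi>' j0 U' S' C' C0' I \<phi> i0 U S C C0 by (rule swap)
  obtain \<theta> where \<theta>: "\<theta> \<in> FB" "{\<eta> \<in> topspace B.Xh. g \<eta> \<in> P} \<in> plaques \<theta>"
    using Sw.plaque_pullback[OF \<psi> P(1)] by (elim bexE)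
  have x: "x \<in> topspace A.Xh" using plaque_sub[OF \<psi> P(1)] P(2) by (rule subsetD)
  have "f x \<in> {\<eta> \<in> topspace B.Xh. g \<eta> \<in> P}"
    using hat_map_in[OF x] P(2) hat_map_inverse[OF x] by simp
  then show ?thesis using \<theta> by (intro bexI)
qed

lemma foliated_map_hat_map: "foliated_map FA FB f"
  by (rule foliated_map_of_plaque_pullback[where D = "topspace A.Xh"]) (fact plaque_pullback plaque_sub plaque_image)+

lemma foliated_homeomorphism_hat_map: "foliated_homeomorphism A.Xh FA B.Xh FB f"
proof -
  interpret Sw: hol_pair n X Z F x0 I' \<phi>' j0 U' S' C' C0' I \<phi> i0 U S C C0 by (rule swap)
  have "homeomorphic_maps A.Xh B.Xh f g"
    unfolding homeomorphic_maps_def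
    using continuous_hat_map Sw.continuous_hat_map hat_map_inverse Sw.hat_map_inverse by (intro conjI ballI)
  then show ?thesis
    unfolding foliated_homeomorphism_def using foliated_map_hat_map Sw.foliated_map_hat_map by blast
qed

end

theorem proposition4p13:
  fixes n :: nat
    and X :: "'x topology" and Z :: "'z topology"
    and F :: "('x, 'z) fchart set" and x0 :: 'x
    and I :: "'i set" and \<phi> :: "'i \<Rightarrow> ('x, 'z) fchart" and i0 :: 'i
    and I' :: "'j set" and \<phi>' :: "'j \<Rightarrow> ('x, 'z) fchart" and j0 :: 'j
  assumes "foliated_space n X Z F" and "compact_space X"
    and "minimal_foliation n X Z F"
    and "equicontinuous_foliation n X Z F"
    and "strongly_quasi_analytic_holonomy_closure n X Z F"
    and "x0 \<in> topspace X"
    and "regular_foliated_atlas n X Z F I \<phi>"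
    and "i0 \<in> I" and "x0 \<in> dom (\<phi> i0)"
    and "t0 = to_transversal \<phi> i0 x0"
    and "construction_choice (transversal Z I \<phi>) (holonomy_pseudogroup Z I \<phi>) t0 U S C C0"
    and "regular_foliated_atlas n X Z F I' \<phi>'"
    and "j0 \<in> I'" and "x0 \<in> dom (\<phi>' j0)"
    and "t0' = to_transversal \<phi>' j0 x0"
    and "construction_choice (transversal Z I' \<phi>') (holonomy_pseudogroup Z I' \<phi>') t0' U' S' C' C0'"
  shows "\<exists>f. foliated_homeomorphism
               (X_hat X Z I \<phi> S t0) (F_hat n X Z I \<phi> S t0)
               (X_hat X Z I' \<phi>' S' t0') (F_hat n X Z I' \<phi>' S' t0') f \<and>
             (\<forall>\<xi> \<in> topspace (X_hat X Z I \<phi> S t0). pi_hat (f \<xi>) = pi_hat \<xi>)"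
proof -
  have "hol_pair n X Z F x0 I \<phi> i0 U S C C0 I' \<phi>' j0 U' S' C' C0'"
    by (intro hol_pair.intro hol.intro) (use assms in simp_all)
  then interpret hol_pair n X Z F x0 I \<phi> i0 U S C C0 I' \<phi>' j0 U' S' C' C0' .
  show ?thesis
    unfolding assms(10,15) using foliated_homeomorphism_hat_map pi_hat_hat_map by blast
qed

end
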